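(* Let $p\in(1,\infty)$ and let $u$ be a weak supersolution of $A_{\mu,p}u=0$ in $\Omega$ such that $u\geq0$ in $B_R:=B_R(x_0)\subset\Omega$. Then for any $B_r:=B_r(x_0)\subset B_{\frac R2}(x_0)$ and $d>0$, there exists a positive constant $C=C(N,p,\Sigma,\mu)$ such that $$\alpha\int_{B_r}|\nabla\log(u+d)|^p\,dx+\int_{(0,1)}C_{N,p,s}\left(\int_{B_r}\int_{B_r}\left|\log\left(\frac{u(x)+d}{u(y)+d}\right)\right|^p\frac{dx\,dy}{|x-y|^{N+sp}}\right)d\mu(s)$$ $$\leq Cr^N\left(d^{1-p}R^{-p}[\operatorname{Tail}(u_-;x_0,R)]^{p-1}+\sup_{s\in\Sigma}r^{-sp}\right)+C\alpha r^{N-p}.$$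
   Context: Let $p\in(1,\infty)$ and let $\Omega\subset\mathbb{R}^N$ be a bounded domain. $\mu$ is a nonnegative finite Borel measure on $[0,1]$, nontrivial on $(0,1)$, with $\mu(\{0\})=0$ and $\alpha:=\mu(\{1\})>0$; $\Sigma:=\operatorname{supp}(\mu)$. $B_r(x_0)$ is the open ball of radius $r$ centered at $x_0$, and $u_-:=\max\{-u,0\}$. The operator is $A_{\mu,p}u=\int_{(0,1)}(-\Delta)_p^su\,d\mu(s)-\alpha\Delta_pu$ (fractional $p$-Laplacians and the $p$-Laplacian $\Delta_pu=\operatorname{div}(|\nabla u|^{p-2}\nabla u)$); (super)solutions are understood in the weak sense defined below. For $s\in(0,1)$ the normalization constant is $$C_{N,p,s}=\frac{\frac{sp}{2}(1-s)2^{2s-1}}{\pi^{\frac{N-1}{2}}}\,\frac{\Gamma\left(\frac{N+ps}{2}\right)}{\Gamma\left(\frac{p+1}{2}\right)\Gamma(2-s)}.$$ Tail: for $u\in L^{p-1}_{loc}(\mathbb{R}^N)$, $$\operatorname{Tail}(u;x_0,r)=\left[\int_{(0,1)}C_{N,p,s}\,r^{p}\left(\int_{\mathbb{R}^N\setminus B_r(x_0)}\frac{|u(y)|^{p-1}}{|y-x_0|^{N+sp}}\,dy\right)d\mu(s)\right]^{\frac1{p-1}}.$$ Tail space: $L^{p-1}_{sp,\mu}(\mathbb{R}^N)=\{u\in L^{p-1}_{loc}(\mathbb{R}^N):\operatorname{Tail}(u;x,r)<\infty\ \forall x\in\mathbb{R}^N,\ \forall r\in(0,\infty)\}$. For a bounded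 domain $\Omega'$, $W_0^{1,p}(\Omega')=\{v\in W^{1,p}(\Omega'):v=0\text{ in }\mathbb{R}^N\setminus\Omega'\}$. A function $u\in W^{1,p}_{loc}(\Omega)\cap L^{p-1}_{sp,\mu}(\mathbb{R}^N)$ is a weak supersolution of $A_{\mu,p}u=0$ in $\Omega$ if for every $\Omega'\Subset\Omega$ and every nonnegative $v\in W_0^{1,p}(\Omega')$ $$\int_{(0,1)}C_{N,p,s}\iint_{\mathbb{R}^{2N}}\frac{|u(x)-u(y)|^{p-2}(u(x)-u(y))(v(x)-v(y))}{|x-y|^{N+sp}}\,dx\,dy\,d\mu(s)+\alpha\int_\Omega|\nabla u|^{p-2}\nabla u\cdot\nabla v\,dx\geq0.$$ *)

theory Defs
  imports "HOL-Analysis.Analysis"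
begin

section \<open>Lebesgue and Sobolev spaces\<close>

definition Lp :: "real \<Rightarrow> 'a::euclidean_space set \<Rightarrow> ('a \<Rightarrow> 'b::euclidean_space) set" where
  "Lp q A = {f. set_borel_measurable lebesgue A f \<and>
                (\<integral>\<^sup>+x\<in>A. ennreal (norm (f x) powr q) \<partial>lebesgue) < \<infinity>}"

definition Lp_loc :: "real \<Rightarrow> 'a::euclidean_space set \<Rightarrow> ('a \<Rightarrow> 'b::euclidean_space) set" where
  "Lp_loc q \<Omega> = {f. \<forall>K. compact K \<and> K \<subseteq> \<Omega> \<longrightarrow> f \<in> Lp q K}"

primrec C_k :: "nat \<Rightarrow> ('a::euclidean_space \<Rightarrow> real) \<Rightarrow> bool" where
  "C_k 0 f \<longleftrightarrow> continuous_on UNIV f"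
| "C_k (Suc k) f \<longleftrightarrow> (\<exists>f'. (\<forall>x. (f has_derivative f' x) (at x)) \<and> (\<forall>h. C_k k (\<lambda>x. f' x h)))"

definition test_functions :: "'a::euclidean_space set \<Rightarrow> ('a \<Rightarrow> real) set" where
  "test_functions \<Omega> = {\<phi>. (\<forall>k. C_k k \<phi>) \<and> compact (closure {x. \<phi> x \<noteq> 0})
                            \<and> closure {x. \<phi> x \<noteq> 0} \<subseteq> \<Omega>}"

text \<open>The weak gradient is a relation; \<open>g\<close> is determined by \<open>f\<close> only up to null sets of \<open>\<Omega>\<close>.\<close>

definition has_weak_gradient ::
    "('a::euclidean_space \<Rightarrow> real) \<Rightarrow> ('a \<Rightarrow> 'a) \<Rightarrow> 'a set \<Rightarrow> bool" where
  "has_weak_gradient f g \<Omega> \<longleftrightarrow> f \<in> Lp_loc 1 \<Omega> \<and> g \<in> Lp_loc 1 \<Omega> \<and>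
     (\<forall>\<phi>\<in>test_functions \<Omega>. \<forall>b\<in>Basis.
        (LINT x:\<Omega>|lebesgue. f x * frechet_derivative \<phi> (at x) b)
          = - (LINT x:\<Omega>|lebesgue. (g x \<bullet> b) * \<phi> x))"

definition W1p :: "real \<Rightarrow> 'a::euclidean_space set \<Rightarrow> ('a \<Rightarrow> real) set" where
  "W1p p \<Omega> = {f. f \<in> Lp p \<Omega> \<and> (\<exists>g. has_weak_gradient f g \<Omega> \<and> g \<in> Lp p \<Omega>)}"

definition W1p_loc :: "real \<Rightarrow> 'a::euclidean_space set \<Rightarrow> ('a \<Rightarrow> real) set" where
  "W1p_loc p \<Omega> = {f. f \<in> Lp_loc p \<Omega> \<and> (\<exists>g. has_weak_gradient f g \<Omega> \<and> g \<in> Lp_loc p \<Omega>)}"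

text \<open>The Sobolev condition is imposed on the whole space, i.e. on the extension by zero: imposed
  only inside \<open>\<Omega>'\<close> it would allow jumps across the boundary, such as indicator functions.\<close>

definition W1p_0 :: "real \<Rightarrow> 'a::euclidean_space set \<Rightarrow> ('a \<Rightarrow> real) set" where
  "W1p_0 p \<Omega>' = {v. v \<in> W1p p UNIV \<and> (AE x in lebesgue. x \<notin> \<Omega>' \<longrightarrow> v x = 0)}"

definition compactly_inside :: "'a::euclidean_space set \<Rightarrow> 'a set \<Rightarrow> bool" where
  "compactly_inside \<Omega>' \<Omega> \<longleftrightarrow> open \<Omega>' \<and> compact (closure \<Omega>') \<and> closure \<Omega>' \<subseteq> \<Omega>"


section \<open>The nonlocal operator\<close>

definition normalization :: "real \<Rightarrow> real \<Rightarrow> real \<Rightarrow> real" where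
  "normalization N p s =
     (s * p / 2 * (1 - s) * 2 powr (2 * s - 1)) / pi powr ((N - 1) / 2)
     * (Gamma ((N + p * s) / 2) / (Gamma ((p + 1) / 2) * Gamma (2 - s)))"

text \<open>Intended for exponents \<open>a > 0\<close> only.\<close>

definition ennpowr :: "ennreal \<Rightarrow> real \<Rightarrow> ennreal" where
  "ennpowr x a = (if x = \<infinity> then \<infinity> else ennreal (enn2real x powr a))"

definition Tail ::
    "real measure \<Rightarrow> real \<Rightarrow> ('a::euclidean_space \<Rightarrow> real) \<Rightarrow> 'a \<Rightarrow> real \<Rightarrow> ennreal" where
  "Tail \<mu> p u x\<^sub>0 r =
     ennpowr
       (\<integral>\<^sup>+s\<in>{0<..<1}.
          ennreal (normalization DIM('a) p s * r powr p) *
          (\<integral>\<^sup>+y\<in>- ball x\<^sub>0 r.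
             ennreal (\<bar>u y\<bar> powr (p - 1) / norm (y - x\<^sub>0) powr (DIM('a) + s * p)) \<partial>lebesgue) \<partial>\<mu>)
       (1 / (p - 1))"

definition tail_space :: "real measure \<Rightarrow> real \<Rightarrow> ('a::euclidean_space \<Rightarrow> real) set" where
  "tail_space \<mu> p = {u. u \<in> Lp_loc (p - 1) UNIV \<and> (\<forall>x. \<forall>r>0. Tail \<mu> p u x r < \<infinity>)}"

definition weak_form ::
    "real measure \<Rightarrow> real \<Rightarrow> 'a::euclidean_space set \<Rightarrow> ('a \<Rightarrow> real) \<Rightarrow> ('a \<Rightarrow> 'a)
      \<Rightarrow> ('a \<Rightarrow> real) \<Rightarrow> ('a \<Rightarrow> 'a) \<Rightarrow> real" where
  "weak_form \<mu> p \<Omega> u Du v Dv =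
     (LINT s:{0<..<1}|\<mu>. normalization DIM('a) p s *
        (LINT (x, y)|(lebesgue \<Otimes>\<^sub>M lebesgue).
           \<bar>u x - u y\<bar> powr (p - 2) * (u x - u y) * (v x - v y)
             / norm (x - y) powr (DIM('a) + s * p)))
     + measure \<mu> {1} * (LINT x:\<Omega>|lebesgue. norm (Du x) powr (p - 2) * (Du x \<bullet> Dv x))"

text \<open>All integrals in \<open>weak_form\<close> converge absolutely for \<open>u\<close> and \<open>v\<close> as below (the inner double
  integral for \<open>\<mu>\<close>-almost every \<open>s\<close>), and they do not depend on the representatives
  chosen for the weak gradients.\<close>

definition weak_supersolution ::
    "real measure \<Rightarrow> real \<Rightarrow> 'a::euclidean_space set \<Rightarrow> ('a \<Rightarrow> real) \<Rightarrow> bool" where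
  "weak_supersolution \<mu> p \<Omega> u \<longleftrightarrow>
     u \<in> W1p_loc p \<Omega> \<and> u \<in> tail_space \<mu> p \<and>
     (\<forall>\<Omega>' v Du Dv.
        compactly_inside \<Omega>' \<Omega> \<and> v \<in> W1p_0 p \<Omega>' \<and> (AE x in lebesgue. 0 \<le> v x) \<and>
        has_weak_gradient u Du \<Omega> \<and> has_weak_gradient v Dv UNIV
        \<longrightarrow> 0 \<le> weak_form \<mu> p \<Omega> u Du v Dv)"

definition support :: "real measure \<Rightarrow> real set" where
  "support \<mu> = {s \<in> space \<mu>. \<forall>U. open U \<and> s \<in> U \<longrightarrow> 0 < emeasure \<mu> (U \<inter> space \<mu>)}"

end

theory Submission imports Defs begin

text \<open>
  The supersolution is tested with \<open>v = \<eta>\<^sup>p (u + d) powr (1 - p)\<close>, where \<open>\<eta>\<close> is a cutoff supported in the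
  ball of radius \<open>3 r / 2\<close>. For \<open>x, y\<close> in the ball of radius \<open>R\<close> a pointwise inequality bounds the
  integrand by \<open>C |\<eta> x - \<eta> y|\<^sup>p - c |log ((u x + d) / (u y + d))|\<^sup>p\<close>; for \<open>y\<close> outside only the negative part
  of \<open>u y\<close> matters and gives the tail. Young's inequality treats the gradient term in the same way.

  Absorbing the logarithmic terms requires that all integrals converge. Near the diagonal this rests on
  \<open>\<integral>|u (x + h) - u x|\<^sup>p dx \<le> |h|\<^sup>p \<integral>|Du|\<^sup>p\<close>, which follows from the identity
  \<open>u (x + h) - u x = \<integral>\<^sub>0\<^sup>1 Du (x + t h) \<bullet> h dt\<close> for almost every \<open>x\<close>. The same identity shows that weak
  gradients are exactly the local \<open>L\<^sup>1\<close> limits of difference quotients, and the chain and product rules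
  needed for \<open>v\<close> and \<open>log (u + d)\<close> are proved on this level, without mollification.
\<close>

section \<open>Smooth functions\<close>

text \<open>The weak form is made of Bochner integrals, whose value is 0 for a non-integrable
  integrand, so testing says something only once every term is known to be integrable. The
  conclusion, on the other hand, compares extended nonnegative integrals, where nothing can be
  subtracted. Hence two separate layers: convergence is proved with bounds that may depend on
  \<open>u\<close>, the quantitative estimate is pointwise, and they meet in
  \<open>absorb_signed_parts\<close>, which cancels finite quantities only.

  The constant must not depend on \<open>s\<close>. Radial integration of the kernel costs 1/s at
  large and 1/(1 - s) at small distances; every other power is bounded uniformly for 0 < s < 1, so
  that a single integration over the exponents remains.

  The radii are nested: the cutoff lives in radius 3r/2, at most 3R/4; increments of length at most
  R/8 stay inside radius 15R/16; a point outside the ball of radius R is far from the cutoff in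
  proportion to its distance from the centre.\<close>

definition flat :: "real poly \<Rightarrow> real \<Rightarrow> real" where
  "flat P t = (if t \<le> 0 then 0 else poly P (1 / t) * exp (- (1 / t)))"

lemma poly_times_exp_tendsto_0: "((\<lambda>y::real. poly P y * exp (- y)) \<longlongrightarrow> 0) at_top"
proof -
  have "((\<lambda>y::real. \<Sum>i\<le>degree P. coeff P i * (y ^ i / exp y)) \<longlongrightarrow> (\<Sum>i\<le>degree P. coeff P i * 0)) at_top"
    by (intro tendsto_sum tendsto_mult tendsto_const tendsto_power_div_exp_0)
  moreover have "(\<Sum>i\<le>degree P. coeff P i * (y ^ i / exp y)) = poly P y * exp (- y)" for y :: real
    by (simp add: poly_altdef sum_distrib_right exp_minus divide_inverse mult.assoc)
  ultimately show ?thesis by simp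
qed

text \<open>With y = 1/t, the chain rule turns P(y) e^(-y) into y^2 (P(y) - P'(y)) e^(-y): the
  family is closed under differentiation, which is why \<open>flat\<close> carries a polynomial. At
  0 the right difference quotient is y P(y) e^(-y) with y = 1/h, which tends to 0.\<close>

lemma flat_has_derivative:
  "(flat P has_real_derivative flat ([:0, 0, 1:] * (P - pderiv P)) t) (at t)"
proof -
  consider "t > 0" | "t < 0" | "t = 0" by linarith
  then show ?thesis
  proof cases
    case 1
    have "((\<lambda>t. poly P (1 / t) * exp (- (1 / t))) has_real_derivative
        flat ([:0, 0, 1:] * (P - pderiv P)) t) (at t)"
      using 1 by (auto intro!: derivative_eq_intros poly_DERIV[THEN DERIV_chain2] simp: flat_def)
        (simp add: field_simps power2_eq_square)
    moreover have "eventually (\<lambda>s. flat P s = poly P (1 / s) * exp (- (1 / s))) (nhds t)"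
      using eventually_nhds_in_open[of "{0<..}" t] 1 by (auto elim!: eventually_mono simp: flat_def)
    ultimately show ?thesis
      by (subst DERIV_cong_ev[OF refl _ refl])
  next
    case 2
    have "((\<lambda>t. 0::real) has_real_derivative 0) (at t)" by simp
    moreover have "eventually (\<lambda>s. flat P s = 0) (nhds t)"
      using eventually_nhds_in_open[of "{..<0}" t] 2 by (auto elim!: eventually_mono simp: flat_def)
    ultimately show ?thesis
      using 2 by (subst DERIV_cong_ev[OF refl _ refl]) (auto simp: flat_def)
  next
    case 3
    have "((\<lambda>h. flat P h / h) \<longlongrightarrow> 0) (at_right 0)"
    proof -
      have "filterlim (\<lambda>h::real. 1 / h) at_top (at_right 0)"
        using filterlim_inverse_at_top_right by (simp add: inverse_eq_divide)
      from filterlim_compose[OF poly_times_exp_tendsto_0[of "[:0,1:] * P"] this]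
      have "((\<lambda>h::real. poly ([:0,1:] * P) (1 / h) * exp (- (1 / h))) \<longlongrightarrow> 0) (at_right 0)" .
      moreover have "eventually (\<lambda>h::real. flat P h / h = poly ([:0,1:] * P) (1 / h) * exp (- (1 / h))) (at_right 0)"
        using eventually_at_right_less[of "0::real"] by eventually_elim (auto simp: flat_def field_simps)
      ultimately show ?thesis
        by (rule iffD2[OF tendsto_cong, rotated])
    qed
    moreover have "((\<lambda>h. flat P h / h) \<longlongrightarrow> 0) (at_left 0)"
      by (rule tendsto_eventually) (auto simp: eventually_at_left_field flat_def intro!: exI[of _ "-1"])
    ultimately have "((\<lambda>h. flat P h / h) \<longlongrightarrow> 0) (at 0)"
      by (simp add: filterlim_split_at)
    then show ?thesis using 3
      by (simp add: DERIV_def) (simp add: flat_def)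
  qed
qed

lemma flat_one_bounds: "0 \<le> flat 1 t" "flat 1 t \<le> 1"
  by (auto simp: flat_def)

lemma flat_one_tendsto: "(\<lambda>n. flat 1 (real n * t)) \<longlonglongrightarrow> of_bool (0 < t)"
proof (cases "0 < t")
  case True
  have "(\<lambda>n. exp (- (1 / (real n * t)))) \<longlonglongrightarrow> exp (- 0)"
  proof (intro tendsto_intros)
    have "(\<lambda>n. inverse (real n) * (1 / t)) \<longlonglongrightarrow> 0 * (1 / t)"
      by (intro tendsto_intros lim_inverse_n)
    then show "(\<lambda>n. 1 / (real n * t)) \<longlonglongrightarrow> 0" by (simp add: field_simps)
  qed
  moreover have "eventually (\<lambda>n. flat 1 (real n * t) = exp (- (1 / (real n * t)))) sequentially"
    using eventually_gt_at_top[of 0] by eventually_elim (use True in \<open>auto simp: flat_def mult_le_0_iff\<close>)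
  ultimately show ?thesis using True by (simp add: tendsto_cong)
next
  case False
  then show ?thesis by (auto simp: flat_def mult_le_0_iff intro!: tendsto_eventually always_eventually)
qed

lemma C_k_imp_continuous: "C_k k f \<Longrightarrow> continuous_on UNIV f"
proof (cases k)
  case (Suc j)
  assume "C_k k f"
  then obtain f' where "\<And>x. (f has_derivative f' x) (at x)" using Suc by auto
  then show ?thesis
    by (intro continuous_at_imp_continuous_on ballI has_derivative_continuous)
qed simp

lemma C_k_SucD: "C_k (Suc k) f \<Longrightarrow> C_k k f"
proof (induction k arbitrary: f)
  case 0
  then show ?case using C_k_imp_continuous[of "Suc 0"] by simp
next
  case (Suc k)
  then show ?case by (metis C_k.simps(2))
qed

lemma C_k_const: "C_k k (\<lambda>x. c)"
  by (induction k arbitrary: c) (auto intro!: exI[of _ "\<lambda>_ _. 0"])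

lemma C_k_add: "C_k k f \<Longrightarrow> C_k k g \<Longrightarrow> C_k k (\<lambda>x. f x + g x)"
proof (induction k arbitrary: f g)
  case 0
  then show ?case by (auto intro!: continuous_intros)
next
  case (Suc k)
  then obtain f' g' where "\<forall>x. (f has_derivative f' x) (at x)" "\<forall>h. C_k k (\<lambda>x. f' x h)"
    "\<forall>x. (g has_derivative g' x) (at x)" "\<forall>h. C_k k (\<lambda>x. g' x h)" by auto
  then show ?case
    using Suc.IH by (auto intro!: exI[of _ "\<lambda>x h. f' x h + g' x h"] has_derivative_add)
qed

lemma C_k_mult: "C_k k f \<Longrightarrow> C_k k g \<Longrightarrow> C_k k (\<lambda>x. f x * g x)"
proof (induction k arbitrary: f g)
  case 0
  then show ?case by (auto intro!: continuous_intros)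
next
  case (Suc k)
  then obtain f' g' where "\<forall>x. (f has_derivative f' x) (at x)" "\<forall>h. C_k k (\<lambda>x. f' x h)"
    "\<forall>x. (g has_derivative g' x) (at x)" "\<forall>h. C_k k (\<lambda>x. g' x h)" by auto
  then show ?case
    using Suc.IH Suc.prems[THEN C_k_SucD]
    by (auto intro!: exI[of _ "\<lambda>x h. f x * g' x h + f' x h * g x"] has_derivative_mult C_k_add)
qed

lemma C_k_prod: "finite A \<Longrightarrow> (\<And>i. i \<in> A \<Longrightarrow> C_k k (f i)) \<Longrightarrow> C_k k (\<lambda>x. \<Prod>i\<in>A. f i x)"
  by (induction A rule: finite_induct) (auto intro: C_k_const C_k_mult)

lemma C_k_translate: "C_k k f \<Longrightarrow> C_k k (\<lambda>x. f (x - a))"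
proof (induction k arbitrary: f)
  case 0
  then show ?case by (auto intro!: continuous_intros continuous_on_compose2[of UNIV f])
next
  case (Suc k)
  then obtain f' where f': "\<forall>x. (f has_derivative f' x) (at x)" "\<forall>h. C_k k (\<lambda>x. f' x h)" by auto
  have "((\<lambda>x. f (x - a)) has_derivative f' (x - a)) (at x)" for x
  proof -
    have "((\<lambda>x. x - a) has_derivative (\<lambda>h. h)) (at x)" by (auto intro!: derivative_eq_intros)
    from diff_chain_at[OF this, of f "f' (x - a)"] f'(1) show ?thesis by (simp add: o_def)
  qed
  with f' Suc.IH show ?case by (auto intro!: exI[of _ "\<lambda>x. f' (x - a)"])
qed

text \<open>Both \<open>c\<close> and \<open>P\<close> vary in the induction: the derivative in
  direction \<open>h\<close> has the same form, with \<open>c\<close> multiplied by m (h . v) and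
  \<open>P\<close> replaced as in \<open>flat_has_derivative\<close>.\<close>

lemma C_k_flat: "C_k k (\<lambda>x. c * flat P (m * (x \<bullet> v) + w))"
proof (induction k arbitrary: c P)
  case 0
  have "continuous_on UNIV (flat P)"
    using flat_has_derivative DERIV_continuous_on by blast
  then show ?case by (auto intro!: continuous_intros continuous_on_compose2[of UNIV "flat P"])
next
  case (Suc k)
  let ?P = "[:0, 0, 1:] * (P - pderiv P)"
  have "((\<lambda>x. c * flat P (m * (x \<bullet> v) + w)) has_derivative
      (\<lambda>h. (c * (m * (h \<bullet> v))) * flat ?P (m * (x \<bullet> v) + w))) (at x)" for x
    by (auto intro!: derivative_eq_intros has_derivative_compose[where g = "flat P"]
        flat_has_derivative[unfolded has_field_derivative_def] simp: algebra_simps)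
  with Suc.IH show ?case by (auto intro!: exI)
qed

section \<open>Box bumps and the fundamental lemma of the calculus of variations\<close>

definition box_bump :: "'a::euclidean_space \<Rightarrow> 'a \<Rightarrow> nat \<Rightarrow> 'a \<Rightarrow> real" where
  "box_bump a c n x =
     (\<Prod>b\<in>Basis. flat 1 (real n * (x \<bullet> b - a \<bullet> b)) * flat 1 (real n * (c \<bullet> b - x \<bullet> b)))"

lemma box_bump_bounds: "0 \<le> box_bump a c n x" "box_bump a c n x \<le> 1"
  unfolding box_bump_def
  by (auto intro!: prod_nonneg prod_le_1 mult_nonneg_nonneg mult_le_one simp: flat_one_bounds)

lemma box_bump_outside: "x \<notin> box a c \<Longrightarrow> box_bump a c n x = 0"
proof -
  assume "x \<notin> box a c"
  then obtain b where "b \<in> Basis" "x \<bullet> b \<le> a \<bullet> b \<or> c \<bullet> b \<le> x \<bullet> b"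
    by (force simp: mem_box)
  then show ?thesis
    unfolding box_bump_def by (intro prod_zero) (auto simp: flat_def mult_le_0_iff intro!: bexI[of _ b])
qed

lemma box_bump_tendsto: "(\<lambda>n. box_bump a c n x) \<longlonglongrightarrow> indicator (box a c) x"
proof -
  have "(\<lambda>n. box_bump a c n x) \<longlonglongrightarrow>
      (\<Prod>b\<in>Basis. of_bool (0 < x \<bullet> b - a \<bullet> b) * of_bool (0 < c \<bullet> b - x \<bullet> b) :: real)"
    unfolding box_bump_def by (intro tendsto_prod tendsto_mult flat_one_tendsto)
  moreover have "(\<Prod>b\<in>Basis. of_bool (0 < x \<bullet> b - a \<bullet> b) * of_bool (0 < c \<bullet> b - x \<bullet> b)) = (indicator (box a c) x :: real)"
  proof (cases "x \<in> box a c")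
    case True
    then show ?thesis by (simp add: mem_box)
  next
    case False
    then obtain b where "b \<in> Basis" "x \<bullet> b \<le> a \<bullet> b \<or> c \<bullet> b \<le> x \<bullet> b"
      by (force simp: mem_box)
    then have "(\<Prod>b\<in>Basis. of_bool (0 < x \<bullet> b - a \<bullet> b) * of_bool (0 < c \<bullet> b - x \<bullet> b)) = (0::real)"
      by (intro prod_zero) (auto intro!: bexI[of _ b])
    with False show ?thesis by simp
  qed
  ultimately show ?thesis by simp
qed

text \<open>Boxes are preferred to balls because they are stable under intersection and generate the
  Borel sets, and because smoothness reduces to one variable. The closed box has to fit, since the
  support is a closure.\<close>

lemma box_bump_test_function:
  assumes "cbox a c \<subseteq> \<Omega>" shows "box_bump a c n \<in> test_functions \<Omega>"
proof -
  have "C_k k (\<lambda>x. flat 1 (real n * (x \<bullet> b - a \<bullet> b)) * flat 1 (real n * (c \<bullet> b - x \<bullet> b)))" for k b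
    using C_k_mult[OF C_k_flat[of k 1 1 "real n" b "- (real n * (a \<bullet> b))"]
        C_k_flat[of k 1 1 "- real n" b "real n * (c \<bullet> b)"]]
    by (simp add: algebra_simps)
  then have "C_k k (box_bump a c n)" for k
    unfolding box_bump_def by (intro C_k_prod) auto
  moreover have sub: "closure {x. box_bump a c n x \<noteq> 0} \<subseteq> cbox a c"
    using box_bump_outside[of _ a c n] box_subset_cbox[of a c] by (intro closure_minimal) blast+
  moreover have "compact (closure {x. box_bump a c n x \<noteq> 0})"
    using compact_Int_closed[OF compact_cbox closed_closure] sub by (metis inf.absorb_iff2)
  ultimately show ?thesis using assms by (auto simp: test_functions_def)
qed

text \<open>The Borel sets over which \<open>W\<close> integrates to 0 form a Dynkin system
  containing the intersection-stable family of boxes, hence all Borel sets. The complement step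
  needs the integral over the whole space, which \<open>total\<close> supplies.\<close>

lemma AE_zero_of_box_integrals:
  fixes W :: "'a::euclidean_space \<Rightarrow> real"
  assumes W: "integrable lborel W" and box: "\<And>a c. (LINT x:box a c|lborel. W x) = 0"
    and total: "(LINT x|lborel. W x) = 0"
  shows "AE x in lborel. W x = 0"
proof (rule sigma_finite_measure.density_zero[OF sigma_finite_lborel W])
  have W': "set_integrable lborel A W" if "A \<in> sets borel" for A
    using integrable_mult_indicator[OF _ W, of A] that by (simp add: set_integrable_def)
  let ?G = "range (\<lambda>(a, c). box a c :: 'a set)"
  fix A :: "'a set" assume "A \<in> sets lborel"
  then have AG: "A \<in> sigma_sets UNIV ?G"
    by (simp add: borel_eq_box)
  have sub: "sigma_sets UNIV ?G = sets borel" by (simp add: borel_eq_box)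
  have stable: "Int_stable ?G"
    by (auto simp: Int_stable_def box_Int_box)
  have "?G \<subseteq> Pow UNIV" by simp
  from stable this AG show "(LINT x:A|lborel. W x) = 0"
  proof (induction rule: sigma_sets_induct_disjoint)
    case (basic A)
    then show ?case using box by auto
  next
    case empty
    then show ?case by (simp add: set_lebesgue_integral_def)
  next
    case (compl A)
    then have A: "A \<in> sets borel" by (simp add: sub)
    have "(LINT x|lborel. W x) = (LINT x:A \<union> (UNIV - A)|lborel. W x)"
      by (simp add: set_lebesgue_integral_def)
    also have "\<dots> = (LINT x:A|lborel. W x) + (LINT x:UNIV - A|lborel. W x)"
      using A by (intro set_integral_Un W') auto
    finally show ?case using total compl by simp
  next
    case (union A)
    then have A: "\<And>i. A i \<in> sets borel" by (auto simp: sub)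
    have "(LINT x:(\<Union>i. A i)|lborel. W x) = (\<Sum>i. LINT x:A i|lborel. W x)"
      using A union by (intro lebesgue_integral_countable_add W') (auto simp: disjoint_family_on_def)
    then show ?case using union by simp
  qed
qed

text \<open>Bumps converge boundedly to the indicator of a box, so dominated convergence gives zero
  integrals over all boxes whose closed box lies in \<open>U\<close>. The previous lemma then
  applies on one such box at a time, and countably many of them exhaust \<open>U\<close>.\<close>

lemma AE_zero_of_test_functions:
  fixes w :: "'a::euclidean_space \<Rightarrow> real"
  assumes U: "open U" and w[measurable]: "w \<in> borel_measurable borel"
    and int: "\<And>K. compact K \<Longrightarrow> K \<subseteq> U \<Longrightarrow> set_integrable lborel K w"
    and test: "\<And>\<psi>. \<psi> \<in> test_functions U \<Longrightarrow> (LINT x|lborel. w x * \<psi> x) = 0"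
  shows "AE x in lborel. x \<in> U \<longrightarrow> w x = 0"
proof -
  have box0: "(LINT x:box a c|lborel. w x) = 0" if "cbox a c \<subseteq> U" for a c
  proof -
    have "(\<lambda>n. LINT x|lborel. w x * box_bump a c n x) \<longlonglongrightarrow> (LINT x|lborel. w x * indicator (box a c) x)"
    proof (rule integral_dominated_convergence)
      show "integrable lborel (\<lambda>x. indicator (cbox a c) x *\<^sub>R \<bar>w x\<bar>)"
        using int[OF compact_cbox that] set_integrable_abs by (auto simp: set_integrable_def)
      show "AE x in lborel. (\<lambda>n. w x * box_bump a c n x) \<longlonglongrightarrow> w x * indicator (box a c) x"
        by (intro AE_I2 tendsto_mult tendsto_const box_bump_tendsto)
      have "box_bump a c n \<in> borel_measurable borel" for n
        using box_bump_test_function[of a c UNIV n]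
        by (intro borel_measurable_continuous_onI C_k_imp_continuous[of 0]) (simp add: test_functions_def del: C_k.simps)
      then show "(\<lambda>x. w x * box_bump a c n x) \<in> borel_measurable lborel" for n by simp
      show "AE x in lborel. norm (w x * box_bump a c n x) \<le> indicator (cbox a c) x *\<^sub>R \<bar>w x\<bar>" for n
      proof (intro AE_I2)
        fix x
        have "box_bump a c n x = 0" if "x \<notin> cbox a c"
          using that box_subset_cbox by (intro box_bump_outside) blast
        then show "norm (w x * box_bump a c n x) \<le> indicator (cbox a c) x *\<^sub>R \<bar>w x\<bar>"
          using box_bump_bounds[of a c n x] by (auto simp: abs_mult indicator_def mult_left_le)
      qed
    qed simp
    moreover have "(LINT x|lborel. w x * box_bump a c n x) = 0" for n
      using test box_bump_test_function[OF that] by blast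
    ultimately have "(LINT x|lborel. w x * indicator (box a c) x) = 0"
      by (simp add: LIMSEQ_const_iff)
    then show ?thesis by (simp add: set_lebesgue_integral_def mult.commute)
  qed
  \<comment> \<open>Multiplying \<open>w\<close> by the indicator of the box makes it globally
    integrable, and its integral over any other box is one of \<open>w\<close> over the
    intersection, again a box.\<close>
  have AEbox: "AE x in lborel. x \<in> box a c \<longrightarrow> w x = 0" if ac: "cbox a c \<subseteq> U" for a c
  proof -
    let ?W = "\<lambda>x. indicator (box a c) x * w x"
    have "integrable lborel (\<lambda>x. indicator (box a c) x *\<^sub>R w x)"
      using set_integrable_subset[OF int[OF compact_cbox ac], of "box a c"] box_subset_cbox[of a c]
      by (simp add: set_integrable_def)
    moreover have "(LINT x:box a' c'|lborel. ?W x) = 0" for a' c'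
    proof -
      obtain a2 c2 where eq: "box a' c' \<inter> box a c = box a2 c2"
        by (simp add: box_Int_box)
      have "(LINT x:box a' c'|lborel. ?W x) = (LINT x:box a2 c2|lborel. w x)"
        unfolding set_lebesgue_integral_def eq[symmetric]
        by (auto intro!: Bochner_Integration.integral_cong simp: indicator_def)
      also have "\<dots> = 0"
      \<comment> \<open>\<open>box0\<close> asks for the closed box inside \<open>U\<close>. For a
        nonempty open box this is its closure; if the open box is empty, \<open>cbox a2 c2\<close>
        need not relate to \<open>cbox a c\<close>, but then the integral is trivially 0.\<close>
      proof (cases "box a2 c2 = {}")
        case False
        then have "cbox a2 c2 = closure (box a2 c2)" by (simp add: closure_box)
        also have "\<dots> \<subseteq> cbox a c"
          using eq box_subset_cbox[of a c] by (intro closure_minimal) auto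
        finally show ?thesis using ac by (intro box0) auto
      qed (simp add: set_lebesgue_integral_def)
      finally show ?thesis .
    qed
    moreover have "(LINT x|lborel. ?W x) = 0"
      using box0[OF ac] by (simp add: set_lebesgue_integral_def)
    ultimately have "AE x in lborel. ?W x = 0"
      by (intro AE_zero_of_box_integrals) auto
    then show ?thesis by eventually_elim (auto simp: indicator_def split: if_splits)
  qed
  obtain \<D> where D: "countable \<D>" "\<D> \<subseteq> Pow U" "\<And>X. X \<in> \<D> \<Longrightarrow> \<exists>a b. X = cbox a b" "\<Union>\<D> = U"
    using open_countable_Union_open_cbox[OF U] by metis
  have "AE x in lborel. \<forall>X\<in>\<D>. x \<in> X \<longrightarrow> w x = 0"
  proof (intro AE_ball_countable[THEN iffD2] D(1) ballI)
    fix X assume X: "X \<in> \<D>"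
    then obtain a c where ac: "X = cbox a c" using D(3) by blast
    have "cbox a c - box a c \<in> null_sets lborel"
      by (simp add: null_setsI emeasure_Diff emeasure_lborel_cbox_eq emeasure_lborel_box_eq box_subset_cbox)
    then have "AE x in lborel. x \<notin> cbox a c - box a c" by (rule AE_not_in)
    moreover have "cbox a c \<subseteq> U" using X ac D(2) by auto
    ultimately show "AE x in lborel. x \<in> X \<longrightarrow> w x = 0"
      using AEbox[of a c] unfolding ac by auto
  qed
  then show ?thesis using D(4) by (auto elim!: eventually_mono)
qed

section \<open>Translations in the space of integrable functions\<close>

lemma nn_integral_lborel_translate:
  fixes f :: "'a::euclidean_space \<Rightarrow> ennreal"
  assumes [measurable]: "f \<in> borel_measurable borel"
  shows "(\<integral>\<^sup>+x. f (a + x) \<partial>lborel) = (\<integral>\<^sup>+x. f x \<partial>lborel)"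
  by (subst (2) lborel_distr_plus[of a, symmetric]) (simp add: nn_integral_distr)

lemma nn_integral_lborel_reflect:
  fixes f :: "'a::euclidean_space \<Rightarrow> ennreal"
  assumes [measurable]: "f \<in> borel_measurable borel"
  shows "(\<integral>\<^sup>+x. f (a - x) \<partial>lborel) = (\<integral>\<^sup>+x. f x \<partial>lborel)"
proof -
  have "lborel = distr lborel borel (\<lambda>x::'a. a + (-1) *\<^sub>R x)"
    using lborel_affine[of "-1" a] by (simp add: density_1)
  then have "(\<integral>\<^sup>+x. f x \<partial>lborel) = (\<integral>\<^sup>+x. f x \<partial>distr lborel borel (\<lambda>x::'a. a + (-1) *\<^sub>R x))"
    by simp
  then show ?thesis by (simp add: nn_integral_distr)
qed

lemma integrable_lborel_translate:
  fixes f :: "'a::euclidean_space \<Rightarrow> 'b::{banach, second_countable_topology}"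
  shows "integrable lborel (\<lambda>x. f (a + x)) \<longleftrightarrow> integrable lborel f" (is "?L \<longleftrightarrow> ?R")
proof -
  have *: "integrable lborel (\<lambda>x. f (a + x))" if "integrable lborel f" for f :: "'a \<Rightarrow> 'b" and a
  proof -
    have "integrable (distr lborel borel ((+) a)) f"
      using that by (simp add: lborel_distr_plus)
    then show ?thesis
      using that by (subst (asm) integrable_distr_eq) (auto)
  qed
  show ?thesis using *[of f a] *[of "\<lambda>x. f (a + x)" "- a"] by auto
qed

lemma integral_lborel_translate:
  fixes f :: "'a::euclidean_space \<Rightarrow> 'b::{banach, second_countable_topology}"
  shows "(LINT x|lborel. f (a + x)) = (LINT x|lborel. f x)"
proof (cases "integrable lborel f")
  case True
  then have [measurable]: "f \<in> borel_measurable borel" by auto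
  show ?thesis
    by (subst (2) lborel_distr_plus[of a, symmetric]) (simp add: integral_distr)
next
  case False
  then show ?thesis using integrable_lborel_translate[of f a] by (simp add: not_integrable_integral_eq)
qed

text \<open>By induction over integrable functions. For an indicator of \<open>A\<close>, choose a
  compact \<open>K\<close> inside and an open \<open>T\<close> outside with small excess. A shift
  shorter than the distance from \<open>K\<close> to the complement of \<open>T\<close> maps
  \<open>K\<close> into \<open>T\<close>, so the two indicators can differ only on
  \<open>A - K\<close>, \<open>T - A\<close> and their translates. Translation invariance carries
  the approximation through limits.\<close>

lemma nn_integral_translation_continuous:
  fixes f :: "'a::euclidean_space \<Rightarrow> real"
  assumes "integrable lborel f" "0 < e"
  shows "\<exists>\<delta>>0. \<forall>h. norm h < \<delta> \<longrightarrow> (\<integral>\<^sup>+x. ennreal \<bar>f (h + x) - f x\<bar> \<partial>lborel) \<le> ennreal e"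
  using assms
proof (induction arbitrary: e rule: integrable_induct)
  case (base A c)
  then have A: "A \<in> sets borel" "emeasure lborel A < \<infinity>" by auto
  \<comment> \<open>Four exceptional sets, each of measure below e'/2, contribute at most 2 e' |c|,
    which is below \<open>e\<close>; the added 1 covers c = 0.\<close>
  define e' where "e' = e / (2 * (\<bar>c\<bar> + 1))"
  have e': "e' > 0" using base by (auto simp: e'_def intro!: divide_pos_pos)
  have e4: "e'/4 > 0" using e' by simp
  have AL: "A \<in> sets lebesgue" using A by auto
  obtain T where T: "open T" "A \<subseteq> T" "emeasure lebesgue (T - A) < ennreal (e'/2)"
    using sets_lebesgue_outer_open[OF AL half_gt_zero[OF e']] by metis
  obtain S where S: "closed S" "S \<subseteq> A" "emeasure lebesgue (A - S) < ennreal (e'/4)"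
    using sets_lebesgue_inner_closed[OF AL e4] by metis
  \<comment> \<open>The inner approximation is only closed. As its measure is finite, cutting it by
    a large ball loses little and makes it compact, which the positive distance below
    requires.\<close>
  obtain K where K: "compact K" "K \<subseteq> S" "emeasure lborel (S - K) < ennreal (e'/4)"
  proof -
    let ?B = "\<lambda>n. S - cball 0 (real n)"
    have "emeasure lborel S \<le> emeasure lborel A" using S A by (intro emeasure_mono) auto
    then have fin: "emeasure lborel S < \<infinity>" using A by (auto simp: order.strict_trans1)
    have "emeasure lborel (?B n) \<noteq> \<infinity>" for n
      using emeasure_mono[of "?B n" S lborel] fin S(1) by (auto simp: top_unique)
    then have "(\<lambda>n. emeasure lborel (?B n)) \<longlonglongrightarrow> emeasure lborel (\<Inter>n. ?B n)"
      using S(1) by (intro Lim_emeasure_decseq) (auto simp: decseq_def)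
    moreover have "(\<Inter>n. ?B n) = {}"
      by (auto simp: not_le not_less real_arch_simple)
    ultimately have "(\<lambda>n. emeasure lborel (?B n)) \<longlonglongrightarrow> 0"
      by (metis emeasure_empty)
    then have "eventually (\<lambda>n. emeasure lborel (?B n) < ennreal (e'/4)) sequentially"
      using e' by (intro order_tendstoD) auto
    then obtain n where "emeasure lborel (?B n) < ennreal (e'/4)"
      by (auto simp: eventually_sequentially)
    then show ?thesis
      using S(1) that[of "S \<inter> cball 0 (real n)"] by (auto simp: closed_Int_compact Diff_Int)
  qed
  have AK: "emeasure lborel (A - K) < ennreal (e'/2)"
  proof -
    have "emeasure lborel (A - K) \<le> emeasure lborel ((A - S) \<union> (S - K))"
      using A S K by (intro emeasure_mono) (auto dest: compact_imp_closed)
    also have "\<dots> \<le> emeasure lborel (A - S) + emeasure lborel (S - K)"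
      using A S K by (intro emeasure_subadditive) (auto dest: compact_imp_closed)
    also have "\<dots> < ennreal (e'/4) + ennreal (e'/4)"
      using S(3) K(3) A S(1) by (intro add_strict_mono) auto
    also have "\<dots> = ennreal (e'/2)" using e' by (simp flip: ennreal_plus)
    finally show ?thesis .
  qed
  have TA: "emeasure lborel (T - A) < ennreal (e'/2)" using T A by auto
  obtain \<delta> where \<delta>: "\<delta> > 0" "\<And>x y. x \<in> K \<Longrightarrow> y \<notin> T \<Longrightarrow> \<delta> \<le> dist x y"
    using separate_compact_closed[of K "- T"] K(1,2) T(1,2) S(2) by (auto simp: disjoint_iff) blast
  have [measurable]: "A \<in> sets borel" "K \<in> sets borel" "T \<in> sets borel"
    using A K T by (auto dest: compact_imp_closed)
  have "(\<integral>\<^sup>+x. ennreal \<bar>indicator A (h + x) *\<^sub>R c - indicator A x *\<^sub>R c\<bar> \<partial>lborel) \<le> ennreal e"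
    if h: "norm h < \<delta>" for h
  proof -
    have *: "ennreal \<bar>indicator A (h + x) *\<^sub>R c - indicator A x *\<^sub>R c\<bar>
      \<le> ennreal \<bar>c\<bar> * (indicator (A - K) (h + x) + indicator (T - A) x + indicator (A - K) x + indicator (T - A) (h + x))" for x
    proof -
      have 1: "h + x \<in> T" if "x \<in> K"
      proof (rule ccontr)
        assume "h + x \<notin> T"
        from \<delta>(2)[OF that this] h show False by (simp add: dist_norm)
      qed
      have 2: "x \<in> T" if "h + x \<in> K"
      proof (rule ccontr)
        assume "x \<notin> T"
        from \<delta>(2)[OF that this] h show False by (simp add: dist_norm)
      qed
      have "\<bar>indicator A (h + x) *\<^sub>R c - indicator A x *\<^sub>R c\<bar>
        \<le> \<bar>c\<bar> * (indicator (A - K) (h + x) + indicator (T - A) x + indicator (A - K) x + indicator (T - A) (h + x))"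
        using 1 2 by (auto simp: indicator_def)
      then have "ennreal \<bar>indicator A (h + x) *\<^sub>R c - indicator A x *\<^sub>R c\<bar>
        \<le> ennreal (\<bar>c\<bar> * (indicator (A - K) (h + x) + indicator (T - A) x + indicator (A - K) x + indicator (T - A) (h + x)))"
        by (rule ennreal_leI)
      also have "\<dots> = ennreal \<bar>c\<bar> * (indicator (A - K) (h + x) + indicator (T - A) x + indicator (A - K) x + indicator (T - A) (h + x))"
        by (simp add: ennreal_mult ennreal_indicator)
      finally show ?thesis .
    qed
    have "(\<integral>\<^sup>+x. ennreal \<bar>indicator A (h + x) *\<^sub>R c - indicator A x *\<^sub>R c\<bar> \<partial>lborel)
      \<le> (\<integral>\<^sup>+x. ennreal \<bar>c\<bar> * (indicator (A - K) (h + x) + indicator (T - A) x + indicator (A - K) x + indicator (T - A) (h + x)) \<partial>lborel)"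
      by (intro nn_integral_mono *)
    also have "\<dots> = ennreal \<bar>c\<bar> * (emeasure lborel (A - K) + emeasure lborel (T - A) + emeasure lborel (A - K) + emeasure lborel (T - A))"
      by (simp add: nn_integral_cmult nn_integral_add nn_integral_lborel_translate[where f = "indicator X" for X])
    also have "\<dots> \<le> ennreal \<bar>c\<bar> * (ennreal (e'/2) + ennreal (e'/2) + ennreal (e'/2) + ennreal (e'/2))"
      using AK TA by (intro mult_left_mono add_mono) auto
    also have "\<dots> = ennreal (\<bar>c\<bar> * (2 * e'))" using e' by (simp add: ennreal_mult flip: ennreal_plus)
    also have "\<dots> \<le> ennreal e"
      using base by (intro ennreal_leI) (auto simp: e'_def field_simps)
    finally show ?thesis .
  qed
  then show ?case using \<delta>(1) by blast
next
  case (add f g)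
  obtain d1 where d1: "d1 > 0"
    "\<And>h. norm h < d1 \<Longrightarrow> (\<integral>\<^sup>+x. ennreal \<bar>f (h + x) - f x\<bar> \<partial>lborel) \<le> ennreal (e/2)"
    using add.IH(1)[OF half_gt_zero[OF \<open>0 < e\<close>]] by blast
  obtain d2 where d2: "d2 > 0"
    "\<And>h. norm h < d2 \<Longrightarrow> (\<integral>\<^sup>+x. ennreal \<bar>g (h + x) - g x\<bar> \<partial>lborel) \<le> ennreal (e/2)"
    using add.IH(2)[OF half_gt_zero[OF \<open>0 < e\<close>]] by blast
  note d = d1(1) d2(1) d1(2) d2(2)
  have [measurable]: "f \<in> borel_measurable borel" "g \<in> borel_measurable borel" using add by auto
  have "(\<integral>\<^sup>+x. ennreal \<bar>(f (h + x) + g (h + x)) - (f x + g x)\<bar> \<partial>lborel) \<le> ennreal e"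
    if "norm h < min d1 d2" for h
  proof -
    have "(\<integral>\<^sup>+x. ennreal \<bar>(f (h + x) + g (h + x)) - (f x + g x)\<bar> \<partial>lborel)
      \<le> (\<integral>\<^sup>+x. ennreal \<bar>f (h + x) - f x\<bar> + ennreal \<bar>g (h + x) - g x\<bar> \<partial>lborel)"
      by (intro nn_integral_mono) (auto simp flip: ennreal_plus intro!: ennreal_leI)
    also have "\<dots> \<le> ennreal (e/2) + ennreal (e/2)"
      using d(3,4) that by (simp add: nn_integral_add add_mono)
    also have "\<dots> = ennreal e" using add by (simp flip: ennreal_plus)
    finally show ?thesis .
  qed
  then show ?case using d(1,2) by (intro exI[of _ "min d1 d2"]) auto
next
  case (lim f s)
  have [measurable]: "f \<in> borel_measurable borel" "\<And>i. s i \<in> borel_measurable borel"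
    using lim by auto
  have "(\<lambda>i. \<integral>\<^sup>+x. norm (f x - s i x) \<partial>lborel) \<longlonglongrightarrow> 0"
  proof (rule Bochner_Integration.nn_integral_dominated_convergence_norm)
    show "AE x in lborel. norm (s j x) \<le> 2 * norm (f x)" for j using lim by auto
    show "AE x in lborel. (\<lambda>i. s i x) \<longlonglongrightarrow> f x" using lim by auto
    show "(\<integral>\<^sup>+x. ennreal (2 * norm (f x)) \<partial>lborel) < \<infinity>"
    proof -
      have "integrable lborel f" using lim by blast
      then have "(\<integral>\<^sup>+x. ennreal (norm (f x)) \<partial>lborel) < \<infinity>" by (simp add: integrable_iff_bounded)
      then show ?thesis by (simp add: ennreal_mult nn_integral_cmult ennreal_mult_less_top)
    qed
  qed auto
  then have "eventually (\<lambda>i. (\<integral>\<^sup>+x. norm (s i x - f x) \<partial>lborel) < ennreal (e/3)) sequentially"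
    using lim by (subst norm_minus_commute, intro order_tendstoD) auto
  then obtain i where i: "(\<integral>\<^sup>+x. norm (s i x - f x) \<partial>lborel) < ennreal (e/3)"
    by (auto simp: eventually_sequentially)
  have "0 < e/3" using lim by simp
  from lim.IH[OF this, of i]
  obtain d where d: "d > 0" "\<And>h. norm h < d \<Longrightarrow> (\<integral>\<^sup>+x. ennreal \<bar>s i (h + x) - s i x\<bar> \<partial>lborel) \<le> ennreal (e/3)"
    by blast
  have "(\<integral>\<^sup>+x. ennreal \<bar>f (h + x) - f x\<bar> \<partial>lborel) \<le> ennreal e" if "norm h < d" for h
  proof -
    have "(\<integral>\<^sup>+x. ennreal \<bar>f (h + x) - f x\<bar> \<partial>lborel)
      \<le> (\<integral>\<^sup>+x. ennreal \<bar>s i (h + x) - f (h + x)\<bar> + ennreal \<bar>s i (h + x) - s i x\<bar> + ennreal \<bar>s i x - f x\<bar> \<partial>lborel)"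
      by (intro nn_integral_mono) (auto simp flip: ennreal_plus intro!: ennreal_leI)
    also have "\<dots> = (\<integral>\<^sup>+x. norm (s i x - f x) \<partial>lborel) + (\<integral>\<^sup>+x. ennreal \<bar>s i (h + x) - s i x\<bar> \<partial>lborel) + (\<integral>\<^sup>+x. norm (s i x - f x) \<partial>lborel)"
      using nn_integral_lborel_translate[where f = "\<lambda>x. ennreal \<bar>s i x - f x\<bar>"]
      by (simp add: nn_integral_add)
    also have "\<dots> \<le> ennreal (e/3) + ennreal (e/3) + ennreal (e/3)"
      using d(2)[OF that] i by (intro add_mono) auto
    also have "\<dots> = ennreal e" using lim by (simp flip: ennreal_plus)
    finally show ?thesis .
  qed
  then show ?case using d(1) by blast
qed

section \<open>Difference quotients and weak gradients\<close>

lemma Lp_loc_1_iff: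
  fixes f :: "'a::euclidean_space \<Rightarrow> 'b::euclidean_space"
  assumes [measurable]: "f \<in> borel_measurable borel"
  shows "f \<in> Lp_loc 1 \<Omega> \<longleftrightarrow> (\<forall>K. compact K \<and> K \<subseteq> \<Omega> \<longrightarrow> set_integrable lborel K f)"
proof -
  have "f \<in> Lp 1 K \<longleftrightarrow> set_integrable lborel K f" if "compact K" for K
  proof -
    have K[measurable]: "K \<in> sets borel" using that by (simp add: borel_compact)
    have "set_borel_measurable lborel K f" by (simp add: set_borel_measurable_def)
    then have "set_borel_measurable lebesgue K f"
      unfolding set_borel_measurable_def by (rule measurable_completion)
    moreover have "(\<integral>\<^sup>+x\<in>K. ennreal (norm (f x) powr 1) \<partial>lebesgue)
        = (\<integral>\<^sup>+x. ennreal (norm (indicator K x *\<^sub>R f x)) \<partial>lborel)"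
      by (simp add: nn_integral_completion) (auto intro!: nn_integral_cong simp: indicator_def)
    ultimately show ?thesis
      by (simp add: Lp_def set_integrable_def integrable_iff_bounded del: norm_scaleR)
  qed
  then show ?thesis by (auto simp: Lp_loc_def)
qed

text \<open>\<open>frechet_derivative\<close> is a chosen derivative; uniqueness identifies it with
  the one provided by \<open>C_k\<close>, and it inherits its continuity. Off the support the
  function is 0 on an open set, hence so is the derivative.\<close>

lemma test_function_facts:
  assumes "\<psi> \<in> test_functions \<Omega>"
  defines "K \<equiv> closure {x. \<psi> x \<noteq> 0}"
  shows "compact K" "K \<subseteq> \<Omega>" "\<And>x. x \<notin> K \<Longrightarrow> \<psi> x = 0" "continuous_on UNIV \<psi>"
    "(\<psi> has_derivative frechet_derivative \<psi> (at x)) (at x)"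
    "\<And>x. x \<notin> K \<Longrightarrow> frechet_derivative \<psi> (at x) h = 0"
    "continuous_on UNIV (\<lambda>x. frechet_derivative \<psi> (at x) h)"
proof -
  have C: "C_k k \<psi>" for k using assms by (simp add: test_functions_def)
  obtain f' where f': "\<And>x. (\<psi> has_derivative f' x) (at x)" "\<And>h. continuous_on UNIV (\<lambda>x. f' x h)"
    using C[of "Suc 0"] by auto
  have eq: "f' x = frechet_derivative \<psi> (at x)" for x
    by (rule frechet_derivative_at) (rule f'(1))
  show "(\<psi> has_derivative frechet_derivative \<psi> (at x)) (at x)"
    "continuous_on UNIV (\<lambda>x. frechet_derivative \<psi> (at x) h)"
    using f' by (auto simp: eq)
  show K: "compact K" "K \<subseteq> \<Omega>" using assms by (auto simp: test_functions_def)
  show 0: "\<psi> x = 0" if "x \<notin> K" for x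
    using that closure_subset by (force simp: K_def)
  show "continuous_on UNIV \<psi>" using C[of 0] by simp
  show "frechet_derivative \<psi> (at x) h = 0" if "x \<notin> K" for x
  proof -
    have "(\<psi> has_derivative (\<lambda>_. 0)) (at x)"
      by (rule has_derivative_transform_within_open[of "\<lambda>_. 0" _ _ _ "- K"])
        (use 0 that compact_imp_closed[OF K(1)] in \<open>simp_all add: open_closed\<close>)
    from fun_cong[OF frechet_derivative_at[OF this], of h] show ?thesis by simp
  qed
qed

lemma continuous_vanishing_bounded:
  fixes \<phi> :: "'a::euclidean_space \<Rightarrow> real"
  assumes "compact K" "continuous_on UNIV \<phi>" "\<And>x. x \<notin> K \<Longrightarrow> \<phi> x = 0"
  shows "\<exists>M\<ge>0. \<forall>x. \<bar>\<phi> x\<bar> \<le> M"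
proof -
  have "bounded (\<phi> ` K)"
    using assms by (intro compact_imp_bounded compact_continuous_image continuous_on_subset[OF assms(2)]) auto
  then obtain M where "\<forall>x\<in>K. \<bar>\<phi> x\<bar> \<le> M" by (auto simp: bounded_iff)
  then have "\<forall>x. \<bar>\<phi> x\<bar> \<le> max M 0" using assms(3) by (metis abs_zero max.cobounded2 max.coboundedI1)
  then show ?thesis by (meson max.cobounded2)
qed

lemma nn_integral_mult_bounded_le:
  fixes f \<phi> :: "'a::euclidean_space \<Rightarrow> real"
  assumes [measurable]: "f \<in> borel_measurable borel" "K \<in> sets borel"
    and "0 \<le> M" "\<And>x. \<bar>\<phi> x\<bar> \<le> M" "\<And>x. x \<notin> K \<Longrightarrow> \<phi> x = 0"
  shows "(\<integral>\<^sup>+x. ennreal \<bar>f x * \<phi> x\<bar> \<partial>lborel) \<le> ennreal M * (\<integral>\<^sup>+x\<in>K. ennreal \<bar>f x\<bar> \<partial>lborel)"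
proof -
  have "(\<integral>\<^sup>+x. ennreal \<bar>f x * \<phi> x\<bar> \<partial>lborel) \<le> (\<integral>\<^sup>+x. ennreal M * (ennreal \<bar>f x\<bar> * indicator K x) \<partial>lborel)"
    using assms(3-5)
    by (intro nn_integral_mono)
      (auto simp: abs_mult indicator_def mult.commute[of M] mult_left_mono simp flip: ennreal_mult intro!: ennreal_leI)
  then show ?thesis by (simp add: nn_integral_cmult)
qed

lemma set_integrable_imp_nn_finite:
  fixes f :: "'a::euclidean_space \<Rightarrow> real"
  assumes "set_integrable lborel K f"
  shows "(\<integral>\<^sup>+x\<in>K. ennreal \<bar>f x\<bar> \<partial>lborel) < \<infinity>"
proof -
  have "(\<integral>\<^sup>+x. ennreal (norm (indicator K x *\<^sub>R f x)) \<partial>lborel) < \<infinity>"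
    using assms by (simp add: set_integrable_def integrable_iff_bounded)
  moreover have "(\<integral>\<^sup>+x. ennreal (norm (indicator K x *\<^sub>R f x)) \<partial>lborel) = (\<integral>\<^sup>+x\<in>K. ennreal \<bar>f x\<bar> \<partial>lborel)"
    by (intro nn_integral_cong) (auto simp: indicator_def)
  ultimately show ?thesis by simp
qed

lemma integrable_mult_continuous_vanishing:
  fixes f \<phi> :: "'a::euclidean_space \<Rightarrow> real"
  assumes f[measurable]: "f \<in> borel_measurable borel" and "set_integrable lborel K f" "compact K"
    and \<phi>: "continuous_on UNIV \<phi>" "\<And>x. x \<notin> K \<Longrightarrow> \<phi> x = 0"
  shows "integrable lborel (\<lambda>x. f x * \<phi> x)"
proof -
  obtain M where M: "M \<ge> 0" "\<And>x. \<bar>\<phi> x\<bar> \<le> M"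
    using continuous_vanishing_bounded assms by blast
  have [measurable]: "\<phi> \<in> borel_measurable borel" using \<phi> by (simp add: borel_measurable_continuous_onI)
  have "(\<integral>\<^sup>+x. ennreal \<bar>f x * \<phi> x\<bar> \<partial>lborel) \<le> ennreal M * (\<integral>\<^sup>+x\<in>K. ennreal \<bar>f x\<bar> \<partial>lborel)"
    using assms M by (intro nn_integral_mult_bounded_le) (auto simp: borel_compact)
  also have "\<dots> < \<infinity>"
    using set_integrable_imp_nn_finite[OF assms(2)] by (simp add: ennreal_mult_less_top)
  finally show ?thesis by (intro integrableI_bounded) auto
qed

text \<open>The definition tests coordinate directions only; linearity in the direction gives every
  \<open>h\<close>, which is needed for increments along arbitrary segments. Since
  \<open>\<psi>\<close> vanishes outside \<Omega>, the integrals may be taken over the whole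
  space.\<close>

lemma has_weak_gradientD:
  fixes f :: "'a::euclidean_space \<Rightarrow> real"
  assumes wg: "has_weak_gradient f g \<Omega>" and [measurable]: "f \<in> borel_measurable borel" "g \<in> borel_measurable borel"
    and \<psi>: "\<psi> \<in> test_functions \<Omega>"
  shows "(LINT x|lborel. f x * frechet_derivative \<psi> (at x) h) = - (LINT x|lborel. (g x \<bullet> h) * \<psi> x)"
proof -
  define K where "K = closure {x. \<psi> x \<noteq> 0}"
  note F = test_function_facts[OF \<psi>, folded K_def]
  have fK: "set_integrable lborel K f" and gK: "set_integrable lborel K g"
    using wg F(1,2) by (auto simp: has_weak_gradient_def Lp_loc_1_iff)
  have gb: "set_integrable lborel K (\<lambda>x. g x \<bullet> b)" for b
    using integrable_inner_left[of b lborel, OF gK[unfolded set_integrable_def]]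
    by (simp add: set_integrable_def)
  have i1: "integrable lborel (\<lambda>x. f x * frechet_derivative \<psi> (at x) b)" for b
    using fK F by (intro integrable_mult_continuous_vanishing[of _ K]) auto
  have i2: "integrable lborel (\<lambda>x. (g x \<bullet> b) * \<psi> x)" for b
    using gb F by (intro integrable_mult_continuous_vanishing[of _ K]) auto
  have b: "(LINT x|lborel. f x * frechet_derivative \<psi> (at x) b) = - (LINT x|lborel. (g x \<bullet> b) * \<psi> x)"
    if "b \<in> Basis" for b
  proof -
    have "(LINT x:\<Omega>|lebesgue. f x * frechet_derivative \<psi> (at x) b) = - (LINT x:\<Omega>|lebesgue. (g x \<bullet> b) * \<psi> x)"
      using wg \<psi> that by (auto simp: has_weak_gradient_def)
    moreover have "(LINT x:\<Omega>|lebesgue. f x * frechet_derivative \<psi> (at x) b) = (LINT x|lebesgue. f x * frechet_derivative \<psi> (at x) b)"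
      unfolding set_lebesgue_integral_def using F(2,6)
      by (intro Bochner_Integration.integral_cong) (auto simp: indicator_def)
    moreover have "(LINT x:\<Omega>|lebesgue. (g x \<bullet> b) * \<psi> x) = (LINT x|lebesgue. (g x \<bullet> b) * \<psi> x)"
      unfolding set_lebesgue_integral_def using F(2,3)
      by (intro Bochner_Integration.integral_cong) (auto simp: indicator_def)
    ultimately show ?thesis
      using i1 i2 by (simp add: integral_completion borel_measurable_integrable)
  qed
  have lin: "frechet_derivative \<psi> (at x) h = (\<Sum>b\<in>Basis. (h \<bullet> b) * frechet_derivative \<psi> (at x) b)" for x
  proof -
    have "linear (frechet_derivative \<psi> (at x))" using F(5) by (rule has_derivative_linear)
    then show ?thesis
      by (subst (1) euclidean_representation[of h, symmetric]) (simp add: linear_sum linear_cmul)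
  qed
  have gh: "g x \<bullet> h = (\<Sum>b\<in>Basis. (h \<bullet> b) * (g x \<bullet> b))" for x
    by (subst euclidean_inner) (simp add: mult.commute)
  have "(LINT x|lborel. f x * frechet_derivative \<psi> (at x) h)
      = (LINT x|lborel. (\<Sum>b\<in>Basis. (h \<bullet> b) * (f x * frechet_derivative \<psi> (at x) b)))"
    by (simp add: lin sum_distrib_left mult.left_commute)
  also have "\<dots> = (\<Sum>b\<in>Basis. (h \<bullet> b) * (LINT x|lborel. f x * frechet_derivative \<psi> (at x) b))"
    using i1 by simp
  also have "\<dots> = - (\<Sum>b\<in>Basis. (h \<bullet> b) * (LINT x|lborel. (g x \<bullet> b) * \<psi> x))"
    by (simp add: b sum_negf)
  also have "\<dots> = - (LINT x|lborel. (\<Sum>b\<in>Basis. (h \<bullet> b) * ((g x \<bullet> b) * \<psi> x)))"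
    using i2 by simp
  also have "\<dots> = - (LINT x|lborel. (g x \<bullet> h) * \<psi> x)"
    by (simp add: gh sum_distrib_right mult.assoc)
  finally show ?thesis .
qed

lemma test_function_translate:
  assumes \<psi>: "\<psi> \<in> test_functions U" and sub: "\<And>x. x \<in> U \<Longrightarrow> a + x \<in> \<Omega>"
  shows "(\<lambda>x. \<psi> (x - a)) \<in> test_functions \<Omega>"
    "frechet_derivative (\<lambda>x. \<psi> (x - a)) (at x) = frechet_derivative \<psi> (at (x - a))"
proof -
  have "{x. \<psi> (x - a) \<noteq> 0} = (\<lambda>x. a + x) ` {x. \<psi> x \<noteq> 0}"
    by (auto intro!: image_eqI[of _ _ "_ - a"])
  then have cl: "closure {x. \<psi> (x - a) \<noteq> 0} = (\<lambda>x. a + x) ` closure {x. \<psi> x \<noteq> 0}"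
    by (simp add: closure_translation)
  then show "(\<lambda>x. \<psi> (x - a)) \<in> test_functions \<Omega>"
    using \<psi> sub compact_translation[of "closure {x. \<psi> x \<noteq> 0}" a]
    by (auto simp: test_functions_def C_k_translate simp del: compact_closure)
  have "((\<lambda>x. x - a) has_derivative (\<lambda>h. h)) (at x)" by (auto intro!: derivative_eq_intros)
  from diff_chain_at[OF this, of \<psi>, OF test_function_facts(5)[OF \<psi>]]
  have "((\<lambda>x. \<psi> (x - a)) has_derivative frechet_derivative \<psi> (at (x - a))) (at x)" by (simp add: o_def)
  then show "frechet_derivative (\<lambda>x. \<psi> (x - a)) (at x) = frechet_derivative \<psi> (at (x - a))"
    by (rule frechet_derivative_at[symmetric])
qed

section \<open>The increment of a weakly differentiable function as a line integral\<close>

lemma Fubini_unit_interval: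
  fixes F :: "real \<Rightarrow> 'a::euclidean_space \<Rightarrow> real"
  assumes [measurable]: "case_prod F \<in> borel_measurable (borel \<Otimes>\<^sub>M borel)"
    and C: "C < \<infinity>" "\<And>t. 0 \<le> t \<Longrightarrow> t \<le> 1 \<Longrightarrow> (\<integral>\<^sup>+x. ennreal \<bar>F t x\<bar> \<partial>lborel) \<le> C"
  shows "(LINT t:{0..1}|lborel. (LINT x|lborel. F t x)) = (LINT x|lborel. (LINT t:{0..1}|lborel. F t x))"
    "integrable lborel (\<lambda>x. LINT t:{0..1}|lborel. F t x)"
proof -
  let ?G = "\<lambda>t x. indicator {0..1} t *\<^sub>R F t x"
  have [measurable]: "case_prod F \<in> borel_measurable (lborel \<Otimes>\<^sub>M lborel)"
    by (simp add: measurable_cong_sets[OF sets_pair_measure_cong[OF sets_lborel sets_lborel] refl])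
  have "integrable (lborel \<Otimes>\<^sub>M lborel) (case_prod ?G)"
  proof (rule integrableI_bounded)
    have "(\<integral>\<^sup>+z. ennreal (norm (case_prod ?G z)) \<partial>(lborel \<Otimes>\<^sub>M lborel))
        = (\<integral>\<^sup>+t. \<integral>\<^sup>+x. ennreal (norm (?G t x)) \<partial>lborel \<partial>lborel)"
      by (subst lborel.nn_integral_fst[symmetric]) auto
    also have "\<dots> \<le> (\<integral>\<^sup>+t. C * indicator {0..1::real} t \<partial>lborel)"
    proof (intro nn_integral_mono)
      fix t :: real
      show "(\<integral>\<^sup>+x. ennreal (norm (?G t x)) \<partial>lborel) \<le> C * indicator {0..1} t"
        using C(2)[of t] by (cases "t \<in> {0..1}") auto
    qed
    also have "\<dots> < \<infinity>" using C(1) by (simp add: nn_integral_cmult)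
    finally show "(\<integral>\<^sup>+z. ennreal (norm (case_prod ?G z)) \<partial>(lborel \<Otimes>\<^sub>M lborel)) < \<infinity>" .
  qed measurable
  from lborel_pair.Fubini_integral[OF this] lborel_pair.integrable_snd[OF this]
  show "(LINT t:{0..1}|lborel. (LINT x|lborel. F t x)) = (LINT x|lborel. (LINT t:{0..1}|lborel. F t x))"
    "integrable lborel (\<lambda>x. LINT t:{0..1}|lborel. F t x)"
    by (simp_all add: set_lebesgue_integral_def)
qed

text \<open>Tested against \<open>\<psi>\<close>, the increment of \<open>f\<close> becomes an
  increment of \<open>\<psi>\<close>, which is the integral of its derivative along the segment. For
  each t the derivative is moved onto \<open>g\<close> with the translated test function
  \<open>\<psi>\<close> (x - t h), admissible by \<open>seg\<close>; Fubini collects the t-integral,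
  and the fundamental lemma removes \<open>\<psi>\<close>.\<close>

lemma weak_gradient_difference:
  fixes f :: "'a::euclidean_space \<Rightarrow> real"
  assumes U: "open U" and f[measurable]: "f \<in> borel_measurable borel" and g[measurable]: "g \<in> borel_measurable borel"
    and wg: "has_weak_gradient f g \<Omega>"
    and seg: "\<And>x t. x \<in> U \<Longrightarrow> 0 \<le> t \<Longrightarrow> t \<le> 1 \<Longrightarrow> t *\<^sub>R h + x \<in> \<Omega>"
  shows "AE x in lborel. x \<in> U \<longrightarrow> f (h + x) - f x = (LINT t:{0..1}|lborel. g (t *\<^sub>R h + x) \<bullet> h)"
proof -
  \<comment> \<open>The compact set swept out by \<open>K\<close> along the segment: on it local
    integrability of \<open>f\<close> and \<open>g\<close> bounds all shifts at once.\<close>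
  define S where "S K = (\<lambda>(t, x). t *\<^sub>R h + x) ` ({0..1} \<times> K)" for K :: "'a set"
  have S: "compact (S K)" "S K \<subseteq> \<Omega>" if "compact K" "K \<subseteq> U" for K
    using that seg unfolding S_def
    by (auto intro!: compact_continuous_image compact_Times continuous_intros simp: split_beta)
  have SI: "t *\<^sub>R h + x \<in> S K" if "x \<in> K" "0 \<le> t" "t \<le> 1" for t x K
    using that by (auto simp: S_def intro!: image_eqI[of _ _ "(t, x)"])
  have SfI: "set_integrable lborel (S K) f" and SgI: "set_integrable lborel (S K) (\<lambda>x. g x \<bullet> h)"
    if "compact K" "K \<subseteq> U" for K
  proof -
    show "set_integrable lborel (S K) f" using wg S[OF that] by (auto simp: has_weak_gradient_def Lp_loc_1_iff)
    have "set_integrable lborel (S K) g" using wg S[OF that] by (auto simp: has_weak_gradient_def Lp_loc_1_iff)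
    then show "set_integrable lborel (S K) (\<lambda>x. g x \<bullet> h)"
      using integrable_inner_left[of h lborel "\<lambda>x. indicator (S K) x *\<^sub>R g x"] by (simp add: set_integrable_def)
  qed
  have [measurable]: "S K \<in> sets borel" if "compact K" "K \<subseteq> U" for K
    using S(1)[OF that] by (rule borel_compact)
  \<comment> \<open>Stated for any bounded measurable weight vanishing off \<open>K\<close>, because
    it is used twice: with a test function, and with the indicator of \<open>K\<close> to see that
    the line integral is locally integrable in x.\<close>
  have G: "(LINT t:{0..1}|lborel. (LINT x|lborel. (g (t *\<^sub>R h + x) \<bullet> h) * \<phi> x))
      = (LINT x|lborel. (LINT t:{0..1}|lborel. (g (t *\<^sub>R h + x) \<bullet> h) * \<phi> x))" (is ?eq)
    "integrable lborel (\<lambda>x. LINT t:{0..1}|lborel. (g (t *\<^sub>R h + x) \<bullet> h) * \<phi> x)" (is ?int)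
    if K: "compact K" "K \<subseteq> U" and \<phi>: "0 \<le> M" "\<And>x. \<bar>\<phi> x\<bar> \<le> M" "\<And>x. x \<notin> K \<Longrightarrow> \<phi> x = 0"
      and [measurable]: "\<phi> \<in> borel_measurable borel"
    for \<phi> :: "'a \<Rightarrow> real" and K M
  proof -
    note [measurable] = \<open>compact K \<Longrightarrow> K \<subseteq> U \<Longrightarrow> S K \<in> sets borel\<close>[OF K]
    have C: "ennreal M * (\<integral>\<^sup>+x\<in>S K. ennreal \<bar>g x \<bullet> h\<bar> \<partial>lborel) < \<infinity>"
      using set_integrable_imp_nn_finite[OF SgI[OF K]] by (simp add: ennreal_mult_less_top)
    have le: "(\<integral>\<^sup>+x. ennreal \<bar>(g (t *\<^sub>R h + x) \<bullet> h) * \<phi> x\<bar> \<partial>lborel)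
        \<le> ennreal M * (\<integral>\<^sup>+x\<in>S K. ennreal \<bar>g x \<bullet> h\<bar> \<partial>lborel)" if t: "0 \<le> t" "t \<le> 1" for t
    proof -
      have "(\<integral>\<^sup>+x. ennreal \<bar>(g (t *\<^sub>R h + x) \<bullet> h) * \<phi> x\<bar> \<partial>lborel)
          = (\<integral>\<^sup>+x. ennreal \<bar>(g x \<bullet> h) * \<phi> (x - t *\<^sub>R h)\<bar> \<partial>lborel)"
        using nn_integral_lborel_translate[of "\<lambda>x. ennreal \<bar>(g x \<bullet> h) * \<phi> (x - t *\<^sub>R h)\<bar>" "t *\<^sub>R h"] by simp
      also have "\<dots> \<le> ennreal M * (\<integral>\<^sup>+x\<in>S K. ennreal \<bar>g x \<bullet> h\<bar> \<partial>lborel)"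
      proof (rule nn_integral_mult_bounded_le)
        fix x assume "x \<notin> S K"
        then show "\<phi> (x - t *\<^sub>R h) = 0" using \<phi>(3) SI[of "x - t *\<^sub>R h" K t] t by auto
      qed (use \<phi> in auto)
      finally show ?thesis .
    qed
    show ?eq by (rule Fubini_unit_interval(1)[OF _ C le]) measurable
    show ?int by (rule Fubini_unit_interval(2)[OF _ C le]) measurable
  qed
  define w where "w x = f (h + x) - f x - (LINT t:{0..1}|lborel. g (t *\<^sub>R h + x) \<bullet> h)" for x
  have "AE x in lborel. x \<in> U \<longrightarrow> w x = 0"
  proof (rule AE_zero_of_test_functions[OF U])
    show "w \<in> borel_measurable borel" unfolding w_def set_lebesgue_integral_def by measurable
    fix K assume K: "compact K" "K \<subseteq> U"
    then have [measurable]: "K \<in> sets borel" by (simp add: borel_compact)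
    have "set_integrable lborel K (\<lambda>x. f (h + x))"
    proof -
      have "set_integrable lborel ((\<lambda>x. h + x) ` K) f"
        by (rule set_integrable_subset[OF SfI[OF K]])
          (use K SI[of _ K 1] compact_translation[OF K(1), of h] in \<open>auto simp: borel_compact\<close>)
      then have "integrable lborel (\<lambda>x. indicator ((\<lambda>x. h + x) ` K) (h + x) *\<^sub>R f (h + x))"
        unfolding set_integrable_def by (subst integrable_lborel_translate)
      moreover have "indicator ((\<lambda>x. h + x) ` K) (h + x) = (indicator K x :: real)" for x
        by (auto simp: indicator_def)
      ultimately show ?thesis by (simp add: set_integrable_def)
    qed
    moreover have "set_integrable lborel K f"
      by (rule set_integrable_subset[OF SfI[OF K]]) (use SI[of _ K 0] in auto)
    moreover have "set_integrable lborel K (\<lambda>x. LINT t:{0..1}|lborel. g (t *\<^sub>R h + x) \<bullet> h)"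
      using G(2)[where M = 1 and \<phi> = "indicator K", OF K]
      by (simp add: set_integrable_def set_lebesgue_integral_def indicator_def mult.assoc[symmetric] mult.commute)
    ultimately show "set_integrable lborel K w"
      unfolding w_def by (intro set_integral_diff)
  next
    fix \<psi> assume \<psi>: "\<psi> \<in> test_functions U"
    define K where "K = closure {x. \<psi> x \<noteq> 0}"
    note F = test_function_facts[OF \<psi>, folded K_def]
    have K: "compact K" "K \<subseteq> U" by (fact F)+
    note [measurable] = \<open>compact K \<Longrightarrow> K \<subseteq> U \<Longrightarrow> S K \<in> sets borel\<close>[OF K]
    have [measurable]: "\<psi> \<in> borel_measurable borel" using F(4) by (simp add: borel_measurable_continuous_onI)
    let ?D = "\<lambda>x. frechet_derivative \<psi> (at x) h"
    have [measurable]: "?D \<in> borel_measurable borel" using F(7) by (simp add: borel_measurable_continuous_onI)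
    obtain M where M: "M \<ge> 0" "\<And>x. \<bar>\<psi> x\<bar> \<le> M"
      using continuous_vanishing_bounded F(1,3,4) by blast
    obtain M' where M': "M' \<ge> 0" "\<And>x. \<bar>?D x\<bar> \<le> M'"
      using continuous_vanishing_bounded[OF F(1) F(7)[of h] F(6)] by blast
    have tr: "(LINT x|lborel. f x * ?D (x - t *\<^sub>R h)) = - (LINT x|lborel. (g (t *\<^sub>R h + x) \<bullet> h) * \<psi> x)"
      if t: "0 \<le> t" "t \<le> 1" for t
    proof -
      note T = test_function_translate[OF \<psi>, of "t *\<^sub>R h" \<Omega>, OF seg[OF _ t]]
      have "(LINT x|lborel. f x * ?D (x - t *\<^sub>R h)) = - (LINT x|lborel. (g x \<bullet> h) * \<psi> (x - t *\<^sub>R h))"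
        using has_weak_gradientD[OF wg f g T(1), of h] by (simp add: T(2))
      also have "(LINT x|lborel. (g x \<bullet> h) * \<psi> (x - t *\<^sub>R h)) = (LINT x|lborel. (g (t *\<^sub>R h + x) \<bullet> h) * \<psi> x)"
        using integral_lborel_translate[of "\<lambda>x. (g x \<bullet> h) * \<psi> (x - t *\<^sub>R h)" "t *\<^sub>R h"] by simp
      finally show ?thesis .
    qed
    \<comment> \<open>The fundamental theorem of calculus is applied to the test function alone,
      where it holds at every point.\<close>
    have ftc: "(LINT t:{0..1}|lborel. ?D (x - t *\<^sub>R h)) = \<psi> x - \<psi> (x - h)" for x
    proof -
      have "((\<lambda>t. \<psi> (x - t *\<^sub>R h)) has_vector_derivative - ?D (x - t *\<^sub>R h)) (at t within {0..1})" for t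
      proof -
        have "((\<lambda>t. x - t *\<^sub>R h) has_vector_derivative - h) (at t within {0..1})"
          by (auto intro!: derivative_eq_intros)
        from vector_derivative_diff_chain_within[OF this has_derivative_at_withinI[OF F(5)]]
        show ?thesis using has_derivative_linear[OF F(5)[of "x - t *\<^sub>R h"]]
          by (simp add: o_def linear_neg)
      qed
      moreover have "continuous_on {0..1} (\<lambda>t. - ?D (x - t *\<^sub>R h))"
        by (intro continuous_intros continuous_on_compose2[OF F(7)]) auto
      ultimately have "(LBINT t. indicator {0..1} t *\<^sub>R - ?D (x - t *\<^sub>R h)) = \<psi> (x - 1 *\<^sub>R h) - \<psi> (x - 0 *\<^sub>R h)"
        by (intro integral_FTC_atLeastAtMost) auto
      then show ?thesis by (simp add: set_lebesgue_integral_def)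
    qed
    have i1: "integrable lborel (\<lambda>x. f x * \<psi> x)"
    proof (rule integrable_mult_continuous_vanishing[OF f SfI[OF K] S(1)[OF K] F(4)])
      fix x assume "x \<notin> S K" then show "\<psi> x = 0" using F(3) SI[of x K 0] by auto
    qed
    have i2: "integrable lborel (\<lambda>x. f x * \<psi> (x - h))"
    proof (rule integrable_mult_continuous_vanishing[OF f SfI[OF K] S(1)[OF K]])
      show "continuous_on UNIV (\<lambda>x. \<psi> (x - h))" by (intro continuous_on_compose2[OF F(4)] continuous_intros) auto
      fix x assume "x \<notin> S K" then show "\<psi> (x - h) = 0" using F(3) SI[of "x - h" K 1] by auto
    qed
    have i2': "integrable lborel (\<lambda>x. f (h + x) * \<psi> x)"
      using i2 integrable_lborel_translate[of "\<lambda>x. f x * \<psi> (x - h)" h] by simp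
    note G\<psi> = G[where \<phi> = \<psi>, OF K M F(3)]
    have fub: "(LINT t:{0..1}|lborel. (LINT x|lborel. f x * ?D (x - t *\<^sub>R h)))
        = (LINT x|lborel. (LINT t:{0..1}|lborel. f x * ?D (x - t *\<^sub>R h)))"
    proof (rule Fubini_unit_interval(1)[where C = "ennreal M' * (\<integral>\<^sup>+x\<in>S K. ennreal \<bar>f x\<bar> \<partial>lborel)"])
      show "ennreal M' * (\<integral>\<^sup>+x\<in>S K. ennreal \<bar>f x\<bar> \<partial>lborel) < \<infinity>"
        using set_integrable_imp_nn_finite[OF SfI[OF K]] by (simp add: ennreal_mult_less_top)
      fix t :: real assume t: "0 \<le> t" "t \<le> 1"
      show "(\<integral>\<^sup>+x. ennreal \<bar>f x * ?D (x - t *\<^sub>R h)\<bar> \<partial>lborel) \<le> ennreal M' * (\<integral>\<^sup>+x\<in>S K. ennreal \<bar>f x\<bar> \<partial>lborel)"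
      proof (rule nn_integral_mult_bounded_le)
        fix x assume "x \<notin> S K"
        then show "?D (x - t *\<^sub>R h) = 0" using F(6) SI[of "x - t *\<^sub>R h" K t] t by auto
      qed (use M' in auto)
    qed measurable
    have "(LINT x|lborel. f (h + x) * \<psi> x) = (LINT x|lborel. f x * \<psi> (x - h))"
      using integral_lborel_translate[of "\<lambda>x. f x * \<psi> (x - h)" h] by simp
    then have "(LINT x|lborel. (f (h + x) - f x) * \<psi> x) = - (LINT x|lborel. f x * (\<psi> x - \<psi> (x - h)))"
      using i1 i2 i2' by (simp add: algebra_simps)
    also have "\<dots> = - (LINT x|lborel. (LINT t:{0..1}|lborel. f x * ?D (x - t *\<^sub>R h)))"
      by (simp add: ftc[symmetric])
    also have "\<dots> = - (LINT t:{0..1}|lborel. (LINT x|lborel. f x * ?D (x - t *\<^sub>R h)))"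
      by (simp add: fub)
    also have "\<dots> = - (LINT t:{0..1}|lborel. - (LINT x|lborel. (g (t *\<^sub>R h + x) \<bullet> h) * \<psi> x))"
      using tr by (intro arg_cong[where f = uminus] set_lebesgue_integral_cong) auto
    also have "\<dots> = (LINT x|lborel. (LINT t:{0..1}|lborel. g (t *\<^sub>R h + x) \<bullet> h) * \<psi> x)"
      using G\<psi>(1) by (simp add: set_lebesgue_integral_def)
    finally have "(LINT x|lborel. (f (h + x) - f x) * \<psi> x) = (LINT x|lborel. (LINT t:{0..1}|lborel. g (t *\<^sub>R h + x) \<bullet> h) * \<psi> x)" .
    moreover have "integrable lborel (\<lambda>x. (f (h + x) - f x) * \<psi> x)"
      using i1 i2' by (simp add: algebra_simps)
    ultimately show "(LINT x|lborel. w x * \<psi> x) = 0"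
      using G\<psi>(2) by (simp add: w_def left_diff_distrib[of "f (h + _) - f _"])
  qed
  then show ?thesis by (auto simp: w_def elim!: eventually_mono)
qed

text \<open>Rearranged: the graph of t^p lies above its tangent at \<open>x\<close>. In this
  normalization it yields both Jensen's inequality and the weighted Young inequality.\<close>

lemma Young_powr_diff:
  fixes x y p :: real
  assumes "1 < p" "0 \<le> x" "0 \<le> y"
  shows "p * x powr (p - 1) * y \<le> (p - 1) * x powr p + y powr p"
proof -
  have "y * x powr (p - 1) \<le> y powr p / p + (x powr (p - 1)) powr (p / (p - 1)) / (p / (p - 1))"
    using assms by (intro Youngs_inequality) (auto simp: field_simps)
  also have "(x powr (p - 1)) powr (p / (p - 1)) = x powr p"
    using assms by (simp add: powr_powr)
  finally show ?thesis using assms by (simp add: field_simps)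
qed

text \<open>The interval has length 1, so \<open>c\<close> is its own mean. If \<phi> is not
  integrable, the integral on the left is 0 by convention, but then neither is \<phi> - c integrable
  and the right side is infinite.\<close>

lemma set_integral_le_nn_integral:
  fixes \<phi> :: "real \<Rightarrow> real"
  assumes [measurable]: "\<phi> \<in> borel_measurable borel"
  shows "ennreal \<bar>(LINT t:{0..1}|lborel. \<phi> t) - c\<bar> \<le> (\<integral>\<^sup>+t\<in>{0..1}. ennreal \<bar>\<phi> t - c\<bar> \<partial>lborel)"
proof (cases "set_integrable lborel {0..1} \<phi>")
  case True
  then have *: "integrable lborel (\<lambda>t. indicator {0..1} t *\<^sub>R (\<phi> t - c))"
    by (simp add: set_integrable_def right_diff_distrib)
  have "(LINT t:{0..1}|lborel. \<phi> t) - c = (LINT t|lborel. indicator {0..1} t *\<^sub>R (\<phi> t - c))"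
    using True by (simp add: set_integrable_def right_diff_distrib set_lebesgue_integral_def)
  then have "ennreal \<bar>(LINT t:{0..1}|lborel. \<phi> t) - c\<bar> \<le> (\<integral>\<^sup>+t. norm (indicator {0..1} t *\<^sub>R (\<phi> t - c)) \<partial>lborel)"
    using integral_norm_bound_ennreal[OF *] by simp
  also have "\<dots> = (\<integral>\<^sup>+t\<in>{0..1}. ennreal \<bar>\<phi> t - c\<bar> \<partial>lborel)"
    by (intro nn_integral_cong) (auto simp: indicator_def)
  finally show ?thesis .
next
  case False
  have "(\<integral>\<^sup>+t\<in>{0..1}. ennreal \<bar>\<phi> t - c\<bar> \<partial>lborel) = \<infinity>"
  proof (rule ccontr)
    assume "(\<integral>\<^sup>+t\<in>{0..1}. ennreal \<bar>\<phi> t - c\<bar> \<partial>lborel) \<noteq> \<infinity>"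
    then have fin: "(\<integral>\<^sup>+t\<in>{0..1}. ennreal \<bar>\<phi> t - c\<bar> \<partial>lborel) < \<infinity>" by (simp add: less_top)
    have "(\<integral>\<^sup>+t. ennreal (norm (indicator {0..1} t *\<^sub>R \<phi> t)) \<partial>lborel)
      \<le> (\<integral>\<^sup>+t. (ennreal \<bar>\<phi> t - c\<bar> * indicator {0..1} t + ennreal \<bar>c\<bar> * indicator {0..1} t) \<partial>lborel)"
      by (intro nn_integral_mono) (auto simp: indicator_def simp flip: ennreal_plus intro!: ennreal_leI)
    also have "\<dots> < \<infinity>" using fin by (simp add: nn_integral_add nn_integral_cmult)
    finally show False using False by (simp add: set_integrable_def integrable_iff_bounded)
  qed
  then show ?thesis by simp
qed

text \<open>Jensen's inequality, by integrating the tangent bound at the mean \<open>m\<close> of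
  the absolute value. The term (p - 1) m^p is carried on both sides and cancelled, being finite. In
  the non-integrable case the left side is 0.\<close>

lemma set_integral_powr_le:
  fixes \<phi> :: "real \<Rightarrow> real"
  assumes p: "1 < p" and [measurable]: "\<phi> \<in> borel_measurable borel"
  shows "ennreal (\<bar>LINT t:{0..1}|lborel. \<phi> t\<bar> powr p) \<le> (\<integral>\<^sup>+t\<in>{0..1}. ennreal (\<bar>\<phi> t\<bar> powr p) \<partial>lborel)"
proof (cases "set_integrable lborel {0..1} \<phi>")
  case True
  define m where "m = (LINT t:{0..1}|lborel. \<bar>\<phi> t\<bar>)"
  have m0: "0 \<le> m" by (simp add: m_def set_lebesgue_integral_def)
  have le: "\<bar>LINT t:{0..1}|lborel. \<phi> t\<bar> \<le> m"
    using set_integral_norm_bound[OF True] by (simp add: m_def)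
  have "set_integrable lborel {0..1} (\<lambda>t. \<bar>\<phi> t\<bar>)" using True by (rule set_integrable_abs)
  then have em: "(\<integral>\<^sup>+t\<in>{0..1}. ennreal \<bar>\<phi> t\<bar> \<partial>lborel) = ennreal m"
    unfolding m_def set_lebesgue_integral_def set_integrable_def
    by (subst nn_integral_eq_integral[symmetric]) (auto intro!: nn_integral_cong simp: indicator_def)
  have "ennreal (m powr p) + ennreal ((p - 1) * m powr p)
      = ennreal (p * m powr (p - 1)) * ennreal m"
    using m0 p by (cases "m = 0") (auto simp flip: ennreal_plus ennreal_mult simp: powr_mult_base[symmetric] algebra_simps powr_diff)
  also have "\<dots> = (\<integral>\<^sup>+t. ennreal (p * m powr (p - 1)) * (ennreal \<bar>\<phi> t\<bar> * indicator {0..1} t) \<partial>lborel)"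
    by (simp add: nn_integral_cmult em)
  also have "\<dots> \<le> (\<integral>\<^sup>+t. ennreal (\<bar>\<phi> t\<bar> powr p) * indicator {0..1} t + ennreal ((p - 1) * m powr p) * indicator {0..1} t \<partial>lborel)"
  proof (intro nn_integral_mono)
    fix t
    have "p * m powr (p - 1) * \<bar>\<phi> t\<bar> \<le> \<bar>\<phi> t\<bar> powr p + (p - 1) * m powr p"
      using Young_powr_diff[OF p m0, of "\<bar>\<phi> t\<bar>"] by simp
    then have "ennreal (p * m powr (p - 1)) * ennreal \<bar>\<phi> t\<bar> \<le> ennreal (\<bar>\<phi> t\<bar> powr p) + ennreal ((p - 1) * m powr p)"
      using p by (simp flip: ennreal_plus ennreal_mult add: ennreal_leI)
    then show "ennreal (p * m powr (p - 1)) * (ennreal \<bar>\<phi> t\<bar> * indicator {0..1} t)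
      \<le> ennreal (\<bar>\<phi> t\<bar> powr p) * indicator {0..1} t + ennreal ((p - 1) * m powr p) * indicator {0..1} t"
      by (auto simp: indicator_def)
  qed
  also have "\<dots> = (\<integral>\<^sup>+t\<in>{0..1}. ennreal (\<bar>\<phi> t\<bar> powr p) \<partial>lborel) + ennreal ((p - 1) * m powr p)"
    by (simp add: nn_integral_add nn_integral_cmult)
  finally have "ennreal (m powr p) \<le> (\<integral>\<^sup>+t\<in>{0..1}. ennreal (\<bar>\<phi> t\<bar> powr p) \<partial>lborel)"
    by (simp add: add.commute ennreal_add_left_cancel_le)
  moreover have "\<bar>LINT t:{0..1}|lborel. \<phi> t\<bar> powr p \<le> m powr p"
    using le p by (intro powr_mono2) auto
  ultimately show ?thesis by (meson ennreal_leI order_trans)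
next
  case False
  then have "(LINT t:{0..1}|lborel. \<phi> t) = 0"
    by (simp add: set_lebesgue_integral_def set_integrable_def not_integrable_integral_eq)
  then show ?thesis using p by simp
qed

lemma AE_lborel_translate:
  fixes a :: "'a::euclidean_space"
  assumes "AE x in lborel. P x" shows "AE x in lborel. P (a + x)"
proof -
  have "AE x in distr lborel borel ((+) a). P x" using assms by (simp only: lborel_distr_plus)
  then show ?thesis by (rule AE_distrD[rotated]) simp
qed

text \<open>Jensen moves the power inside the line integral and Cauchy-Schwarz extracts |h|^p. After
  exchanging the integrals, each shift of \<open>U\<close> by t h lies in \<open>V\<close>, so the
  bound does not depend on t.\<close>

lemma Lp_difference_le:
  fixes f :: "'a::euclidean_space \<Rightarrow> real"
  assumes p: "1 < p" and U: "open U" and f[measurable]: "f \<in> borel_measurable borel" and g[measurable]: "g \<in> borel_measurable borel"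
    and wg: "has_weak_gradient f g \<Omega>" and [measurable]: "V \<in> sets borel" and V: "V \<subseteq> \<Omega>"
    and seg: "\<And>x t. x \<in> U \<Longrightarrow> 0 \<le> t \<Longrightarrow> t \<le> 1 \<Longrightarrow> t *\<^sub>R h + x \<in> V"
  shows "(\<integral>\<^sup>+x\<in>U. ennreal (\<bar>f (h + x) - f x\<bar> powr p) \<partial>lborel)
    \<le> ennreal (norm h powr p) * (\<integral>\<^sup>+x\<in>V. ennreal (norm (g x) powr p) \<partial>lborel)"
proof -
  have [measurable]: "U \<in> sets borel" using U by simp
  have "AE x in lborel. x \<in> U \<longrightarrow> f (h + x) - f x = (LINT t:{0..1}|lborel. g (t *\<^sub>R h + x) \<bullet> h)"
    using seg V by (intro weak_gradient_difference[OF U f g wg]) auto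
  then have "(\<integral>\<^sup>+x\<in>U. ennreal (\<bar>f (h + x) - f x\<bar> powr p) \<partial>lborel)
    \<le> (\<integral>\<^sup>+x. \<integral>\<^sup>+t. ennreal (norm h powr p) * (ennreal (norm (g (t *\<^sub>R h + x)) powr p) * indicator U x * indicator {0..1} t) \<partial>lborel \<partial>lborel)"
  proof (intro nn_integral_mono_AE, eventually_elim)
    case (elim x)
    have "ennreal (\<bar>LINT t:{0..1}|lborel. g (t *\<^sub>R h + x) \<bullet> h\<bar> powr p)
      \<le> (\<integral>\<^sup>+t\<in>{0..1}. ennreal (\<bar>g (t *\<^sub>R h + x) \<bullet> h\<bar> powr p) \<partial>lborel)"
      by (intro set_integral_powr_le[OF p]) auto
    also have "\<dots> \<le> (\<integral>\<^sup>+t. ennreal (norm h powr p) * (ennreal (norm (g (t *\<^sub>R h + x)) powr p) * indicator {0..1} t) \<partial>lborel)"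
    proof (intro nn_integral_mono)
      fix t :: real
      have "\<bar>g (t *\<^sub>R h + x) \<bullet> h\<bar> powr p \<le> (norm (g (t *\<^sub>R h + x)) * norm h) powr p"
        using p by (intro powr_mono2 Cauchy_Schwarz_ineq2) auto
      also have "\<dots> = norm h powr p * norm (g (t *\<^sub>R h + x)) powr p" by (simp add: powr_mult mult.commute)
      finally show "ennreal (\<bar>g (t *\<^sub>R h + x) \<bullet> h\<bar> powr p) * indicator {0..1} t
        \<le> ennreal (norm h powr p) * (ennreal (norm (g (t *\<^sub>R h + x)) powr p) * indicator {0..1} t)"
        by (auto simp: indicator_def simp flip: ennreal_mult intro!: ennreal_leI)
    qed
    finally show ?case using elim by (auto simp: indicator_def)
  qed
  also have "\<dots> = (\<integral>\<^sup>+t. \<integral>\<^sup>+x. ennreal (norm h powr p) * (ennreal (norm (g (t *\<^sub>R h + x)) powr p) * indicator U x * indicator {0..1} t) \<partial>lborel \<partial>lborel)"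
    by (rule lborel_pair.Fubini') measurable
  also have "\<dots> \<le> (\<integral>\<^sup>+t. ennreal (norm h powr p) * (\<integral>\<^sup>+x\<in>V. ennreal (norm (g x) powr p) \<partial>lborel) * indicator {0..1::real} t \<partial>lborel)"
  proof (intro nn_integral_mono)
    fix t :: real
    have "(\<integral>\<^sup>+x. ennreal (norm h powr p) * (ennreal (norm (g (t *\<^sub>R h + x)) powr p) * indicator U x * indicator {0..1} t) \<partial>lborel)
      \<le> (\<integral>\<^sup>+x. ennreal (norm h powr p) * (ennreal (norm (g (t *\<^sub>R h + x)) powr p) * indicator V (t *\<^sub>R h + x)) * indicator {0..1} t \<partial>lborel)"
      using seg by (intro nn_integral_mono) (auto simp: indicator_def)
    also have "\<dots> = ennreal (norm h powr p) * (\<integral>\<^sup>+x. ennreal (norm (g (t *\<^sub>R h + x)) powr p) * indicator V (t *\<^sub>R h + x) \<partial>lborel) * indicator {0..1} t"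
      by (simp add: nn_integral_cmult nn_integral_multc)
    also have "(\<integral>\<^sup>+x. ennreal (norm (g (t *\<^sub>R h + x)) powr p) * indicator V (t *\<^sub>R h + x) \<partial>lborel)
      = (\<integral>\<^sup>+x\<in>V. ennreal (norm (g x) powr p) \<partial>lborel)"
      by (rule nn_integral_lborel_translate[where f = "\<lambda>x. ennreal (norm (g x) powr p) * indicator V x"]) measurable
    finally show "(\<integral>\<^sup>+x. ennreal (norm h powr p) * (ennreal (norm (g (t *\<^sub>R h + x)) powr p) * indicator U x * indicator {0..1} t) \<partial>lborel)
      \<le> ennreal (norm h powr p) * (\<integral>\<^sup>+x\<in>V. ennreal (norm (g x) powr p) \<partial>lborel) * indicator {0..1::real} t" .
  qed
  also have "\<dots> = ennreal (norm h powr p) * (\<integral>\<^sup>+x\<in>V. ennreal (norm (g x) powr p) \<partial>lborel)"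
    by (simp add: nn_integral_cmult)
  finally show ?thesis .
qed

section \<open>Weak gradients as limits of difference quotients\<close>

lemma compact_enlarge:
  fixes K :: "'a::euclidean_space set"
  assumes "compact K" "open \<Omega>" "K \<subseteq> \<Omega>"
  obtains e L where "e > 0" "compact L" "L \<subseteq> \<Omega>" "\<And>x y. x \<in> K \<Longrightarrow> norm y \<le> e \<Longrightarrow> y + x \<in> L"
proof -
  obtain e where e: "e > 0" "(\<Union>x\<in>K. cball x e) \<subseteq> \<Omega>"
    using compact_subset_open_imp_cball_epsilon_subset[OF assms] .
  let ?L = "{x + y |x y. x \<in> K \<and> y \<in> cball 0 e}"
  have "compact ?L" using assms(1) by (intro compact_sums) auto
  moreover have "?L \<subseteq> \<Omega>" using e(2) by (auto simp: subset_eq dist_norm)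
  ultimately show ?thesis using e(1) that[of e ?L] by (force simp: add.commute)
qed

text \<open>By the line-integral identity, quotient minus gradient is the mean over t of the
  increments of \<open>g\<close> . b along the segment. Cutting \<open>g\<close> off to a compact
  neighbourhood makes it integrable, and continuity of translations bounds every such
  increment.\<close>

lemma difference_quotient_tendsto:
  fixes f :: "'a::euclidean_space \<Rightarrow> real"
  assumes \<Omega>: "open \<Omega>" and f[measurable]: "f \<in> borel_measurable borel" and g[measurable]: "g \<in> borel_measurable borel"
    and wg: "has_weak_gradient f g \<Omega>" and K: "compact K" "K \<subseteq> \<Omega>"
  shows "((\<lambda>\<epsilon>. \<integral>\<^sup>+x\<in>K. ennreal \<bar>(f (\<epsilon> *\<^sub>R b + x) - f x) / \<epsilon> - g x \<bullet> b\<bar> \<partial>lborel) \<longlongrightarrow> 0) (at_right 0)"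
proof -
  obtain e1 L where L: "e1 > 0" "compact L" "L \<subseteq> \<Omega>" "\<And>x y. x \<in> K \<Longrightarrow> norm y \<le> e1 \<Longrightarrow> y + x \<in> L"
    using compact_enlarge[OF K(1) \<Omega> K(2)] by metis
  \<comment> \<open>The line-integral identity is proved on open sets, so \<open>K\<close> is first
    replaced by an open neighbourhood that still has room inside \<open>L\<close>.\<close>
  define U where "U = (\<Union>x\<in>K. ball x (e1/2))"
  have U: "open U" "K \<subseteq> U" using L(1) by (auto simp: U_def)
  have UL: "y + x \<in> L" if "x \<in> U" "norm y \<le> e1/2" for x y
  proof -
    obtain z where z: "z \<in> K" "dist z x < e1/2" using \<open>x \<in> U\<close> by (auto simp: U_def)
    have "norm (y + (x - z)) \<le> e1"
      using norm_triangle_ineq[of y "x - z"] that(2) z(2) by (simp add: dist_norm norm_minus_commute)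
    from L(4)[OF z(1) this] show ?thesis by simp
  qed
  have [measurable]: "K \<in> sets borel" "L \<in> sets borel" using K L by (auto simp: borel_compact)
  define G where "G x = indicator L x * (g x \<bullet> b)" for x
  have [measurable]: "G \<in> borel_measurable borel" unfolding G_def by measurable
  have "set_integrable lborel L g" using wg L by (auto simp: has_weak_gradient_def Lp_loc_1_iff)
  then have G: "integrable lborel G"
    using integrable_inner_left[of b lborel "\<lambda>x. indicator L x *\<^sub>R g x"] by (simp add: set_integrable_def G_def[abs_def])
  show ?thesis
  proof (rule order_tendstoI)
    fix c :: ennreal assume "0 < c"
    obtain c' where c': "0 < c'" "ennreal c' < c"
    proof (cases c)
      case (real r)
      then show thesis using \<open>0 < c\<close> that[of "r / 2"] by (auto simp: ennreal_less_iff)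
    qed (use that[of 1] in auto)
    obtain \<delta> where \<delta>: "\<delta> > 0" "\<And>h. norm h < \<delta> \<Longrightarrow> (\<integral>\<^sup>+x. ennreal \<bar>G (h + x) - G x\<bar> \<partial>lborel) \<le> ennreal c'"
      using nn_integral_translation_continuous[OF G c'(1)] by blast
    \<comment> \<open>For \<epsilon> below this value the shift \<epsilon> b stays within both
      admissible lengths; the added 1 in the denominator covers b = 0.\<close>
    define \<delta>' where "\<delta>' = min (e1/2) (\<delta>/2) / (norm b + 1)"
    have \<delta>': "\<delta>' > 0" using L(1) \<delta>(1) by (auto simp: \<delta>'_def intro!: divide_pos_pos add_nonneg_pos)
    have "(\<integral>\<^sup>+x\<in>K. ennreal \<bar>(f (\<epsilon> *\<^sub>R b + x) - f x) / \<epsilon> - g x \<bullet> b\<bar> \<partial>lborel) < c"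
      if \<epsilon>: "0 < \<epsilon>" "\<epsilon> < \<delta>'" for \<epsilon>
    proof -
      have "norm (\<epsilon> *\<^sub>R b) \<le> \<delta>' * (norm b + 1)" using \<epsilon> by (auto intro!: mult_mono)
      also have "\<dots> = min (e1/2) (\<delta>/2)" by (simp add: \<delta>'_def add_nonneg_eq_0_iff)
      finally have nb: "norm (\<epsilon> *\<^sub>R b) \<le> e1/2" "norm (\<epsilon> *\<^sub>R b) < \<delta>" using \<delta>(1) by auto
      have nt: "norm (t *\<^sub>R \<epsilon> *\<^sub>R b) \<le> norm (\<epsilon> *\<^sub>R b)" if "0 \<le> t" "t \<le> 1" for t
        using that by (auto simp: abs_mult intro!: mult_right_mono mult_left_le_one_le)
      have inL: "t *\<^sub>R \<epsilon> *\<^sub>R b + x \<in> L" if "x \<in> U" "0 \<le> t" "t \<le> 1" for x t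
        using UL[OF that(1)] nt[OF that(2,3)] nb(1) order_trans by blast
      have "AE x in lborel. x \<in> U \<longrightarrow> f (\<epsilon> *\<^sub>R b + x) - f x = (LINT t:{0..1}|lborel. g (t *\<^sub>R \<epsilon> *\<^sub>R b + x) \<bullet> (\<epsilon> *\<^sub>R b))"
        using inL L(3) by (intro weak_gradient_difference[OF U(1) f g wg]) auto
      then have "(\<integral>\<^sup>+x\<in>K. ennreal \<bar>(f (\<epsilon> *\<^sub>R b + x) - f x) / \<epsilon> - g x \<bullet> b\<bar> \<partial>lborel)
        \<le> (\<integral>\<^sup>+x. \<integral>\<^sup>+t. ennreal \<bar>G (t *\<^sub>R \<epsilon> *\<^sub>R b + x) - G x\<bar> * indicator {0..1} t \<partial>lborel \<partial>lborel)"
      proof (intro nn_integral_mono_AE, eventually_elim)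
        case (elim x)
        show ?case
        proof (cases "x \<in> K")
          case True
          with U have xU: "x \<in> U" by auto
          have "f (\<epsilon> *\<^sub>R b + x) - f x = (LINT t:{0..1}|lborel. \<epsilon> * G (t *\<^sub>R \<epsilon> *\<^sub>R b + x))"
          proof -
            have "f (\<epsilon> *\<^sub>R b + x) - f x = (LINT t:{0..1}|lborel. g (t *\<^sub>R \<epsilon> *\<^sub>R b + x) \<bullet> (\<epsilon> *\<^sub>R b))"
              using elim xU by blast
            also have "\<dots> = (LINT t:{0..1}|lborel. \<epsilon> * G (t *\<^sub>R \<epsilon> *\<^sub>R b + x))"
              using inL[OF xU] by (intro set_lebesgue_integral_cong) (auto simp: G_def)
            finally show ?thesis .
          qed
          then have "(f (\<epsilon> *\<^sub>R b + x) - f x) / \<epsilon> = (LINT t:{0..1}|lborel. G (t *\<^sub>R \<epsilon> *\<^sub>R b + x))"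
            using \<epsilon> by simp
          moreover have "g x \<bullet> b = G x" using UL[OF xU, of 0] L(1) by (simp add: G_def)
          ultimately show ?thesis
            using set_integral_le_nn_integral[of "\<lambda>t. G (t *\<^sub>R \<epsilon> *\<^sub>R b + x)" "G x"] True by simp
        qed simp
      qed
      also have "\<dots> = (\<integral>\<^sup>+t. \<integral>\<^sup>+x. ennreal \<bar>G (t *\<^sub>R \<epsilon> *\<^sub>R b + x) - G x\<bar> * indicator {0..1} t \<partial>lborel \<partial>lborel)"
        by (rule lborel_pair.Fubini') measurable
      also have "\<dots> \<le> (\<integral>\<^sup>+t. ennreal c' * indicator {0..1::real} t \<partial>lborel)"
      proof (intro nn_integral_mono)
        fix t :: real
        have "(\<integral>\<^sup>+x. ennreal \<bar>G (t *\<^sub>R \<epsilon> *\<^sub>R b + x) - G x\<bar> \<partial>lborel) \<le> ennreal c'" if "0 \<le> t" "t \<le> 1"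
          using nt[OF that] nb(2) by (intro \<delta>(2)) simp
        then show "(\<integral>\<^sup>+x. ennreal \<bar>G (t *\<^sub>R \<epsilon> *\<^sub>R b + x) - G x\<bar> * indicator {0..1} t \<partial>lborel) \<le> ennreal c' * indicator {0..1::real} t"
          by (auto simp: indicator_def)
      qed
      also have "\<dots> = ennreal c'" by (simp add: nn_integral_cmult)
      finally show ?thesis using c'(2) by simp
    qed
    then show "eventually (\<lambda>\<epsilon>. (\<integral>\<^sup>+x\<in>K. ennreal \<bar>(f (\<epsilon> *\<^sub>R b + x) - f x) / \<epsilon> - g x \<bullet> b\<bar> \<partial>lborel) < c) (at_right 0)"
      using \<delta>' by (auto simp: eventually_at_right_field)
  qed simp
qed

text \<open>Discrete integration by parts: a shift moves the difference quotient from
  \<open>f\<close> to the test function, and both sides have limits. Only some sequence \<epsilon>,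
  depending on \<open>K\<close> and \<open>b\<close>, is asked for, because the chain rule produces
  one by extracting an almost everywhere convergent subsequence.\<close>

lemma has_weak_gradientI:
  fixes f :: "'a::euclidean_space \<Rightarrow> real"
  assumes \<Omega>: "open \<Omega>" and f[measurable]: "f \<in> borel_measurable borel" and g[measurable]: "g \<in> borel_measurable borel"
    and fL: "f \<in> Lp_loc 1 \<Omega>" and gL: "g \<in> Lp_loc 1 \<Omega>"
    and lim: "\<And>K b. compact K \<Longrightarrow> K \<subseteq> \<Omega> \<Longrightarrow> b \<in> Basis \<Longrightarrow> \<exists>\<epsilon>. filterlim \<epsilon> (at_right 0) sequentially \<and>
      (\<lambda>n. \<integral>\<^sup>+x\<in>K. ennreal \<bar>(f (\<epsilon> n *\<^sub>R b + x) - f x) / \<epsilon> n - g x \<bullet> b\<bar> \<partial>lborel) \<longlonglongrightarrow> 0"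
  shows "has_weak_gradient f g \<Omega>"
  unfolding has_weak_gradient_def
proof (intro conjI ballI fL gL)
  fix \<psi> b assume \<psi>: "\<psi> \<in> test_functions \<Omega>" and b: "(b::'a) \<in> Basis"
  define K where "K = closure {x. \<psi> x \<noteq> 0}"
  note F = test_function_facts[OF \<psi>, folded K_def]
  let ?D = "\<lambda>x. frechet_derivative \<psi> (at x) b"
  obtain e L where L: "e > 0" "compact L" "L \<subseteq> \<Omega>" "\<And>x y. x \<in> K \<Longrightarrow> norm y \<le> e \<Longrightarrow> y + x \<in> L"
    using compact_enlarge[OF F(1) \<Omega> F(2)] by metis
  have KL: "K \<subseteq> L" using L(1) L(4)[of _ 0] by auto
  have [measurable]: "L \<in> sets borel" "K \<in> sets borel" "\<psi> \<in> borel_measurable borel" "?D \<in> borel_measurable borel"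
    using L(2) F(1,4,7) by (auto simp: borel_compact borel_measurable_continuous_onI)
  obtain \<epsilon> where \<epsilon>: "filterlim \<epsilon> (at_right 0) sequentially"
    and lim: "(\<lambda>n. \<integral>\<^sup>+x\<in>L. ennreal \<bar>(f (\<epsilon> n *\<^sub>R b + x) - f x) / \<epsilon> n - g x \<bullet> b\<bar> \<partial>lborel) \<longlonglongrightarrow> 0"
    using lim[OF L(2,3) b] by blast
  have \<epsilon>0: "\<epsilon> \<longlonglongrightarrow> 0" using \<epsilon> by (auto simp: filterlim_at)
  have "eventually (\<lambda>n. 0 < \<epsilon> n) sequentially" using \<epsilon> by (auto simp: filterlim_at elim: eventually_mono)
  moreover have "eventually (\<lambda>n. \<epsilon> n < e) sequentially" using \<epsilon>0 L(1) by (rule order_tendstoD)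
  ultimately have ev: "eventually (\<lambda>n. 0 < \<epsilon> n \<and> \<epsilon> n < e) sequentially" by eventually_elim simp
  obtain M where M: "M \<ge> 0" "\<And>x. \<bar>\<psi> x\<bar> \<le> M"
    using continuous_vanishing_bounded F(1,3,4) by blast
  obtain M' where M': "M' \<ge> 0" "\<And>x. \<bar>?D x\<bar> \<le> M'"
    using continuous_vanishing_bounded[OF F(1) F(7)[of b] F(6)] by blast
  have fI: "set_integrable lborel L f" using fL L(2,3) by (auto simp: Lp_loc_1_iff)
  have gI: "set_integrable lborel L (\<lambda>x. g x \<bullet> b)"
  proof -
    have "set_integrable lborel L g" using gL L(2,3) by (auto simp: Lp_loc_1_iff)
    then show ?thesis
      using integrable_inner_left[of b lborel "\<lambda>x. indicator L x *\<^sub>R g x"] by (simp add: set_integrable_def)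
  qed
  have nz: "\<psi> x = 0" "?D x = 0" if "x \<notin> L" for x using that KL F(3,6) by auto
  have i1: "integrable lborel (\<lambda>x. f x * \<psi> x)" "integrable lborel (\<lambda>x. (g x \<bullet> b) * \<psi> x)" "integrable lborel (\<lambda>x. f x * ?D x)"
    using fI gI L(2) F(4,7) nz by (auto intro!: integrable_mult_continuous_vanishing[of _ L])
  have i2: "integrable lborel (\<lambda>x. f x * \<psi> (x - \<epsilon> n *\<^sub>R b))" "integrable lborel (\<lambda>x. f (\<epsilon> n *\<^sub>R b + x) * \<psi> x)"
    if n: "0 < \<epsilon> n" "\<epsilon> n < e" for n
  proof -
    show "integrable lborel (\<lambda>x. f x * \<psi> (x - \<epsilon> n *\<^sub>R b))"
    proof (rule integrable_mult_continuous_vanishing[OF f fI L(2)])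
      show "continuous_on UNIV (\<lambda>x. \<psi> (x - \<epsilon> n *\<^sub>R b))" by (intro continuous_on_compose2[OF F(4)] continuous_intros) auto
      fix x assume "x \<notin> L" then show "\<psi> (x - \<epsilon> n *\<^sub>R b) = 0"
        using F(3) L(4)[of "x - \<epsilon> n *\<^sub>R b" "\<epsilon> n *\<^sub>R b"] n b by auto
    qed
    then show "integrable lborel (\<lambda>x. f (\<epsilon> n *\<^sub>R b + x) * \<psi> x)"
      using integrable_lborel_translate[of "\<lambda>x. f x * \<psi> (x - \<epsilon> n *\<^sub>R b)" "\<epsilon> n *\<^sub>R b"] by simp
  qed
  have lim1: "(\<lambda>n. LINT x|lborel. (f (\<epsilon> n *\<^sub>R b + x) - f x) / \<epsilon> n * \<psi> x) \<longlonglongrightarrow> (LINT x|lborel. (g x \<bullet> b) * \<psi> x)"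
  proof (rule tendsto_dist_iff[THEN iffD2], rule real_tendsto_sandwich[where f = "\<lambda>_. 0"])
    let ?d = "\<lambda>n. \<integral>\<^sup>+x\<in>L. ennreal \<bar>(f (\<epsilon> n *\<^sub>R b + x) - f x) / \<epsilon> n - g x \<bullet> b\<bar> \<partial>lborel"
    have "eventually (\<lambda>n. ?d n < ennreal 1) sequentially" using lim by (rule order_tendstoD) simp
    then have fin: "eventually (\<lambda>n. ?d n < \<infinity>) sequentially"
      by eventually_elim (auto intro: less_trans)
    show "eventually (\<lambda>n. dist (LINT x|lborel. (f (\<epsilon> n *\<^sub>R b + x) - f x) / \<epsilon> n * \<psi> x) (LINT x|lborel. (g x \<bullet> b) * \<psi> x)
        \<le> M * enn2real (?d n)) sequentially"
      using ev fin
    proof eventually_elim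
      case (elim n)
      have i3: "integrable lborel (\<lambda>x. (f (\<epsilon> n *\<^sub>R b + x) - f x) / \<epsilon> n * \<psi> x)"
        using i1 i2[of n] elim by (simp add: left_diff_distrib diff_divide_distrib)
      have i4: "integrable lborel (\<lambda>x. ((f (\<epsilon> n *\<^sub>R b + x) - f x) / \<epsilon> n - g x \<bullet> b) * \<psi> x)"
        using i1(2) i3 by (simp add: left_diff_distrib)
      have "dist (LINT x|lborel. (f (\<epsilon> n *\<^sub>R b + x) - f x) / \<epsilon> n * \<psi> x) (LINT x|lborel. (g x \<bullet> b) * \<psi> x)
        = norm (LINT x|lborel. ((f (\<epsilon> n *\<^sub>R b + x) - f x) / \<epsilon> n - g x \<bullet> b) * \<psi> x)"
        using i1(2) i3 by (simp add: left_diff_distrib dist_norm)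
      also have "ennreal \<dots> \<le> (\<integral>\<^sup>+x. ennreal \<bar>((f (\<epsilon> n *\<^sub>R b + x) - f x) / \<epsilon> n - g x \<bullet> b) * \<psi> x\<bar> \<partial>lborel)"
        using integral_norm_bound_ennreal[OF i4] by simp
      also have "\<dots> \<le> ennreal M * ?d n"
        by (rule nn_integral_mult_bounded_le) (use M nz in auto)
      also have "\<dots> = ennreal (M * enn2real (?d n))"
        using elim(2) M(1) by (simp add: ennreal_mult)
      finally show ?case using M(1) by (simp add: ennreal_le_iff)
    qed
    have "(\<lambda>n. enn2real (?d n)) \<longlonglongrightarrow> 0"
      using lim by (intro tendsto_enn2real) auto
    from tendsto_mult[OF tendsto_const this, of M] show "(\<lambda>n. M * enn2real (?d n)) \<longlonglongrightarrow> 0" by simp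
  qed auto
  have lim2: "(\<lambda>n. LINT x|lborel. f x * ((\<psi> (x - \<epsilon> n *\<^sub>R b) - \<psi> x) / \<epsilon> n)) \<longlonglongrightarrow> (LINT x|lborel. f x * - ?D x)"
  proof -
    \<comment> \<open>Setting the quotient to 0 for the finitely many n with \<epsilon> n out of
      range lets one dominating function serve for all n.\<close>
    define q where "q n x = (if 0 < \<epsilon> n \<and> \<epsilon> n < e then f x * ((\<psi> (x - \<epsilon> n *\<^sub>R b) - \<psi> x) / \<epsilon> n) else 0)" for n x
    have "(\<lambda>n. LINT x|lborel. q n x) \<longlonglongrightarrow> (LINT x|lborel. f x * - ?D x)"
    proof (rule integral_dominated_convergence)
      show "(\<lambda>x. q n x) \<in> borel_measurable lborel" for n unfolding q_def by measurable
      have "set_integrable lborel L (\<lambda>x. \<bar>f x\<bar> * M')" using set_integrable_abs[OF fI] by simp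
      then show "integrable lborel (\<lambda>x. indicator L x *\<^sub>R (\<bar>f x\<bar> * M'))" by (simp add: set_integrable_def)
      have D: "((\<lambda>t. \<psi> (x - t *\<^sub>R b)) has_real_derivative - ?D (x - t *\<^sub>R b)) (at t within X)" for x t X
      proof -
        have "((\<lambda>t. x - t *\<^sub>R b) has_vector_derivative - b) (at t within X)"
          by (auto intro!: derivative_eq_intros)
        from vector_derivative_diff_chain_within[OF this has_derivative_at_withinI[OF F(5)]]
        show ?thesis using has_derivative_linear[OF F(5)[of "x - t *\<^sub>R b"]]
          by (simp add: o_def linear_neg has_real_derivative_iff_has_vector_derivative)
      qed
      show "AE x in lborel. norm (q n x) \<le> indicator L x *\<^sub>R (\<bar>f x\<bar> * M')" for n
      proof (intro AE_I2)
        fix x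
        show "norm (q n x) \<le> indicator L x *\<^sub>R (\<bar>f x\<bar> * M')"
        proof (cases "0 < \<epsilon> n \<and> \<epsilon> n < e")
          case True
          show ?thesis
          proof (cases "x \<in> L")
            assume "x \<in> L"
            obtain z where z: "\<psi> (x - \<epsilon> n *\<^sub>R b) - \<psi> (x - 0 *\<^sub>R b) = - ?D (x - z *\<^sub>R b) * (\<epsilon> n - 0)"
              using mvt_simple[OF conjunct1[OF True] D[unfolded has_field_derivative_def], of x] by auto
            then have "\<bar>(\<psi> (x - \<epsilon> n *\<^sub>R b) - \<psi> x) / \<epsilon> n\<bar> \<le> M'"
              using True M'(2)[of "x - z *\<^sub>R b"] by simp
            from mult_left_mono[OF this abs_ge_zero[of "f x"]]
            show ?thesis using True \<open>x \<in> L\<close> by (simp add: q_def abs_mult)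
          next
            assume "x \<notin> L"
            then have "\<psi> (x - \<epsilon> n *\<^sub>R b) = 0"
              using F(3) L(4)[of "x - \<epsilon> n *\<^sub>R b" "\<epsilon> n *\<^sub>R b"] True b by auto
            then show ?thesis using nz \<open>x \<notin> L\<close> by (simp add: q_def)
          qed
        qed (use M'(1) in \<open>auto simp: q_def\<close>)
      qed
      show "AE x in lborel. (\<lambda>n. q n x) \<longlonglongrightarrow> f x * - ?D x"
      proof (intro AE_I2)
        fix x
        have "((\<lambda>h. (\<psi> (x - h *\<^sub>R b) - \<psi> x) / h) \<longlongrightarrow> - ?D x) (at 0)"
          using D[of x 0 UNIV] by (simp add: DERIV_def)
        then have "((\<lambda>h. (\<psi> (x - h *\<^sub>R b) - \<psi> x) / h) \<longlongrightarrow> - ?D x) (at_right 0)"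
          by (rule tendsto_within_subset) auto
        from tendsto_mult[OF tendsto_const filterlim_compose[OF this \<epsilon>], of "f x"]
        have "(\<lambda>n. f x * ((\<psi> (x - \<epsilon> n *\<^sub>R b) - \<psi> x) / \<epsilon> n)) \<longlonglongrightarrow> f x * - ?D x" by simp
        moreover have "eventually (\<lambda>n. f x * ((\<psi> (x - \<epsilon> n *\<^sub>R b) - \<psi> x) / \<epsilon> n) = q n x) sequentially"
          using ev by eventually_elim (simp add: q_def)
        ultimately show "(\<lambda>n. q n x) \<longlonglongrightarrow> f x * - ?D x" by (rule Lim_transform_eventually)
      qed
    qed measurable
    moreover have "eventually (\<lambda>n. (LINT x|lborel. q n x) = (LINT x|lborel. f x * ((\<psi> (x - \<epsilon> n *\<^sub>R b) - \<psi> x) / \<epsilon> n))) sequentially"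
      using ev by eventually_elim (simp add: q_def)
    ultimately show ?thesis by (rule Lim_transform_eventually)
  qed
  have "eventually (\<lambda>n. (LINT x|lborel. (f (\<epsilon> n *\<^sub>R b + x) - f x) / \<epsilon> n * \<psi> x)
      = (LINT x|lborel. f x * ((\<psi> (x - \<epsilon> n *\<^sub>R b) - \<psi> x) / \<epsilon> n))) sequentially"
    using ev
  proof eventually_elim
    case (elim n)
    have "(LINT x|lborel. f (\<epsilon> n *\<^sub>R b + x) * \<psi> x) = (LINT x|lborel. f x * \<psi> (x - \<epsilon> n *\<^sub>R b))"
      using integral_lborel_translate[of "\<lambda>x. f x * \<psi> (x - \<epsilon> n *\<^sub>R b)" "\<epsilon> n *\<^sub>R b"] by simp
    then show ?case
      using i1 i2[of n] elim by (simp add: left_diff_distrib right_diff_distrib diff_divide_distrib)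
  qed
  from Lim_transform_eventually[OF lim1 this] lim2
  have "(LINT x|lborel. (g x \<bullet> b) * \<psi> x) = (LINT x|lborel. f x * - ?D x)" by (rule LIMSEQ_unique)
  then have eq: "(LINT x|lborel. f x * ?D x) = - (LINT x|lborel. (g x \<bullet> b) * \<psi> x)" by simp
  have "(LINT x:\<Omega>|lebesgue. f x * ?D x) = (LINT x|lebesgue. f x * ?D x)"
    unfolding set_lebesgue_integral_def using F(2,6)
    by (intro Bochner_Integration.integral_cong) (auto simp: indicator_def)
  moreover have "(LINT x:\<Omega>|lebesgue. (g x \<bullet> b) * \<psi> x) = (LINT x|lebesgue. (g x \<bullet> b) * \<psi> x)"
    unfolding set_lebesgue_integral_def using F(2,3)
    by (intro Bochner_Integration.integral_cong) (auto simp: indicator_def)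
  ultimately show "(LINT x:\<Omega>|lebesgue. f x * ?D x) = - (LINT x:\<Omega>|lebesgue. (g x \<bullet> b) * \<psi> x)"
    using eq by (simp add: integral_completion)
qed

text \<open>The quotient of F(f) is \<open>q n\<close> times the quotient of \<open>f\<close>, where
  \<open>q n\<close> is the divided difference of \<open>F\<close>, bounded by \<open>M\<close>. Its
  error splits into \<open>q n\<close> times the error of \<open>f\<close>, which tends to 0 in L^1,
  and (\<open>q n\<close> - F'(f)) times \<open>g\<close> . b, handled by dominated convergence.
  Only arguments t \<ge> 0 are constrained, since the powers and the logarithm applied later are
  singular at t = -d.\<close>

lemma has_weak_gradient_compose:
  fixes f :: "'a::euclidean_space \<Rightarrow> real"
  assumes \<Omega>: "open \<Omega>" and f[measurable]: "f \<in> borel_measurable borel" and g[measurable]: "g \<in> borel_measurable borel"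
    and wg: "has_weak_gradient f g \<Omega>" and pos: "AE x in lborel. x \<in> \<Omega> \<longrightarrow> 0 \<le> f x"
    and F[measurable]: "F \<in> borel_measurable borel" and F'[measurable]: "F' \<in> borel_measurable borel"
    and D: "\<And>t. 0 \<le> t \<Longrightarrow> (F has_real_derivative F' t) (at t)" and M: "\<And>t. 0 \<le> t \<Longrightarrow> \<bar>F' t\<bar> \<le> M"
  shows "has_weak_gradient (\<lambda>x. F (f x)) (\<lambda>x. F' (f x) *\<^sub>R g x) \<Omega>"
proof (rule has_weak_gradientI[OF \<Omega>])
  have M0: "0 \<le> M" using M[of 0] by linarith
  have lip: "\<bar>F s - F t\<bar> \<le> M * \<bar>s - t\<bar>" if "0 \<le> s" "0 \<le> t" for s t
    using field_differentiable_bound[of "{0..}" F F' M s t] that D M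
    by (auto intro: has_field_derivative_at_within)
  have fI: "set_integrable lborel K f" and gI: "set_integrable lborel K g" if "compact K" "K \<subseteq> \<Omega>" for K
    using wg that by (auto simp: has_weak_gradient_def Lp_loc_1_iff)
  have posK: "AE x in lborel. x \<in> K \<longrightarrow> 0 \<le> f x" if "K \<subseteq> \<Omega>" for K
    using pos by eventually_elim (use that in auto)
  show "(\<lambda>x. F (f x)) \<in> Lp_loc 1 \<Omega>"
    unfolding Lp_loc_1_iff[OF measurable_compose[OF f F]]
  proof (intro allI impI)
    fix K assume K: "compact K \<and> K \<subseteq> \<Omega>"
    then have [measurable]: "K \<in> sets borel" by (simp add: borel_compact)
    have "set_integrable lborel K (\<lambda>x. \<bar>F 0\<bar> + M * \<bar>f x\<bar>)"
      using fI K emeasure_compact_finite[of K]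
      by (intro set_integral_add set_integrable_mult_right set_integrable_abs) (auto simp: set_integrable_def)
    moreover have "AE x in lborel. x \<in> K \<longrightarrow> norm (F (f x)) \<le> norm (\<bar>F 0\<bar> + M * \<bar>f x\<bar>)"
      using posK[OF conjunct2[OF K]]
    proof eventually_elim
      case (elim x)
      have "0 \<le> M * \<bar>f x\<bar>" using M0 by simp
      with elim show ?case using lip[of "f x" 0] by auto
    qed
    ultimately show "set_integrable lborel K (\<lambda>x. F (f x))"
      by - (rule set_integrable_bound, assumption, simp add: set_borel_measurable_def, assumption)
  qed
  have gm: "(\<lambda>x. F' (f x) *\<^sub>R g x) \<in> borel_measurable borel" by measurable
  show "(\<lambda>x. F' (f x) *\<^sub>R g x) \<in> Lp_loc 1 \<Omega>"
    unfolding Lp_loc_1_iff[OF gm]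
  proof (intro allI impI)
    fix K assume K: "compact K \<and> K \<subseteq> \<Omega>"
    then have [measurable]: "K \<in> sets borel" by (simp add: borel_compact)
    have "set_integrable lborel K (\<lambda>x. M *\<^sub>R g x)"
      using gI[of K] K by (intro set_integrable_scaleR_right) auto
    moreover have "AE x in lborel. x \<in> K \<longrightarrow> norm (F' (f x) *\<^sub>R g x) \<le> norm (M *\<^sub>R g x)"
      using posK[OF conjunct2[OF K]]
      by eventually_elim (use M M0 in \<open>auto intro!: mult_right_mono\<close>)
    ultimately show "set_integrable lborel K (\<lambda>x. F' (f x) *\<^sub>R g x)"
      by - (rule set_integrable_bound, assumption, simp add: set_borel_measurable_def, assumption)
  qed
  fix K b assume K: "compact K" "K \<subseteq> \<Omega>" and b: "(b::'a) \<in> Basis"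
  have [measurable]: "K \<in> sets borel" using K by (simp add: borel_compact)
  obtain e L where L: "e > 0" "compact L" "L \<subseteq> \<Omega>" "\<And>x y. x \<in> K \<Longrightarrow> norm y \<le> e \<Longrightarrow> y + x \<in> L"
    using compact_enlarge[OF K(1) \<Omega> K(2)] by metis
  define Q where "Q \<epsilon> x = (f (\<epsilon> *\<^sub>R b + x) - f x) / \<epsilon> - g x \<bullet> b" for \<epsilon> x
  have [measurable]: "Q \<epsilon> \<in> borel_measurable borel" for \<epsilon> unfolding Q_def by measurable
  have limQ: "((\<lambda>\<epsilon>. \<integral>\<^sup>+x\<in>K. ennreal \<bar>Q \<epsilon> x\<bar> \<partial>lborel) \<longlongrightarrow> 0) (at_right 0)"
    using difference_quotient_tendsto[OF \<Omega> f g wg K, of b] by (simp add: Q_def)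
  define \<delta> where "\<delta> n = min e 1 / (real n + 1)" for n
  have \<delta>: "0 < \<delta> n" "\<delta> n \<le> e" "\<delta> n \<le> 1" for n
  proof -
    have "min e 1 / (real n + 1) \<le> min e 1 / 1" using L(1) by (intro divide_left_mono) auto
    then show "0 < \<delta> n" "\<delta> n \<le> e" "\<delta> n \<le> 1" using L(1) by (auto simp: \<delta>_def)
  qed
  have "(\<lambda>n. min e 1 * (1 / (real n + 1))) \<longlonglongrightarrow> min e 1 * 0"
    using LIMSEQ_inverse_real_of_nat by (intro tendsto_mult tendsto_const) (simp add: inverse_eq_divide add.commute)
  then have "\<delta> \<longlonglongrightarrow> 0" by (simp add: \<delta>_def[abs_def])
  then have \<delta>lim: "filterlim \<delta> (at_right 0) sequentially"
    using \<delta>(1) by (simp add: filterlim_at \<delta>(1)[THEN less_imp_neq, THEN not_sym])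
  have lim\<delta>: "(\<lambda>n. \<integral>\<^sup>+x\<in>K. ennreal \<bar>Q (\<delta> n) x\<bar> \<partial>lborel) \<longlonglongrightarrow> 0"
    using filterlim_compose[OF limQ \<delta>lim] .
  have gb: "set_integrable lborel K (\<lambda>x. g x \<bullet> b)"
    using integrable_inner_left[of b lborel "\<lambda>x. indicator K x *\<^sub>R g x"] gI[OF K] by (simp add: set_integrable_def)
  note gbfin = set_integrable_imp_nn_finite[OF gb]
  \<comment> \<open>L^1 convergence yields pointwise convergence only along a subsequence. The first
    N quotients are skipped because they are not known to be integrable.\<close>
  obtain \<rho> :: "nat \<Rightarrow> nat" where \<rho>: "strict_mono \<rho>" and AEQ: "AE x in lborel. (\<lambda>n. indicator K x *\<^sub>R Q (\<delta> (\<rho> n)) x) \<longlonglongrightarrow> 0"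
  proof -
    have ev: "eventually (\<lambda>n. (\<integral>\<^sup>+x\<in>K. ennreal \<bar>Q (\<delta> n) x\<bar> \<partial>lborel) < ennreal 1) sequentially"
      using lim\<delta> by (rule order_tendstoD) simp
    then obtain N where N: "\<And>n. N \<le> n \<Longrightarrow> (\<integral>\<^sup>+x\<in>K. ennreal \<bar>Q (\<delta> n) x\<bar> \<partial>lborel) < ennreal 1"
      by (auto simp: eventually_sequentially)
    have eq: "(\<integral>\<^sup>+x. ennreal (norm (indicator K x *\<^sub>R Q \<epsilon> x)) \<partial>lborel) = (\<integral>\<^sup>+x\<in>K. ennreal \<bar>Q \<epsilon> x\<bar> \<partial>lborel)" for \<epsilon>
      by (intro nn_integral_cong) (auto simp: indicator_def)
    have int: "integrable lborel (\<lambda>x. indicator K x *\<^sub>R Q (\<delta> (n + N)) x)" for n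
    proof (rule integrableI_bounded)
      show "(\<integral>\<^sup>+x. ennreal (norm (indicator K x *\<^sub>R Q (\<delta> (n + N)) x)) \<partial>lborel) < \<infinity>"
        unfolding eq using N[of "n + N"] by (auto intro: less_trans)
    qed measurable
    have "(\<lambda>n. LINT x|lborel. norm (indicator K x *\<^sub>R Q (\<delta> (n + N)) x)) \<longlonglongrightarrow> 0"
    proof -
      have "(\<lambda>n. enn2real (\<integral>\<^sup>+x\<in>K. ennreal \<bar>Q (\<delta> (n + N)) x\<bar> \<partial>lborel)) \<longlonglongrightarrow> 0"
        using LIMSEQ_ignore_initial_segment[OF lim\<delta>, of N] by (intro tendsto_enn2real) auto
      moreover have "(LINT x|lborel. norm (indicator K x *\<^sub>R Q (\<delta> (n + N)) x)) = enn2real (\<integral>\<^sup>+x\<in>K. ennreal \<bar>Q (\<delta> (n + N)) x\<bar> \<partial>lborel)" for n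
        unfolding eq[symmetric] by (intro integral_eq_nn_integral) auto
      ultimately show ?thesis by simp
    qed
    from tendsto_L1_AE_subseq[OF int this] obtain s where "strict_mono s"
      "AE x in lborel. (\<lambda>n. indicator K x *\<^sub>R Q (\<delta> (s n + N)) x) \<longlonglongrightarrow> 0" by blast
    then show thesis by (intro that[of "\<lambda>n. s n + N"]) (auto simp: strict_mono_def)
  qed
  define \<epsilon> where "\<epsilon> = \<delta> \<circ> \<rho>"
  have \<epsilon>: "0 < \<epsilon> n" "\<epsilon> n \<le> e" "\<epsilon> n \<le> 1" for n using \<delta> by (auto simp: \<epsilon>_def)
  have \<epsilon>lim: "filterlim \<epsilon> (at_right 0) sequentially"
    unfolding \<epsilon>_def comp_def using \<delta>lim filterlim_subseq[OF \<rho>] by (rule filterlim_compose)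
  have \<epsilon>0: "\<epsilon> \<longlonglongrightarrow> 0" using \<epsilon>lim by (simp add: filterlim_at)
  \<comment> \<open>The divided difference, completed by F' where the two values of \<open>f\<close>
    coincide; with this default it is continuous in the second value at \<open>f x\<close>.\<close>
  define q where "q n x = (if f (\<epsilon> n *\<^sub>R b + x) = f x then F' (f x)
     else (F (f (\<epsilon> n *\<^sub>R b + x)) - F (f x)) / (f (\<epsilon> n *\<^sub>R b + x) - f x))" for n x
  have [measurable]: "q n \<in> borel_measurable borel" for n unfolding q_def by measurable
  \<comment> \<open>The Lipschitz bound for \<open>F\<close> holds on nonnegative arguments only.
    Positivity holds almost everywhere, so it is transported to countably many translates
    simultaneously; \<open>L\<close> keeps them inside \<Omega>.\<close>
  have posT: "AE x in lborel. x \<in> K \<longrightarrow> 0 \<le> f x \<and> (\<forall>n. 0 \<le> f (\<epsilon> n *\<^sub>R b + x))"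
  proof -
    have "AE x in lborel. \<forall>n. \<epsilon> n *\<^sub>R b + x \<in> \<Omega> \<longrightarrow> 0 \<le> f (\<epsilon> n *\<^sub>R b + x)"
      using AE_lborel_translate[OF pos] by (simp add: AE_all_countable)
    with pos show ?thesis
    proof eventually_elim
      case (elim x)
      have "\<epsilon> n *\<^sub>R b + x \<in> \<Omega>" if "x \<in> K" for n
        using L(3,4) that \<epsilon>[of n] b by (auto intro!: subsetD[OF L(3)])
      with elim K(2) show ?case by blast
    qed
  qed
  have qM: "\<bar>q n x\<bar> \<le> M" if "0 \<le> f x" "0 \<le> f (\<epsilon> n *\<^sub>R b + x)" for n x
    using lip[OF that(2,1)] M[OF that(1)] by (auto simp: q_def field_simps)
  have lim2: "(\<lambda>n. \<integral>\<^sup>+x\<in>K. ennreal \<bar>(q n x - F' (f x)) * (g x \<bullet> b)\<bar> \<partial>lborel) \<longlonglongrightarrow> (\<integral>\<^sup>+x. 0 \<partial>(lborel::'a measure))"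
  proof (rule nn_integral_dominated_convergence)
    show "(\<integral>\<^sup>+x. ennreal (2 * M) * (ennreal \<bar>g x \<bullet> b\<bar> * indicator K x) \<partial>lborel) < \<infinity>"
      using gbfin by (simp add: nn_integral_cmult ennreal_mult_less_top)
    show "AE x in lborel. ennreal \<bar>(q n x - F' (f x)) * (g x \<bullet> b)\<bar> * indicator K x \<le> ennreal (2 * M) * (ennreal \<bar>g x \<bullet> b\<bar> * indicator K x)" for n
      using posT
    proof eventually_elim
      case (elim x)
      show ?case
      proof (cases "x \<in> K")
        case True
        then have "\<bar>q n x - F' (f x)\<bar> \<le> 2 * M"
          using qM[of x n] M[of "f x"] elim by fastforce
        then show ?thesis using True M0
          by (auto simp: abs_mult simp flip: ennreal_mult intro!: ennreal_leI mult_right_mono)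
      qed simp
    qed
    show "AE x in lborel. (\<lambda>n. ennreal \<bar>(q n x - F' (f x)) * (g x \<bullet> b)\<bar> * indicator K x) \<longlonglongrightarrow> 0"
      using posT AEQ
    proof eventually_elim
      case (elim x)
      show ?case
      proof (cases "x \<in> K")
        case True
        \<comment> \<open>Along the subsequence the quotients of \<open>f\<close> converge at x;
          multiplied by \<epsilon> n they give f(x + \<epsilon> b) \<rightarrow> f(x), although
          \<open>f\<close> has no continuity of its own.\<close>
        have "(\<lambda>n. f x + \<epsilon> n * (Q (\<epsilon> n) x + g x \<bullet> b)) \<longlonglongrightarrow> f x + 0 * (0 + g x \<bullet> b)"
          using elim(2) True \<epsilon>0 by (intro tendsto_intros) (auto simp: \<epsilon>_def comp_def)
        moreover have "f x + \<epsilon> n * (Q (\<epsilon> n) x + g x \<bullet> b) = f (\<epsilon> n *\<^sub>R b + x)" for n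
          using \<epsilon>(1)[of n] by (simp add: Q_def)
        ultimately have lf: "(\<lambda>n. f (\<epsilon> n *\<^sub>R b + x)) \<longlonglongrightarrow> f x" by simp
        have "((\<lambda>y. if y = f x then F' (f x) else (F y - F (f x)) / (y - f x)) \<longlongrightarrow> F' (f x)) (at (f x))"
        proof -
          have "((\<lambda>y. (F y - F (f x)) / (y - f x)) \<longlongrightarrow> F' (f x)) (at (f x))"
            using D[of "f x"] elim True by (simp add: has_field_derivative_iff)
          moreover have "eventually (\<lambda>y. (F y - F (f x)) / (y - f x) = (if y = f x then F' (f x) else (F y - F (f x)) / (y - f x))) (at (f x))"
            by (auto simp: eventually_at_filter)
          ultimately show ?thesis by (rule Lim_transform_eventually)
        qed
        then have "isCont (\<lambda>y. if y = f x then F' (f x) else (F y - F (f x)) / (y - f x)) (f x)"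
          by (simp add: isCont_def)
        from isCont_tendsto_compose[OF this lf] have "(\<lambda>n. q n x) \<longlonglongrightarrow> F' (f x)"
          by (simp add: q_def)
        then have "(\<lambda>n. ennreal \<bar>(q n x - F' (f x)) * (g x \<bullet> b)\<bar>) \<longlonglongrightarrow> ennreal \<bar>(F' (f x) - F' (f x)) * (g x \<bullet> b)\<bar>"
          by (intro tendsto_intros)
        then show ?thesis using True by simp
      qed simp
    qed
  qed measurable
  have lim1: "(\<lambda>n. ennreal M * (\<integral>\<^sup>+x\<in>K. ennreal \<bar>Q (\<epsilon> n) x\<bar> \<partial>lborel)) \<longlonglongrightarrow> ennreal M * 0"
    using filterlim_compose[OF limQ \<epsilon>lim] by (intro ennreal_tendsto_cmult) auto
  have lim12: "(\<lambda>n. ennreal M * (\<integral>\<^sup>+x\<in>K. ennreal \<bar>Q (\<epsilon> n) x\<bar> \<partial>lborel)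
      + (\<integral>\<^sup>+x\<in>K. ennreal \<bar>(q n x - F' (f x)) * (g x \<bullet> b)\<bar> \<partial>lborel)) \<longlonglongrightarrow> 0"
    using tendsto_add[OF lim1 lim2] by simp
  show "\<exists>\<epsilon>. filterlim \<epsilon> (at_right 0) sequentially \<and>
      (\<lambda>n. \<integral>\<^sup>+x\<in>K. ennreal \<bar>(F (f (\<epsilon> n *\<^sub>R b + x)) - F (f x)) / \<epsilon> n - (F' (f x) *\<^sub>R g x) \<bullet> b\<bar> \<partial>lborel) \<longlonglongrightarrow> 0"
  proof (intro exI[of _ \<epsilon>] conjI \<epsilon>lim, rule tendsto_sandwich[OF _ _ tendsto_const lim12])
    show "eventually (\<lambda>n. (\<integral>\<^sup>+x\<in>K. ennreal \<bar>(F (f (\<epsilon> n *\<^sub>R b + x)) - F (f x)) / \<epsilon> n - (F' (f x) *\<^sub>R g x) \<bullet> b\<bar> \<partial>lborel)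
      \<le> ennreal M * (\<integral>\<^sup>+x\<in>K. ennreal \<bar>Q (\<epsilon> n) x\<bar> \<partial>lborel)
      + (\<integral>\<^sup>+x\<in>K. ennreal \<bar>(q n x - F' (f x)) * (g x \<bullet> b)\<bar> \<partial>lborel)) sequentially"
    proof (intro always_eventually allI)
      fix n
      have "(\<integral>\<^sup>+x\<in>K. ennreal \<bar>(F (f (\<epsilon> n *\<^sub>R b + x)) - F (f x)) / \<epsilon> n - (F' (f x) *\<^sub>R g x) \<bullet> b\<bar> \<partial>lborel)
        \<le> (\<integral>\<^sup>+x. ennreal M * (ennreal \<bar>Q (\<epsilon> n) x\<bar> * indicator K x)
            + ennreal \<bar>(q n x - F' (f x)) * (g x \<bullet> b)\<bar> * indicator K x \<partial>lborel)"
      proof (intro nn_integral_mono_AE, use posT in eventually_elim)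
        case (elim x)
        show ?case
        proof (cases "x \<in> K")
          case True
          have "(F (f (\<epsilon> n *\<^sub>R b + x)) - F (f x)) / \<epsilon> n = q n x * (Q (\<epsilon> n) x + g x \<bullet> b)"
            using \<epsilon>(1)[of n] by (auto simp: q_def Q_def field_simps)
          then have eq: "(F (f (\<epsilon> n *\<^sub>R b + x)) - F (f x)) / \<epsilon> n - (F' (f x) *\<^sub>R g x) \<bullet> b
              = q n x * Q (\<epsilon> n) x + (q n x - F' (f x)) * (g x \<bullet> b)" by (simp add: algebra_simps)
          have "\<bar>q n x * Q (\<epsilon> n) x\<bar> \<le> M * \<bar>Q (\<epsilon> n) x\<bar>"
            using qM[of x n] elim True by (auto simp: abs_mult intro!: mult_right_mono)
          then have "\<bar>(F (f (\<epsilon> n *\<^sub>R b + x)) - F (f x)) / \<epsilon> n - (F' (f x) *\<^sub>R g x) \<bullet> b\<bar>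
              \<le> M * \<bar>Q (\<epsilon> n) x\<bar> + \<bar>(q n x - F' (f x)) * (g x \<bullet> b)\<bar>" unfolding eq by linarith
          then show ?thesis using True M0 by (auto simp flip: ennreal_mult ennreal_plus intro!: ennreal_leI)
        qed simp
      qed
      then show "(\<integral>\<^sup>+x\<in>K. ennreal \<bar>(F (f (\<epsilon> n *\<^sub>R b + x)) - F (f x)) / \<epsilon> n - (F' (f x) *\<^sub>R g x) \<bullet> b\<bar> \<partial>lborel)
        \<le> ennreal M * (\<integral>\<^sup>+x\<in>K. ennreal \<bar>Q (\<epsilon> n) x\<bar> \<partial>lborel)
        + (\<integral>\<^sup>+x\<in>K. ennreal \<bar>(q n x - F' (f x)) * (g x \<bullet> b)\<bar> \<partial>lborel)"
        by (simp add: nn_integral_add nn_integral_cmult)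
    qed
  qed auto
qed measurable

text \<open>The discrete Leibniz rule leaves three errors: one from the quotient of
  \<open>w\<close>, one from the increment of \<open>\<eta>\<close>, of size L \<epsilon>, and one
  from the quotient of \<open>\<eta>\<close>. The conclusion holds on the whole space although
  \<open>w\<close> is controlled in \<Omega> only, because small shifts of points outside
  \<open>V\<close> never reach \<open>S\<close>.\<close>

lemma has_weak_gradient_mult_cutoff:
  fixes w \<eta> :: "'a::euclidean_space \<Rightarrow> real"
  assumes \<Omega>: "open \<Omega>" and w[measurable]: "w \<in> borel_measurable borel" and g[measurable]: "g \<in> borel_measurable borel"
    and wg: "has_weak_gradient w g \<Omega>" and S: "compact S" "S \<subseteq> \<Omega>"
    and \<eta>: "\<And>x. (\<eta> has_derivative (\<lambda>h. D\<eta> x \<bullet> h)) (at x)" and lip: "\<And>x y. \<bar>\<eta> x - \<eta> y\<bar> \<le> L * norm (x - y)"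
    and D\<eta>[measurable]: "D\<eta> \<in> borel_measurable borel" and DL: "\<And>x. norm (D\<eta> x) \<le> L"
    and out: "\<And>x. x \<notin> S \<Longrightarrow> \<eta> x = 0" "\<And>x. x \<notin> S \<Longrightarrow> D\<eta> x = 0"
  shows "has_weak_gradient (\<lambda>x. \<eta> x * w x) (\<lambda>x. \<eta> x *\<^sub>R g x + w x *\<^sub>R D\<eta> x) UNIV"
proof -
  have cont: "continuous_on UNIV \<eta>"
    using \<eta> by (intro continuous_at_imp_continuous_on ballI has_derivative_continuous)
  then have [measurable]: "\<eta> \<in> borel_measurable borel" by (rule borel_measurable_continuous_onI)
  show ?thesis
  proof (rule has_weak_gradientI)
  obtain M where M: "M \<ge> 0" "\<And>x. \<bar>\<eta> x\<bar> \<le> M"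
    using continuous_vanishing_bounded[OF S(1) cont out(1)] by blast
  have L0: "0 \<le> L" using DL[of 0] norm_ge_zero order_trans by blast
  have wI: "set_integrable lborel K w" and gI: "set_integrable lborel K g" if "compact K" "K \<subseteq> \<Omega>" for K
    using wg that by (auto simp: has_weak_gradient_def Lp_loc_1_iff)
  have [measurable]: "S \<in> sets borel" using S by (simp add: borel_compact)
  have wS: "integrable lborel (\<lambda>x. indicator S x *\<^sub>R w x)" and gS: "integrable lborel (\<lambda>x. indicator S x *\<^sub>R g x)"
    using wI[OF S] gI[OF S] by (simp_all add: set_integrable_def)
  have sub: "f \<in> Lp_loc 1 UNIV" if [measurable]: "f \<in> borel_measurable borel" and "integrable lborel f" for f :: "'a \<Rightarrow> 'c::euclidean_space"
    unfolding Lp_loc_1_iff[OF that(1)] set_integrable_def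
    using that(2) by (auto intro!: integrable_mult_indicator simp: borel_compact)
  show "(\<lambda>x. \<eta> x * w x) \<in> Lp_loc 1 UNIV"
  proof (rule sub)
    show "integrable lborel (\<lambda>x. \<eta> x * w x)"
    proof (rule Bochner_Integration.integrable_bound[OF integrable_mult_right[OF wS, of M]])
      show "AE x in lborel. norm (\<eta> x * w x) \<le> norm (M * (indicator S x *\<^sub>R w x))"
        using M out(1) by (intro AE_I2) (auto simp: abs_mult indicator_def intro!: mult_right_mono)
    qed measurable
  qed measurable
  show "(\<lambda>x. \<eta> x *\<^sub>R g x + w x *\<^sub>R D\<eta> x) \<in> Lp_loc 1 UNIV"
  proof (rule sub)
    have "integrable lborel (\<lambda>x. \<eta> x *\<^sub>R g x)"
    proof (rule Bochner_Integration.integrable_bound[OF integrable_scaleR_right[OF gS, of M]])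
      show "AE x in lborel. norm (\<eta> x *\<^sub>R g x) \<le> norm (M *\<^sub>R (indicator S x *\<^sub>R g x))"
        using M out(1) by (intro AE_I2) (auto simp: indicator_def intro!: mult_right_mono)
    qed measurable
    moreover have "integrable lborel (\<lambda>x. w x *\<^sub>R D\<eta> x)"
    proof (rule Bochner_Integration.integrable_bound[OF integrable_mult_right[OF wS, of L]])
      show "AE x in lborel. norm (w x *\<^sub>R D\<eta> x) \<le> norm (L * (indicator S x *\<^sub>R w x))"
        using DL L0 out(2) by (intro AE_I2) (auto simp: indicator_def abs_mult mult.commute[of L] intro!: mult_left_mono)
    qed measurable
    ultimately show "integrable lborel (\<lambda>x. \<eta> x *\<^sub>R g x + w x *\<^sub>R D\<eta> x)" by simp
  qed measurable
  fix K :: "'a set" and b assume "compact K" and b: "(b::'a) \<in> Basis"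
  then have [measurable]: "K \<in> sets borel" by (simp add: borel_compact)
  obtain e V where V: "e > 0" "compact V" "V \<subseteq> \<Omega>" "\<And>x y. x \<in> S \<Longrightarrow> norm y \<le> e \<Longrightarrow> y + x \<in> V"
    using compact_enlarge[OF S(1) \<Omega> S(2)] by metis
  have SV: "x \<in> V" if "x \<in> S" for x using V(4)[OF that, of 0] V(1) by simp
  have [measurable]: "V \<in> sets borel" using V by (simp add: borel_compact)
  define Q where "Q \<epsilon> x = (w (\<epsilon> *\<^sub>R b + x) - w x) / \<epsilon> - g x \<bullet> b" for \<epsilon> x
  have [measurable]: "Q \<epsilon> \<in> borel_measurable borel" for \<epsilon> unfolding Q_def by measurable
  have limQ: "((\<lambda>\<epsilon>. \<integral>\<^sup>+x\<in>V. ennreal \<bar>Q \<epsilon> x\<bar> \<partial>lborel) \<longlongrightarrow> 0) (at_right 0)"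
    using difference_quotient_tendsto[OF \<Omega> w g wg V(2,3), of b] by (simp add: Q_def)
  have gb: "set_integrable lborel V (\<lambda>x. g x \<bullet> b)"
    using integrable_inner_left[of b lborel "\<lambda>x. indicator V x *\<^sub>R g x"] gI[OF V(2,3)] by (simp add: set_integrable_def)
  note fin = set_integrable_imp_nn_finite[OF gb] set_integrable_imp_nn_finite[OF wI[OF V(2,3)]]
  define \<epsilon> where "\<epsilon> n = 1 / (real n + 1)" for n
  have \<epsilon>pos: "0 < \<epsilon> n" for n by (simp add: \<epsilon>_def)
  have \<epsilon>0: "\<epsilon> \<longlonglongrightarrow> 0"
    using LIMSEQ_inverse_real_of_nat by (simp add: \<epsilon>_def[abs_def] inverse_eq_divide add.commute)
  have \<epsilon>lim: "filterlim \<epsilon> (at_right 0) sequentially"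
    using \<epsilon>0 by (simp add: filterlim_at \<epsilon>pos \<epsilon>pos[THEN less_imp_neq, THEN not_sym])
  have ev: "eventually (\<lambda>n. \<epsilon> n < e) sequentially" using \<epsilon>0 V(1) by (rule order_tendstoD)
  define q where "q n x = (\<eta> (\<epsilon> n *\<^sub>R b + x) - \<eta> x) / \<epsilon> n - D\<eta> x \<bullet> b" for n x
  have [measurable]: "q n \<in> borel_measurable borel" for n unfolding q_def by measurable
  have q2: "\<bar>q n x\<bar> \<le> 2 * L" for n x
  proof -
    have "\<bar>\<eta> (\<epsilon> n *\<^sub>R b + x) - \<eta> x\<bar> \<le> L * \<epsilon> n"
      using lip[of "\<epsilon> n *\<^sub>R b + x" x] b \<epsilon>pos[of n] by simp
    then have "\<bar>(\<eta> (\<epsilon> n *\<^sub>R b + x) - \<eta> x) / \<epsilon> n\<bar> \<le> L" using \<epsilon>pos[of n] by (simp add: field_simps)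
    moreover have "\<bar>D\<eta> x \<bullet> b\<bar> \<le> L" using Cauchy_Schwarz_ineq2[of "D\<eta> x" b] DL[of x] b by simp
    ultimately show ?thesis unfolding q_def by linarith
  qed
  have lim1: "(\<lambda>n. ennreal M * (\<integral>\<^sup>+x\<in>V. ennreal \<bar>Q (\<epsilon> n) x\<bar> \<partial>lborel)) \<longlonglongrightarrow> ennreal M * 0"
    using filterlim_compose[OF limQ \<epsilon>lim] by (intro ennreal_tendsto_cmult) auto
  have lim2: "(\<lambda>n. ennreal (L * \<epsilon> n) * (\<integral>\<^sup>+x\<in>V. ennreal \<bar>g x \<bullet> b\<bar> \<partial>lborel)) \<longlonglongrightarrow> 0"
  proof -
    have "(\<lambda>n. L * \<epsilon> n * enn2real (\<integral>\<^sup>+x\<in>V. ennreal \<bar>g x \<bullet> b\<bar> \<partial>lborel)) \<longlonglongrightarrow> L * 0 * enn2real (\<integral>\<^sup>+x\<in>V. ennreal \<bar>g x \<bullet> b\<bar> \<partial>lborel)"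
      by (intro tendsto_intros \<epsilon>0)
    then have "(\<lambda>n. ennreal (L * \<epsilon> n * enn2real (\<integral>\<^sup>+x\<in>V. ennreal \<bar>g x \<bullet> b\<bar> \<partial>lborel))) \<longlonglongrightarrow> ennreal 0"
      by (intro tendsto_ennrealI) simp
    moreover have "ennreal (L * \<epsilon> n * enn2real (\<integral>\<^sup>+x\<in>V. ennreal \<bar>g x \<bullet> b\<bar> \<partial>lborel)) = ennreal (L * \<epsilon> n) * (\<integral>\<^sup>+x\<in>V. ennreal \<bar>g x \<bullet> b\<bar> \<partial>lborel)" for n
      using L0 \<epsilon>pos[of n] fin(1) by (simp add: ennreal_mult)
    ultimately show ?thesis by simp
  qed
  have lim3: "(\<lambda>n. \<integral>\<^sup>+x\<in>V. ennreal \<bar>w x * q n x\<bar> \<partial>lborel) \<longlonglongrightarrow> (\<integral>\<^sup>+x. 0 \<partial>(lborel::'a measure))"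
  proof (rule nn_integral_dominated_convergence)
    show "(\<integral>\<^sup>+x. ennreal (2 * L) * (ennreal \<bar>w x\<bar> * indicator V x) \<partial>lborel) < \<infinity>"
      using fin(2) by (simp add: nn_integral_cmult ennreal_mult_less_top)
    show "AE x in lborel. ennreal \<bar>w x * q n x\<bar> * indicator V x \<le> ennreal (2 * L) * (ennreal \<bar>w x\<bar> * indicator V x)" for n
      using q2[of n] L0
      by (intro AE_I2) (auto simp: indicator_def abs_mult mult.commute[of "2 * L"] simp flip: ennreal_mult intro!: ennreal_leI mult_left_mono)
    show "AE x in lborel. (\<lambda>n. ennreal \<bar>w x * q n x\<bar> * indicator V x) \<longlonglongrightarrow> 0"
    proof (intro AE_I2)
      fix x
      have "((\<lambda>h. \<eta> (h *\<^sub>R b + x)) has_real_derivative D\<eta> x \<bullet> b) (at 0)"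
      proof -
        have "((\<lambda>h. h *\<^sub>R b + x) has_derivative (\<lambda>h. h *\<^sub>R b)) (at 0)" by (auto intro!: derivative_eq_intros)
        from diff_chain_at[OF this, of \<eta> "\<lambda>h. D\<eta> x \<bullet> h"] \<eta>[of x]
        show ?thesis by (simp add: has_field_derivative_def o_def mult_commute_abs)
      qed
      then have "((\<lambda>h. (\<eta> (h *\<^sub>R b + x) - \<eta> x) / h) \<longlongrightarrow> D\<eta> x \<bullet> b) (at 0)" by (simp add: DERIV_def)
      then have "((\<lambda>h. (\<eta> (h *\<^sub>R b + x) - \<eta> x) / h) \<longlongrightarrow> D\<eta> x \<bullet> b) (at_right 0)"
        by (rule tendsto_within_subset) auto
      from filterlim_compose[OF this \<epsilon>lim]
      have "(\<lambda>n. (\<eta> (\<epsilon> n *\<^sub>R b + x) - \<eta> x) / \<epsilon> n) \<longlonglongrightarrow> D\<eta> x \<bullet> b" .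
      from tendsto_diff[OF this tendsto_const, of "D\<eta> x \<bullet> b"]
      have "(\<lambda>n. q n x) \<longlonglongrightarrow> 0" by (simp add: q_def)
      then have "(\<lambda>n. ennreal \<bar>w x * q n x\<bar>) \<longlonglongrightarrow> ennreal \<bar>w x * 0\<bar>" by (intro tendsto_intros)
      then show "(\<lambda>n. ennreal \<bar>w x * q n x\<bar> * indicator V x) \<longlonglongrightarrow> 0" by (simp add: indicator_def)
    qed
  qed measurable
  have lim123: "(\<lambda>n. ennreal M * (\<integral>\<^sup>+x\<in>V. ennreal \<bar>Q (\<epsilon> n) x\<bar> \<partial>lborel)
      + ennreal (L * \<epsilon> n) * (\<integral>\<^sup>+x\<in>V. ennreal \<bar>g x \<bullet> b\<bar> \<partial>lborel) + (\<integral>\<^sup>+x\<in>V. ennreal \<bar>w x * q n x\<bar> \<partial>lborel)) \<longlonglongrightarrow> 0"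
    using tendsto_add[OF tendsto_add[OF lim1 lim2] lim3] by simp
  show "\<exists>\<epsilon>. filterlim \<epsilon> (at_right 0) sequentially \<and>
      (\<lambda>n. \<integral>\<^sup>+x\<in>K. ennreal \<bar>(\<eta> (\<epsilon> n *\<^sub>R b + x) * w (\<epsilon> n *\<^sub>R b + x) - \<eta> x * w x) / \<epsilon> n
        - (\<eta> x *\<^sub>R g x + w x *\<^sub>R D\<eta> x) \<bullet> b\<bar> \<partial>lborel) \<longlonglongrightarrow> 0"
  proof (intro exI[of _ \<epsilon>] conjI \<epsilon>lim, rule tendsto_sandwich[OF _ _ tendsto_const lim123])
    show "eventually (\<lambda>n. (\<integral>\<^sup>+x\<in>K. ennreal \<bar>(\<eta> (\<epsilon> n *\<^sub>R b + x) * w (\<epsilon> n *\<^sub>R b + x) - \<eta> x * w x) / \<epsilon> n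
        - (\<eta> x *\<^sub>R g x + w x *\<^sub>R D\<eta> x) \<bullet> b\<bar> \<partial>lborel)
      \<le> ennreal M * (\<integral>\<^sup>+x\<in>V. ennreal \<bar>Q (\<epsilon> n) x\<bar> \<partial>lborel)
      + ennreal (L * \<epsilon> n) * (\<integral>\<^sup>+x\<in>V. ennreal \<bar>g x \<bullet> b\<bar> \<partial>lborel) + (\<integral>\<^sup>+x\<in>V. ennreal \<bar>w x * q n x\<bar> \<partial>lborel)) sequentially"
      using ev
    proof eventually_elim
      case (elim n)
      have "(\<integral>\<^sup>+x\<in>K. ennreal \<bar>(\<eta> (\<epsilon> n *\<^sub>R b + x) * w (\<epsilon> n *\<^sub>R b + x) - \<eta> x * w x) / \<epsilon> n
          - (\<eta> x *\<^sub>R g x + w x *\<^sub>R D\<eta> x) \<bullet> b\<bar> \<partial>lborel)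
        \<le> (\<integral>\<^sup>+x. ennreal M * (ennreal \<bar>Q (\<epsilon> n) x\<bar> * indicator V x)
          + ennreal (L * \<epsilon> n) * (ennreal \<bar>g x \<bullet> b\<bar> * indicator V x) + ennreal \<bar>w x * q n x\<bar> * indicator V x \<partial>lborel)"
      proof (intro nn_integral_mono)
        fix x
        let ?E = "(\<eta> (\<epsilon> n *\<^sub>R b + x) * w (\<epsilon> n *\<^sub>R b + x) - \<eta> x * w x) / \<epsilon> n - (\<eta> x *\<^sub>R g x + w x *\<^sub>R D\<eta> x) \<bullet> b"
        show "ennreal \<bar>?E\<bar> * indicator K x \<le> ennreal M * (ennreal \<bar>Q (\<epsilon> n) x\<bar> * indicator V x)
          + ennreal (L * \<epsilon> n) * (ennreal \<bar>g x \<bullet> b\<bar> * indicator V x) + ennreal \<bar>w x * q n x\<bar> * indicator V x"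
        proof (cases "x \<in> V")
          case False
          then have "x \<notin> S" "\<epsilon> n *\<^sub>R b + x \<notin> S"
            using SV V(4)[of "\<epsilon> n *\<^sub>R b + x" "- (\<epsilon> n *\<^sub>R b)"] elim \<epsilon>pos[of n] b by auto
          then show ?thesis using out by simp
        next
          case True
          \<comment> \<open>The cutoff is evaluated at the shifted point in the first term and
            \<open>w\<close> at the unshifted one in the last, so that no product of two increments
            remains.\<close>
          have "?E = \<eta> (\<epsilon> n *\<^sub>R b + x) * Q (\<epsilon> n) x + (\<eta> (\<epsilon> n *\<^sub>R b + x) - \<eta> x) * (g x \<bullet> b) + w x * q n x"
            using \<epsilon>pos[of n] by (simp add: Q_def q_def inner_add_left field_simps)
          moreover have "\<bar>\<eta> (\<epsilon> n *\<^sub>R b + x) * Q (\<epsilon> n) x\<bar> \<le> M * \<bar>Q (\<epsilon> n) x\<bar>"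
            using M(2) by (auto simp: abs_mult intro!: mult_right_mono)
          moreover have "\<bar>(\<eta> (\<epsilon> n *\<^sub>R b + x) - \<eta> x) * (g x \<bullet> b)\<bar> \<le> L * \<epsilon> n * \<bar>g x \<bullet> b\<bar>"
            using lip[of "\<epsilon> n *\<^sub>R b + x" x] b \<epsilon>pos[of n] by (simp add: abs_mult mult_right_mono)
          ultimately have "\<bar>?E\<bar> \<le> M * \<bar>Q (\<epsilon> n) x\<bar> + L * \<epsilon> n * \<bar>g x \<bullet> b\<bar> + \<bar>w x * q n x\<bar>" by linarith
          then have "ennreal \<bar>?E\<bar> \<le> ennreal M * ennreal \<bar>Q (\<epsilon> n) x\<bar> + ennreal (L * \<epsilon> n) * ennreal \<bar>g x \<bullet> b\<bar> + ennreal \<bar>w x * q n x\<bar>"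
            using M(1) L0 \<epsilon>pos[of n] by (simp flip: ennreal_mult ennreal_plus add: ennreal_leI)
          then show ?thesis using True by (auto simp: indicator_def)
        qed
      qed
      then show ?case by (simp add: nn_integral_add nn_integral_cmult)
    qed
  qed auto
  qed measurable
qed

section \<open>Integrals of radial powers\<close>

lemma nn_integral_powr_from_0:
  fixes a \<delta> :: real
  assumes "0 < a" "0 \<le> \<delta>"
  shows "(\<integral>\<^sup>+t\<in>{0..\<delta>}. ennreal (t powr (a - 1)) \<partial>lborel) = ennreal (\<delta> powr a / a)"
proof -
  have "((\<lambda>t. t powr (a - 1)) has_integral (\<delta> powr (a - 1 + 1) / (a - 1 + 1))) {0..\<delta>}"
    using assms by (intro has_integral_powr_from_0) auto
  then have "(\<integral>\<^sup>+t. ennreal (t powr (a - 1)) * indicator {0..\<delta>} t \<partial>lborel) = ennreal (\<delta> powr a / a)"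
    using nn_integral_has_integral_lebesgue[of "{0..\<delta>}" "\<lambda>t. t powr (a - 1)" "\<delta> powr a / a"]
    by (simp add: nn_integral_completion ennreal_mult'' ennreal_indicator mult.commute)
  then show ?thesis .
qed

lemma nn_integral_powr_to_inf:
  fixes a \<delta> :: real
  assumes "0 < a" "0 < \<delta>"
  shows "(\<integral>\<^sup>+t\<in>{\<delta>..}. ennreal (t powr (- a - 1)) \<partial>lborel) = ennreal (\<delta> powr (- a) / a)"
proof -
  have "((\<lambda>t. t powr (- a - 1)) has_integral (- (\<delta> powr (- a - 1 + 1) / (- a - 1 + 1)))) {\<delta>..}"
    using has_integral_powr_to_inf[of "- a - 1" \<delta>] assms by simp
  then show ?thesis
    using nn_integral_has_integral_lebesgue[of "{\<delta>..}" "\<lambda>t. t powr (- a - 1)" "\<delta> powr (- a) / a"]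
    by (simp add: nn_integral_completion ennreal_mult'' ennreal_indicator mult.commute)
qed

text \<open>Polar coordinates for radial integrands. The two measures agree on the half-lines
  \<open>{..t}\<close> by the volume formula for balls, and half-lines form an intersection-stable
  generator. The factor of the density is the area of the unit sphere.\<close>

lemma distr_norm_lborel:
  "distr lborel borel (norm :: 'a::euclidean_space \<Rightarrow> real)
    = density lborel (\<lambda>t. ennreal (DIM('a) * unit_ball_vol DIM('a) * t powr (real DIM('a) - 1)) * indicator {0..} t)"
  (is "?M = ?N")
proof -
  let ?c = "DIM('a) * unit_ball_vol DIM('a)"
  have e: "emeasure ?M {..t} = ennreal (if 0 \<le> t then unit_ball_vol DIM('a) * t ^ DIM('a) else 0)" for t
  proof -
    have "emeasure ?M {..t} = emeasure lborel (norm -` {..t} :: 'a set)" by (simp add: emeasure_distr)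
    also have "norm -` {..t} = (cball 0 t :: 'a set)" by auto
    finally show ?thesis by (cases "0 \<le> t") (simp_all add: emeasure_cball)
  qed
  have f: "emeasure ?N {..t} = emeasure ?M {..t}" for t
  proof (cases "0 \<le> t")
    case True
    have "emeasure ?N {..t} = (\<integral>\<^sup>+s. ennreal (?c * s powr (real DIM('a) - 1)) * indicator {0..} s * indicator {..t} s \<partial>lborel)"
      by (simp add: emeasure_density)
    also have "\<dots> = (\<integral>\<^sup>+s. ennreal ?c * (ennreal (s powr (real DIM('a) - 1)) * indicator {0..t} s) \<partial>lborel)"
      by (intro nn_integral_cong) (auto simp: indicator_def ennreal_mult)
    also have "\<dots> = ennreal ?c * ennreal (t powr DIM('a) / DIM('a))"
      using nn_integral_powr_from_0[of "DIM('a)" t] True by (simp add: nn_integral_cmult)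
    also have "\<dots> = ennreal (unit_ball_vol DIM('a) * t ^ DIM('a))"
      using True by (cases "t = 0") (auto simp: powr_realpow zero_power simp flip: ennreal_mult)
    finally show ?thesis using True by (simp add: e)
  next
    case False
    have "emeasure ?N {..t} = (\<integral>\<^sup>+s. ennreal (?c * s powr (real DIM('a) - 1)) * indicator {0..} s * indicator {..t} s \<partial>lborel)"
      by (simp add: emeasure_density)
    also have "\<dots> = (\<integral>\<^sup>+s. 0 \<partial>(lborel :: real measure))"
      using False by (intro nn_integral_cong) (auto simp: indicator_def)
    finally show ?thesis using False by (simp add: e)
  qed
  have "range (\<lambda>n. {..real n}) \<subseteq> range (atMost :: real \<Rightarrow> _)" by auto
  show ?thesis
  proof (rule measure_eqI_generator_eq[of "range atMost" UNIV _ _ "\<lambda>n. {..real n}"])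
    show "Int_stable (range atMost :: real set set)" by (auto simp: Int_stable_def)
    show "sets ?M = sigma_sets UNIV (range atMost)" "sets ?N = sigma_sets UNIV (range atMost)"
      by (simp_all add: borel_eq_atMost)
    show "(\<Union>n. {..real n}) = UNIV" using real_arch_simple by auto
    show "emeasure ?M {..real n} \<noteq> \<infinity>" for n by (simp add: e)
  qed (use f in auto)
qed

lemma nn_integral_radial:
  fixes f :: "real \<Rightarrow> ennreal"
  assumes [measurable]: "f \<in> borel_measurable borel"
  shows "(\<integral>\<^sup>+h. f (norm h) \<partial>(lborel :: 'a::euclidean_space measure))
    = ennreal (DIM('a) * unit_ball_vol DIM('a)) * (\<integral>\<^sup>+t\<in>{0..}. ennreal (t powr (real DIM('a) - 1)) * f t \<partial>lborel)"
proof -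
  have "(\<integral>\<^sup>+h. f (norm h) \<partial>(lborel :: 'a measure)) = (\<integral>\<^sup>+t. f t \<partial>distr lborel borel (norm :: 'a \<Rightarrow> real))"
    by (simp add: nn_integral_distr)
  also have "\<dots> = (\<integral>\<^sup>+t. ennreal (DIM('a) * unit_ball_vol DIM('a)) * (ennreal (t powr (real DIM('a) - 1)) * f t * indicator {0..} t) \<partial>lborel)"
    unfolding distr_norm_lborel
    by (subst nn_integral_density) (auto intro!: nn_integral_cong simp: ennreal_mult mult_ac)
  finally show ?thesis by (simp add: nn_integral_cmult)
qed

text \<open>Used with a = s p for the part of the kernel away from the diagonal; division by
  \<open>a\<close> is the origin of the factor 1/s.\<close>

lemma nn_integral_norm_powr_outside:
  fixes a \<delta> :: real
  assumes a: "0 < a" and \<delta>: "0 < \<delta>"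
  shows "(\<integral>\<^sup>+h. ennreal (1 / norm h powr (DIM('a) + a)) * indicator {h. \<delta> \<le> norm h} h \<partial>(lborel :: 'a::euclidean_space measure))
    = ennreal (DIM('a) * unit_ball_vol DIM('a) * (\<delta> powr (- a) / a))"
proof -
  have "(\<integral>\<^sup>+h. ennreal (1 / norm h powr (DIM('a) + a)) * indicator {h. \<delta> \<le> norm h} h \<partial>(lborel :: 'a measure))
    = (\<integral>\<^sup>+h. ennreal (1 / norm h powr (DIM('a) + a)) * indicator {\<delta>..} (norm h) \<partial>(lborel :: 'a measure))"
    by (intro nn_integral_cong) (auto simp: indicator_def)
  also have "\<dots> = ennreal (DIM('a) * unit_ball_vol DIM('a)) *
      (\<integral>\<^sup>+t\<in>{0..}. ennreal (t powr (real DIM('a) - 1)) * (ennreal (1 / t powr (DIM('a) + a)) * indicator {\<delta>..} t) \<partial>lborel)"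
    by (rule nn_integral_radial) measurable
  also have "(\<integral>\<^sup>+t\<in>{0..}. ennreal (t powr (real DIM('a) - 1)) * (ennreal (1 / t powr (DIM('a) + a)) * indicator {\<delta>..} t) \<partial>lborel)
    = (\<integral>\<^sup>+t\<in>{\<delta>..}. ennreal (t powr (- a - 1)) \<partial>lborel)"
  proof (intro nn_integral_cong)
    fix t :: real
    have "t powr (real DIM('a) - 1) * (1 / t powr (DIM('a) + a)) = t powr (- a - 1)" if "0 < t"
      using that by (simp add: powr_diff[symmetric] minus_diff_commute)
    then show "ennreal (t powr (real DIM('a) - 1)) * (ennreal (1 / t powr (DIM('a) + a)) * indicator {\<delta>..} t) * indicator {0..} t
      = ennreal (t powr (- a - 1)) * indicator {\<delta>..} t"
      using \<delta> by (cases "\<delta> \<le> t") (simp_all flip: ennreal_mult)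
  qed
  also have "\<dots> = ennreal (\<delta> powr (- a) / a)" using a \<delta> by (rule nn_integral_powr_to_inf)
  finally show ?thesis using a by (simp flip: ennreal_mult)
qed

text \<open>Used with a = p (1 - s), the exponent left after |h|^p has compensated the singularity
  of the kernel; this is the origin of 1/(1 - s).\<close>

lemma nn_integral_norm_powr_inside:
  fixes a \<delta> :: real
  assumes a: "0 < a" and \<delta>: "0 < \<delta>"
  shows "(\<integral>\<^sup>+h. ennreal (norm h powr (a - DIM('a))) * indicator {h. norm h \<le> \<delta>} h \<partial>(lborel :: 'a::euclidean_space measure))
    = ennreal (DIM('a) * unit_ball_vol DIM('a) * (\<delta> powr a / a))"
proof -
  have "(\<integral>\<^sup>+h. ennreal (norm h powr (a - DIM('a))) * indicator {h. norm h \<le> \<delta>} h \<partial>(lborel :: 'a measure))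
    = (\<integral>\<^sup>+h. ennreal (norm h powr (a - DIM('a))) * indicator {..\<delta>} (norm h) \<partial>(lborel :: 'a measure))"
    by (intro nn_integral_cong) (auto simp: indicator_def)
  also have "\<dots> = ennreal (DIM('a) * unit_ball_vol DIM('a)) *
      (\<integral>\<^sup>+t\<in>{0..}. ennreal (t powr (real DIM('a) - 1)) * (ennreal (t powr (a - DIM('a))) * indicator {..\<delta>} t) \<partial>lborel)"
    by (rule nn_integral_radial) measurable
  also have "(\<integral>\<^sup>+t\<in>{0..}. ennreal (t powr (real DIM('a) - 1)) * (ennreal (t powr (a - DIM('a))) * indicator {..\<delta>} t) \<partial>lborel)
    = (\<integral>\<^sup>+t\<in>{0..\<delta>}. ennreal (t powr (a - 1)) \<partial>lborel)"
  proof (intro nn_integral_cong)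
    fix t :: real
    have "t powr (real DIM('a) - 1) * t powr (a - DIM('a)) = t powr (a - 1)"
      by (simp flip: powr_add)
    then show "ennreal (t powr (real DIM('a) - 1)) * (ennreal (t powr (a - DIM('a))) * indicator {..\<delta>} t) * indicator {0..} t
      = ennreal (t powr (a - 1)) * indicator {0..\<delta>} t"
      by (auto simp: indicator_def simp flip: ennreal_mult)
  qed
  also have "\<dots> = ennreal (\<delta> powr a / a)" using a \<delta> by (intro nn_integral_powr_from_0) auto
  finally show ?thesis using a by (simp flip: ennreal_mult)
qed

section \<open>Pointwise inequalities\<close>

text \<open>Young's inequality for l x and y / l^(p - 1), where l^p = 1/2. Halving the first
  coefficient leaves half of the good gradient term over in \<open>local_term_le\<close>, and that
  half becomes the gradient of the logarithm.\<close>

lemma Young_powr_half: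
  fixes x y p :: real
  assumes p: "1 < p" and "0 \<le> x" "0 \<le> y"
  shows "p * x powr (p - 1) * y \<le> (p - 1) / 2 * x powr p + 2 powr (p - 1) * y powr p"
proof -
  define l where "l = 2 powr (- 1 / p)"
  have "l powr p = 2 powr (- 1 / p * p)" unfolding l_def by (rule powr_powr)
  also have "\<dots> = 1 / 2" using p by (simp add: powr_neg_one)
  finally have l: "0 < l" "l powr p = 1 / 2" by (simp_all add: l_def)
  have "(l powr (p - 1)) powr p = (l powr p) powr (p - 1)" by (simp add: powr_powr mult.commute)
  then have l2: "1 / (l powr (p - 1)) powr p = 2 powr (p - 1)" by (simp add: l(2) powr_divide)
  have "p * x powr (p - 1) * y = p * (l * x) powr (p - 1) * (y / l powr (p - 1))"
    using l(1) assms by (simp add: powr_mult)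
  also have "\<dots> \<le> (p - 1) * (l * x) powr p + (y / l powr (p - 1)) powr p"
    using l(1) assms by (intro Young_powr_diff) auto
  also have "\<dots> = (p - 1) / 2 * x powr p + 2 powr (p - 1) * y powr p"
    using l(1) assms by (simp add: powr_mult powr_divide l(2) l2[symmetric])
  finally show ?thesis .
qed

text \<open>That is, sinh x \<ge> x. The derivative of the difference is a perfect square. Used at
  half the logarithm in \<open>log_inequality_ordered\<close>.\<close>

lemma two_sinh_ge: 
  fixes x :: real
  assumes "0 \<le> x" shows "2 * x \<le> exp x - exp (- x)"
proof -
  have "(\<lambda>x. exp x - exp (- x) - 2 * x) 0 \<le> (\<lambda>x. exp x - exp (- x) - 2 * x) x"
  proof (rule DERIV_nonneg_imp_nondecreasing[OF assms])
    fix t :: real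
    have "0 \<le> (exp (t / 2) - exp (- t / 2))\<^sup>2" by simp
    also have "\<dots> = exp t + exp (- t) - 2"
      by (simp add: power2_eq_square algebra_simps flip: exp_add)
    finally show "\<exists>y. ((\<lambda>x. exp x - exp (- x) - 2 * x) has_real_derivative y) (at t) \<and> 0 \<le> y"
      by (intro exI[of _ "exp t + exp (- t) - 2"]) (auto intro!: derivative_eq_intros)
  qed
  then show ?thesis by simp
qed

text \<open>Convexity of t^p at the points y / l and |x - y| / (1 - l) with weights \<open>l\<close>
  and 1 - \<open>l\<close>. The cases in which one of these points is 0 are direct.\<close>

lemma powr_le_weighted:
  fixes x y l p :: real
  assumes p: "1 < p" and l: "0 < l" "l < 1" and "0 \<le> x" "0 \<le> y"
  shows "x powr p \<le> l powr (1 - p) * y powr p + (1 - l) powr (1 - p) * \<bar>x - y\<bar> powr p"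
proof (cases "y = 0 \<or> x = y")
  case True
  have one: "1 \<le> c powr (1 - p)" if "0 < c" "c < 1" for c :: real
    using powr_mono2'[of "1 - p" c 1] p that by simp
  show ?thesis
  proof (cases "x = y")
    case True
    then show ?thesis using mult_right_mono[OF one[of l], of "x powr p"] l p by simp
  next
    case False
    with True have "y = 0" by simp
    then show ?thesis using mult_right_mono[OF one[of "1 - l"], of "x powr p"] l p assms by simp
  qed
next
  case False
  have "x powr p \<le> (l *\<^sub>R (y / l) + (1 - l) *\<^sub>R (\<bar>x - y\<bar> / (1 - l))) powr p"
    using assms by (intro powr_mono2) auto
  also have "\<dots> \<le> l * (y / l) powr p + (1 - l) * (\<bar>x - y\<bar> / (1 - l)) powr p"
    using assms False convex_onD[OF powr_convex[of p], of "1 - l" "y / l" "\<bar>x - y\<bar> / (1 - l)"] by simp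
  also have "\<dots> = l powr (1 - p) * y powr p + (1 - l) powr (1 - p) * \<bar>x - y\<bar> powr p"
    using assms by (simp add: powr_divide powr_diff)
  finally show ?thesis .
qed

text \<open>The interpolation weight \<open>1 - \<sigma> / 2\<close> with \<open>\<sigma> = 1 - b / a\<close> is what leaves room for the logarithm:
  the weight \<open>1 - \<sigma>\<close> would give the inequality without the last term.\<close>

lemma log_inequality_ordered:
  fixes a b x y p :: real
  assumes p: "1 < p" and ab: "0 < b" "b \<le> a" and xy: "0 \<le> x" "0 \<le> y"
  shows "(a - b) powr (p - 1) * (x powr p * a powr (1 - p) - y powr p * b powr (1 - p))
    \<le> 2 powr (p - 1) * \<bar>x - y\<bar> powr p - (p - 1) / 2 * y powr p * ln (a / b) powr p"
proof (cases "a = b")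
  case False
  with ab have "b < a" by simp
  define s where "s = 1 - b / a"
  have s: "0 < s" "s < 1" using \<open>b < a\<close> ab by (auto simp: s_def)
  define l where "l = ln (a / b)"
  have l: "0 < l" using \<open>b < a\<close> ab by (simp add: l_def)
  have el: "exp l = a / b" using ab by (simp add: l_def)
  have ws: "1 - s = exp (- l)" using ab by (simp add: s_def exp_minus el)
  have 1: "(a - b) powr (p - 1) * a powr (1 - p) = s powr (p - 1)"
  proof -
    have "s = (a - b) / a" using ab by (simp add: s_def field_simps)
    then show ?thesis using ab by (simp add: powr_divide powr_diff[of a 1 p] powr_diff[of a p 1])
  qed
  have 2: "(a - b) powr (p - 1) * b powr (1 - p) = s powr (p - 1) * (1 - s) powr (1 - p)"
  proof -
    have "(a - b) powr (p - 1) * b powr (1 - p) = s powr (p - 1) * (a powr (p - 1) * b powr (1 - p))"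
      using ab by (simp add: 1[symmetric] flip: powr_add)
    also have "a powr (p - 1) * b powr (1 - p) = (1 - s) powr (1 - p)"
      using ab by (simp add: s_def powr_divide powr_diff[of _ 1 p] powr_diff[of _ p 1])
    finally show ?thesis .
  qed
  \<comment> \<open>The second coefficient (s/2)^(1 - p) blows up as s tends to 0, but only in the
    proportion that the common factor s^(p - 1) cancels, leaving 2^(p - 1).\<close>
  have w: "x powr p \<le> (1 - s / 2) powr (1 - p) * y powr p + (s / 2) powr (1 - p) * \<bar>x - y\<bar> powr p"
    using powr_le_weighted[OF p, of "1 - s / 2" x y] s xy by simp
  have "s powr (p - 1) * (s / 2) powr (1 - p) = 2 powr (p - 1)"
    using s by (simp add: powr_divide powr_diff[of _ 1 p] powr_diff[of _ p 1])
  with mult_left_mono[OF w, of "s powr (p - 1)"]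
  have 3: "s powr (p - 1) * x powr p \<le> s powr (p - 1) * (1 - s / 2) powr (1 - p) * y powr p + 2 powr (p - 1) * \<bar>x - y\<bar> powr p"
    by (simp add: distrib_left mult.assoc[symmetric])
  \<comment> \<open>Put k = p - 1 and E = e^(k l / 2), so that (1 - s)^(-k) = E^2. By the
    arithmetic-geometric mean inequality for 1 and 1 - s = e^(-l), 1 - s/2 \<ge> e^(-l/2), hence (1
    - s/2)^(-k) \<le> E. The difference is thus at least E (E - 1) \<ge> E k l / 2. Finally l \<le>
    s e^(l/2), so s^k E \<ge> l^k.\<close>
  have 4: "(p - 1) / 2 * l powr p \<le> s powr (p - 1) * ((1 - s) powr (1 - p) - (1 - s / 2) powr (1 - p))"
  proof -
    define k where "k = p - 1"
    have k: "0 < k" using p by (simp add: k_def)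
    have "0 \<le> (1 - exp (- l / 2))\<^sup>2" by simp
    also have "\<dots> = 1 + exp (- l) - 2 * exp (- l / 2)"
      by (simp add: power2_eq_square algebra_simps flip: exp_add)
    finally have "exp (- l / 2) \<le> 1 - s / 2" using ws by (simp add: field_simps)
    then have "(1 - s / 2) powr (1 - p) \<le> exp (- l / 2) powr (1 - p)"
      using p by (intro powr_mono2') auto
    also have "\<dots> = exp (k * l / 2)" by (simp add: powr_def k_def field_simps)
    finally have A: "(1 - s / 2) powr (1 - p) \<le> exp (k * l / 2)" .
    have B: "(1 - s) powr (1 - p) = exp (k * l / 2) * exp (k * l / 2)"
      by (simp add: ws powr_def k_def flip: exp_add) (simp add: field_simps)
    have "k * l / 2 \<le> exp (k * l / 2) - 1" using exp_ge_add_one_self[of "k * l / 2"] by linarith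
    then have "exp (k * l / 2) * (k * l / 2) \<le> exp (k * l / 2) * (exp (k * l / 2) - 1)"
      by (intro mult_left_mono) auto
    also have "\<dots> \<le> (1 - s) powr (1 - p) - (1 - s / 2) powr (1 - p)"
      using A B by (simp add: algebra_simps)
    finally have C: "s powr k * (exp (k * l / 2) * (k * l / 2)) \<le> s powr k * ((1 - s) powr (1 - p) - (1 - s / 2) powr (1 - p))"
      by (intro mult_left_mono) auto
    have "l \<le> exp (l / 2) - exp (- (l / 2))" using two_sinh_ge[of "l / 2"] l by simp
    also have "\<dots> = s * exp (l / 2)"
    proof -
      have "s = 1 - exp (- l)" using ws by simp
      then show ?thesis by (simp add: left_diff_distrib flip: exp_add)
    qed
    finally have "l powr k \<le> (s * exp (l / 2)) powr k" using l k by (intro powr_mono2) auto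
    also have "\<dots> = s powr k * exp (k * l / 2)" using s by (simp add: powr_mult powr_def[of "exp _"])
    finally have "l powr k * (k * l / 2) \<le> s powr k * exp (k * l / 2) * (k * l / 2)"
      using k l by (intro mult_right_mono) auto
    moreover have "l powr k * (k * l / 2) = (p - 1) / 2 * l powr p"
      using l by (simp add: k_def powr_diff)
    ultimately show ?thesis using C unfolding k_def mult.assoc by linarith
  qed
  have "(a - b) powr (p - 1) * (x powr p * a powr (1 - p) - y powr p * b powr (1 - p))
    = s powr (p - 1) * x powr p - s powr (p - 1) * (1 - s) powr (1 - p) * y powr p"
  proof -
    have "(a - b) powr (p - 1) * (x powr p * a powr (1 - p) - y powr p * b powr (1 - p))
      = ((a - b) powr (p - 1) * a powr (1 - p)) * x powr p - ((a - b) powr (p - 1) * b powr (1 - p)) * y powr p"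
      by (simp add: algebra_simps)
    then show ?thesis by (simp only: 1 2)
  qed
  also have "\<dots> \<le> 2 powr (p - 1) * \<bar>x - y\<bar> powr p
      - s powr (p - 1) * ((1 - s) powr (1 - p) - (1 - s / 2) powr (1 - p)) * y powr p"
    using 3 by (simp add: algebra_simps)
  also have "\<dots> \<le> 2 powr (p - 1) * \<bar>x - y\<bar> powr p - (p - 1) / 2 * l powr p * y powr p"
    using mult_right_mono[OF 4, of "y powr p"] by simp
  finally show ?thesis by (simp add: l_def mult_ac)
qed (use p in simp)

text \<open>Exchanging the two points reverses both differences, so the ordered case applies to
  either order. There the logarithm carries the cutoff value belonging to the smaller of
  \<open>a\<close> and \<open>b\<close>; the minimum is below both and makes the bound
  symmetric.\<close>

lemma log_inequality:
  fixes a b x y p :: real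
  assumes p: "1 < p" and ab: "0 < a" "0 < b" and xy: "0 \<le> x" "0 \<le> y"
  shows "\<bar>a - b\<bar> powr (p - 2) * (a - b) * (x powr p * a powr (1 - p) - y powr p * b powr (1 - p))
    \<le> 2 powr (p - 1) * \<bar>x - y\<bar> powr p - (p - 1) / 2 * min x y powr p * \<bar>ln (a / b)\<bar> powr p"
proof -
  have eq: "t powr (p - 2) * t = t powr (p - 1)" if "0 \<le> t" for t :: real
    using that powr_mult_base[of t "p - 2"] by (simp add: mult.commute)
  have m: "(p - 1) / 2 * min x y powr p * t \<le> (p - 1) / 2 * z powr p * t"
    if "0 \<le> t" "min x y \<le> z" for t z
    using p xy that by (intro mult_right_mono mult_left_mono powr_mono2) auto
  show ?thesis
  proof (cases "b \<le> a")
    case True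
    have "\<bar>ln (a / b)\<bar> = ln (a / b)" using True ab by simp
    then show ?thesis
      using log_inequality_ordered[OF p ab(2) True xy] m[of "ln (a / b) powr p" y] True by (simp add: eq)
  next
    case False
    then have "a \<le> b" by simp
    have l: "\<bar>ln (a / b)\<bar> = ln (b / a)" using \<open>a \<le> b\<close> ab by (simp add: ln_div)
    have "\<bar>a - b\<bar> powr (p - 2) * (a - b) = - ((b - a) powr (p - 2) * (b - a))"
      using \<open>a \<le> b\<close> by (simp add: minus_mult_right)
    also have "\<dots> = - ((b - a) powr (p - 1))" using eq[of "b - a"] \<open>a \<le> b\<close> by simp
    finally have "\<bar>a - b\<bar> powr (p - 2) * (a - b) * (x powr p * a powr (1 - p) - y powr p * b powr (1 - p))
        = (b - a) powr (p - 1) * (y powr p * b powr (1 - p) - x powr p * a powr (1 - p))"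
      by (simp only:) (simp add: algebra_simps)
    also have "\<dots> \<le> 2 powr (p - 1) * \<bar>y - x\<bar> powr p - (p - 1) / 2 * x powr p * ln (b / a) powr p"
      by (rule log_inequality_ordered[OF p ab(1) \<open>a \<le> b\<close> xy(2,1)])
    also have "\<dots> \<le> 2 powr (p - 1) * \<bar>x - y\<bar> powr p - (p - 1) / 2 * min x y powr p * ln (b / a) powr p"
      using m[of "ln (b / a) powr p" x] by (simp add: abs_minus_commute)
    finally show ?thesis unfolding l .
  qed
qed

text \<open>The crude constant is valid for every positive exponent, in particular for p - 1 < 1,
  where t^(p - 1) is not convex.\<close>

lemma powr_add_le:
  fixes x y q :: real
  assumes "0 \<le> x" "0 \<le> y" "0 < q"
  shows "(x + y) powr q \<le> 2 powr q * (x powr q + y powr q)"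
proof -
  have "(x + y) powr q \<le> (2 * max x y) powr q" using assms by (intro powr_mono2) auto
  also have "\<dots> = 2 powr q * max x y powr q" using assms by (simp add: powr_mult)
  also have "max x y powr q \<le> x powr q + y powr q" by (simp add: max_def)
  finally show ?thesis by simp
qed

section \<open>The measure on the exponents\<close>

text \<open>After s (1 - s) is factored out, the rest is continuous on the closed unit interval, all
  arguments of \<open>Gamma\<close> staying positive there; compactness bounds it.\<close>

lemma normalization_bounds:
  fixes N p :: real
  assumes "0 < N" "1 < p"
  shows "\<exists>C>0. \<forall>s\<in>{0<..<1}. 0 \<le> normalization N p s \<and> normalization N p s \<le> C * (s * (1 - s))"
    "continuous_on {0..1} (normalization N p)"
proof -
  define H where "H s = p / 2 * 2 powr (2 * s - 1) / pi powr ((N - 1) / 2)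
     * (Gamma ((N + p * s) / 2) / (Gamma ((p + 1) / 2) * Gamma (2 - s)))" for s :: real
  have eq: "normalization N p s = s * (1 - s) * H s" for s
    by (simp add: normalization_def H_def)
  have pos: "0 < (N + p * s) / 2" "0 < 2 - s" "0 < (p + 1) / 2" if "s \<in> {0..1}" for s
    using assms that by (auto intro!: add_pos_nonneg)
  have nn: "z \<notin> \<int>\<^sub>\<le>\<^sub>0" if "0 < z" for z :: real using that by (auto simp: nonpos_Ints_def)
  have G: "0 < Gamma ((N + p * s) / 2)" "0 < Gamma (2 - s)" "0 < Gamma ((p + 1) / 2)" if "s \<in> {0..1}" for s
    using pos[OF that] by (auto intro!: Gamma_real_pos)
  have cG: "continuous_on {0<..} (Gamma :: real \<Rightarrow> real)" using nn by (intro continuous_on_Gamma) auto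
  have cont: "continuous_on {0..1} H"
    unfolding H_def using pos G
    by (intro continuous_intros continuous_on_compose2[OF cG]) (auto simp: less_imp_neq[THEN not_sym])
  then show "continuous_on {0..1} (normalization N p)"
    unfolding eq[abs_def] by (intro continuous_intros)
  have "bounded (H ` {0..1})"
    by (intro compact_imp_bounded compact_continuous_image cont) auto
  then obtain C where "\<forall>s\<in>{0..1}. \<bar>H s\<bar> \<le> C" by (auto simp: bounded_iff)
  then have C: "\<And>s. s \<in> {0..1} \<Longrightarrow> \<bar>H s\<bar> \<le> C" by blast
  have H0: "0 \<le> H s" if "s \<in> {0..1}" for s
    unfolding H_def using G[OF that] assms by (intro mult_nonneg_nonneg divide_nonneg_nonneg) auto
  show "\<exists>C>0. \<forall>s\<in>{0<..<1}. 0 \<le> normalization N p s \<and> normalization N p s \<le> C * (s * (1 - s))"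
  proof (intro exI[of _ "max C 1"] conjI ballI)
    fix s :: real assume s: "s \<in> {0<..<1}"
    then show "0 \<le> normalization N p s" using H0[of s] by (simp add: eq)
    have "H s \<le> max C 1" using C[of s] s by auto
    then show "normalization N p s \<le> max C 1 * (s * (1 - s))"
      using s by (simp add: eq mult.commute[of _ "s * (1 - s)"] mult_left_mono)
  qed auto
qed

text \<open>The complement of the support is covered by the null sets of a countable basis. This
  lets the supremum over the support bound r^(-s p) for almost every s.\<close>

lemma AE_in_support:
  fixes \<mu> :: "real measure"
  assumes sets: "sets \<mu> = sets (restrict_space borel A)" and [measurable]: "A \<in> sets borel"
  shows "AE s in \<mu>. s \<in> support \<mu>"
proof -
  have sp: "space \<mu> = A" using sets_eq_imp_space_eq[OF sets] by (simp add: space_restrict_space)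
  have sets_Int: "V \<inter> A \<in> sets \<mu>" if "open V" for V
    unfolding sets using that by (subst sets_restrict_space_iff) auto
  obtain B :: "real set set" where B: "countable B" "topological_basis B" using ex_countable_basis by blast
  let ?B = "{b \<in> B. emeasure \<mu> (b \<inter> A) = 0}"
  have "(\<Union>b\<in>?B. b \<inter> A) \<in> null_sets \<mu>"
  proof (intro null_sets_UN')
    show "countable ?B" using B(1) by simp
    fix b assume b: "b \<in> ?B"
    then have "open b" using B(2) topological_basis_open by blast
    then show "b \<inter> A \<in> null_sets \<mu>" using b sets_Int by (auto simp: null_sets_def)
  qed
  then have "AE s in \<mu>. s \<notin> (\<Union>b\<in>?B. b \<inter> A)" by (rule AE_not_in)
  then show ?thesis
  proof (rule AE_mp, intro AE_I2 impI)
    fix s assume s: "s \<in> space \<mu>" "s \<notin> (\<Union>b\<in>?B. b \<inter> A)"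
    show "s \<in> support \<mu>"
      unfolding support_def
    proof (intro CollectI conjI s allI impI)
      fix U :: "real set" assume U: "open U \<and> s \<in> U"
      obtain b where b: "b \<in> B" "s \<in> b" "b \<subseteq> U" by (rule topological_basisE[OF B(2), of U s]) (use U in auto)
      then have "open b" using B(2) topological_basis_open by blast
      then have "0 < emeasure \<mu> (b \<inter> A)" using s b sp by (auto simp: zero_less_iff_neq_zero)
      also have "emeasure \<mu> (b \<inter> A) \<le> emeasure \<mu> (U \<inter> space \<mu>)"
        using b(3) U by (intro emeasure_mono) (auto simp: sp intro: sets_Int)
      finally show "0 < emeasure \<mu> (U \<inter> space \<mu>)" .
    qed
  qed
qed

text \<open>Since the normalization constant is at most a multiple of \<open>s (1 - s)\<close>, the function
  \<open>1 / s + 1 / (1 - s)\<close>, which carries the blow-up of all radial integrals, is integrable for this measure.\<close>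

definition weighted_exponents :: "real measure \<Rightarrow> real \<Rightarrow> real \<Rightarrow> real measure" where
  "weighted_exponents \<mu> N p =
     density (distr \<mu> borel (\<lambda>s. s)) (\<lambda>s. ennreal (normalization N p s * indicator {0<..<1} s))"

context
  fixes \<mu> :: "real measure" and N p :: real
  assumes sets: "sets \<mu> = sets (restrict_space borel {0..1})" and fin: "finite_measure \<mu>" and N: "0 < N" and p: "1 < p"
begin

lemma space_exponents: "space \<mu> = {0..1}"
  using sets_eq_imp_space_eq[OF sets] by (simp add: space_restrict_space)

lemma measurable_exponents: "(\<lambda>s. s) \<in> borel_measurable \<mu>"
  by (subst measurable_cong_sets[OF sets refl]) (simp add: measurable_restrict_space1)

lemma normalization_measurable:
  "(\<lambda>s. normalization N p s * indicator {0<..<1} s) \<in> borel_measurable borel"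
proof -
  have "(\<lambda>s. indicator {0..1} s *\<^sub>R normalization N p s) \<in> borel_measurable borel"
    using normalization_bounds(2)[OF N p] by (intro borel_measurable_continuous_on_indicator) auto
  then have "(\<lambda>s. (indicator {0..1} s *\<^sub>R normalization N p s) * indicator {0<..<1} s) \<in> borel_measurable borel"
    by measurable
  then show ?thesis
    by (rule back_subst[of "\<lambda>f. f \<in> borel_measurable borel"]) (auto simp: indicator_def fun_eq_iff)
qed

lemma normalization_nonneg: "0 \<le> normalization N p s * indicator {0<..<1} s"
  using normalization_bounds(1)[OF N p] by (auto simp: indicator_def)

lemma sets_weighted_exponents [simp]: "sets (weighted_exponents \<mu> N p) = sets borel"
  by (simp add: weighted_exponents_def)

lemma nn_integral_weighted_exponents:
  assumes [measurable]: "G \<in> borel_measurable borel"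
  shows "(\<integral>\<^sup>+s. G s \<partial>weighted_exponents \<mu> N p) = (\<integral>\<^sup>+s\<in>{0<..<1}. ennreal (normalization N p s) * G s \<partial>\<mu>)"
proof -
  define c where "c s = normalization N p s * indicator {0<..<1} s" for s
  have [measurable]: "c \<in> borel_measurable borel" unfolding c_def[abs_def] by (rule normalization_measurable)
  note [measurable] = measurable_exponents
  have "(\<integral>\<^sup>+s. G s \<partial>weighted_exponents \<mu> N p) = (\<integral>\<^sup>+s. ennreal (c s) * G s \<partial>\<mu>)"
    unfolding weighted_exponents_def c_def[symmetric] by (simp add: nn_integral_density nn_integral_distr)
  also have "\<dots> = (\<integral>\<^sup>+s\<in>{0<..<1}. ennreal (normalization N p s) * G s \<partial>\<mu>)"
    by (intro nn_integral_cong) (auto simp: c_def indicator_def)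
  finally show ?thesis .
qed

lemma integral_weighted_exponents:
  fixes G :: "real \<Rightarrow> real"
  assumes [measurable]: "G \<in> borel_measurable borel"
  shows "(LINT s|weighted_exponents \<mu> N p. G s) = (LINT s:{0<..<1}|\<mu>. normalization N p s * G s)"
proof -
  define c where "c s = normalization N p s * indicator {0<..<1} s" for s
  have [measurable]: "c \<in> borel_measurable borel" unfolding c_def[abs_def] by (rule normalization_measurable)
  note [measurable] = measurable_exponents
  have c_nonneg: "0 \<le> c s" for s unfolding c_def by (rule normalization_nonneg)
  have "(LINT s|weighted_exponents \<mu> N p. G s) = (LINT s|distr \<mu> borel (\<lambda>s. s). c s *\<^sub>R G s)"
    unfolding weighted_exponents_def c_def[symmetric]
    by (intro integral_density) (auto simp: c_nonneg)
  also have "\<dots> = (LINT s|\<mu>. c s *\<^sub>R G s)"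
    by (intro integral_distr) measurable
  finally show ?thesis by (simp add: c_def set_lebesgue_integral_def mult_ac)
qed

lemma AE_weighted_exponents:
  "AE s in weighted_exponents \<mu> N p. 0 < s \<and> s < 1" "AE s in weighted_exponents \<mu> N p. s \<in> support \<mu>"
proof -
  have c: "(\<lambda>s. ennreal (normalization N p s * indicator {0<..<1} s)) \<in> borel_measurable (distr \<mu> borel (\<lambda>s. s))"
    unfolding measurable_distr_eq1 using measurable_compose[OF normalization_measurable measurable_ennreal] .
  show "AE s in weighted_exponents \<mu> N p. 0 < s \<and> s < 1"
    unfolding weighted_exponents_def by (subst AE_density[OF c]) (auto simp: indicator_def)
  note [measurable] = measurable_exponents
  have "AE s in \<mu>. s \<in> support \<mu>" using AE_in_support[OF sets] by simp
  then obtain M where M: "\<And>s. s \<in> space \<mu> - M \<Longrightarrow> s \<in> support \<mu>" "M \<in> null_sets \<mu>"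
    by (rule AE_E3) blast
  then have "M \<in> sets \<mu>" by auto
  then have "M \<in> sets borel" by (auto simp: sets sets_restrict_space)
  moreover have "emeasure (distr \<mu> borel (\<lambda>s. s)) M = 0"
  proof -
    have "(\<lambda>s. s) -` M \<inter> space \<mu> = M" using sets.sets_into_space[OF \<open>M \<in> sets \<mu>\<close>] by auto
    then show ?thesis using M(2) \<open>M \<in> sets borel\<close> by (subst emeasure_distr) auto
  qed
  ultimately have "AE s in distr \<mu> borel (\<lambda>s. s). s \<notin> M" by (intro AE_not_in) (auto simp: null_sets_def)
  then have "AE s in distr \<mu> borel (\<lambda>s. s). 0 < ennreal (normalization N p s * indicator {0<..<1} s) \<longrightarrow> s \<in> support \<mu>"
    by eventually_elim (use M(1) space_exponents in \<open>auto simp: indicator_def split: if_splits\<close>)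
  then show "AE s in weighted_exponents \<mu> N p. s \<in> support \<mu>"
    unfolding weighted_exponents_def by (subst AE_density[OF c])
qed

text \<open>As s (1 - s) (1/s + 1/(1 - s)) = 1, the integral is at most the constant of
  \<open>normalization_bounds\<close> times the mass of \<mu>. The summand 1 keeps the bound
  positive.\<close>

lemma weighted_exponents_bound:
  "\<exists>A>0. (\<integral>\<^sup>+s. ennreal (1 / s + 1 / (1 - s)) \<partial>weighted_exponents \<mu> N p) \<le> ennreal A"
proof -
  obtain C where C: "C > 0" "\<And>s. s \<in> {0<..<1} \<Longrightarrow> 0 \<le> normalization N p s \<and> normalization N p s \<le> C * (s * (1 - s))"
    using normalization_bounds(1)[OF N p] by blast
  have "(\<integral>\<^sup>+s. ennreal (1 / s + 1 / (1 - s)) \<partial>weighted_exponents \<mu> N p)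
      = (\<integral>\<^sup>+s\<in>{0<..<1}. ennreal (normalization N p s) * ennreal (1 / s + 1 / (1 - s)) \<partial>\<mu>)"
    by (rule nn_integral_weighted_exponents) measurable
  also have "\<dots> \<le> (\<integral>\<^sup>+s. ennreal C \<partial>\<mu>)"
  proof (intro nn_integral_mono)
    fix s
    show "ennreal (normalization N p s) * ennreal (1 / s + 1 / (1 - s)) * indicator {0<..<1} s \<le> ennreal C"
    proof (cases "s \<in> {0<..<1}")
      case True
      have "normalization N p s * (1 / s + 1 / (1 - s)) \<le> C * (s * (1 - s)) * (1 / s + 1 / (1 - s))"
        using C(2)[OF True] True by (intro mult_right_mono) auto
      also have "\<dots> = C" using True by (simp add: field_simps)
      finally have "ennreal (normalization N p s * (1 / s + 1 / (1 - s))) \<le> ennreal C" by (rule ennreal_leI)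
      moreover have "ennreal (normalization N p s * (1 / s + 1 / (1 - s))) = ennreal (normalization N p s) * ennreal (1 / s + 1 / (1 - s))"
        using True C(2)[OF True] by (intro ennreal_mult) auto
      ultimately show ?thesis using True by simp
    qed simp
  qed
  also have "\<dots> = ennreal (C * measure \<mu> (space \<mu>))"
    using C(1) finite_measure.emeasure_eq_measure[OF fin] by (simp add: ennreal_mult)
  also have "\<dots> \<le> ennreal (C * measure \<mu> (space \<mu>) + 1)" by (intro ennreal_leI) simp
  finally show ?thesis using C(1) by (intro exI[of _ "C * measure \<mu> (space \<mu>) + 1"]) (auto intro: add_nonneg_pos)
qed

lemma finite_measure_weighted_exponents: "finite_measure (weighted_exponents \<mu> N p)"
proof (rule finite_measureI)
  obtain A where A: "(\<integral>\<^sup>+s. ennreal (1 / s + 1 / (1 - s)) \<partial>weighted_exponents \<mu> N p) \<le> ennreal A"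
    using weighted_exponents_bound by blast
  have "emeasure (weighted_exponents \<mu> N p) (space (weighted_exponents \<mu> N p)) = (\<integral>\<^sup>+s. 1 \<partial>weighted_exponents \<mu> N p)"
    by simp
  also have "\<dots> \<le> (\<integral>\<^sup>+s. ennreal (1 / s + 1 / (1 - s)) \<partial>weighted_exponents \<mu> N p)"
    using AE_weighted_exponents(1)
  proof (intro nn_integral_mono_AE, eventually_elim)
    case (elim s)
    then have "1 \<le> 1 / s" by simp
    moreover have "0 \<le> 1 / (1 - s)" using elim by simp
    ultimately have "1 \<le> 1 / s + 1 / (1 - s)" by linarith
    then show ?case using ennreal_leI[of 1 "1 / s + 1 / (1 - s)"] by simp
  qed
  finally show "emeasure (weighted_exponents \<mu> N p) (space (weighted_exponents \<mu> N p)) \<noteq> \<infinity>"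
    using A by (auto simp: top_unique)
qed

end

section \<open>Borel representatives\<close>

text \<open>For a function that is merely Lebesgue measurable, \<open>(x, h) \<mapsto> u (x + h)\<close> need not be measurable for the
  product of the Lebesgue sigma-algebras; hence the passage to Borel representatives.\<close>

lemma Lp_loc_measurable:
  fixes f :: "'a::euclidean_space \<Rightarrow> 'b::euclidean_space"
  assumes f: "f \<in> Lp_loc q \<Omega>" and \<Omega>: "open \<Omega>"
  shows "set_borel_measurable lebesgue \<Omega> f"
proof -
  obtain C :: "nat \<Rightarrow> 'a set" where C: "\<And>n. compact (C n)" "\<And>n. C n \<subseteq> \<Omega>"
    "\<And>n. C n \<subseteq> interior (C (Suc n))" "\<Union>(range C) = \<Omega>"
    using open_Union_compact_subsets[OF \<Omega>] by metis
  have mono: "C m \<subseteq> C n" if "m \<le> n" for m n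
    using lift_Suc_mono_le[of C] C(3) interior_subset that by blast
  have m: "(\<lambda>x. indicator (C n) x *\<^sub>R f x) \<in> borel_measurable lebesgue" for n
    using f C(1,2) by (simp add: Lp_loc_def Lp_def set_borel_measurable_def)
  have "(\<lambda>x. indicator \<Omega> x *\<^sub>R f x) \<in> borel_measurable lebesgue"
  proof (rule borel_measurable_LIMSEQ_metric[OF m])
    fix x
    show "(\<lambda>n. indicator (C n) x *\<^sub>R f x) \<longlonglongrightarrow> indicator \<Omega> x *\<^sub>R f x"
    proof (cases "x \<in> \<Omega>")
      case True
      then obtain m where m: "x \<in> C m" using C(4) by auto
      have "x \<in> C n" if "m \<le> n" for n using m mono[OF that] by blast
      then have "eventually (\<lambda>n. indicator (C n) x *\<^sub>R f x = indicator \<Omega> x *\<^sub>R f x) sequentially"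
        using True by (auto simp: eventually_sequentially intro!: exI[of _ m])
      then show ?thesis by (rule tendsto_eventually)
    next
      case False
      then have "x \<notin> C n" for n using C(2) by blast
      then show ?thesis using False by simp
    qed
  qed
  then show ?thesis by (simp add: set_borel_measurable_def)
qed

text \<open>Each coordinate, extended by 0 outside \<Omega>, is measurable for the completion and
  hence equals a Borel function off a null set; finitely many coordinates are reassembled.\<close>

lemma Borel_representative:
  fixes f :: "'a::euclidean_space \<Rightarrow> 'b::euclidean_space"
  assumes "set_borel_measurable lebesgue \<Omega> f"
  obtains f' where "f' \<in> borel_measurable borel" "AE x in lebesgue. x \<in> \<Omega> \<longrightarrow> f x = f' x"
proof -
  have "\<exists>h\<in>borel_measurable lborel. AE x in lborel. (indicator \<Omega> x *\<^sub>R f x) \<bullet> b = h x" for b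
    by (rule completion_ex_borel_measurable_real)
      (rule borel_measurable_inner[OF assms[unfolded set_borel_measurable_def] borel_measurable_const])
  then obtain h where h: "\<And>b. h b \<in> borel_measurable lborel"
    "\<And>b. AE x in lborel. (indicator \<Omega> x *\<^sub>R f x) \<bullet> b = h b x" by metis
  show thesis
  proof (rule that[of "\<lambda>x. \<Sum>b\<in>Basis. h b x *\<^sub>R b"])
    show "(\<lambda>x. \<Sum>b\<in>Basis. h b x *\<^sub>R b) \<in> borel_measurable borel" using h(1) by simp
    have "AE x in lebesgue. \<forall>b\<in>Basis. (indicator \<Omega> x *\<^sub>R f x) \<bullet> b = h b x"
      using h(2) by (intro AE_finite_allI AE_completion) auto
    then show "AE x in lebesgue. x \<in> \<Omega> \<longrightarrow> f x = (\<Sum>b\<in>Basis. h b x *\<^sub>R b)"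
    proof eventually_elim
      case (elim x)
      show ?case
      proof
        assume "x \<in> \<Omega>"
        have "f x = (\<Sum>b\<in>Basis. (f x \<bullet> b) *\<^sub>R b)" by (simp add: euclidean_representation)
        also have "\<dots> = (\<Sum>b\<in>Basis. h b x *\<^sub>R b)" using elim \<open>x \<in> \<Omega>\<close> by (intro sum.cong) auto
        finally show "f x = (\<Sum>b\<in>Basis. h b x *\<^sub>R b)" .
      qed
    qed
  qed
qed

lemma Lp_cong_AE:
  assumes f: "f \<in> Lp q A" and m: "set_borel_measurable lebesgue A f'" and eq: "AE x in lebesgue. x \<in> A \<longrightarrow> f x = f' x"
  shows "f' \<in> Lp q A"
proof -
  have "(\<integral>\<^sup>+x\<in>A. ennreal (norm (f x) powr q) \<partial>lebesgue) = (\<integral>\<^sup>+x\<in>A. ennreal (norm (f' x) powr q) \<partial>lebesgue)"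
    by (intro nn_integral_cong_AE, use eq in eventually_elim) (auto simp: indicator_def)
  then show ?thesis using f m by (simp add: Lp_def)
qed

lemma Lp_loc_cong_AE:
  assumes f: "f \<in> Lp_loc q \<Omega>" and m: "set_borel_measurable lebesgue \<Omega> f'" and eq: "AE x in lebesgue. x \<in> \<Omega> \<longrightarrow> f x = f' x"
  shows "f' \<in> Lp_loc q \<Omega>"
  unfolding Lp_loc_def
proof (intro CollectI allI impI)
  fix K assume K: "compact K \<and> K \<subseteq> \<Omega>"
  show "f' \<in> Lp q K"
  proof (rule Lp_cong_AE)
    show "f \<in> Lp q K" using f K by (simp add: Lp_loc_def)
    show "set_borel_measurable lebesgue K f'"
      using set_borel_measurable_subset[OF m, of K] K by (simp add: borel_compact)
    show "AE x in lebesgue. x \<in> K \<longrightarrow> f x = f' x" using eq by eventually_elim (use K in auto)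
  qed
qed

text \<open>Allows the function and its gradient to be exchanged for Borel representatives. A Borel
  version of the gradient is again a weak gradient, and the supersolution condition ranges over all
  of these.\<close>

lemma has_weak_gradient_cong_AE:
  fixes f f' :: "'a::euclidean_space \<Rightarrow> real"
  assumes wg: "has_weak_gradient f g \<Omega>" and \<Omega>: "open \<Omega>"
    and f': "set_borel_measurable lebesgue \<Omega> f'" "AE x in lebesgue. x \<in> \<Omega> \<longrightarrow> f x = f' x"
    and g': "set_borel_measurable lebesgue \<Omega> g'" "AE x in lebesgue. x \<in> \<Omega> \<longrightarrow> g x = g' x"
  shows "has_weak_gradient f' g' \<Omega>"
proof -
  have fL: "f \<in> Lp_loc 1 \<Omega>" "g \<in> Lp_loc 1 \<Omega>" using wg by (auto simp: has_weak_gradient_def)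
  note fm = Lp_loc_measurable[OF fL(1) \<Omega>] Lp_loc_measurable[OF fL(2) \<Omega>]
  have "(LINT x:\<Omega>|lebesgue. f' x * frechet_derivative \<phi> (at x) b) = - (LINT x:\<Omega>|lebesgue. (g' x \<bullet> b) * \<phi> x)"
    if \<phi>: "\<phi> \<in> test_functions \<Omega>" and b: "b \<in> Basis" for \<phi> b
  proof -
    have [measurable]: "\<phi> \<in> borel_measurable lebesgue" "(\<lambda>x. frechet_derivative \<phi> (at x) b) \<in> borel_measurable lebesgue"
      using test_function_facts(4,7)[OF \<phi>] by (auto intro!: measurable_completion borel_measurable_continuous_onI)
    have 1: "(LINT x:\<Omega>|lebesgue. h x * \<psi> x) = (LINT x:\<Omega>|lebesgue. h' x * \<psi> x)"
      if h: "set_borel_measurable lebesgue \<Omega> h" "set_borel_measurable lebesgue \<Omega> h'" "AE x in lebesgue. x \<in> \<Omega> \<longrightarrow> h x = h' x"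
        and \<psi>: "\<psi> \<in> borel_measurable lebesgue" for h h' \<psi> :: "'a \<Rightarrow> real"
      unfolding set_lebesgue_integral_def
    proof (rule integral_cong_AE)
      show "(\<lambda>x. indicator \<Omega> x *\<^sub>R (h x * \<psi> x)) \<in> borel_measurable lebesgue"
        "(\<lambda>x. indicator \<Omega> x *\<^sub>R (h' x * \<psi> x)) \<in> borel_measurable lebesgue"
        using borel_measurable_times[OF h(1)[unfolded set_borel_measurable_def] \<psi>] borel_measurable_times[OF h(2)[unfolded set_borel_measurable_def] \<psi>]
        by (simp_all add: mult.assoc)
      show "AE x in lebesgue. indicator \<Omega> x *\<^sub>R (h x * \<psi> x) = indicator \<Omega> x *\<^sub>R (h' x * \<psi> x)"
        using h(3) by eventually_elim (auto simp: indicator_def)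
    qed
    have gb: "set_borel_measurable lebesgue \<Omega> (\<lambda>x. g x \<bullet> b)" "set_borel_measurable lebesgue \<Omega> (\<lambda>x. g' x \<bullet> b)"
      using borel_measurable_inner[OF fm(2)[unfolded set_borel_measurable_def] borel_measurable_const[of b]]
        borel_measurable_inner[OF g'(1)[unfolded set_borel_measurable_def] borel_measurable_const[of b]]
      by (simp_all add: set_borel_measurable_def)
    have "(LINT x:\<Omega>|lebesgue. f' x * frechet_derivative \<phi> (at x) b) = (LINT x:\<Omega>|lebesgue. f x * frechet_derivative \<phi> (at x) b)"
      using f'(2) by (intro 1[symmetric] fm f') auto
    also have "\<dots> = - (LINT x:\<Omega>|lebesgue. (g x \<bullet> b) * \<phi> x)"
      using wg \<phi> b by (auto simp: has_weak_gradient_def)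
    also have "(LINT x:\<Omega>|lebesgue. (g x \<bullet> b) * \<phi> x) = (LINT x:\<Omega>|lebesgue. (g' x \<bullet> b) * \<phi> x)"
      by (intro 1 gb, use g'(2) in eventually_elim) auto
    finally show ?thesis .
  qed
  then show ?thesis
    using Lp_loc_cong_AE[OF fL(1) f'] Lp_loc_cong_AE[OF fL(2) g'] by (auto simp: has_weak_gradient_def)
qed

lemma has_weak_gradient_subset:
  fixes f :: "'a::euclidean_space \<Rightarrow> real"
  assumes wg: "has_weak_gradient f g \<Omega>" and sub: "\<Omega>' \<subseteq> \<Omega>"
  shows "has_weak_gradient f g \<Omega>'"
proof -
  have "(LINT x:\<Omega>'|lebesgue. f x * frechet_derivative \<phi> (at x) b) = - (LINT x:\<Omega>'|lebesgue. (g x \<bullet> b) * \<phi> x)"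
    if \<phi>: "\<phi> \<in> test_functions \<Omega>'" and b: "b \<in> Basis" for \<phi> b
  proof -
    note F = test_function_facts[OF \<phi>]
    have ind: "indicator \<Omega> x *\<^sub>R (a * z) = indicator \<Omega>' x *\<^sub>R (a * z)" if "x \<notin> \<Omega>' \<Longrightarrow> z = 0" for x and a z :: real
      using that sub by (cases "x \<in> \<Omega>'") (auto simp: indicator_def)
    have z: "\<phi> x = 0" "frechet_derivative \<phi> (at x) b = 0" if "x \<notin> \<Omega>'" for x
      using that F(2,3,6) by blast+
    have "\<phi> \<in> test_functions \<Omega>" using \<phi> sub by (auto simp: test_functions_def)
    then have "(LINT x:\<Omega>|lebesgue. f x * frechet_derivative \<phi> (at x) b) = - (LINT x:\<Omega>|lebesgue. (g x \<bullet> b) * \<phi> x)"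
      using wg b by (auto simp: has_weak_gradient_def)
    moreover have "(LINT x:\<Omega>|lebesgue. f x * frechet_derivative \<phi> (at x) b) = (LINT x:\<Omega>'|lebesgue. f x * frechet_derivative \<phi> (at x) b)"
      unfolding set_lebesgue_integral_def by (intro Bochner_Integration.integral_cong ind z refl)
    moreover have "(LINT x:\<Omega>|lebesgue. (g x \<bullet> b) * \<phi> x) = (LINT x:\<Omega>'|lebesgue. (g x \<bullet> b) * \<phi> x)"
      unfolding set_lebesgue_integral_def by (intro Bochner_Integration.integral_cong ind z refl)
    ultimately show ?thesis by simp
  qed
  moreover have "f \<in> Lp_loc 1 \<Omega>'" "g \<in> Lp_loc 1 \<Omega>'"
    using wg subset_trans[OF _ sub] unfolding has_weak_gradient_def Lp_loc_def by simp_all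
  ultimately show ?thesis unfolding has_weak_gradient_def by blast
qed

lemma sigma_finite_lebesgue: "sigma_finite_measure (lebesgue :: 'a::euclidean_space measure)"
proof
  show "\<exists>A. countable A \<and> A \<subseteq> sets (lebesgue :: 'a measure) \<and> \<Union>A = space lebesgue \<and> (\<forall>a\<in>A. emeasure lebesgue a \<noteq> \<infinity>)"
    using real_arch_simple[of "norm (_ :: 'a)"]
    by (intro exI[of _ "range (\<lambda>n::nat. cball (0::'a) (real n))"])
      (auto simp: emeasure_cball)
qed

lemma AE_pair_fst:
  assumes M: "sigma_finite_measure M" "sigma_finite_measure N" and P: "AE x in M. P x"
  shows "AE z in M \<Otimes>\<^sub>M N. P (fst z)"
proof -
  interpret N: sigma_finite_measure N by fact
  obtain A where A: "A \<in> null_sets M" "\<And>x. x \<in> space M - A \<Longrightarrow> P x" using P by (auto elim: AE_E3)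
  have "A \<times> space N \<in> null_sets (M \<Otimes>\<^sub>M N)"
    using A(1) N.emeasure_pair_measure_Times[of A M "space N"] null_setsD1[OF A(1)] null_setsD2[OF A(1)]
    by (intro null_setsI) auto
  then have "AE z in M \<Otimes>\<^sub>M N. z \<notin> A \<times> space N" by (rule AE_not_in)
  then show ?thesis
    by (rule AE_mp) (auto intro!: AE_I2 A(2) simp: space_pair_measure)
qed

lemma AE_pair_snd:
  assumes M: "sigma_finite_measure M" "sigma_finite_measure N" and P: "AE x in N. P x"
  shows "AE z in M \<Otimes>\<^sub>M N. P (snd z)"
proof -
  interpret N: sigma_finite_measure N by fact
  obtain A where A: "A \<in> null_sets N" "\<And>x. x \<in> space N - A \<Longrightarrow> P x" using P by (auto elim: AE_E3)
  have "space M \<times> A \<in> null_sets (M \<Otimes>\<^sub>M N)"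
    using A(1) N.emeasure_pair_measure_Times[of "space M" M A] null_setsD1[OF A(1)] null_setsD2[OF A(1)]
    by (intro null_setsI) auto
  then have "AE z in M \<Otimes>\<^sub>M N. z \<notin> space M \<times> A" by (rule AE_not_in)
  then show ?thesis
    by (rule AE_mp) (auto intro!: AE_I2 A(2) simp: space_pair_measure)
qed

text \<open>The weak form integrates over the product of two completed measures, whose sigma-algebra
  is larger than the Borel one. Both products give the same mass to Borel rectangles, so for Borel
  integrands they can be interchanged.\<close>

lemma distr_lebesgue_pair:
  "distr (lebesgue \<Otimes>\<^sub>M lebesgue) (lborel \<Otimes>\<^sub>M lborel) (\<lambda>z. z)
    = (lborel \<Otimes>\<^sub>M lborel :: ('a::euclidean_space \<times> 'b::euclidean_space) measure)"
proof (rule pair_measure_eqI[symmetric])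
  interpret sigma_finite_measure "lebesgue :: 'b measure" by (rule sigma_finite_lebesgue)
  have id: "(\<lambda>z. z) \<in> (lebesgue \<Otimes>\<^sub>M lebesgue) \<rightarrow>\<^sub>M (lborel \<Otimes>\<^sub>M lborel :: ('a \<times> 'b) measure)"
  proof -
    have "(\<lambda>z. (fst z, snd z)) \<in> (lebesgue \<Otimes>\<^sub>M lebesgue) \<rightarrow>\<^sub>M (lborel \<Otimes>\<^sub>M lborel :: ('a \<times> 'b) measure)"
      by (intro measurable_Pair measurable_compose[OF measurable_fst] measurable_compose[OF measurable_snd] measurable_completion) auto
    then show ?thesis by simp
  qed
  fix A :: "'a set" and B :: "'b set" assume "A \<in> sets lborel" "B \<in> sets lborel"
  then show "emeasure lborel A * emeasure lborel B = emeasure (distr (lebesgue \<Otimes>\<^sub>M lebesgue) (lborel \<Otimes>\<^sub>M lborel) (\<lambda>z. z)) (A \<times> B)"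
    by (subst emeasure_distr[OF id]) (auto simp: space_pair_measure emeasure_pair_measure_Times)
qed (auto intro: sigma_finite_lborel)

section \<open>The cutoff function\<close>

text \<open>At 0 the quotient is bounded by |h|^(p - 1), which tends to 0 because p > 1.\<close>

lemma max_0_powr_has_derivative:
  fixes p t :: real
  assumes p: "1 < p"
  shows "((\<lambda>t. max 0 t powr p) has_real_derivative p * max 0 t powr (p - 1)) (at t)"
proof -
  consider "t > 0" | "t < 0" | "t = 0" by linarith
  then show ?thesis
  proof cases
    case 1
    have "((\<lambda>t. t powr p) has_real_derivative p * max 0 t powr (p - 1)) (at t)"
      using 1 by (auto intro!: derivative_eq_intros)
    moreover have "eventually (\<lambda>s. max 0 s powr p = s powr p) (nhds t)"
      using eventually_nhds_in_open[of "{0<..}" t] 1 by (auto elim!: eventually_mono)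
    ultimately show ?thesis by (subst DERIV_cong_ev[OF refl _ refl])
  next
    case 2
    have "((\<lambda>t. 0::real) has_real_derivative 0) (at t)" by simp
    moreover have "eventually (\<lambda>s. max 0 s powr p = 0) (nhds t)"
      using eventually_nhds_in_open[of "{..<0}" t] 2 p by (auto elim!: eventually_mono)
    ultimately have "((\<lambda>t. max 0 t powr p) has_real_derivative 0) (at t)"
      by (subst DERIV_cong_ev[OF refl _ refl])
    then show ?thesis using 2 p by simp
  next
    case 3
    have "((\<lambda>h. \<bar>h\<bar> powr (p - 1)) \<longlongrightarrow> \<bar>0\<bar> powr (p - 1)) (at (0::real))"
      using p by (intro tendsto_powr' tendsto_intros) auto
    then have "((\<lambda>h. \<bar>h\<bar> powr (p - 1)) \<longlongrightarrow> 0) (at (0::real))" using p by simp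
    then have "((\<lambda>h. max 0 h powr p / h) \<longlongrightarrow> 0) (at (0::real))"
    proof (rule Lim_null_comparison[rotated])
      have "norm (max 0 h powr p / h) \<le> \<bar>h\<bar> powr (p - 1)" for h :: real
        using p powr_mult_base[of h "p - 1"] by (cases "h > 0") (auto simp: max_def field_simps)
      then show "\<forall>\<^sub>F h in at 0. norm (max 0 h powr p / h) \<le> \<bar>h\<bar> powr (p - 1)" by simp
    qed
    then show ?thesis using 3 p by (simp add: DERIV_def)
  qed
qed

text \<open>The cutoff need not be \<open>1\<close> on the smaller ball, a positive lower bound suffices; so no smooth
  transition is needed, and its \<open>p\<close>-th power is continuously differentiable because \<open>p > 1\<close>.\<close>

definition bump :: "'a::euclidean_space \<Rightarrow> real \<Rightarrow> 'a \<Rightarrow> real" where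
  "bump x0 \<rho> x = max 0 (1 - (norm (x - x0) / \<rho>)\<^sup>2)"

text \<open>The gradient of the p-th power of \<open>bump\<close>, not of \<open>bump\<close>: only
  the power is differentiable across the sphere of radius \<rho>.\<close>

definition bump_grad :: "real \<Rightarrow> 'a::euclidean_space \<Rightarrow> real \<Rightarrow> 'a \<Rightarrow> 'a" where
  "bump_grad p x0 \<rho> x = (- (p * bump x0 \<rho> x powr (p - 1) * (2 / \<rho>\<^sup>2))) *\<^sub>R (x - x0)"

lemma bump_bounds: "0 \<le> bump x0 \<rho> x" "bump x0 \<rho> x \<le> 1"
  by (auto simp: bump_def)

lemma bump_outside: "0 < \<rho> \<Longrightarrow> x \<notin> cball x0 \<rho> \<Longrightarrow> bump x0 \<rho> x = 0"
  by (auto simp: bump_def dist_norm norm_minus_commute abs_square_le_1[symmetric] power_divide one_le_power intro!: max_absorb1)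

text \<open>The radius 3r/2 of the cutoff puts the smaller ball at relative radius 2/3, and 5/9 = 1
  - (2/3)^2. This value enters the final constant through (5/9)^p.\<close>

lemma bump_ge:
  assumes "0 < r" "x \<in> ball x0 r"
  shows "5 / 9 \<le> bump x0 (3 * r / 2) x"
proof -
  have "norm (x - x0) / (3 * r / 2) \<le> 2 / 3"
    using assms by (simp add: dist_norm norm_minus_commute field_simps)
  then have "(norm (x - x0) / (3 * r / 2))\<^sup>2 \<le> (2 / 3)\<^sup>2"
    using assms by (intro power_mono) auto
  then show ?thesis by (simp add: bump_def power2_eq_square)
qed

text \<open>The bump equals 1 - m^2, where \<open>m\<close> is the relative radius truncated at 1.
  Truncation does not increase differences, and the square is 2-Lipschitz on [0, 1].\<close>

lemma bump_Lipschitz: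
  assumes "0 < \<rho>" shows "\<bar>bump x0 \<rho> x - bump x0 \<rho> y\<bar> \<le> 2 / \<rho> * norm (x - y)"
proof -
  define m where "m z = min 1 (norm (z - x0) / \<rho>)" for z
  have m: "0 \<le> m z" "m z \<le> 1" for z using assms by (auto simp: m_def)
  have eq: "bump x0 \<rho> z = 1 - (m z)\<^sup>2" for z
  proof (cases "norm (z - x0) / \<rho> \<le> 1")
    case True
    then have "(norm (z - x0) / \<rho>)\<^sup>2 \<le> 1" using assms by (simp add: power_le_one)
    then show ?thesis using True by (simp add: bump_def m_def)
  next
    case False
    then have "1 \<le> (norm (z - x0) / \<rho>)\<^sup>2" using one_le_power[of "norm (z - x0) / \<rho>" 2] by simp
    then show ?thesis using False by (simp add: bump_def m_def)
  qed
  have "bump x0 \<rho> x - bump x0 \<rho> y = (m y - m x) * (m y + m x)"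
    by (simp add: eq power2_eq_square algebra_simps)
  then have "\<bar>bump x0 \<rho> x - bump x0 \<rho> y\<bar> = \<bar>m y - m x\<bar> * (m y + m x)"
    using m by (simp add: abs_mult)
  also have "\<dots> \<le> \<bar>m y - m x\<bar> * 2" using m[of x] m[of y] by (intro mult_left_mono) auto
  also have "\<bar>m y - m x\<bar> \<le> \<bar>norm (y - x0) / \<rho> - norm (x - x0) / \<rho>\<bar>" by (simp add: m_def)
  also have "\<dots> = \<bar>norm (y - x0) - norm (x - x0)\<bar> / \<rho>" using assms by (simp flip: diff_divide_distrib)
  also have "\<dots> \<le> norm (x - y) / \<rho>"
    using norm_triangle_ineq3[of "y - x0" "x - x0"] assms by (intro divide_right_mono) (auto simp: norm_minus_commute)
  finally show ?thesis by (simp add: mult.commute)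
qed

lemma bump_powr_Lipschitz:
  assumes "0 < \<rho>" "1 < p"
  shows "\<bar>bump x0 \<rho> x powr p - bump x0 \<rho> y powr p\<bar> \<le> p * (2 / \<rho>) * norm (x - y)"
proof -
  have *: "\<bar>s powr p - t powr p\<bar> \<le> p * \<bar>s - t\<bar>" if "s \<in> {0..1}" "t \<in> {0..1}" for s t :: real
  proof -
    have "norm (max 0 s powr p - max 0 t powr p) \<le> p * norm (s - t)"
    proof (rule field_differentiable_bound[of "{0..1}"])
      fix z :: real assume z: "z \<in> {0..1}"
      show "((\<lambda>t. max 0 t powr p) has_field_derivative p * max 0 z powr (p - 1)) (at z within {0..1})"
        using max_0_powr_has_derivative[OF assms(2)] by (rule has_field_derivative_at_within)
      show "norm (p * max 0 z powr (p - 1)) \<le> p"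
        using z assms powr_mono2[of "p - 1" z 1] by (auto simp: abs_mult)
    qed (use that in auto)
    then show ?thesis using that by simp
  qed
  have "\<bar>bump x0 \<rho> x powr p - bump x0 \<rho> y powr p\<bar> \<le> p * \<bar>bump x0 \<rho> x - bump x0 \<rho> y\<bar>"
    by (intro *) (auto simp: bump_bounds)
  also have "\<dots> \<le> p * (2 / \<rho> * norm (x - y))"
    using bump_Lipschitz[OF assms(1)] assms(2) by (intro mult_left_mono) auto
  finally show ?thesis by simp
qed

lemma bump_powr_has_derivative:
  assumes "0 < \<rho>" "1 < p"
  shows "((\<lambda>x. bump x0 \<rho> x powr p) has_derivative (\<lambda>h. bump_grad p x0 \<rho> x \<bullet> h)) (at x)"
proof -
  let ?q = "\<lambda>x. 1 - ((x - x0) \<bullet> (x - x0)) / \<rho>\<^sup>2"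
  have q: "(?q has_derivative (\<lambda>h. - (2 * ((x - x0) \<bullet> h) / \<rho>\<^sup>2))) (at x)"
    using assms(1) by (auto intro!: derivative_eq_intros simp: inner_commute fun_eq_iff field_simps power2_eq_square power4_eq_xxxx)
  have b: "bump x0 \<rho> z = max 0 (?q z)" for z
    by (simp add: bump_def power_divide power2_norm_eq_inner)
  have "((\<lambda>t. max 0 t powr p) has_derivative (\<lambda>h. p * max 0 (?q x) powr (p - 1) * h)) (at (?q x))"
    using max_0_powr_has_derivative[OF assms(2)] by (simp add: has_field_derivative_def)
  from diff_chain_at[OF q this]
  have "((\<lambda>x. max 0 (?q x) powr p) has_derivative (\<lambda>h. p * max 0 (?q x) powr (p - 1) * - (2 * ((x - x0) \<bullet> h) / \<rho>\<^sup>2))) (at x)"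
    by (simp add: o_def)
  moreover have "p * max 0 (?q x) powr (p - 1) * - (2 * ((x - x0) \<bullet> h) / \<rho>\<^sup>2) = bump_grad p x0 \<rho> x \<bullet> h" for h
    by (simp add: bump_grad_def b)
  ultimately show ?thesis by (simp add: b)
qed

text \<open>The factor \<open>bump\<close>^(p - 1) is kept rather than bounded by 1: in
  \<open>local_term_le\<close> it combines with |Du|^(p - 1) to the power that Young's inequality
  expects.\<close>

lemma norm_bump_grad_le:
  assumes "0 < \<rho>" "1 < p"
  shows "norm (bump_grad p x0 \<rho> x) \<le> p * bump x0 \<rho> x powr (p - 1) * (2 / \<rho>)"
proof (cases "x \<in> cball x0 \<rho>")
  case True
  have "norm (bump_grad p x0 \<rho> x) = p * bump x0 \<rho> x powr (p - 1) * ((2 / \<rho>\<^sup>2) * norm (x - x0))"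
    using assms bump_bounds[of x0 \<rho> x] by (simp add: bump_grad_def)
  also have "\<dots> \<le> p * bump x0 \<rho> x powr (p - 1) * ((2 / \<rho>\<^sup>2) * \<rho>)"
    using True assms by (intro mult_left_mono) (auto simp: dist_norm norm_minus_commute)
  finally show ?thesis using assms by (simp add: power2_eq_square)
next
  case False
  then show ?thesis using bump_outside[OF assms(1) False] assms by (simp add: bump_grad_def)
qed

lemma bump_measurable [measurable]: "bump x0 \<rho> \<in> borel_measurable borel"
  unfolding bump_def by measurable

lemma bump_grad_measurable [measurable]: "bump_grad p x0 \<rho> \<in> borel_measurable borel"
  unfolding bump_grad_def by measurable

section \<open>The test function\<close>

text \<open>The situation after passing to Borel representatives: nonnegativity holds at every point
  of the ball, and neither \<Omega> nor the supersolution property appears. The latter enters once,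
  as the hypothesis \<open>ineq\<close> of \<open>weighted_log_estimate\<close>.\<close>

locale log_estimate =
  fixes p R r d :: real and x0 :: "'a::euclidean_space" and u :: "'a \<Rightarrow> real" and Du :: "'a \<Rightarrow> 'a"
  assumes p: "1 < p" and r: "0 < r" and rR: "r \<le> R / 2" and d: "0 < d"
    and u_meas [measurable]: "u \<in> borel_measurable borel" and Du_meas [measurable]: "Du \<in> borel_measurable borel"
    and u_nonneg: "\<And>x. x \<in> ball x0 R \<Longrightarrow> 0 \<le> u x"
    and weak_gradient: "has_weak_gradient u Du (ball x0 R)"
    and Du_powr_finite: "\<And>K. compact K \<Longrightarrow> K \<subseteq> ball x0 R \<Longrightarrow> (\<integral>\<^sup>+x\<in>K. ennreal (norm (Du x) powr p) \<partial>lborel) < \<infinity>"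
    and u_powr_finite: "\<And>K. compact K \<Longrightarrow> (\<integral>\<^sup>+x\<in>K. ennreal (\<bar>u x\<bar> powr (p - 1)) \<partial>lborel) < \<infinity>"
begin

abbreviation (input) "S \<equiv> cball x0 (3 * r / 2)"

definition "\<eta> = bump x0 (3 * r / 2)"

definition "v x = \<eta> x powr p * (u x + d) powr (1 - p)"

definition "Dv x = \<eta> x powr p *\<^sub>R (((1 - p) * (u x + d) powr (- p)) *\<^sub>R Du x)
  + (u x + d) powr (1 - p) *\<^sub>R bump_grad p x0 (3 * r / 2) x"

lemma R_pos: "0 < R" using r rR by simp

text \<open>Since r \<le> R/2, the cutoff radius is at most 3R/4. Radius 13R/16 gives an open
  neighbourhood for the difference estimate, and the gap up to R makes the far kernel comparable to
  the one centred at \<open>x0\<close>.\<close>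

lemma S_subset: "S \<subseteq> ball x0 (13 * R / 16)" "S \<subseteq> ball x0 R" "S \<subseteq> cball x0 (3 * R / 4)"
  using r rR by auto

lemma \<eta>_meas [measurable]: "\<eta> \<in> borel_measurable borel"
  unfolding \<eta>_def by measurable

lemma v_meas [measurable]: "v \<in> borel_measurable borel"
  unfolding v_def by measurable

lemma Dv_meas [measurable]: "Dv \<in> borel_measurable borel"
  unfolding Dv_def by measurable

lemma \<eta>_bounds: "0 \<le> \<eta> x" "\<eta> x \<le> 1" "x \<notin> S \<Longrightarrow> \<eta> x = 0" "x \<in> ball x0 r \<Longrightarrow> 5 / 9 \<le> \<eta> x"
  unfolding \<eta>_def using r bump_ge[OF r] by (auto simp: bump_bounds intro!: bump_outside simp del: mem_cball mem_ball)

lemma \<eta>_Lipschitz: "\<bar>\<eta> x - \<eta> y\<bar> \<le> 4 / (3 * r) * norm (x - y)"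
  using bump_Lipschitz[of "3 * r / 2" x0 x y] r by (simp add: \<eta>_def)

lemma v_outside: "x \<notin> S \<Longrightarrow> v x = 0" "x \<notin> S \<Longrightarrow> Dv x = 0"
  using p \<eta>_bounds(3)[of x] by (auto simp: v_def Dv_def bump_grad_def \<eta>_def)

lemma u_add_d: "x \<in> ball x0 R \<Longrightarrow> d \<le> u x + d"
  using u_nonneg by simp

lemma powr_u_add_d_le: "x \<in> ball x0 R \<Longrightarrow> q \<le> 0 \<Longrightarrow> (u x + d) powr q \<le> d powr q"
  using u_add_d d by (intro powr_mono2') auto

lemma v_bounds: "0 \<le> v x" "v x \<le> d powr (1 - p)"
proof -
  show "0 \<le> v x" by (simp add: v_def)
  show "v x \<le> d powr (1 - p)"
  proof (cases "x \<in> S")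
    case True
    then have x: "x \<in> ball x0 R" using S_subset(2) by blast
    have "\<eta> x powr p \<le> 1" using \<eta>_bounds(1,2)[of x] p powr_mono2[of p "\<eta> x" 1] by simp
    then have "v x \<le> 1 * d powr (1 - p)"
      unfolding v_def using p powr_u_add_d_le[OF x, of "1 - p"] by (intro mult_mono) auto
    then show ?thesis by simp
  next
    case False
    then show ?thesis using v_outside by simp
  qed
qed

text \<open>The increments of the position and of \<open>u\<close> are kept apart: \<open>u\<close>
  need not be Lipschitz, but its increments are controlled in the mean of order p by
  \<open>Lp_difference_le\<close>.\<close>

lemma v_Lipschitz:
  assumes "x \<in> ball x0 R" "y \<in> ball x0 R"
  shows "\<bar>v x - v y\<bar> \<le> p * (4 / (3 * r)) * d powr (1 - p) * norm (x - y) + (p - 1) * d powr (- p) * \<bar>u x - u y\<bar>"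
proof -
  have "v x - v y = \<eta> x powr p * ((u x + d) powr (1 - p) - (u y + d) powr (1 - p))
      + (u y + d) powr (1 - p) * (\<eta> x powr p - \<eta> y powr p)"
    by (simp add: v_def algebra_simps)
  moreover have "\<bar>\<eta> x powr p * ((u x + d) powr (1 - p) - (u y + d) powr (1 - p))\<bar> \<le> 1 * ((p - 1) * d powr (- p) * \<bar>u x - u y\<bar>)"
    unfolding abs_mult
  proof (intro mult_mono)
    show "\<bar>\<eta> x powr p\<bar> \<le> 1" using \<eta>_bounds(1,2)[of x] p powr_mono2[of p "\<eta> x" 1] by simp
    have "norm ((u x + d) powr (1 - p) - (u y + d) powr (1 - p)) \<le> (p - 1) * d powr (- p) * norm (u x + d - (u y + d))"
    proof (rule field_differentiable_bound[of "{d..}"])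
      fix z :: real assume z: "z \<in> {d..}"
      then show "((\<lambda>t. t powr (1 - p)) has_field_derivative (1 - p) * z powr (- p)) (at z within {d..})"
        using d by (auto intro!: derivative_eq_intros)
      have "z powr (- p) \<le> d powr (- p)" using z d p by (intro powr_mono2') auto
      then show "norm ((1 - p) * z powr (- p)) \<le> (p - 1) * d powr (- p)" using p by (simp add: abs_mult)
    qed (use u_add_d assms in auto)
    then show "\<bar>(u x + d) powr (1 - p) - (u y + d) powr (1 - p)\<bar> \<le> (p - 1) * d powr (- p) * \<bar>u x - u y\<bar>" by simp
  qed (use p in auto)
  moreover have "\<bar>(u y + d) powr (1 - p) * (\<eta> x powr p - \<eta> y powr p)\<bar> \<le> d powr (1 - p) * (p * (4 / (3 * r)) * norm (x - y))"
    unfolding abs_mult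
    using powr_u_add_d_le[OF assms(2), of "1 - p"] p bump_powr_Lipschitz[of "3 * r / 2" p x0 x y] r
    by (intro mult_mono) (auto simp: \<eta>_def)
  ultimately show ?thesis by (simp add: mult_ac)
qed

text \<open>On t \<ge> 0 the function (t + d)^(1 - p) has a derivative bounded by (p - 1) d^(-p);
  this is where d > 0 makes the chain rule applicable.\<close>

lemma weak_gradient_v: "has_weak_gradient v Dv UNIV"
proof -
  have "has_weak_gradient (\<lambda>x. (u x + d) powr (1 - p)) (\<lambda>x. ((1 - p) * (u x + d) powr (- p)) *\<^sub>R Du x) (ball x0 R)"
  proof (rule has_weak_gradient_compose[where F = "\<lambda>t. (t + d) powr (1 - p)" and F' = "\<lambda>t. (1 - p) * (t + d) powr (- p)" and M = "(p - 1) * d powr (- p)"])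
    show "AE x in lborel. x \<in> ball x0 R \<longrightarrow> 0 \<le> u x" using u_nonneg by simp
    fix t :: real assume t: "0 \<le> t"
    show "((\<lambda>t. (t + d) powr (1 - p)) has_real_derivative (1 - p) * (t + d) powr - p) (at t)"
      using t d by (auto intro!: derivative_eq_intros)
    have "(t + d) powr (- p) \<le> d powr (- p)" using t d p by (intro powr_mono2') auto
    then show "\<bar>(1 - p) * (t + d) powr - p\<bar> \<le> (p - 1) * d powr (- p)" using p by (simp add: abs_mult)
  qed (use weak_gradient in auto)
  then have "has_weak_gradient (\<lambda>x. \<eta> x powr p * (u x + d) powr (1 - p))
    (\<lambda>x. \<eta> x powr p *\<^sub>R (((1 - p) * (u x + d) powr (- p)) *\<^sub>R Du x) + (u x + d) powr (1 - p) *\<^sub>R bump_grad p x0 (3 * r / 2) x) UNIV"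
  proof (rule has_weak_gradient_mult_cutoff[where S = S and L = "p * (4 / (3 * r))", rotated 3])
    show "((\<lambda>x. \<eta> x powr p) has_derivative (\<lambda>h. bump_grad p x0 (3 * r / 2) x \<bullet> h)) (at x)" for x
      unfolding \<eta>_def using r p by (intro bump_powr_has_derivative) auto
    show "\<bar>\<eta> x powr p - \<eta> y powr p\<bar> \<le> p * (4 / (3 * r)) * norm (x - y)" for x y
      using bump_powr_Lipschitz[of "3 * r / 2" p x0 x y] r p by (simp add: \<eta>_def)
    show "norm (bump_grad p x0 (3 * r / 2) x) \<le> p * (4 / (3 * r))" for x
    proof -
      have "norm (bump_grad p x0 (3 * r / 2) x) \<le> p * \<eta> x powr (p - 1) * (2 / (3 * r / 2))"
        unfolding \<eta>_def using r p by (intro norm_bump_grad_le) auto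
      also have "\<dots> \<le> p * 1 * (2 / (3 * r / 2))"
        using \<eta>_bounds(1,2)[of x] p r powr_mono2[of "p - 1" "\<eta> x" 1] by (intro mult_right_mono mult_left_mono) auto
      finally show ?thesis by simp
    qed
    show "\<eta> x powr p = 0" if "x \<notin> S" for x using \<eta>_bounds(3)[OF that] p by simp
    show "bump_grad p x0 (3 * r / 2) x = 0" if "x \<notin> S" for x using \<eta>_bounds(3)[OF that] p by (simp add: bump_grad_def \<eta>_def)
  qed (use S_subset in auto)
  then show ?thesis by (simp add: v_def[abs_def] Dv_def[abs_def])
qed

lemma norm_Dv_le:
  "norm (Dv x) \<le> ((p - 1) * d powr (- p) * norm (Du x) + d powr (1 - p) * (p * (4 / (3 * r)))) * indicator S x"
proof (cases "x \<in> S")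
  case True
  then have x: "x \<in> ball x0 R" using S_subset(2) by blast
  have 1: "\<eta> x powr p \<le> 1" "\<eta> x powr (p - 1) \<le> 1"
    using \<eta>_bounds(1,2)[of x] p powr_mono2[of p "\<eta> x" 1] powr_mono2[of "p - 1" "\<eta> x" 1] by auto
  have "norm (\<eta> x powr p *\<^sub>R (((1 - p) * (u x + d) powr (- p)) *\<^sub>R Du x)) = \<eta> x powr p * ((p - 1) * (u x + d) powr (- p) * norm (Du x))"
    using p by (simp add: abs_mult)
  also have "\<dots> \<le> 1 * ((p - 1) * d powr (- p) * norm (Du x))"
    using 1 p powr_u_add_d_le[OF x, of "- p"] by (intro mult_mono mult_right_mono mult_left_mono) auto
  finally have A: "norm (\<eta> x powr p *\<^sub>R (((1 - p) * (u x + d) powr (- p)) *\<^sub>R Du x)) \<le> (p - 1) * d powr (- p) * norm (Du x)"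
    by simp
  have "norm (bump_grad p x0 (3 * r / 2) x) \<le> p * \<eta> x powr (p - 1) * (2 / (3 * r / 2))"
    unfolding \<eta>_def using r p by (intro norm_bump_grad_le) auto
  also have "\<dots> \<le> p * 1 * (2 / (3 * r / 2))" using 1 p r by (intro mult_right_mono mult_left_mono) auto
  finally have G: "norm (bump_grad p x0 (3 * r / 2) x) \<le> p * (4 / (3 * r))" by simp
  have "(u x + d) powr (1 - p) * norm (bump_grad p x0 (3 * r / 2) x) \<le> d powr (1 - p) * (p * (4 / (3 * r)))"
    using powr_u_add_d_le[OF x, of "1 - p"] p by (intro mult_mono G) auto
  then have "norm ((u x + d) powr (1 - p) *\<^sub>R bump_grad p x0 (3 * r / 2) x) \<le> d powr (1 - p) * (p * (4 / (3 * r)))"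
    by simp
  with A show ?thesis using True unfolding Dv_def by (auto intro: norm_triangle_le)
next
  case False
  then show ?thesis using v_outside(2) by simp
qed

end

section \<open>The nonlocal integrand: pointwise bounds and convergence of its integrals\<close>

lemma nn_integral_convolution:
  fixes f \<omega> :: "'a::euclidean_space \<Rightarrow> ennreal"
  assumes [measurable]: "f \<in> borel_measurable borel" "\<omega> \<in> borel_measurable borel"
  shows "(\<integral>\<^sup>+x. \<integral>\<^sup>+y. f x * \<omega> (x - y) \<partial>lborel \<partial>lborel) = (\<integral>\<^sup>+x. f x \<partial>lborel) * (\<integral>\<^sup>+h. \<omega> h \<partial>lborel)"
  by (simp add: nn_integral_cmult nn_integral_lborel_reflect[of \<omega>] nn_integral_multc)

context log_estimate
begin

definition "\<Phi> x y = \<bar>u x - u y\<bar> powr (p - 2) * (u x - u y) * (v x - v y)"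

text \<open>The majorant for one point in the cutoff and the other outside the large ball. The 1 is
  (u x + d)^(p - 1) (u x + d)^(1 - p), the other summand the tail density weighted by the largest
  possible (u x + d)^(1 - p).\<close>

definition "tail_part x y = indicator S x * indicator (- ball x0 R) y * (1 + d powr (1 - p) * max (- u y) 0 powr (p - 1))"

definition "log_part x y = indicator (ball x0 r) x * indicator (ball x0 r) y * \<bar>ln ((u x + d) / (u y + d))\<bar> powr p"

lemma balls_measurable [measurable]: "cball (a :: 'a) t \<in> sets borel" "ball (a :: 'a) t \<in> sets borel"
  by auto

lemma \<Phi>_meas [measurable]: "(\<lambda>z. \<Phi> (fst z) (snd z)) \<in> borel_measurable (borel \<Otimes>\<^sub>M borel)"
  unfolding \<Phi>_def by measurable

lemma tail_part_nonneg: "0 \<le> tail_part x y"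
  by (simp add: tail_part_def)

lemma log_part_nonneg: "0 \<le> log_part x y"
  by (simp add: log_part_def)

lemma \<Phi>_sym: "\<Phi> x y = \<Phi> y x"
  by (simp add: \<Phi>_def abs_minus_commute algebra_simps)

text \<open>Holds at t = 0 too, as 0 \<open>powr\<close> any exponent is 0. Thus the weight with
  exponent p - 2 causes no trouble for p < 2.\<close>

lemma powr_mult_self: "0 \<le> t \<Longrightarrow> t powr (p - 2) * t = t powr (p - 1)" for t :: real
  using powr_mult_base[of t "p - 2"] by (simp add: mult.commute)

text \<open>Here \<open>v y = 0\<close>, and \<open>u x - u y\<close> is at most u x + d plus the
  negative part of u y. Splitting the power of this sum and multiplying by v x \<le> (u x + d)^(1 -
  p) turns the first part into a constant, however large u x is.\<close>

lemma \<Phi>_far_le: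
  assumes x: "x \<in> ball x0 R" and y: "y \<notin> ball x0 R"
  shows "\<Phi> x y \<le> 2 powr (p - 1) * tail_part x y"
proof (cases "x \<in> S")
  case False
  have "y \<notin> S" using y S_subset(2) by blast
  then have "v x = 0" "v y = 0" using v_outside(1) False by blast+
  then show ?thesis using tail_part_nonneg by (simp add: \<Phi>_def)
next
  case True
  have "y \<notin> S" using y S_subset(2) by blast
  then have vy: "v y = 0" by (rule v_outside(1))
  have ux: "0 < u x + d" using u_add_d[OF x] d by simp
  have vx: "v x \<le> (u x + d) powr (1 - p)"
  proof -
    have "\<eta> x powr p \<le> 1" using \<eta>_bounds(1,2)[of x] p powr_mono2[of p "\<eta> x" 1] by simp
    from mult_right_mono[OF this, of "(u x + d) powr (1 - p)"] show ?thesis by (simp add: v_def)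
  qed
  define m where "m = max (- u y) 0"
  show ?thesis
  \<comment> \<open>Since \<open>v x\<close> is nonnegative, \<open>\<Phi> x y\<close> is positive
    only if \<open>u x\<close> exceeds \<open>u y\<close>.\<close>
  proof (cases "u x - u y \<le> 0")
    case True
    then have "\<Phi> x y \<le> 0"
      unfolding \<Phi>_def vy using v_bounds(1)[of x] by (simp add: mult_nonneg_nonpos mult_nonpos_nonneg)
    then show ?thesis using tail_part_nonneg[of x y] by (smt (verit) mult_nonneg_nonneg powr_ge_zero)
  next
    case False
    then have "\<Phi> x y = (u x - u y) powr (p - 1) * v x"
      using powr_mult_self[of "u x - u y"] by (simp add: \<Phi>_def vy)
    also have "\<dots> \<le> ((u x + d) + m) powr (p - 1) * (u x + d) powr (1 - p)"
      using False vx v_bounds(1)[of x] d p ux by (intro mult_mono powr_mono2) (auto simp: m_def)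
    also have "\<dots> \<le> (2 powr (p - 1) * ((u x + d) powr (p - 1) + m powr (p - 1))) * (u x + d) powr (1 - p)"
      using ux p by (intro mult_right_mono powr_add_le) (auto simp: m_def)
    also have "\<dots> = 2 powr (p - 1) * ((u x + d) powr (p - 1) * (u x + d) powr (1 - p) + (u x + d) powr (1 - p) * m powr (p - 1))"
      by (simp add: algebra_simps)
    also have "(u x + d) powr (p - 1) * (u x + d) powr (1 - p) = 1" using ux by (simp flip: powr_add)
    also have "2 powr (p - 1) * (1 + (u x + d) powr (1 - p) * m powr (p - 1)) \<le> 2 powr (p - 1) * (1 + d powr (1 - p) * m powr (p - 1))"
      using powr_u_add_d_le[OF x, of "1 - p"] p by (intro mult_left_mono add_left_mono mult_right_mono) auto
    also have "\<dots> = 2 powr (p - 1) * tail_part x y" using \<open>x \<in> S\<close> y by (simp add: tail_part_def m_def)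
    finally show ?thesis .
  qed
qed

text \<open>When both points lie in the large ball this is \<open>log_inequality\<close>, weakened
  by (5/9)^p on the small ball. In the other cases the logarithmic part vanishes and
  \<open>\<Phi>_far_le\<close>, used symmetrically, suffices.\<close>

lemma \<Phi>_le:
  "\<Phi> x y + (p - 1) / 2 * (5 / 9) powr p * log_part x y
    \<le> 2 powr (p - 1) * (\<bar>\<eta> x - \<eta> y\<bar> powr p + tail_part x y + tail_part y x)"
proof -
  have nn: "0 \<le> 2 powr (p - 1) * \<bar>\<eta> x - \<eta> y\<bar> powr p" "0 \<le> 2 powr (p - 1) * tail_part x y" "0 \<le> 2 powr (p - 1) * tail_part y x"
    using tail_part_nonneg by simp_all
  have Br: "ball x0 r \<subseteq> ball x0 R" using r rR by auto
  consider "x \<in> ball x0 R" "y \<in> ball x0 R" | "x \<in> ball x0 R" "y \<notin> ball x0 R"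
    | "x \<notin> ball x0 R" "y \<in> ball x0 R" | "x \<notin> ball x0 R" "y \<notin> ball x0 R" by blast
  then show ?thesis
  proof cases
    case 1
    have pos: "0 < u x + d" "0 < u y + d" using u_add_d[OF 1(1)] u_add_d[OF 1(2)] d by auto
    have "(p - 1) / 2 * (5 / 9) powr p * log_part x y \<le> (p - 1) / 2 * min (\<eta> x) (\<eta> y) powr p * \<bar>ln ((u x + d) / (u y + d))\<bar> powr p"
    proof (cases "x \<in> ball x0 r \<and> y \<in> ball x0 r")
      case True
      then have "(5 / 9) powr p \<le> min (\<eta> x) (\<eta> y) powr p"
        using \<eta>_bounds(4)[of x] \<eta>_bounds(4)[of y] p by (intro powr_mono2) auto
      then show ?thesis using True p by (auto simp: log_part_def intro!: mult_right_mono mult_left_mono)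
    next
      case False
      then show ?thesis using p by (auto simp: log_part_def)
    qed
    moreover have "\<Phi> x y \<le> 2 powr (p - 1) * \<bar>\<eta> x - \<eta> y\<bar> powr p - (p - 1) / 2 * min (\<eta> x) (\<eta> y) powr p * \<bar>ln ((u x + d) / (u y + d))\<bar> powr p"
      using log_inequality[OF p pos \<eta>_bounds(1)[of x] \<eta>_bounds(1)[of y]] by (simp add: \<Phi>_def v_def)
    ultimately show ?thesis using nn by (simp add: distrib_left)
  next
    case 2
    then have "x \<notin> ball x0 r \<or> y \<notin> ball x0 r" using Br by blast
    then have "log_part x y = 0" by (auto simp: log_part_def simp del: mem_ball)
    then show ?thesis using \<Phi>_far_le[OF 2] nn by (simp only: distrib_left mult_zero_right add_0_right; linarith)
  next
    case 3
    then have "x \<notin> ball x0 r \<or> y \<notin> ball x0 r" using Br by blast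
    then have "log_part x y = 0" by (auto simp: log_part_def simp del: mem_ball)
    then show ?thesis using \<Phi>_far_le[OF 3(2,1)] nn \<Phi>_sym[of x y]
      by (simp only: distrib_left mult_zero_right add_0_right; linarith)
  next
    case 4
    then have "x \<notin> ball x0 r \<or> y \<notin> ball x0 r" using Br by blast
    then have "log_part x y = 0" by (auto simp: log_part_def simp del: mem_ball)
    moreover have "v x = 0" "v y = 0" using v_outside(1)[of x] v_outside(1)[of y] 4 S_subset(2) by blast+
    ultimately show ?thesis using nn by (simp add: distrib_left \<Phi>_def)
  qed
qed

text \<open>As |x - x0| \<le> 3R/4 \<le> (3/4) |y - x0|, a quarter of |y - x0| remains for |x - y|;
  and R/4 \<ge> r/2.\<close>

lemma distance_far:
  assumes "x \<in> S" "y \<notin> ball x0 R"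
  shows "norm (y - x0) / 4 \<le> norm (x - y)" "r / 2 \<le> norm (x - y)" "0 < norm (y - x0)"
proof -
  have y: "R \<le> norm (y - x0)" using assms(2) by (simp add: dist_norm norm_minus_commute)
  have "x \<in> cball x0 (3 * R / 4)" using assms(1) S_subset(3) by blast
  then have "norm (x - x0) \<le> 3 * R / 4" by (simp add: dist_norm norm_minus_commute)
  then have "norm (x - x0) \<le> 3 / 4 * norm (y - x0)" using y by simp
  moreover have "norm (y - x0) \<le> norm (x - y) + norm (x - x0)"
    using norm_triangle_ineq[of "y - x" "x - x0"] by (simp add: norm_minus_commute)
  ultimately show 1: "norm (y - x0) / 4 \<le> norm (x - y)" by simp
  show "r / 2 \<le> norm (x - y)" "0 < norm (y - x0)" using 1 y rR R_pos by auto
qed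

text \<open>Moves the singularity to the centre, as in the tail; 4^(N + p) replaces 4^(N + s p) to
  be uniform in s.\<close>

lemma kernel_far:
  assumes "x \<in> S" "y \<notin> ball x0 R" "0 < s" "s < 1"
  shows "1 / norm (x - y) powr (DIM('a) + s * p) \<le> 4 powr (DIM('a) + p) / norm (y - x0) powr (DIM('a) + s * p)"
proof -
  have e: "0 < DIM('a) + s * p" "DIM('a) + s * p \<le> DIM('a) + p"
    using assms p by (auto intro: add_pos_pos)
  note D = distance_far[OF assms(1,2)]
  have "(norm (y - x0) / 4) powr (DIM('a) + s * p) \<le> norm (x - y) powr (DIM('a) + s * p)"
    using D e by (intro powr_mono2) auto
  moreover have "0 < (norm (y - x0) / 4) powr (DIM('a) + s * p)" using D by simp
  moreover have "0 < norm (x - y)" using D by linarith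
  ultimately have "1 / norm (x - y) powr (DIM('a) + s * p) \<le> 1 / (norm (y - x0) / 4) powr (DIM('a) + s * p)"
    by (intro divide_left_mono mult_pos_pos) auto
  also have "\<dots> = 4 powr (DIM('a) + s * p) / norm (y - x0) powr (DIM('a) + s * p)"
    by (simp add: powr_divide)
  also have "\<dots> \<le> 4 powr (DIM('a) + p) / norm (y - x0) powr (DIM('a) + s * p)"
    using e by (intro divide_right_mono powr_mono) auto
  finally show ?thesis .
qed

lemma emeasure_S: "emeasure lborel S = ennreal (unit_ball_vol DIM('a) * (3 * r / 2) ^ DIM('a))"
  using r by (simp add: emeasure_cball)

lemma kernel_powr:
  assumes "0 < t" shows "t powr p / t powr (DIM('a) + s * p) = t powr (p * (1 - s) - DIM('a))"
  using assms by (simp add: powr_diff[symmetric] algebra_simps)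

text \<open>The volume of \<open>S\<close>.\<close>

definition "vol = unit_ball_vol DIM('a) * (3 * r / 2) ^ DIM('a)"

text \<open>The surface area of the unit sphere.\<close>

definition "sph = DIM('a) * unit_ball_vol DIM('a)"

lemma vol_sph_pos: "0 < vol" "0 < sph"
  using r by (auto simp: vol_def sph_def)

lemma nn_integral_S_convolution:
  fixes \<omega> :: "'a \<Rightarrow> ennreal"
  assumes [measurable]: "\<omega> \<in> borel_measurable borel"
  shows "(\<integral>\<^sup>+x. \<integral>\<^sup>+y. indicator S x * \<omega> (x - y) \<partial>lborel \<partial>lborel) = ennreal vol * (\<integral>\<^sup>+h. \<omega> h \<partial>lborel)"
proof -
  have "(indicator S :: 'a \<Rightarrow> ennreal) \<in> borel_measurable borel" by measurable
  from nn_integral_convolution[OF this assms] show ?thesis by (simp add: emeasure_S vol_def)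
qed

text \<open>The distance is split at \<open>r\<close>. Below it the Lipschitz bound gives |h|^p /
  r^p, above it the oscillation is at most 1; both radial integrals then scale like r^(-s p). One of
  the points must lie in \<open>S\<close>, which accounts for 2 \<open>vol\<close>.\<close>

lemma cutoff_integral_le:
  assumes s: "0 < s" "s < 1"
  shows "(\<integral>\<^sup>+x. \<integral>\<^sup>+y. ennreal (\<bar>\<eta> x - \<eta> y\<bar> powr p / norm (x - y) powr (DIM('a) + s * p)) \<partial>lborel \<partial>lborel)
    \<le> ennreal (2 * vol * sph * (4 / 3) powr p * (r powr (- s * p) * (1 / s + 1 / (1 - s))))"
proof -
  define \<omega> where "\<omega> h = ennreal ((4 / (3 * r)) powr p) * (ennreal (norm h powr (p * (1 - s) - DIM('a))) * indicator {h. norm h \<le> r} h)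
    + ennreal (1 / norm h powr (DIM('a) + s * p)) * indicator {h. r \<le> norm h} h" for h :: 'a
  have [measurable]: "\<omega> \<in> borel_measurable borel" unfolding \<omega>_def by measurable
  have \<omega>sym: "\<omega> (x - y) = \<omega> (y - x)" for x y by (simp add: \<omega>_def norm_minus_commute indicator_def)
  have ps: "0 < p * (1 - s)" "0 < s * p" using p s by auto
  have bound: "ennreal (\<bar>\<eta> x - \<eta> y\<bar> powr p / norm (x - y) powr (DIM('a) + s * p)) \<le> \<omega> (x - y)" for x y
  proof (cases "norm (x - y) \<le> r")
    case True
    show ?thesis
    proof (cases "x = y")
      case False
      then have n: "0 < norm (x - y)" by simp
      have "\<bar>\<eta> x - \<eta> y\<bar> powr p \<le> (4 / (3 * r) * norm (x - y)) powr p"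
        using \<eta>_Lipschitz p by (intro powr_mono2) auto
      also have "\<dots> = (4 / (3 * r)) powr p * norm (x - y) powr p" by (rule powr_mult)
      finally have "\<bar>\<eta> x - \<eta> y\<bar> powr p / norm (x - y) powr (DIM('a) + s * p)
        \<le> (4 / (3 * r)) powr p * norm (x - y) powr p / norm (x - y) powr (DIM('a) + s * p)"
        by (intro divide_right_mono) auto
      also have "\<dots> = (4 / (3 * r)) powr p * norm (x - y) powr (p * (1 - s) - DIM('a))"
        by (simp only: times_divide_eq_right[symmetric] kernel_powr[OF n])
      finally have "ennreal (\<bar>\<eta> x - \<eta> y\<bar> powr p / norm (x - y) powr (DIM('a) + s * p))
        \<le> ennreal ((4 / (3 * r)) powr p) * (ennreal (norm (x - y) powr (p * (1 - s) - DIM('a))) * indicator {h. norm h \<le> r} (x - y))"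
        using True by (simp add: ennreal_leI flip: ennreal_mult)
      then show ?thesis unfolding \<omega>_def by (rule order_trans) simp
    qed simp
  next
    case False
    have "\<bar>\<eta> x - \<eta> y\<bar> \<le> 1" using \<eta>_bounds(1,2)[of x] \<eta>_bounds(1,2)[of y] by linarith
    then have "\<bar>\<eta> x - \<eta> y\<bar> powr p \<le> 1" using p powr_mono2[of p "\<bar>\<eta> x - \<eta> y\<bar>" 1] by simp
    then have "ennreal (\<bar>\<eta> x - \<eta> y\<bar> powr p / norm (x - y) powr (DIM('a) + s * p))
        \<le> ennreal (1 / norm (x - y) powr (DIM('a) + s * p))"
      by (intro ennreal_leI divide_right_mono) auto
    then show ?thesis using False by (simp add: \<omega>_def)
  qed
  have "(\<integral>\<^sup>+x. \<integral>\<^sup>+y. ennreal (\<bar>\<eta> x - \<eta> y\<bar> powr p / norm (x - y) powr (DIM('a) + s * p)) \<partial>lborel \<partial>lborel)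
    \<le> (\<integral>\<^sup>+x. \<integral>\<^sup>+y. indicator S x * \<omega> (x - y) + indicator S y * \<omega> (x - y) \<partial>lborel \<partial>lborel)"
  proof (intro nn_integral_mono)
    fix x y
    show "ennreal (\<bar>\<eta> x - \<eta> y\<bar> powr p / norm (x - y) powr (DIM('a) + s * p)) \<le> indicator S x * \<omega> (x - y) + indicator S y * \<omega> (x - y)"
    proof (cases "x \<in> S \<or> y \<in> S")
      case True
      then show ?thesis using bound[of x y] order_trans[OF bound[of x y], of "\<omega> (x - y) + \<omega> (x - y)"]
        by (auto simp: indicator_def simp del: mem_cball)
    next
      case False
      then show ?thesis using \<eta>_bounds(3)[of x] \<eta>_bounds(3)[of y] p by simp
    qed
  qed
  also have "\<dots> = (\<integral>\<^sup>+x. \<integral>\<^sup>+y. indicator S x * \<omega> (x - y) \<partial>lborel \<partial>lborel) + (\<integral>\<^sup>+x. \<integral>\<^sup>+y. indicator S y * \<omega> (x - y) \<partial>lborel \<partial>lborel)"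
    by (simp add: nn_integral_add)
  also have "(\<integral>\<^sup>+x. \<integral>\<^sup>+y. indicator S y * \<omega> (x - y) \<partial>lborel \<partial>lborel) = (\<integral>\<^sup>+y. \<integral>\<^sup>+x. indicator S y * \<omega> (x - y) \<partial>lborel \<partial>lborel)"
    by (rule lborel_pair.Fubini') measurable
  also have "\<dots> = (\<integral>\<^sup>+y. \<integral>\<^sup>+x. indicator S y * \<omega> (y - x) \<partial>lborel \<partial>lborel)"
    by (subst \<omega>sym) simp
  also have "(\<integral>\<^sup>+x. \<integral>\<^sup>+y. indicator S x * \<omega> (x - y) \<partial>lborel \<partial>lborel) + \<dots> = 2 * (ennreal vol * (\<integral>\<^sup>+h. \<omega> h \<partial>lborel))"
    by (simp add: nn_integral_S_convolution mult_2)
  also have "(\<integral>\<^sup>+h. \<omega> h \<partial>lborel) = ennreal ((4 / (3 * r)) powr p * (sph * (r powr (p * (1 - s)) / (p * (1 - s)))) + sph * (r powr (- (s * p)) / (s * p)))"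
  proof -
    define X where "X = sph * (r powr (p * (1 - s)) / (p * (1 - s)))"
    define Y where "Y = sph * (r powr (- (s * p)) / (s * p))"
    have XY: "0 \<le> X" "0 \<le> Y" using vol_sph_pos ps by (simp_all add: X_def Y_def)
    have "(\<integral>\<^sup>+h. \<omega> h \<partial>lborel) = ennreal ((4 / (3 * r)) powr p) * ennreal X + ennreal Y"
      unfolding \<omega>_def X_def Y_def sph_def
        nn_integral_norm_powr_inside[OF ps(1) r, where 'a = 'a, symmetric] nn_integral_norm_powr_outside[OF ps(2) r, where 'a = 'a, symmetric]
      by (simp add: nn_integral_add nn_integral_cmult)
    also have "\<dots> = ennreal ((4 / (3 * r)) powr p * X + Y)" using XY by (simp add: ennreal_mult)
    finally show ?thesis by (simp only: X_def Y_def)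
  qed
  also have "(4 / (3 * r)) powr p * (sph * (r powr (p * (1 - s)) / (p * (1 - s)))) + sph * (r powr (- (s * p)) / (s * p))
     \<le> sph * (4 / 3) powr p * (r powr (- s * p) * (1 / s + 1 / (1 - s)))"
  proof -
    \<comment> \<open>The Lipschitz constant contributes r^(-p) and the integral r^(p (1 - s)):
      together r^(-s p), the same power as far from the diagonal.\<close>
    have a: "(4 / (3 * r)) powr p * r powr (p * (1 - s)) = (4 / 3) powr p * r powr (- s * p)"
    proof -
      have "(4 / (3 * r)) powr p = (4 / 3) powr p * r powr (- p)"
        using r by (simp add: powr_divide powr_mult powr_minus_divide)
      then show ?thesis by (simp add: algebra_simps flip: powr_add)
    qed
    have i: "1 / (p * (1 - s)) \<le> 1 / (1 - s)" "1 / (s * p) \<le> 1 / s"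
      using p s by (auto intro!: divide_left_mono)
    have one: "1 \<le> (4 / 3 :: real) powr p" using p by (intro ge_one_powr_ge_zero) auto
    have "(4 / (3 * r)) powr p * (sph * (r powr (p * (1 - s)) / (p * (1 - s)))) = sph * ((4 / (3 * r)) powr p * r powr (p * (1 - s))) * (1 / (p * (1 - s)))"
      by simp
    also have "\<dots> = sph * (4 / 3) powr p * r powr (- s * p) * (1 / (p * (1 - s)))" by (simp only: a mult.assoc)
    also have "\<dots> \<le> sph * (4 / 3) powr p * r powr (- s * p) * (1 / (1 - s))"
      using i(1) vol_sph_pos by (intro mult_left_mono) auto
    finally have A: "(4 / (3 * r)) powr p * (sph * (r powr (p * (1 - s)) / (p * (1 - s)))) \<le> sph * (4 / 3) powr p * r powr (- s * p) * (1 / (1 - s))" .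
    have "sph * (r powr (- (s * p)) / (s * p)) = sph * 1 * r powr (- s * p) * (1 / (s * p))" by simp
    also have "\<dots> \<le> sph * (4 / 3) powr p * r powr (- s * p) * (1 / s)"
      using i(2) one vol_sph_pos s p by (intro mult_mono mult_right_mono mult_left_mono mult_nonneg_nonneg) auto
    finally show ?thesis using A by (simp add: distrib_left)
  qed
  finally have *: "(\<integral>\<^sup>+x. \<integral>\<^sup>+y. ennreal (\<bar>\<eta> x - \<eta> y\<bar> powr p / norm (x - y) powr (DIM('a) + s * p)) \<partial>lborel \<partial>lborel)
    \<le> 2 * (ennreal vol * ennreal (sph * (4 / 3) powr p * (r powr (- s * p) * (1 / s + 1 / (1 - s)))))"
    by (simp add: mult_left_mono ennreal_leI)
  also have "\<dots> = ennreal (2 * vol * sph * (4 / 3) powr p * (r powr (- s * p) * (1 / s + 1 / (1 - s))))"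
    using vol_sph_pos s by (simp add: ennreal_mult' mult.assoc)
  finally show ?thesis .
qed

text \<open>The constant summand sees only distances of at least r/2, and (r/2)^(-s p) \<le> 2^p
  r^(-s p). In the other one \<open>kernel_far\<close> separates the variables, so that the integral
  over x is just \<open>vol\<close>.\<close>

lemma tail_part_integral_le:
  assumes s: "0 < s" "s < 1"
  shows "(\<integral>\<^sup>+x. \<integral>\<^sup>+y. ennreal (tail_part x y / norm (x - y) powr (DIM('a) + s * p)) \<partial>lborel \<partial>lborel)
    \<le> ennreal (vol * sph * 2 powr p * (r powr (- s * p) * (1 / s + 1 / (1 - s))))
      + ennreal (vol * 4 powr (DIM('a) + p) * d powr (1 - p))
        * (\<integral>\<^sup>+y\<in>- ball x0 R. ennreal (max (- u y) 0 powr (p - 1) / norm (y - x0) powr (DIM('a) + s * p)) \<partial>lborel)"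
proof -
  define \<omega> where "\<omega> h = ennreal (1 / norm h powr (DIM('a) + s * p)) * indicator {h. r / 2 \<le> norm h} h" for h :: 'a
  have [measurable]: "\<omega> \<in> borel_measurable borel" unfolding \<omega>_def by measurable
  define t where "t y = ennreal (max (- u y) 0 powr (p - 1) / norm (y - x0) powr (DIM('a) + s * p)) * indicator (- ball x0 R) y" for y
  have [measurable]: "t \<in> borel_measurable borel" unfolding t_def by measurable
  define c where "c = 4 powr (DIM('a) + p) * d powr (1 - p)"
  have c: "0 \<le> c" by (simp add: c_def)
  have sp: "0 < s * p" using s p by simp
  have "(\<integral>\<^sup>+x. \<integral>\<^sup>+y. ennreal (tail_part x y / norm (x - y) powr (DIM('a) + s * p)) \<partial>lborel \<partial>lborel)
    \<le> (\<integral>\<^sup>+x. \<integral>\<^sup>+y. indicator S x * \<omega> (x - y) + indicator S x * (ennreal c * t y) \<partial>lborel \<partial>lborel)"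
  proof (intro nn_integral_mono)
    fix x y
    show "ennreal (tail_part x y / norm (x - y) powr (DIM('a) + s * p)) \<le> indicator S x * \<omega> (x - y) + indicator S x * (ennreal c * t y)"
    proof (cases "x \<in> S \<and> y \<notin> ball x0 R")
      case True
      let ?m = "max (- u y) 0 powr (p - 1)"
      have "tail_part x y / norm (x - y) powr (DIM('a) + s * p)
        = 1 / norm (x - y) powr (DIM('a) + s * p) + d powr (1 - p) * ?m * (1 / norm (x - y) powr (DIM('a) + s * p))"
        using True by (simp add: tail_part_def add_divide_distrib)
      also have "\<dots> \<le> 1 / norm (x - y) powr (DIM('a) + s * p) + d powr (1 - p) * ?m * (4 powr (DIM('a) + p) / norm (y - x0) powr (DIM('a) + s * p))"
        using True s by (intro add_left_mono mult_left_mono kernel_far) auto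
      also have "\<dots> = 1 / norm (x - y) powr (DIM('a) + s * p) + c * (?m / norm (y - x0) powr (DIM('a) + s * p))"
        by (simp add: c_def)
      finally have "ennreal (tail_part x y / norm (x - y) powr (DIM('a) + s * p))
        \<le> ennreal (1 / norm (x - y) powr (DIM('a) + s * p)) + ennreal c * ennreal (?m / norm (y - x0) powr (DIM('a) + s * p))"
        using c by (simp add: ennreal_leI flip: ennreal_plus ennreal_mult)
      then show ?thesis using True distance_far(2)[of x y] by (simp add: \<omega>_def t_def)
    next
      case False
      then show ?thesis by (auto simp: tail_part_def indicator_def simp del: mem_ball mem_cball)
    qed
  qed
  also have "\<dots> = (\<integral>\<^sup>+x. \<integral>\<^sup>+y. indicator S x * \<omega> (x - y) \<partial>lborel \<partial>lborel) + (\<integral>\<^sup>+x. \<integral>\<^sup>+y. indicator S x * (ennreal c * t y) \<partial>lborel \<partial>lborel)"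
    by (simp add: nn_integral_add)
  also have "(\<integral>\<^sup>+x. \<integral>\<^sup>+y. indicator S x * (ennreal c * t y) \<partial>lborel \<partial>lborel) = ennreal vol * (ennreal c * (\<integral>\<^sup>+y. t y \<partial>lborel))"
    by (simp add: nn_integral_cmult nn_integral_multc emeasure_S vol_def)
  also have "(\<integral>\<^sup>+x. \<integral>\<^sup>+y. indicator S x * \<omega> (x - y) \<partial>lborel \<partial>lborel) = ennreal vol * (\<integral>\<^sup>+h. \<omega> h \<partial>lborel)"
    by (rule nn_integral_S_convolution) measurable
  also have "(\<integral>\<^sup>+h. \<omega> h \<partial>lborel) = ennreal (sph * ((r / 2) powr (- (s * p)) / (s * p)))"
    unfolding \<omega>_def sph_def using sp r by (intro nn_integral_norm_powr_outside) auto
  also have "sph * ((r / 2) powr (- (s * p)) / (s * p)) \<le> sph * 2 powr p * (r powr (- s * p) * (1 / s + 1 / (1 - s)))"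
  proof -
    have "(r / 2) powr (- (s * p)) = r powr (- s * p) * 2 powr (s * p)"
      using r by (simp add: powr_divide powr_minus field_simps)
    also have "\<dots> \<le> r powr (- s * p) * 2 powr p" using s p by (intro mult_left_mono powr_mono) auto
    finally have 1: "(r / 2) powr (- (s * p)) \<le> r powr (- s * p) * 2 powr p" .
    have "1 / (s * p) \<le> 1 / s" using p s by (auto intro!: divide_left_mono)
    also have "\<dots> \<le> 1 / s + 1 / (1 - s)" using s by simp
    finally have 2: "1 / (s * p) \<le> 1 / s + 1 / (1 - s)" .
    have "(r / 2) powr (- (s * p)) * (1 / (s * p)) \<le> (r powr (- s * p) * 2 powr p) * (1 / s + 1 / (1 - s))"
      using 1 2 s p by (intro mult_mono) auto
    from mult_left_mono[OF this, of sph] show ?thesis using vol_sph_pos by (simp add: mult_ac)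
  qed
  finally have "(\<integral>\<^sup>+x. \<integral>\<^sup>+y. ennreal (tail_part x y / norm (x - y) powr (DIM('a) + s * p)) \<partial>lborel \<partial>lborel)
    \<le> ennreal vol * ennreal (sph * 2 powr p * (r powr (- s * p) * (1 / s + 1 / (1 - s)))) + ennreal vol * (ennreal c * (\<integral>\<^sup>+y. t y \<partial>lborel))"
    by (simp add: mult_left_mono ennreal_leI add_right_mono)
  also have "\<dots> = ennreal (vol * sph * 2 powr p * (r powr (- s * p) * (1 / s + 1 / (1 - s)))) + ennreal (vol * 4 powr (DIM('a) + p) * d powr (1 - p)) * (\<integral>\<^sup>+y. t y \<partial>lborel)"
    using vol_sph_pos by (simp add: ennreal_mult' mult.assoc c_def)
  finally show ?thesis by (simp add: t_def)
qed

lemma abs_\<Phi>: "\<bar>\<Phi> x y\<bar> = \<bar>u x - u y\<bar> powr (p - 1) * \<bar>v x - v y\<bar>"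
  using powr_mult_self[of "\<bar>u x - u y\<bar>"] by (simp add: \<Phi>_def abs_mult)

text \<open>The length R/8 keeps y in the large ball, where \<open>v_Lipschitz\<close> applies. The
  mixed product |u x - u y|^(p - 1) |x - y| is at most the p-th power of the larger factor.\<close>

lemma abs_\<Phi>_near:
  assumes "x \<in> S" "norm (x - y) \<le> R / 8"
  shows "\<bar>\<Phi> x y\<bar> \<le> (p * (4 / (3 * r)) * d powr (1 - p) + (p - 1) * d powr (- p)) * (norm (x - y) powr p + \<bar>u x - u y\<bar> powr p)"
proof -
  define a where "a = \<bar>u x - u y\<bar>"
  define b where "b = norm (x - y)"
  define L where "L = p * (4 / (3 * r)) * d powr (1 - p)"
  define K where "K = (p - 1) * d powr (- p)"
  have LK: "0 \<le> L" "0 \<le> K" using p r by (auto simp: L_def K_def)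
  have ab: "0 \<le> a" "0 \<le> b" by (auto simp: a_def b_def)
  have x: "x \<in> ball x0 R" using assms(1) S_subset(2) by blast
  have "x \<in> cball x0 (3 * R / 4)" using assms(1) S_subset(3) by blast
  then have "dist x0 y \<le> 3 * R / 4 + R / 8"
    using dist_triangle[of x0 y x] assms(2) by (simp add: dist_norm)
  then have y: "y \<in> ball x0 R" using R_pos by simp
  have "\<bar>\<Phi> x y\<bar> \<le> a powr (p - 1) * (L * b + K * a)"
    unfolding abs_\<Phi> a_def b_def L_def K_def using v_Lipschitz[OF x y] by (intro mult_left_mono) auto
  also have "\<dots> = L * (a powr (p - 1) * b) + K * a powr p"
    using powr_mult_base[of a "p - 1"] ab by (simp add: algebra_simps)
  also have "a powr (p - 1) * b \<le> max a b powr (p - 1) * max a b"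
    using ab p by (intro mult_mono powr_mono2) auto
  also have "max a b powr (p - 1) * max a b = max a b powr p"
    using powr_mult_base[of "max a b" "p - 1"] ab by (simp add: mult.commute)
  also have "max a b powr p \<le> b powr p + a powr p" by (simp add: max_def)
  finally have "\<bar>\<Phi> x y\<bar> \<le> L * (b powr p + a powr p) + K * a powr p"
    using LK by (simp add: mult_left_mono)
  also have "\<dots> \<le> L * (b powr p + a powr p) + K * (b powr p + a powr p)"
    using LK by (intro add_left_mono mult_left_mono) auto
  finally show ?thesis by (simp add: L_def K_def a_def b_def distrib_right)
qed

text \<open>Away from the diagonal boundedness of \<open>v\<close> is enough, and the growth of
  order p - 1 is what membership in the tail space controls.\<close>

lemma abs_\<Phi>_le: "\<bar>\<Phi> x y\<bar> \<le> d powr (1 - p) * 2 powr (p - 1) * (\<bar>u x\<bar> powr (p - 1) + \<bar>u y\<bar> powr (p - 1))"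
proof -
  have "\<bar>u x - u y\<bar> powr (p - 1) \<le> (\<bar>u x\<bar> + \<bar>u y\<bar>) powr (p - 1)"
    using p by (intro powr_mono2) auto
  also have "\<dots> \<le> 2 powr (p - 1) * (\<bar>u x\<bar> powr (p - 1) + \<bar>u y\<bar> powr (p - 1))"
    using p by (intro powr_add_le) auto
  finally have "\<bar>u x - u y\<bar> powr (p - 1) * \<bar>v x - v y\<bar>
    \<le> (2 powr (p - 1) * (\<bar>u x\<bar> powr (p - 1) + \<bar>u y\<bar> powr (p - 1))) * d powr (1 - p)"
    using v_bounds[of x] v_bounds[of y] by (intro mult_mono) auto
  then show ?thesis by (simp add: abs_\<Phi> mult_ac)
qed

lemma \<Phi>_outside: "x \<notin> S \<Longrightarrow> y \<notin> S \<Longrightarrow> \<Phi> x y = 0"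
  using v_outside(1)[of x] v_outside(1)[of y] by (simp add: \<Phi>_def)

text \<open>With y = x + h and the order of integration exchanged, \<open>Lp_difference_le\<close>
  applies for each fixed \<open>h\<close>; its |h|^p against the kernel leaves a radial power
  integrable at 0.\<close>

lemma difference_integral_le:
  assumes s: "0 < s" "s < 1"
  shows "(\<integral>\<^sup>+x. \<integral>\<^sup>+y. indicator S x * (ennreal (\<bar>u x - u y\<bar> powr p / norm (x - y) powr (DIM('a) + s * p)) * indicator {h. norm h \<le> R / 8} (x - y)) \<partial>lborel \<partial>lborel)
    \<le> (\<integral>\<^sup>+x\<in>cball x0 (15 * R / 16). ennreal (norm (Du x) powr p) \<partial>lborel)
      * (\<integral>\<^sup>+h. ennreal (norm h powr (p * (1 - s) - DIM('a))) * indicator {h. norm h \<le> R / 8} h \<partial>(lborel :: 'a measure))"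
    (is "_ \<le> ?G * _")
proof -
  have "(\<integral>\<^sup>+x. \<integral>\<^sup>+y. indicator S x * (ennreal (\<bar>u x - u y\<bar> powr p / norm (x - y) powr (DIM('a) + s * p)) * indicator {h. norm h \<le> R / 8} (x - y)) \<partial>lborel \<partial>lborel)
    = (\<integral>\<^sup>+x. \<integral>\<^sup>+h. indicator S x * (ennreal (\<bar>u x - u (h + x)\<bar> powr p / norm h powr (DIM('a) + s * p)) * indicator {h. norm h \<le> R / 8} h) \<partial>lborel \<partial>lborel)"
  proof (rule nn_integral_cong)
    fix x
    have "(\<integral>\<^sup>+y. indicator S x * (ennreal (\<bar>u x - u y\<bar> powr p / norm (x - y) powr (DIM('a) + s * p)) * indicator {h. norm h \<le> R / 8} (x - y)) \<partial>lborel)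
      = (\<integral>\<^sup>+h. indicator S x * (ennreal (\<bar>u x - u (x + h)\<bar> powr p / norm (x - (x + h)) powr (DIM('a) + s * p)) * indicator {h. norm h \<le> R / 8} (x - (x + h))) \<partial>lborel)"
      by (rule nn_integral_lborel_translate[symmetric]) measurable
    also have "\<dots> = (\<integral>\<^sup>+h. indicator S x * (ennreal (\<bar>u x - u (h + x)\<bar> powr p / norm h powr (DIM('a) + s * p)) * indicator {h. norm h \<le> R / 8} h) \<partial>lborel)"
      by (intro nn_integral_cong) (simp add: add.commute indicator_def del: mem_cball)
    finally show "(\<integral>\<^sup>+y. indicator S x * (ennreal (\<bar>u x - u y\<bar> powr p / norm (x - y) powr (DIM('a) + s * p)) * indicator {h. norm h \<le> R / 8} (x - y)) \<partial>lborel)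
      = (\<integral>\<^sup>+h. indicator S x * (ennreal (\<bar>u x - u (h + x)\<bar> powr p / norm h powr (DIM('a) + s * p)) * indicator {h. norm h \<le> R / 8} h) \<partial>lborel)" .
  qed
  also have "\<dots> = (\<integral>\<^sup>+h. \<integral>\<^sup>+x. indicator S x * (ennreal (\<bar>u x - u (h + x)\<bar> powr p / norm h powr (DIM('a) + s * p)) * indicator {h. norm h \<le> R / 8} h) \<partial>lborel \<partial>lborel)"
    by (rule lborel_pair.Fubini') measurable
  also have "\<dots> \<le> (\<integral>\<^sup>+h. ?G * (ennreal (norm h powr (p * (1 - s) - DIM('a))) * indicator {h. norm h \<le> R / 8} h) \<partial>(lborel :: 'a measure))"
  proof (rule nn_integral_mono)
    fix h :: 'a
    show "(\<integral>\<^sup>+x. indicator S x * (ennreal (\<bar>u x - u (h + x)\<bar> powr p / norm h powr (DIM('a) + s * p)) * indicator {h. norm h \<le> R / 8} h) \<partial>lborel)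
      \<le> ?G * (ennreal (norm h powr (p * (1 - s) - DIM('a))) * indicator {h. norm h \<le> R / 8} h)"
    \<comment> \<open>For h = 0 the increment of \<open>u\<close> is 0, and beyond R/8 the indicator
      is 0.\<close>
    proof (cases "norm h \<le> R / 8 \<and> h \<noteq> 0")
      case True
      then have n: "0 < norm h" by simp
      have "(\<integral>\<^sup>+x. indicator S x * (ennreal (\<bar>u x - u (h + x)\<bar> powr p / norm h powr (DIM('a) + s * p)) * indicator {h. norm h \<le> R / 8} h) \<partial>lborel)
        \<le> (\<integral>\<^sup>+x. ennreal (1 / norm h powr (DIM('a) + s * p)) * (ennreal (\<bar>u (h + x) - u x\<bar> powr p) * indicator (ball x0 (13 * R / 16)) x) \<partial>lborel)"
        using S_subset(1) True
        by (intro nn_integral_mono) (auto simp: indicator_def abs_minus_commute simp flip: ennreal_mult simp del: mem_cball mem_ball)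
      also have "\<dots> = ennreal (1 / norm h powr (DIM('a) + s * p)) * (\<integral>\<^sup>+x\<in>ball x0 (13 * R / 16). ennreal (\<bar>u (h + x) - u x\<bar> powr p) \<partial>lborel)"
        by (rule nn_integral_cmult) measurable
      also have "(\<integral>\<^sup>+x\<in>ball x0 (13 * R / 16). ennreal (\<bar>u (h + x) - u x\<bar> powr p) \<partial>lborel) \<le> ennreal (norm h powr p) * ?G"
      \<comment> \<open>The radii fit because 13/16 + 1/8 = 15/16, and the closed ball of radius
        15R/16 is a compact part of the open ball of radius R, where \<open>Du\<close> is
        p-integrable.\<close>
      proof (rule Lp_difference_le[OF p _ u_meas Du_meas weak_gradient])
        show "cball x0 (15 * R / 16) \<subseteq> ball x0 R" using R_pos by auto
        fix x t assume x: "x \<in> ball x0 (13 * R / 16)" and t: "0 \<le> t" "t \<le> (1::real)"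
        have "norm (t *\<^sub>R h) \<le> 1 * norm h" unfolding norm_scaleR using t by (intro mult_right_mono) auto
        with True have "norm (t *\<^sub>R h) \<le> R / 8" by linarith
        then have "dist x0 (t *\<^sub>R h + x) \<le> dist x0 x + R / 8"
          using dist_triangle[of x0 "t *\<^sub>R h + x" x] by (simp add: dist_norm del: norm_scaleR)
        then show "t *\<^sub>R h + x \<in> cball x0 (15 * R / 16)" using x by simp
      qed auto
      also have "ennreal (1 / norm h powr (DIM('a) + s * p)) * (ennreal (norm h powr p) * ?G)
        = ?G * (ennreal (1 / norm h powr (DIM('a) + s * p)) * ennreal (norm h powr p))"
        by (simp only: mult_ac)
      also have "ennreal (1 / norm h powr (DIM('a) + s * p)) * ennreal (norm h powr p) = ennreal (norm h powr p / norm h powr (DIM('a) + s * p))"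
        by (simp flip: ennreal_mult)
      also have "?G * ennreal (norm h powr p / norm h powr (DIM('a) + s * p)) = ?G * (ennreal (norm h powr (p * (1 - s) - DIM('a))) * indicator {h. norm h \<le> R / 8} h)"
        using True by (simp add: kernel_powr[OF n])
      finally show ?thesis by (simp add: mult_left_mono)
    next
      case False
      then show ?thesis by (cases "h = 0") auto
    qed
  qed
  also have "\<dots> = ?G * (\<integral>\<^sup>+h. ennreal (norm h powr (p * (1 - s) - DIM('a))) * indicator {h. norm h \<le> R / 8} h \<partial>(lborel :: 'a measure))"
    by (rule nn_integral_cmult) measurable
  finally show ?thesis .
qed

text \<open>Serves convergence only: \<open>C\<close> may depend on \<open>u\<close>,
  \<open>d\<close> and the radii, but it is independent of s, so the bound can be integrated over
  the exponents.\<close>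

lemma \<Phi>_integral_le:
  "\<exists>C<\<infinity>. \<forall>s. 0 < s \<and> s < 1 \<longrightarrow>
    (\<integral>\<^sup>+x. \<integral>\<^sup>+y. ennreal (\<bar>\<Phi> x y\<bar> / norm (x - y) powr (DIM('a) + s * p)) \<partial>lborel \<partial>lborel)
    \<le> C * ennreal (1 / s + 1 / (1 - s))
      + C * (\<integral>\<^sup>+y\<in>- ball x0 R. ennreal (\<bar>u y\<bar> powr (p - 1) / norm (y - x0) powr (DIM('a) + s * p)) \<partial>lborel)"
proof -
  define \<delta> where "\<delta> = R / 8"
  have \<delta>: "0 < \<delta>" using R_pos by (simp add: \<delta>_def)
  define M where "M = max (p * (4 / (3 * r)) * d powr (1 - p) + (p - 1) * d powr (- p)) (d powr (1 - p) * 2 powr (p - 1))"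
  have M: "0 \<le> M" by (simp add: M_def le_max_iff_disj)
  \<comment> \<open>\<open>D1\<close> dominates \<delta>^(p (1 - s)) and \<open>D\<close> dominates
    \<delta>^(-e) for every exponent e between 0 and N + p, whether \<delta> is below or above
    1.\<close>
  define D1 where "D1 = max 1 (\<delta> powr p)"
  define D where "D = max 1 (\<delta> powr (- (DIM('a) + p)))"
  have D0: "0 \<le> D1" "0 \<le> D" by (simp_all add: D1_def D_def)
  have powr_D: "\<delta> powr (- e) \<le> D" if "0 \<le> e" "e \<le> DIM('a) + p" for e
  proof (cases "1 \<le> \<delta>")
    case True
    then have "\<delta> powr (- e) \<le> \<delta> powr 0" using that by (intro powr_mono) auto
    then show ?thesis using True by (simp add: D_def)
  next
    case False
    then have "\<delta> powr (- e) \<le> \<delta> powr (- (DIM('a) + p))" using that \<delta> by (intro powr_mono') auto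
    then show ?thesis by (simp add: D_def)
  qed
  define G where "G = (\<integral>\<^sup>+x\<in>cball x0 (15 * R / 16). ennreal (norm (Du x) powr p) \<partial>lborel)"
  have G: "G < \<infinity>" unfolding G_def using R_pos by (intro Du_powr_finite) auto
  define U where "U = (\<integral>\<^sup>+x\<in>cball x0 R. ennreal (\<bar>u x\<bar> powr (p - 1)) \<partial>lborel)"
  have U: "U < \<infinity>" unfolding U_def by (intro u_powr_finite) auto
  define C1 where "C1 = ennreal (vol * (sph * D1)) + G * ennreal (sph * D1) + U * ennreal (sph * D) + ennreal vol * (ennreal D * U)"
  define C2 where "C2 = ennreal (vol * 4 powr (DIM('a) + p))"
  have C: "C1 < \<infinity>" "C2 < \<infinity>" using G U by (simp_all add: C1_def C2_def ennreal_mult_less_top)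
  have main: "(\<integral>\<^sup>+x. \<integral>\<^sup>+y. ennreal (\<bar>\<Phi> x y\<bar> / norm (x - y) powr (DIM('a) + s * p)) \<partial>lborel \<partial>lborel)
    \<le> 2 * ennreal M * (C1 * ennreal (1 / s + 1 / (1 - s))
      + C2 * (\<integral>\<^sup>+y\<in>- ball x0 R. ennreal (\<bar>u y\<bar> powr (p - 1) / norm (y - x0) powr (DIM('a) + s * p)) \<partial>lborel))"
    if s: "0 < s" "s < 1" for s
  proof -
    have ps: "0 < p * (1 - s)" "0 < s * p" using p s by auto
    define w where "w = ennreal (1 / s + 1 / (1 - s))"
    have w: "ennreal (1 / (1 - s)) \<le> w" "ennreal (1 / s) \<le> w" using s by (auto simp: w_def intro!: ennreal_leI)
    \<comment> \<open>The term with \<open>u y\<close> inside the large ball has no singular factor;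
      w \<ge> 1 fits it under the common weight.\<close>
    have w1: "1 \<le> w"
    proof -
      have "1 \<le> 1 / s" using s by simp
      then have "ennreal 1 \<le> ennreal (1 / s)" by (rule ennreal_leI)
      then show ?thesis using w(2) by (metis ennreal_1 order_trans)
    qed
    define \<omega>1 where "\<omega>1 h = ennreal (norm h powr (p * (1 - s) - DIM('a))) * indicator {h. norm h \<le> \<delta>} h" for h :: 'a
    define \<omega>3 where "\<omega>3 h = ennreal (1 / norm h powr (DIM('a) + s * p)) * indicator {h. \<delta> \<le> norm h} h" for h :: 'a
    define f where "f x = ennreal (\<bar>u x\<bar> powr (p - 1)) * indicator S x" for x
    define g where "g x = ennreal (\<bar>u x\<bar> powr (p - 1)) * indicator (ball x0 R) x" for x
    define t where "t y = ennreal (\<bar>u y\<bar> powr (p - 1) / norm (y - x0) powr (DIM('a) + s * p)) * indicator (- ball x0 R) y" for y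
    define q where "q x y = ennreal (\<bar>u x - u y\<bar> powr p / norm (x - y) powr (DIM('a) + s * p)) * indicator {h. norm h \<le> \<delta>} (x - y)" for x y
    have [measurable]: "\<omega>1 \<in> borel_measurable borel" "\<omega>3 \<in> borel_measurable borel" "f \<in> borel_measurable borel"
      "g \<in> borel_measurable borel" "t \<in> borel_measurable borel" "(\<lambda>z. q (fst z) (snd z)) \<in> borel_measurable (borel \<Otimes>\<^sub>M borel)"
      unfolding \<omega>1_def \<omega>3_def f_def g_def t_def q_def by measurable
    \<comment> \<open>The majorant for x in \<open>S\<close>: near the diagonal the increments of
      position and of \<open>u\<close>; away from it \<open>u x\<close>, \<open>u y\<close> inside
      the large ball, and \<open>u y\<close> outside. Since the integrand is symmetric and vanishes
      when neither point is in \<open>S\<close>, adding the transposed majorant covers all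
      pairs.\<close>
    define \<Psi> where "\<Psi> x y = indicator S x * \<omega>1 (x - y) + indicator S x * q x y + f x * \<omega>3 (x - y)
      + indicator S x * (ennreal D * g y) + indicator S x * (ennreal (4 powr (DIM('a) + p)) * t y)" for x y
    have \<Psi>m: "(\<lambda>y. \<Psi> x y) \<in> borel_measurable borel" "(\<lambda>y. \<Psi> y x) \<in> borel_measurable borel"
      "(\<lambda>x. \<integral>\<^sup>+y. \<Psi> x y \<partial>lborel) \<in> borel_measurable borel" "(\<lambda>x. \<integral>\<^sup>+y. \<Psi> y x \<partial>lborel) \<in> borel_measurable borel" for x
      unfolding \<Psi>_def q_def by measurable
    have \<omega>1: "(\<integral>\<^sup>+h. \<omega>1 h \<partial>lborel) \<le> ennreal (sph * D1) * w"
    proof -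
      have "(\<integral>\<^sup>+h. \<omega>1 h \<partial>lborel) = ennreal (sph * (\<delta> powr (p * (1 - s)) / (p * (1 - s))))"
        unfolding \<omega>1_def sph_def by (rule nn_integral_norm_powr_inside[OF ps(1) \<delta>])
      also have "\<dots> \<le> ennreal (sph * D1 * (1 / (1 - s)))"
      proof (rule ennreal_leI)
        have "\<delta> powr (p * (1 - s)) \<le> D1"
        proof (cases "1 \<le> \<delta>")
          case True
          then have "\<delta> powr (p * (1 - s)) \<le> \<delta> powr p" using s p by (intro powr_mono) auto
          then show ?thesis by (simp add: D1_def)
        next
          case False
          then have "\<delta> powr (p * (1 - s)) \<le> 1" using \<delta> ps powr_le1[of "p * (1 - s)" \<delta>] by simp
          then show ?thesis by (simp add: D1_def)
        qed
        moreover have "1 / (p * (1 - s)) \<le> 1 / (1 - s)" using p s by (auto intro!: divide_left_mono)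
        ultimately have "\<delta> powr (p * (1 - s)) * (1 / (p * (1 - s))) \<le> D1 * (1 / (1 - s))"
          using ps D0 by (intro mult_mono) auto
        from mult_left_mono[OF this, of sph]
        show "sph * (\<delta> powr (p * (1 - s)) / (p * (1 - s))) \<le> sph * D1 * (1 / (1 - s))"
          using vol_sph_pos by (simp add: mult_ac)
      qed
      also have "\<dots> = ennreal (sph * D1) * ennreal (1 / (1 - s))" using s vol_sph_pos D0 by (intro ennreal_mult) auto
      also have "\<dots> \<le> ennreal (sph * D1) * w" by (intro mult_left_mono w) auto
      finally show ?thesis .
    qed
    have \<omega>3: "(\<integral>\<^sup>+h. \<omega>3 h \<partial>lborel) \<le> ennreal (sph * D) * w"
    proof -
      have "(\<integral>\<^sup>+h. \<omega>3 h \<partial>lborel) = ennreal (sph * (\<delta> powr (- (s * p)) / (s * p)))"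
        unfolding \<omega>3_def sph_def by (rule nn_integral_norm_powr_outside[OF ps(2) \<delta>])
      also have "\<dots> \<le> ennreal (sph * D * (1 / s))"
      proof (rule ennreal_leI)
        have "s * p \<le> 1 * p" using s p by (intro mult_right_mono) auto
        then have "\<delta> powr (- (s * p)) \<le> D" using ps by (intro powr_D) auto
        moreover have "1 / (s * p) \<le> 1 / s" using p s by (auto intro!: divide_left_mono)
        ultimately have "\<delta> powr (- (s * p)) * (1 / (s * p)) \<le> D * (1 / s)"
          using ps D0 by (intro mult_mono) auto
        from mult_left_mono[OF this, of sph]
        show "sph * (\<delta> powr (- (s * p)) / (s * p)) \<le> sph * D * (1 / s)"
          using vol_sph_pos by (simp add: mult_ac)
      qed
      also have "\<dots> = ennreal (sph * D) * ennreal (1 / s)" using s vol_sph_pos D0 by (intro ennreal_mult) auto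
      also have "\<dots> \<le> ennreal (sph * D) * w" by (intro mult_left_mono w) auto
      finally show ?thesis .
    qed
    have bound: "ennreal (\<bar>\<Phi> x y\<bar> / norm (x - y) powr (DIM('a) + s * p)) \<le> ennreal M * \<Psi> x y" if x: "x \<in> S" for x y
    proof (cases "norm (x - y) \<le> \<delta>")
      case True
      show ?thesis
      proof (cases "x = y")
        case False
        then have n: "0 < norm (x - y)" by simp
        have "norm (x - y) \<le> R / 8" using True by (simp add: \<delta>_def)
        from order_trans[OF abs_\<Phi>_near[OF x this] mult_right_mono]
        have "\<bar>\<Phi> x y\<bar> \<le> M * (norm (x - y) powr p + \<bar>u x - u y\<bar> powr p)"
          by (simp add: M_def)
        then have "\<bar>\<Phi> x y\<bar> / norm (x - y) powr (DIM('a) + s * p)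
          \<le> M * (norm (x - y) powr p + \<bar>u x - u y\<bar> powr p) / norm (x - y) powr (DIM('a) + s * p)"
          by (intro divide_right_mono) auto
        also have "\<dots> = M * (norm (x - y) powr (p * (1 - s) - DIM('a)) + \<bar>u x - u y\<bar> powr p / norm (x - y) powr (DIM('a) + s * p))"
          by (simp only: times_divide_eq_right[symmetric] add_divide_distrib kernel_powr[OF n])
        finally have "ennreal (\<bar>\<Phi> x y\<bar> / norm (x - y) powr (DIM('a) + s * p))
          \<le> ennreal M * (\<omega>1 (x - y) + q x y)"
          using True M by (simp add: \<omega>1_def q_def ennreal_leI flip: ennreal_mult ennreal_plus)
        also have "\<dots> \<le> ennreal M * \<Psi> x y"
          using x by (intro mult_left_mono) (auto simp: \<Psi>_def add.assoc simp del: mem_cball intro!: add_left_mono)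
        finally show ?thesis .
      qed (simp add: \<Phi>_def)
    next
      case False
      have "\<bar>\<Phi> x y\<bar> \<le> M * (\<bar>u x\<bar> powr (p - 1) + \<bar>u y\<bar> powr (p - 1))"
        by (rule order_trans[OF abs_\<Phi>_le mult_right_mono]) (simp_all add: M_def)
      then have "\<bar>\<Phi> x y\<bar> / norm (x - y) powr (DIM('a) + s * p)
        \<le> M * (\<bar>u x\<bar> powr (p - 1) + \<bar>u y\<bar> powr (p - 1)) / norm (x - y) powr (DIM('a) + s * p)"
        by (intro divide_right_mono) auto
      also have "\<dots> = M * (\<bar>u x\<bar> powr (p - 1) * (1 / norm (x - y) powr (DIM('a) + s * p)) + \<bar>u y\<bar> powr (p - 1) * (1 / norm (x - y) powr (DIM('a) + s * p)))"
        by (simp add: add_divide_distrib distrib_left)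
      finally have "ennreal (\<bar>\<Phi> x y\<bar> / norm (x - y) powr (DIM('a) + s * p))
        \<le> ennreal M * (ennreal (\<bar>u x\<bar> powr (p - 1)) * ennreal (1 / norm (x - y) powr (DIM('a) + s * p))
          + ennreal (\<bar>u y\<bar> powr (p - 1) * (1 / norm (x - y) powr (DIM('a) + s * p))))"
        using M by (simp add: ennreal_leI flip: ennreal_mult ennreal_plus)
      also have "ennreal (\<bar>u x\<bar> powr (p - 1)) * ennreal (1 / norm (x - y) powr (DIM('a) + s * p)) = f x * \<omega>3 (x - y)"
        using x False by (simp add: f_def \<omega>3_def del: mem_cball)
      also have "ennreal (\<bar>u y\<bar> powr (p - 1) * (1 / norm (x - y) powr (DIM('a) + s * p)))
        \<le> ennreal D * g y + ennreal (4 powr (DIM('a) + p)) * t y"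
      proof (cases "y \<in> ball x0 R")
        case True
        have "s * p \<le> 1 * p" using s p by (intro mult_right_mono) auto
        then have "\<delta> powr (- (DIM('a) + s * p)) \<le> D" using ps by (intro powr_D) auto
        moreover have "norm (x - y) powr (- (DIM('a) + s * p)) \<le> \<delta> powr (- (DIM('a) + s * p))"
          using False \<delta> ps by (intro powr_mono2') auto
        ultimately have "norm (x - y) powr (- (DIM('a) + s * p)) \<le> D" by linarith
        then have "1 / norm (x - y) powr (DIM('a) + s * p) \<le> D" by (simp only: powr_minus_divide)
        from mult_left_mono[OF this, of "\<bar>u y\<bar> powr (p - 1)"]
        have "ennreal (\<bar>u y\<bar> powr (p - 1) * (1 / norm (x - y) powr (DIM('a) + s * p))) \<le> ennreal D * g y"
          using True D0 by (simp add: g_def mult.commute[of D] ennreal_leI del: mem_ball flip: ennreal_mult)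
        then show ?thesis by (rule order_trans) simp
      next
        case False
        have "\<bar>u y\<bar> powr (p - 1) * (1 / norm (x - y) powr (DIM('a) + s * p)) \<le> \<bar>u y\<bar> powr (p - 1) * (4 powr (DIM('a) + p) / norm (y - x0) powr (DIM('a) + s * p))"
          by (intro mult_left_mono kernel_far[OF x False s]) auto
        then have "ennreal (\<bar>u y\<bar> powr (p - 1) * (1 / norm (x - y) powr (DIM('a) + s * p))) \<le> ennreal (4 powr (DIM('a) + p)) * t y"
          using False by (simp add: t_def mult.commute[of "4 powr _"] ennreal_leI del: mem_ball flip: ennreal_mult)
        then show ?thesis by (rule order_trans) simp
      qed
      also have "f x * \<omega>3 (x - y) + (ennreal D * g y + ennreal (4 powr (DIM('a) + p)) * t y) \<le> \<Psi> x y"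
        using x by (simp add: \<Psi>_def add.assoc[symmetric] add_right_mono del: mem_cball)
      finally show ?thesis by (simp add: mult_left_mono add_left_mono)
    qed
    have "(\<integral>\<^sup>+x. \<integral>\<^sup>+y. ennreal (\<bar>\<Phi> x y\<bar> / norm (x - y) powr (DIM('a) + s * p)) \<partial>lborel \<partial>lborel)
      \<le> (\<integral>\<^sup>+x. \<integral>\<^sup>+y. ennreal M * (\<Psi> x y + \<Psi> y x) \<partial>lborel \<partial>lborel)"
    proof (intro nn_integral_mono)
      fix x y
      consider "x \<in> S" | "y \<in> S" | "x \<notin> S" "y \<notin> S" by blast
      then show "ennreal (\<bar>\<Phi> x y\<bar> / norm (x - y) powr (DIM('a) + s * p)) \<le> ennreal M * (\<Psi> x y + \<Psi> y x)"
      proof cases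
        case 1
        have "ennreal M * \<Psi> x y \<le> ennreal M * (\<Psi> x y + \<Psi> y x)" by (intro mult_left_mono) auto
        then show ?thesis using bound[OF 1] order_trans by blast
      next
        case 2
        have "ennreal M * \<Psi> y x \<le> ennreal M * (\<Psi> x y + \<Psi> y x)" by (intro mult_left_mono) auto
        moreover have "ennreal (\<bar>\<Phi> x y\<bar> / norm (x - y) powr (DIM('a) + s * p)) \<le> ennreal M * \<Psi> y x"
          using bound[OF 2, of x] \<Phi>_sym[of x y] by (simp add: norm_minus_commute)
        ultimately show ?thesis using order_trans by blast
      next
        case 3
        then show ?thesis by (simp add: \<Phi>_outside)
      qed
    qed
    also have "\<dots> = ennreal M * ((\<integral>\<^sup>+x. \<integral>\<^sup>+y. \<Psi> x y \<partial>lborel \<partial>lborel) + (\<integral>\<^sup>+x. \<integral>\<^sup>+y. \<Psi> y x \<partial>lborel \<partial>lborel))"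
      using \<Psi>m by (simp add: nn_integral_add nn_integral_cmult)
    also have "(\<integral>\<^sup>+x. \<integral>\<^sup>+y. \<Psi> y x \<partial>lborel \<partial>lborel) = (\<integral>\<^sup>+x. \<integral>\<^sup>+y. \<Psi> x y \<partial>lborel \<partial>lborel)"
      by (rule lborel_pair.Fubini') (unfold \<Psi>_def q_def, measurable)
    also have "(\<integral>\<^sup>+x. \<integral>\<^sup>+y. \<Psi> x y \<partial>lborel \<partial>lborel) + (\<integral>\<^sup>+x. \<integral>\<^sup>+y. \<Psi> x y \<partial>lborel \<partial>lborel) = 2 * (\<integral>\<^sup>+x. \<integral>\<^sup>+y. \<Psi> x y \<partial>lborel \<partial>lborel)"
      by (simp add: mult_2)
    also have "(\<integral>\<^sup>+x. \<integral>\<^sup>+y. \<Psi> x y \<partial>lborel \<partial>lborel) \<le> C1 * w + C2 * (\<integral>\<^sup>+y. t y \<partial>lborel)"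
    proof -
      have "(\<integral>\<^sup>+x. \<integral>\<^sup>+y. \<Psi> x y \<partial>lborel \<partial>lborel) = (\<integral>\<^sup>+x. \<integral>\<^sup>+y. indicator S x * \<omega>1 (x - y) \<partial>lborel \<partial>lborel)
        + (\<integral>\<^sup>+x. \<integral>\<^sup>+y. indicator S x * q x y \<partial>lborel \<partial>lborel) + (\<integral>\<^sup>+x. \<integral>\<^sup>+y. f x * \<omega>3 (x - y) \<partial>lborel \<partial>lborel)
        + (\<integral>\<^sup>+x. \<integral>\<^sup>+y. indicator S x * (ennreal D * g y) \<partial>lborel \<partial>lborel)
        + (\<integral>\<^sup>+x. \<integral>\<^sup>+y. indicator S x * (ennreal (4 powr (DIM('a) + p)) * t y) \<partial>lborel \<partial>lborel)"
        unfolding \<Psi>_def q_def by (simp add: nn_integral_add)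
      also have "(\<integral>\<^sup>+x. \<integral>\<^sup>+y. indicator S x * \<omega>1 (x - y) \<partial>lborel \<partial>lborel) \<le> ennreal (vol * (sph * D1)) * w"
      proof -
        have "(\<integral>\<^sup>+x. \<integral>\<^sup>+y. indicator S x * \<omega>1 (x - y) \<partial>lborel \<partial>lborel) = ennreal vol * (\<integral>\<^sup>+h. \<omega>1 h \<partial>lborel)"
          by (rule nn_integral_S_convolution) measurable
        also have "\<dots> \<le> ennreal vol * (ennreal (sph * D1) * w)" by (intro mult_left_mono \<omega>1) auto
        also have "\<dots> = ennreal (vol * (sph * D1)) * w" using vol_sph_pos D0 by (simp add: ennreal_mult mult.assoc)
        finally show ?thesis .
      qed
      also have "(\<integral>\<^sup>+x. \<integral>\<^sup>+y. indicator S x * q x y \<partial>lborel \<partial>lborel) \<le> G * ennreal (sph * D1) * w"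
      proof -
        have "(\<integral>\<^sup>+x. \<integral>\<^sup>+y. indicator S x * q x y \<partial>lborel \<partial>lborel) \<le> G * (\<integral>\<^sup>+h. \<omega>1 h \<partial>lborel)"
          using difference_integral_le[OF s] by (simp add: q_def \<omega>1_def G_def \<delta>_def)
        also have "\<dots> \<le> G * (ennreal (sph * D1) * w)" by (intro mult_left_mono \<omega>1) auto
        finally show ?thesis by (simp add: mult.assoc)
      qed
      also have "(\<integral>\<^sup>+x. \<integral>\<^sup>+y. f x * \<omega>3 (x - y) \<partial>lborel \<partial>lborel) \<le> U * ennreal (sph * D) * w"
      proof -
        have "(\<integral>\<^sup>+x. \<integral>\<^sup>+y. f x * \<omega>3 (x - y) \<partial>lborel \<partial>lborel) = (\<integral>\<^sup>+x. f x \<partial>lborel) * (\<integral>\<^sup>+h. \<omega>3 h \<partial>lborel)"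
          by (rule nn_integral_convolution) measurable
        also have "(\<integral>\<^sup>+x. f x \<partial>lborel) \<le> U"
          unfolding f_def U_def using r rR by (intro nn_integral_mono) (auto simp: indicator_def)
        also have "U * (\<integral>\<^sup>+h. \<omega>3 h \<partial>lborel) \<le> U * (ennreal (sph * D) * w)" by (intro mult_left_mono \<omega>3) auto
        finally show ?thesis by (simp add: mult.assoc mult_right_mono)
      qed
      also have "(\<integral>\<^sup>+x. \<integral>\<^sup>+y. indicator S x * (ennreal D * g y) \<partial>lborel \<partial>lborel) \<le> ennreal vol * (ennreal D * U) * w"
      proof -
        have "(\<integral>\<^sup>+x. \<integral>\<^sup>+y. indicator S x * (ennreal D * g y) \<partial>lborel \<partial>lborel) = ennreal vol * (ennreal D * (\<integral>\<^sup>+y. g y \<partial>lborel))"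
          by (simp add: nn_integral_cmult nn_integral_multc emeasure_S vol_def)
        also have "(\<integral>\<^sup>+y. g y \<partial>lborel) \<le> U"
          unfolding g_def U_def by (intro nn_integral_mono) (auto simp: indicator_def)
        also have "ennreal vol * (ennreal D * U) \<le> ennreal vol * (ennreal D * U) * w"
          using mult_left_mono[OF w1, of "ennreal vol * (ennreal D * U)"] by simp
        finally show ?thesis by (simp add: mult_left_mono)
      qed
      also have "(\<integral>\<^sup>+x. \<integral>\<^sup>+y. indicator S x * (ennreal (4 powr (DIM('a) + p)) * t y) \<partial>lborel \<partial>lborel) = C2 * (\<integral>\<^sup>+y. t y \<partial>lborel)"
      proof -
        have "(\<integral>\<^sup>+x. \<integral>\<^sup>+y. indicator S x * (ennreal (4 powr (DIM('a) + p)) * t y) \<partial>lborel \<partial>lborel) = ennreal vol * (ennreal (4 powr (DIM('a) + p)) * (\<integral>\<^sup>+y. t y \<partial>lborel))"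
          by (simp add: nn_integral_cmult nn_integral_multc emeasure_S vol_def)
        also have "\<dots> = C2 * (\<integral>\<^sup>+y. t y \<partial>lborel)"
          using vol_sph_pos by (simp add: C2_def ennreal_mult mult.assoc)
        finally show ?thesis .
      qed
      finally show ?thesis by (simp add: C1_def distrib_right add_mono)
    qed
    finally show ?thesis by (simp add: w_def t_def mult_left_mono mult.assoc mult.left_commute)
  qed
  define C where "C = 2 * ennreal M * (C1 + C2)"
  have "C < \<infinity>" using C by (simp add: C_def ennreal_mult_less_top)
  moreover have "2 * ennreal M * (C1 * a + C2 * b) \<le> C * a + C * b" for a b
    unfolding C_def distrib_left mult.assoc[symmetric]
    by (intro add_mono mult_right_mono) (auto intro!: add_increasing add_increasing2)
  ultimately show ?thesis using main by (meson order_trans)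
qed

section \<open>The gradient term and admissibility of the test function\<close>

definition "local_term x = norm (Du x) powr (p - 2) * (Du x \<bullet> Dv x)"

lemma local_term_meas [measurable]: "local_term \<in> borel_measurable borel"
  unfolding local_term_def by measurable

text \<open>The derivative of (u + d)^(1 - p) produces -(p - 1) X^p with X = \<eta> |Du| / (u + d),
  the derivative of the cutoff at most p X^(p - 1) t with t = 4 / (3 r), twice the inverse cutoff
  radius. \<open>Young_powr_half\<close> spends half of the first on the second.\<close>

lemma local_term_le:
  "local_term x + (p - 1) / 2 * (5 / 9) powr p * (indicator (ball x0 r) x * (norm (Du x) / (u x + d)) powr p)
    \<le> 2 powr (p - 1) * (4 / (3 * r)) powr p * indicator S x"
proof (cases "x \<in> S")
  case False
  then have "x \<notin> ball x0 r" using r by auto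
  then show ?thesis using False v_outside(2)[OF False] by (simp add: local_term_def del: mem_ball mem_cball)
next
  case True
  then have x: "x \<in> ball x0 R" using S_subset(2) by blast
  define b where "b = u x + d"
  have b: "0 < b" using u_add_d[OF x] d by (simp add: b_def)
  define n where "n = norm (Du x)"
  define e where "e = \<eta> x"
  define t where "t = 4 / (3 * r)"
  have pos: "0 \<le> n" "0 \<le> e" "0 \<le> t" using \<eta>_bounds(1) r by (auto simp: n_def e_def t_def)
  let ?g = "bump_grad p x0 (3 * r / 2) x"
  have g: "norm ?g \<le> p * e powr (p - 1) * t"
    using norm_bump_grad_le[of "3 * r / 2" p x0 x] r p by (simp add: e_def \<eta>_def t_def)
  have "Du x \<bullet> Dv x = e powr p * ((1 - p) * b powr (- p)) * (n * n) + b powr (1 - p) * (Du x \<bullet> ?g)"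
    by (simp add: Dv_def inner_add_right e_def b_def n_def dot_square_norm power2_eq_square)
  also have "\<dots> \<le> e powr p * ((1 - p) * b powr (- p)) * (n * n) + b powr (1 - p) * (n * (p * e powr (p - 1) * t))"
    using norm_cauchy_schwarz[of "Du x" ?g] mult_left_mono[OF g, of n] pos
    by (intro add_left_mono mult_left_mono) (auto simp: n_def)
  finally have "local_term x \<le> n powr (p - 2) * (e powr p * ((1 - p) * b powr (- p)) * (n * n) + b powr (1 - p) * (n * (p * e powr (p - 1) * t)))"
    unfolding local_term_def n_def by (intro mult_left_mono) auto
  also have "\<dots> = (1 - p) * (e powr p * (n powr (p - 2) * n * n) * b powr (- p)) + p * (e powr (p - 1) * (n powr (p - 2) * n) * b powr (1 - p)) * t"
    by (simp add: algebra_simps)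
  also have "n powr (p - 2) * n = n powr (p - 1)" using powr_mult_self pos by blast
  also have "n powr (p - 1) * n = n powr p"
    using powr_mult_base[of n "p - 1"] pos by (simp add: mult.commute)
  also have "e powr p * n powr p * b powr (- p) = (e * (n / b)) powr p"
    using b by (simp add: powr_mult powr_divide powr_minus_divide)
  also have "e powr (p - 1) * n powr (p - 1) * b powr (1 - p) = (e * (n / b)) powr (p - 1)"
    using b powr_minus_divide[of b "p - 1"] by (simp add: powr_mult powr_divide)
  also have "p * (e * (n / b)) powr (p - 1) * t \<le> (p - 1) / 2 * (e * (n / b)) powr p + 2 powr (p - 1) * t powr p"
    using pos b by (intro Young_powr_half[OF p]) auto
  finally have A: "local_term x \<le> 2 powr (p - 1) * t powr p - (p - 1) / 2 * (e * (n / b)) powr p"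
    by (simp add: field_simps)
  have "(p - 1) / 2 * ((5 / 9) powr p * (indicator (ball x0 r) x * (n / b) powr p)) \<le> (p - 1) / 2 * (e * (n / b)) powr p"
  proof (intro mult_left_mono)
    show "(5 / 9) powr p * (indicator (ball x0 r) x * (n / b) powr p) \<le> (e * (n / b)) powr p"
    proof (cases "x \<in> ball x0 r")
      case True
      then have "(5 / 9) powr p \<le> e powr p" using \<eta>_bounds(4) p by (intro powr_mono2) (auto simp: e_def simp del: mem_ball)
      from mult_right_mono[OF this, of "(n / b) powr p"] show ?thesis
        unfolding powr_mult[of e] using True by (simp del: mem_ball)
    qed (simp del: mem_ball)
  qed (use p in auto)
  with A show ?thesis using True by (simp add: b_def n_def t_def)
qed

lemma Dv_bound: "\<exists>A>0. \<forall>x. norm (Dv x) \<le> A * (norm (Du x) + 1) * indicator S x"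
proof -
  define a where "a = (p - 1) * d powr (- p)"
  define b where "b = d powr (1 - p) * (p * (4 / (3 * r)))"
  have ab: "0 < a" "0 < b" using p d r by (auto simp: a_def b_def)
  have "norm (Dv x) \<le> (a + b) * (norm (Du x) + 1) * indicator S x" for x
  proof -
    have "a * norm (Du x) + b \<le> (a + b) * (norm (Du x) + 1)" using ab by (simp add: algebra_simps)
    from mult_right_mono[OF this, of "indicator S x"] show ?thesis
      using norm_Dv_le[of x] unfolding a_def b_def by (meson indicator_pos_le order_trans)
  qed
  then show ?thesis using ab by (intro exI[of _ "a + b"]) auto
qed

lemma Du_S_finite: "(\<integral>\<^sup>+x\<in>S. ennreal (norm (Du x) powr p) \<partial>lborel) < \<infinity>"
  using S_subset(2) by (intro Du_powr_finite) auto

lemma Dv_powr_finite: "(\<integral>\<^sup>+x. ennreal (norm (Dv x) powr p) \<partial>lborel) < \<infinity>"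
proof -
  obtain A where A: "A > 0" "\<And>x. norm (Dv x) \<le> A * (norm (Du x) + 1) * indicator S x" using Dv_bound by blast
  have "(\<integral>\<^sup>+x. ennreal (norm (Dv x) powr p) \<partial>lborel)
    \<le> (\<integral>\<^sup>+x. ennreal (A powr p * 2 powr p) * (ennreal (norm (Du x) powr p) * indicator S x + indicator S x) \<partial>lborel)"
  proof (intro nn_integral_mono)
    fix x
    show "ennreal (norm (Dv x) powr p) \<le> ennreal (A powr p * 2 powr p) * (ennreal (norm (Du x) powr p) * indicator S x + indicator S x)"
    proof (cases "x \<in> S")
      case True
      have "norm (Dv x) powr p \<le> (A * (norm (Du x) + 1)) powr p"
        using A(2)[of x] True p by (intro powr_mono2) auto
      also have "\<dots> = A powr p * (norm (Du x) + 1) powr p" by (rule powr_mult)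
      also have "\<dots> \<le> A powr p * (2 powr p * (norm (Du x) powr p + 1 powr p))"
        using p by (intro mult_left_mono powr_add_le) auto
      finally have "ennreal (norm (Dv x) powr p) \<le> ennreal (A powr p * 2 powr p) * (ennreal (norm (Du x) powr p) + ennreal 1)"
        by (simp add: mult.assoc ennreal_leI del: ennreal_1 flip: ennreal_mult ennreal_plus)
      then show ?thesis using True by (simp del: mem_cball)
    next
      case False
      then show ?thesis using v_outside(2)[OF False] p by (simp del: mem_cball)
    qed
  qed
  also have "\<dots> < \<infinity>"
    using Du_S_finite by (simp add: nn_integral_add nn_integral_cmult emeasure_S ennreal_mult_less_top)
  finally show ?thesis .
qed

text \<open>With n = |Du| and \<open>Dv_bound\<close>, the integrand is at most A n^(p - 1) (n + 1)
  \<le> 2 A (n^p + 1) on \<open>S\<close>, which has finite measure.\<close>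

lemma local_term_integrable: "integrable lborel local_term"
proof (rule integrableI_bounded)
  obtain A where A: "A > 0" "\<And>x. norm (Dv x) \<le> A * (norm (Du x) + 1) * indicator S x" using Dv_bound by blast
  have "(\<integral>\<^sup>+x. ennreal (norm (local_term x)) \<partial>lborel)
    \<le> (\<integral>\<^sup>+x. ennreal (2 * A) * (ennreal (norm (Du x) powr p) * indicator S x + indicator S x) \<partial>lborel)"
  proof (intro nn_integral_mono)
    fix x
    show "ennreal (norm (local_term x)) \<le> ennreal (2 * A) * (ennreal (norm (Du x) powr p) * indicator S x + indicator S x)"
    proof (cases "x \<in> S")
      case True
      define n where "n = norm (Du x)"
      have n: "0 \<le> n" by (simp add: n_def)
      have "norm (local_term x) \<le> n powr (p - 2) * (n * norm (Dv x))"
        using Cauchy_Schwarz_ineq2[of "Du x" "Dv x"] by (auto simp: local_term_def n_def abs_mult intro!: mult_left_mono)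
      also have "\<dots> = n powr (p - 1) * norm (Dv x)" using powr_mult_self[OF n] by (simp add: mult.assoc[symmetric])
      also have "\<dots> \<le> n powr (p - 1) * (A * (n + 1))"
        using A(2)[of x] True by (intro mult_left_mono) (auto simp: n_def)
      also have "\<dots> = A * (n powr p + n powr (p - 1))"
        using powr_mult_base[OF n, of "p - 1"] by (simp add: algebra_simps)
      also have "\<dots> \<le> A * (2 * (n powr p + 1))"
      proof (intro mult_left_mono)
        have "n powr (p - 1) \<le> n powr p + 1"
        proof (cases "1 \<le> n")
          case True
          then have "n powr (p - 1) \<le> n powr p" by (intro powr_mono) auto
          then show ?thesis by simp
        next
          case False
          then have "n powr (p - 1) \<le> 1" using n p powr_le1[of "p - 1" n] by simp
          then show ?thesis by (simp add: add_increasing)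
        qed
        then show "n powr p + n powr (p - 1) \<le> 2 * (n powr p + 1)" by (smt (verit) powr_ge_zero)
      qed (use A in auto)
      finally have "norm (local_term x) \<le> 2 * A * (n powr p + 1)" by (simp add: algebra_simps)
      then have "ennreal (norm (local_term x)) \<le> ennreal (2 * A) * (ennreal (n powr p) + ennreal 1)"
        using A(1) by (simp add: ennreal_leI del: ennreal_1 flip: ennreal_mult ennreal_plus)
      then show ?thesis using True by (simp add: n_def del: mem_cball)
    next
      case False
      then show ?thesis using v_outside(2)[OF False] by (simp add: local_term_def del: mem_cball)
    qed
  qed
  also have "\<dots> < \<infinity>"
    using Du_S_finite by (simp add: nn_integral_add nn_integral_cmult emeasure_S ennreal_mult_less_top)
  finally show "(\<integral>\<^sup>+x. ennreal (norm (local_term x)) \<partial>lborel) < \<infinity>" .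
qed measurable

text \<open>Radius 7R/8 lies strictly between that of the cutoff and \<open>R\<close>, so this ball
  contains the support of \<open>v\<close> and is compactly inside the large ball.\<close>

lemma v_W1p_0: "v \<in> W1p_0 p (ball x0 (7 * R / 8))"
proof -
  have "(\<integral>\<^sup>+x. ennreal (norm (v x) powr p) \<partial>lborel) \<le> (\<integral>\<^sup>+x. ennreal ((d powr (1 - p)) powr p) * indicator S x \<partial>lborel)"
  proof (intro nn_integral_mono)
    fix x
    have "norm (v x) powr p \<le> (d powr (1 - p)) powr p"
      using v_bounds[of x] p by (intro powr_mono2) auto
    then show "ennreal (norm (v x) powr p) \<le> ennreal ((d powr (1 - p)) powr p) * indicator S x"
      using v_outside(1)[of x] p by (auto simp: indicator_def ennreal_leI simp del: mem_cball)
  qed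
  also have "\<dots> < \<infinity>" by (simp add: nn_integral_cmult emeasure_S ennreal_mult_less_top)
  finally have "v \<in> Lp p UNIV"
    by (simp add: Lp_def set_borel_measurable_def nn_integral_completion measurable_completion)
  moreover have "Dv \<in> Lp p UNIV"
    using Dv_powr_finite by (simp add: Lp_def set_borel_measurable_def nn_integral_completion measurable_completion)
  moreover have "v x = 0" if "x \<notin> ball x0 (7 * R / 8)" for x
  proof (rule v_outside(1))
    have "cball x0 (3 * R / 4) \<subseteq> ball x0 (7 * R / 8)" using R_pos by auto
    then show "x \<notin> S" using that S_subset(3) by blast
  qed
  ultimately show ?thesis using weak_gradient_v by (auto simp: W1p_0_def W1p_def)
qed

end

text \<open>Encodes g + f \<le> h pointwise, with \<open>f\<close> split into its parts so that all
  terms are nonnegative. Integration gives G + P \<le> H + N, and likewise for the primed terms; the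
  sign of the sum of integrals says N + N' \<le> P + P'. Two measure spaces occur because the
  nonlocal and gradient terms live on different ones and only their sum has a sign.\<close>

lemma absorb_signed_parts:
  fixes f :: "'a \<Rightarrow> real" and f' :: "'b \<Rightarrow> real"
  assumes f: "integrable M f" "integrable M' f'" and nonneg: "0 \<le> (LINT x|M. f x) + (LINT x|M'. f' x)"
    and [measurable]: "g \<in> borel_measurable M" "h \<in> borel_measurable M" "g' \<in> borel_measurable M'" "h' \<in> borel_measurable M'"
    and le: "\<And>x. g x + ennreal (f x) \<le> h x + ennreal (- f x)"
    and le': "\<And>x. g' x + ennreal (f' x) \<le> h' x + ennreal (- f' x)"
  shows "(\<integral>\<^sup>+x. g x \<partial>M) + (\<integral>\<^sup>+x. g' x \<partial>M') \<le> (\<integral>\<^sup>+x. h x \<partial>M) + (\<integral>\<^sup>+x. h' x \<partial>M')"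
proof -
  have [measurable]: "f \<in> borel_measurable M" "f' \<in> borel_measurable M'" using f by auto
  define P where "P = (\<integral>\<^sup>+x. ennreal (f x) \<partial>M)"
  define N where "N = (\<integral>\<^sup>+x. ennreal (- f x) \<partial>M)"
  define P' where "P' = (\<integral>\<^sup>+x. ennreal (f' x) \<partial>M')"
  define N' where "N' = (\<integral>\<^sup>+x. ennreal (- f' x) \<partial>M')"
  have fin: "P < \<infinity>" "N < \<infinity>" "P' < \<infinity>" "N' < \<infinity>"
    using f by (auto simp: real_integrable_def P_def N_def P'_def N'_def less_top)
  have "(LINT x|M. f x) = enn2real P - enn2real N" "(LINT x|M'. f' x) = enn2real P' - enn2real N'"
    using f by (auto simp: real_lebesgue_integral_def P_def N_def P'_def N'_def)
  with nonneg have "enn2real N + enn2real N' \<le> enn2real P + enn2real P'" by simp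
  then have "ennreal (enn2real N + enn2real N') \<le> ennreal (enn2real P + enn2real P')" by (rule ennreal_leI)
  then have NP: "N + N' \<le> P + P'" using fin by simp
  have 1: "(\<integral>\<^sup>+x. g x \<partial>M) + P \<le> (\<integral>\<^sup>+x. h x \<partial>M) + N"
    unfolding P_def N_def using nn_integral_mono[of M "\<lambda>x. g x + ennreal (f x)" "\<lambda>x. h x + ennreal (- f x)"] le
    by (simp add: nn_integral_add)
  have 2: "(\<integral>\<^sup>+x. g' x \<partial>M') + P' \<le> (\<integral>\<^sup>+x. h' x \<partial>M') + N'"
    unfolding P'_def N'_def using nn_integral_mono[of M' "\<lambda>x. g' x + ennreal (f' x)" "\<lambda>x. h' x + ennreal (- f' x)"] le'
    by (simp add: nn_integral_add)
  have "(P + P') + ((\<integral>\<^sup>+x. g x \<partial>M) + (\<integral>\<^sup>+x. g' x \<partial>M')) = ((\<integral>\<^sup>+x. g x \<partial>M) + P) + ((\<integral>\<^sup>+x. g' x \<partial>M') + P')"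
    by (simp add: ac_simps)
  also have "\<dots> \<le> ((\<integral>\<^sup>+x. h x \<partial>M) + N) + ((\<integral>\<^sup>+x. h' x \<partial>M') + N')" by (intro add_mono 1 2)
  also have "\<dots> = (N + N') + ((\<integral>\<^sup>+x. h x \<partial>M) + (\<integral>\<^sup>+x. h' x \<partial>M'))" by (simp add: ac_simps)
  also have "\<dots> \<le> (P + P') + ((\<integral>\<^sup>+x. h x \<partial>M) + (\<integral>\<^sup>+x. h' x \<partial>M'))" by (intro add_right_mono NP)
  \<comment> \<open>Integrability makes P + P' finite; only therefore may it be cancelled.\<close>
  finally show ?thesis using fin by (auto simp: ennreal_add_left_cancel_le)
qed

section \<open>Integration over the exponents and absorption\<close>

context log_estimate
begin

text \<open>Here \<open>\<kappa>\<close> abstracts the weighted measure on the exponents,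
  \<open>A\<close> the integral of 1/s + 1/(1 - s), and \<open>B\<close> the supremum of r^(-s p).
  The tail of |u| is assumed finite for convergence; only that of the negative part appears in the
  bound.\<close>

lemma weighted_log_estimate:
  fixes \<kappa> :: "real measure" and \<alpha> A :: real and B :: ennreal
  assumes sets_\<kappa> [measurable_cong]: "sets \<kappa> = sets borel" and fin_\<kappa>: "finite_measure \<kappa>"
    and s01: "AE s in \<kappa>. 0 < s \<and> s < 1"
    and A: "0 \<le> A" "(\<integral>\<^sup>+s. ennreal (1 / s + 1 / (1 - s)) \<partial>\<kappa>) \<le> ennreal A"
    and B: "AE s in \<kappa>. ennreal (r powr (- s * p)) \<le> B"
    and tail: "(\<integral>\<^sup>+s. (\<integral>\<^sup>+y\<in>- ball x0 R. ennreal (\<bar>u y\<bar> powr (p - 1) / norm (y - x0) powr (DIM('a) + s * p)) \<partial>lborel) \<partial>\<kappa>) < \<infinity>"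
    and \<alpha>: "0 \<le> \<alpha>"
    and ineq: "0 \<le> (LINT s|\<kappa>. LINT (x, y)|(lborel \<Otimes>\<^sub>M lborel). \<Phi> x y / norm (x - y) powr (DIM('a) + s * p)) + \<alpha> * (LINT x|lborel. local_term x)"
  shows "ennreal ((p - 1) / 2 * (5 / 9) powr p) *
      (ennreal \<alpha> * (\<integral>\<^sup>+x\<in>ball x0 r. ennreal ((norm (Du x) / (u x + d)) powr p) \<partial>lborel)
        + (\<integral>\<^sup>+s. \<integral>\<^sup>+x. \<integral>\<^sup>+y. ennreal (log_part x y / norm (x - y) powr (DIM('a) + s * p)) \<partial>lborel \<partial>lborel \<partial>\<kappa>))
    \<le> ennreal (2 powr (p - 1)) *
      (ennreal (2 * vol * sph * ((4 / 3) powr p + 2 powr p) * A) * B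
        + ennreal (2 * vol * 4 powr (DIM('a) + p) * d powr (1 - p)) *
          (\<integral>\<^sup>+s. (\<integral>\<^sup>+y\<in>- ball x0 R. ennreal (max (- u y) 0 powr (p - 1) / norm (y - x0) powr (DIM('a) + s * p)) \<partial>lborel) \<partial>\<kappa>)
        + ennreal (\<alpha> * (4 / (3 * r)) powr p * vol))"
proof -
  define L where "L = (lborel \<Otimes>\<^sub>M lborel :: ('a \<times> 'a) measure)"
  define M where "M = \<kappa> \<Otimes>\<^sub>M L"
  interpret K: finite_measure \<kappa> by (rule fin_\<kappa>)
  interpret L: sigma_finite_measure L unfolding L_def by (rule lborel_pair.sigma_finite_measure_axioms)
  interpret KL: pair_sigma_finite \<kappa> L ..
  have sets_M [measurable_cong]: "sets M = sets (borel \<Otimes>\<^sub>M (borel \<Otimes>\<^sub>M borel))"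
    unfolding M_def L_def by (intro sets_pair_measure_cong sets_\<kappa> sets_lborel)
  have sets_L [measurable_cong]: "sets L = sets (borel \<Otimes>\<^sub>M borel)"
    unfolding L_def by (intro sets_pair_measure_cong sets_lborel)
  \<comment> \<open>Product and iterated integrals over (s, x, y) are matched for nonnegative
    integrands, so pointwise bounds live on one measure space while the estimates above are used
    slice by slice.\<close>
  have trip: "(\<integral>\<^sup>+z. G z \<partial>M) = (\<integral>\<^sup>+s. \<integral>\<^sup>+x. \<integral>\<^sup>+y. G (s, x, y) \<partial>lborel \<partial>lborel \<partial>\<kappa>)"
    if G: "G \<in> borel_measurable (borel \<Otimes>\<^sub>M (borel \<Otimes>\<^sub>M borel))" for G :: "real \<times> 'a \<times> 'a \<Rightarrow> ennreal"
  proof -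
    have GM: "G \<in> borel_measurable (\<kappa> \<Otimes>\<^sub>M L)"
      using G measurable_cong_sets[OF sets_M[unfolded M_def] refl] by blast
    have "(\<integral>\<^sup>+z. G z \<partial>M) = (\<integral>\<^sup>+s. \<integral>\<^sup>+w. G (s, w) \<partial>L \<partial>\<kappa>)"
      unfolding M_def by (rule L.nn_integral_fst[symmetric, OF GM])
    also have "\<dots> = (\<integral>\<^sup>+s. \<integral>\<^sup>+x. \<integral>\<^sup>+y. G (s, x, y) \<partial>lborel \<partial>lborel \<partial>\<kappa>)"
    proof (rule nn_integral_cong)
      fix s
      have "(\<lambda>w. G (s, w)) \<in> borel_measurable (lborel \<Otimes>\<^sub>M lborel)"
        using measurable_compose[OF measurable_Pair1' G, of s] by (simp add: L_def[symmetric] cong: measurable_cong_sets)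
      then show "(\<integral>\<^sup>+w. G (s, w) \<partial>L) = (\<integral>\<^sup>+x. \<integral>\<^sup>+y. G (s, x, y) \<partial>lborel \<partial>lborel)"
        unfolding L_def by (rule lborel.nn_integral_fst[symmetric])
    qed
    finally show ?thesis .
  qed
  define f where "f = (\<lambda>(s, x, y). \<Phi> x y / norm (x - y :: 'a) powr (DIM('a) + s * p))"
  define c0 where "c0 = (p - 1) / 2 * (5 / 9) powr p"
  have c0: "0 \<le> c0" using p by (simp add: c0_def)
  define c1 where "c1 = 2 powr (p - 1)"
  have c1: "0 \<le> c1" by (simp add: c1_def)
  define g where "g = (\<lambda>(s, x, y). ennreal c0 * ennreal (log_part x y / norm (x - y :: 'a) powr (DIM('a) + s * p)))"
  define h where "h = (\<lambda>(s, x, y). ennreal c1 * (ennreal (\<bar>\<eta> x - \<eta> y\<bar> powr p / norm (x - y :: 'a) powr (DIM('a) + s * p))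
      + ennreal (tail_part x y / norm (x - y) powr (DIM('a) + s * p)) + ennreal (tail_part y x / norm (x - y) powr (DIM('a) + s * p))))"
  have fm [measurable]: "f \<in> borel_measurable (borel \<Otimes>\<^sub>M (borel \<Otimes>\<^sub>M borel))"
    unfolding f_def \<Phi>_def by measurable
  have gm [measurable]: "g \<in> borel_measurable (borel \<Otimes>\<^sub>M (borel \<Otimes>\<^sub>M borel))"
    unfolding g_def log_part_def by measurable
  have hm [measurable]: "h \<in> borel_measurable (borel \<Otimes>\<^sub>M (borel \<Otimes>\<^sub>M borel))"
    unfolding h_def tail_part_def by measurable
  \<comment> \<open>Joint integrability serves twice: it turns the iterated integral of the weak
    form into one over the product, and it makes the absorption legitimate.\<close>
  have f_int: "integrable M f"
  proof (rule integrableI_bounded)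
    obtain C where C: "C < \<infinity>" "\<And>s. 0 < s \<Longrightarrow> s < 1 \<Longrightarrow>
      (\<integral>\<^sup>+x. \<integral>\<^sup>+y. ennreal (\<bar>\<Phi> x y\<bar> / norm (x - y) powr (DIM('a) + s * p)) \<partial>lborel \<partial>lborel)
      \<le> C * ennreal (1 / s + 1 / (1 - s))
        + C * (\<integral>\<^sup>+y\<in>- ball x0 R. ennreal (\<bar>u y\<bar> powr (p - 1) / norm (y - x0) powr (DIM('a) + s * p)) \<partial>lborel)"
      using \<Phi>_integral_le by blast
    have "(\<integral>\<^sup>+z. ennreal (norm (f z)) \<partial>M) = (\<integral>\<^sup>+s. \<integral>\<^sup>+x. \<integral>\<^sup>+y. ennreal (\<bar>\<Phi> x y\<bar> / norm (x - y) powr (DIM('a) + s * p)) \<partial>lborel \<partial>lborel \<partial>\<kappa>)"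
      by (subst trip) (auto simp: f_def abs_divide)
    also have "\<dots> \<le> (\<integral>\<^sup>+s. C * ennreal (1 / s + 1 / (1 - s))
        + C * (\<integral>\<^sup>+y\<in>- ball x0 R. ennreal (\<bar>u y\<bar> powr (p - 1) / norm (y - x0) powr (DIM('a) + s * p)) \<partial>lborel) \<partial>\<kappa>)"
      by (intro nn_integral_mono_AE, use s01 in eventually_elim) (use C(2) in blast)
    also have "\<dots> = C * (\<integral>\<^sup>+s. ennreal (1 / s + 1 / (1 - s)) \<partial>\<kappa>)
        + C * (\<integral>\<^sup>+s. (\<integral>\<^sup>+y\<in>- ball x0 R. ennreal (\<bar>u y\<bar> powr (p - 1) / norm (y - x0) powr (DIM('a) + s * p)) \<partial>lborel) \<partial>\<kappa>)"
    proof -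
      define tu where "tu s = (\<integral>\<^sup>+y\<in>- ball x0 R. ennreal (\<bar>u y\<bar> powr (p - 1) / norm (y - x0) powr (DIM('a) + s * p)) \<partial>lborel)" for s
      define w where "w s = ennreal (1 / s + 1 / (1 - s))" for s :: real
      have "tu \<in> borel_measurable borel" "w \<in> borel_measurable borel" unfolding tu_def w_def by measurable
      then have "tu \<in> borel_measurable \<kappa>" "w \<in> borel_measurable \<kappa>"
        using measurable_cong_sets[OF sets_\<kappa> refl] by blast+
      then show ?thesis
        unfolding tu_def[symmetric] w_def[symmetric] by (simp add: nn_integral_add nn_integral_cmult)
    qed
    also have "\<dots> < \<infinity>"
      using C(1) tail le_less_trans[OF A(2), of \<infinity>] by (simp add: ennreal_mult_less_top)
    finally show "(\<integral>\<^sup>+z. ennreal (norm (f z)) \<partial>M) < \<infinity>" .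
  qed (use fm in measurable)
  have "(LINT s|\<kappa>. LINT (x, y)|L. \<Phi> x y / norm (x - y) powr (DIM('a) + s * p)) = (LINT z|M. f z)"
  proof -
    have eta: "(\<lambda>(s, w). f (s, w)) = f" by (simp add: fun_eq_iff)
    have "(LINT s|\<kappa>. LINT w|L. f (s, w)) = (LINT z|M. f z)"
      using KL.integral_fst[of "\<lambda>s w. f (s, w)"] f_int unfolding M_def eta by simp
    then show ?thesis by (simp add: f_def)
  qed
  then have ineq': "0 \<le> (LINT z|M. f z) + (LINT x|lborel. \<alpha> * local_term x)"
    using ineq by (simp add: L_def)
  have le: "g z + ennreal (f z) \<le> h z + ennreal (- f z)" for z
  proof -
    obtain s x y where z: "z = (s, x, y)" by (cases z) auto
    define n where "n = norm (x - y) powr (DIM('a) + s * p)"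
    have n: "0 \<le> n" by (simp add: n_def)
    have "(\<Phi> x y + c0 * log_part x y) / n \<le> c1 * (\<bar>\<eta> x - \<eta> y\<bar> powr p + tail_part x y + tail_part y x) / n"
      unfolding c0_def c1_def using \<Phi>_le[of x y] n by (intro divide_right_mono) auto
    then have le: "\<Phi> x y / n + c0 * (log_part x y / n)
      \<le> c1 * (\<bar>\<eta> x - \<eta> y\<bar> powr p / n + tail_part x y / n + tail_part y x / n)"
      by (simp add: add_divide_distrib distrib_left)
    have nn: "0 \<le> log_part x y / n" "0 \<le> tail_part x y / n" "0 \<le> tail_part y x / n" "0 \<le> \<bar>\<eta> x - \<eta> y\<bar> powr p / n"
      using n log_part_nonneg tail_part_nonneg by auto
    define X where "X = c0 * (log_part x y / n)"
    define Y where "Y = c1 * (\<bar>\<eta> x - \<eta> y\<bar> powr p / n + tail_part x y / n + tail_part y x / n)"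
    define W where "W = \<Phi> x y / n"
    have XY: "0 \<le> X" "0 \<le> Y" "W + X \<le> Y"
      using mult_nonneg_nonneg[OF c0 nn(1)] nn c1 le unfolding X_def Y_def W_def by auto
    \<comment> \<open>For W \<ge> 0 the term \<open>ennreal (- W)\<close> is 0, otherwise
      \<open>ennreal W\<close> is; either way the claim is W + X \<le> Y.\<close>
    have "ennreal X + ennreal W \<le> ennreal Y + ennreal (- W)"
    proof (cases "0 \<le> W")
      case True
      then show ?thesis using XY by (simp add: ennreal_leI ennreal_neg flip: ennreal_plus)
    next
      case False
      then show ?thesis using XY by (simp add: ennreal_leI ennreal_neg flip: ennreal_plus)
    qed
    moreover have "g z = ennreal X"
      unfolding X_def ennreal_mult[OF c0 nn(1)] by (simp add: g_def z n_def)
    moreover have "h z = ennreal Y"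
    proof -
      have "ennreal Y = ennreal c1 * ennreal (\<bar>\<eta> x - \<eta> y\<bar> powr p / n + tail_part x y / n + tail_part y x / n)"
        unfolding Y_def using c1 nn by (intro ennreal_mult add_nonneg_nonneg)
      then show ?thesis using nn by (simp add: h_def z n_def)
    qed
    moreover have "f z = W" by (simp add: f_def W_def z n_def)
    ultimately show ?thesis by simp
  qed
  define g' where "g' x = ennreal c0 * (ennreal \<alpha> * (ennreal ((norm (Du x) / (u x + d)) powr p) * indicator (ball x0 r) x))" for x
  define h' where "h' x = ennreal (c1 * (\<alpha> * (4 / (3 * r)) powr p)) * indicator S x" for x
  have [measurable]: "g' \<in> borel_measurable borel" "h' \<in> borel_measurable borel" unfolding g'_def h'_def by measurable
  have le': "g' x + ennreal (\<alpha> * local_term x) \<le> h' x + ennreal (- (\<alpha> * local_term x))" for x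
  proof -
    define X where "X = \<alpha> * (c0 * (indicator (ball x0 r) x * (norm (Du x) / (u x + d)) powr p))"
    define Y where "Y = \<alpha> * (c1 * (4 / (3 * r)) powr p * indicator S x)"
    define W where "W = \<alpha> * local_term x"
    have XY: "0 \<le> X" "0 \<le> Y" using c0 c1 \<alpha> by (auto simp: X_def Y_def)
    have XYW: "W + X \<le> Y"
      using mult_left_mono[OF local_term_le[of x] \<alpha>] by (simp add: X_def Y_def W_def c0_def c1_def distrib_left)
    have "ennreal X + ennreal W \<le> ennreal Y + ennreal (- W)"
    proof (cases "0 \<le> W")
      case True
      then show ?thesis using XY XYW by (simp add: ennreal_leI ennreal_neg flip: ennreal_plus)
    next
      case False
      then show ?thesis using XY XYW by (simp add: ennreal_leI ennreal_neg flip: ennreal_plus)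
    qed
    moreover have "g' x = ennreal X"
      using c0 \<alpha> by (cases "x \<in> ball x0 r") (simp_all add: g'_def X_def ennreal_mult mult_ac del: mem_ball)
    moreover have "h' x = ennreal Y" by (cases "x \<in> S") (simp_all add: h'_def Y_def mult_ac del: mem_cball)
    ultimately show ?thesis by (simp add: W_def)
  qed
  have "(\<integral>\<^sup>+z. g z \<partial>M) + (\<integral>\<^sup>+x. g' x \<partial>lborel) \<le> (\<integral>\<^sup>+z. h z \<partial>M) + (\<integral>\<^sup>+x. h' x \<partial>lborel)"
    using local_term_integrable by (intro absorb_signed_parts[OF f_int _ ineq' _ _ _ _ le le']) (auto intro: measurable_completion)
  also have "(\<integral>\<^sup>+x. h' x \<partial>lborel) = ennreal c1 * ennreal (\<alpha> * (4 / (3 * r)) powr p * vol)"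
    using c1 \<alpha> vol_sph_pos unfolding h'_def
    by (simp add: nn_integral_cmult emeasure_S vol_def[symmetric] mult.assoc flip: ennreal_mult)
  also have "(\<integral>\<^sup>+x. g' x \<partial>lborel) = ennreal c0 * (ennreal \<alpha> * (\<integral>\<^sup>+x\<in>ball x0 r. ennreal ((norm (Du x) / (u x + d)) powr p) \<partial>lborel))"
    unfolding g'_def by (simp add: nn_integral_cmult)
  also have "(\<integral>\<^sup>+z. g z \<partial>M) = ennreal c0 * (\<integral>\<^sup>+s. \<integral>\<^sup>+x. \<integral>\<^sup>+y. ennreal (log_part x y / norm (x - y) powr (DIM('a) + s * p)) \<partial>lborel \<partial>lborel \<partial>\<kappa>)"
  proof -
    define G where "G = (\<lambda>(s, x, y). ennreal (log_part x y / norm (x - y :: 'a) powr (DIM('a) + s * p)))"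
    have G: "G \<in> borel_measurable (borel \<Otimes>\<^sub>M (borel \<Otimes>\<^sub>M borel))"
      unfolding G_def log_part_def by measurable
    then have GM: "G \<in> borel_measurable M" using measurable_cong_sets[OF sets_M refl] by blast
    have "g z = ennreal c0 * G z" for z by (simp add: g_def G_def split_beta)
    then have "(\<integral>\<^sup>+z. g z \<partial>M) = ennreal c0 * (\<integral>\<^sup>+z. G z \<partial>M)"
      using GM by (simp add: nn_integral_cmult)
    then show ?thesis using trip[OF G] by (simp add: G_def)
  qed
  also have "(\<integral>\<^sup>+z. h z \<partial>M) \<le> ennreal c1 * (ennreal (2 * vol * sph * ((4 / 3) powr p + 2 powr p) * A) * B
        + ennreal (2 * vol * 4 powr (DIM('a) + p) * d powr (1 - p)) *
          (\<integral>\<^sup>+s. (\<integral>\<^sup>+y\<in>- ball x0 R. ennreal (max (- u y) 0 powr (p - 1) / norm (y - x0) powr (DIM('a) + s * p)) \<partial>lborel) \<partial>\<kappa>))"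
  proof -
    define tl where "tl s = (\<integral>\<^sup>+y\<in>- ball x0 R. ennreal (max (- u y) 0 powr (p - 1) / norm (y - x0) powr (DIM('a) + s * p)) \<partial>lborel)" for s
    define w where "w s = ennreal (1 / s + 1 / (1 - s))" for s :: real
    have "tl \<in> borel_measurable borel" "w \<in> borel_measurable borel" unfolding tl_def w_def by measurable
    then have m\<kappa>: "tl \<in> borel_measurable \<kappa>" "w \<in> borel_measurable \<kappa>"
      using measurable_cong_sets[OF sets_\<kappa> refl] by blast+
    define E where "E = 2 * vol * sph * ((4 / 3) powr p + 2 powr p)"
    define T where "T = vol * 4 powr (DIM('a) + p) * d powr (1 - p)"
    have ET: "0 \<le> E" "0 \<le> T" using vol_sph_pos by (auto simp: E_def T_def)
    have inner: "(\<integral>\<^sup>+x. \<integral>\<^sup>+y. h (s, x, y) \<partial>lborel \<partial>lborel) \<le> ennreal c1 * (ennreal E * (B * ennreal (1 / s + 1 / (1 - s))) + ennreal (2 * T) * tl s)"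
      if s: "0 < s" "s < 1" and sB: "ennreal (r powr (- s * p)) \<le> B" for s
    proof -
      let ?w = "r powr (- s * p) * (1 / s + 1 / (1 - s))"
      have w: "0 \<le> ?w" using s by simp
      have sym: "(\<integral>\<^sup>+x. \<integral>\<^sup>+y. ennreal (tail_part y x / norm (x - y) powr (DIM('a) + s * p)) \<partial>lborel \<partial>lborel)
        = (\<integral>\<^sup>+x. \<integral>\<^sup>+y. ennreal (tail_part x y / norm (x - y) powr (DIM('a) + s * p)) \<partial>lborel \<partial>lborel)"
      proof -
        have "(\<integral>\<^sup>+x. \<integral>\<^sup>+y. ennreal (tail_part y x / norm (x - y) powr (DIM('a) + s * p)) \<partial>lborel \<partial>lborel)
          = (\<integral>\<^sup>+x. \<integral>\<^sup>+y. ennreal (tail_part y x / norm (y - x) powr (DIM('a) + s * p)) \<partial>lborel \<partial>lborel)"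
          by (simp add: norm_minus_commute)
        also have "\<dots> = (\<integral>\<^sup>+y. \<integral>\<^sup>+x. ennreal (tail_part y x / norm (y - x) powr (DIM('a) + s * p)) \<partial>lborel \<partial>lborel)"
          by (rule lborel_pair.Fubini') (unfold tail_part_def, measurable)
        finally show ?thesis .
      qed
      have "(\<integral>\<^sup>+x. \<integral>\<^sup>+y. h (s, x, y) \<partial>lborel \<partial>lborel)
        = ennreal c1 * ((\<integral>\<^sup>+x. \<integral>\<^sup>+y. ennreal (\<bar>\<eta> x - \<eta> y\<bar> powr p / norm (x - y :: 'a) powr (DIM('a) + s * p)) \<partial>lborel \<partial>lborel)
          + (\<integral>\<^sup>+x. \<integral>\<^sup>+y. ennreal (tail_part x y / norm (x - y) powr (DIM('a) + s * p)) \<partial>lborel \<partial>lborel)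
          + (\<integral>\<^sup>+x. \<integral>\<^sup>+y. ennreal (tail_part y x / norm (x - y) powr (DIM('a) + s * p)) \<partial>lborel \<partial>lborel))"
        unfolding h_def tail_part_def by (simp add: nn_integral_add nn_integral_cmult)
      also have "\<dots> \<le> ennreal c1 * (ennreal (2 * vol * sph * (4 / 3) powr p * ?w)
          + (ennreal (vol * sph * 2 powr p * ?w) + ennreal T * tl s) + (ennreal (vol * sph * 2 powr p * ?w) + ennreal T * tl s))"
        unfolding sym tl_def T_def using s by (intro mult_left_mono add_mono cutoff_integral_le tail_part_integral_le) auto
      also have "\<dots> = ennreal c1 * (ennreal (E * ?w) + ennreal (2 * T) * tl s)"
      proof -
        \<comment> \<open>The two tail parts have equal integrals; their sum supplies the factor 2
          in front of both 2^p and \<open>T\<close>.\<close>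
        have e1: "ennreal (E * ?w) = ennreal (2 * vol * sph * (4 / 3) powr p * ?w) + ennreal (vol * sph * 2 powr p * ?w) + ennreal (vol * sph * 2 powr p * ?w)"
        proof -
          define W where "W = ?w"
          have "0 \<le> 2 * vol * sph * (4 / 3) powr p * W" "0 \<le> vol * sph * 2 powr p * W"
            using vol_sph_pos w by (simp_all only: W_def[symmetric]) auto
          moreover have "E * W = 2 * vol * sph * (4 / 3) powr p * W + vol * sph * 2 powr p * W + vol * sph * 2 powr p * W"
            by (simp add: E_def algebra_simps)
          ultimately show ?thesis unfolding W_def[symmetric] by (simp only: ennreal_plus add_nonneg_nonneg)
        qed
        have e2: "ennreal (2 * T) = ennreal T + ennreal T" using ET by (simp flip: ennreal_plus)
        show ?thesis unfolding e1 e2 by (simp only: distrib_right add_ac)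
      qed
      also have "ennreal (E * ?w) = ennreal E * (ennreal (r powr (- s * p)) * ennreal (1 / s + 1 / (1 - s)))"
        using ET s by (simp add: ennreal_mult del: ennreal_plus)
      also have "\<dots> \<le> ennreal E * (B * ennreal (1 / s + 1 / (1 - s)))"
        by (intro mult_left_mono mult_right_mono sB) auto
      finally show ?thesis by (simp add: mult_left_mono add_right_mono)
    qed
    have "(\<integral>\<^sup>+z. h z \<partial>M) = (\<integral>\<^sup>+s. \<integral>\<^sup>+x. \<integral>\<^sup>+y. h (s, x, y) \<partial>lborel \<partial>lborel \<partial>\<kappa>)"
      by (rule trip) measurable
    also have "\<dots> \<le> (\<integral>\<^sup>+s. ennreal c1 * (ennreal E * (B * ennreal (1 / s + 1 / (1 - s))) + ennreal (2 * T) * tl s) \<partial>\<kappa>)"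
      by (intro nn_integral_mono_AE, use s01 B in eventually_elim) (use inner in blast)
    also have "\<dots> = ennreal c1 * (ennreal E * (B * (\<integral>\<^sup>+s. ennreal (1 / s + 1 / (1 - s)) \<partial>\<kappa>)) + ennreal (2 * T) * (\<integral>\<^sup>+s. tl s \<partial>\<kappa>))"
      using m\<kappa> unfolding w_def[symmetric] by (simp add: nn_integral_add nn_integral_cmult)
    also have "\<dots> \<le> ennreal c1 * (ennreal E * (B * ennreal A) + ennreal (2 * T) * (\<integral>\<^sup>+s. tl s \<partial>\<kappa>))"
      by (intro mult_left_mono add_right_mono A) auto
    also have "ennreal E * (B * ennreal A) = ennreal (E * A) * B" using ET A(1) by (simp add: ennreal_mult mult_ac)
    finally show ?thesis by (simp add: E_def T_def tl_def mult.assoc)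
  qed
  finally show ?thesis
    unfolding c0_def[symmetric] c1_def[symmetric] by (simp add: distrib_left add_right_mono add.commute add.left_commute)
qed

end

section \<open>The original integrals in terms of Borel representatives\<close>

lemma ennpowr_ennpowr_inverse: "0 < a \<Longrightarrow> ennpowr (ennpowr X (1 / a)) a = X"
  by (cases "X = \<infinity>") (auto simp: ennpowr_def powr_powr less_top)

text \<open>Raising to p - 1 undoes the outer root, also for an infinite tail, and R^p comes out of
  the integral; it is compensated by R^(-p) in the theorem.\<close>

lemma Tail_powr:
  fixes \<mu> :: "real measure" and w w' :: "'a::euclidean_space \<Rightarrow> real"
  assumes \<mu>: "sets \<mu> = sets (restrict_space borel {0..1})" "finite_measure \<mu>" and p: "1 < p" and R: "0 < R"
    and w': "w' \<in> borel_measurable borel" and eq: "AE x in lebesgue. w x = w' x"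
  shows "ennpowr (Tail \<mu> p w x0 R) (p - 1) = ennreal (R powr p) *
    (\<integral>\<^sup>+s. (\<integral>\<^sup>+y\<in>- ball x0 R. ennreal (\<bar>w' y\<bar> powr (p - 1) / norm (y - x0) powr (DIM('a) + s * p)) \<partial>lborel)
      \<partial>weighted_exponents \<mu> DIM('a) p)"
proof -
  note [measurable] = w'
  have N: "0 < real DIM('a)" by simp
  define t where "t s = (\<integral>\<^sup>+y\<in>- ball x0 R. ennreal (\<bar>w' y\<bar> powr (p - 1) / norm (y - x0) powr (DIM('a) + s * p)) \<partial>lborel)" for s
  have [measurable]: "t \<in> borel_measurable borel"
    unfolding t_def by measurable
  have inner: "(\<integral>\<^sup>+y\<in>- ball x0 R. ennreal (\<bar>w y\<bar> powr (p - 1) / norm (y - x0) powr (DIM('a) + s * p)) \<partial>lebesgue) = t s" for s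
  proof -
    have "(\<integral>\<^sup>+y\<in>- ball x0 R. ennreal (\<bar>w y\<bar> powr (p - 1) / norm (y - x0) powr (DIM('a) + s * p)) \<partial>lebesgue)
      = (\<integral>\<^sup>+y\<in>- ball x0 R. ennreal (\<bar>w' y\<bar> powr (p - 1) / norm (y - x0) powr (DIM('a) + s * p)) \<partial>lebesgue)"
      by (intro nn_integral_cong_AE, use eq in eventually_elim) simp
    then show ?thesis by (simp add: t_def nn_integral_completion)
  qed
  define X where "X = (\<integral>\<^sup>+s\<in>{0<..<1}. ennreal (normalization DIM('a) p s * R powr p) * t s \<partial>\<mu>)"
  have "Tail \<mu> p w x0 R = ennpowr X (1 / (p - 1))"
    by (simp add: Tail_def X_def inner)
  then have "ennpowr (Tail \<mu> p w x0 R) (p - 1) = X"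
    using p by (simp add: ennpowr_ennpowr_inverse)
  also have "X = (\<integral>\<^sup>+s\<in>{0<..<1}. ennreal (normalization DIM('a) p s) * (ennreal (R powr p) * t s) \<partial>\<mu>)"
    unfolding X_def
  proof (intro nn_integral_cong)
    fix s
    show "ennreal (normalization DIM('a) p s * R powr p) * t s * indicator {0<..<1} s
      = ennreal (normalization DIM('a) p s) * (ennreal (R powr p) * t s) * indicator {0<..<1} s"
      by (simp add: ennreal_mult'' mult.assoc)
  qed
  also have "\<dots> = (\<integral>\<^sup>+s. ennreal (R powr p) * t s \<partial>weighted_exponents \<mu> DIM('a) p)"
    by (rule nn_integral_weighted_exponents[OF \<mu> N p, symmetric]) measurable
  also have "\<dots> = ennreal (R powr p) * (\<integral>\<^sup>+s. t s \<partial>weighted_exponents \<mu> DIM('a) p)"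
    using measurable_cong_sets[OF sets_weighted_exponents[OF \<mu> N p] refl]
    by (intro nn_integral_cmult) (auto simp: weighted_exponents_def)
  finally show ?thesis by (simp add: t_def)
qed

lemma LINT_lebesgue_pair:
  fixes F :: "'a::euclidean_space \<times> 'b::euclidean_space \<Rightarrow> real"
  assumes "F \<in> borel_measurable (borel \<Otimes>\<^sub>M borel)"
  shows "(LINT z|(lebesgue \<Otimes>\<^sub>M lebesgue). F z) = (LINT z|(lborel \<Otimes>\<^sub>M lborel). F z)"
    "F \<in> borel_measurable (lebesgue \<Otimes>\<^sub>M lebesgue)"
proof -
  have id: "(\<lambda>z. z) \<in> (lebesgue \<Otimes>\<^sub>M lebesgue) \<rightarrow>\<^sub>M (lborel \<Otimes>\<^sub>M lborel :: ('a \<times> 'b) measure)"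
  proof -
    have "(\<lambda>z. (fst z, snd z)) \<in> (lebesgue \<Otimes>\<^sub>M lebesgue) \<rightarrow>\<^sub>M (lborel \<Otimes>\<^sub>M lborel :: ('a \<times> 'b) measure)"
      by (intro measurable_Pair measurable_compose[OF measurable_fst] measurable_compose[OF measurable_snd] measurable_completion) auto
    then show ?thesis by simp
  qed
  have F: "F \<in> borel_measurable (lborel \<Otimes>\<^sub>M lborel)"
    using assms measurable_cong_sets[OF sets_pair_measure_cong[OF sets_lborel sets_lborel] refl] by blast
  show "F \<in> borel_measurable (lebesgue \<Otimes>\<^sub>M lebesgue)" using measurable_compose[OF id F] .
  show "(LINT z|(lebesgue \<Otimes>\<^sub>M lebesgue). F z) = (LINT z|(lborel \<Otimes>\<^sub>M lborel). F z)"
    using integral_distr[OF id F] by (simp add: distr_lebesgue_pair)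
qed

context log_estimate
begin

text \<open>Here \<open>w\<close> is the given Lebesgue measurable function and \<open>u\<close> its
  Borel representative. They differ on a null set, which stays null in either variable of the
  product; the normalization constant moves into the measure. Since \<open>Dv\<close> vanishes off
  \<open>S\<close>, the set \<Omega> disappears from the gradient term.\<close>

lemma weak_form_eq:
  fixes \<mu> :: "real measure" and w :: "'a \<Rightarrow> real"
  assumes \<mu>: "sets \<mu> = sets (restrict_space borel {0..1})" "finite_measure \<mu>"
    and w: "w \<in> borel_measurable lebesgue" "AE x in lebesgue. w x = u x" and \<Omega>: "ball x0 R \<subseteq> \<Omega>"
  shows "weak_form \<mu> p \<Omega> w Du v Dv
    = (LINT s|weighted_exponents \<mu> DIM('a) p. LINT (x, y)|(lborel \<Otimes>\<^sub>M lborel). \<Phi> x y / norm (x - y) powr (DIM('a) + s * p))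
      + measure \<mu> {1} * (LINT x|lborel. local_term x)"
proof -
  have N: "0 < real DIM('a)" by simp
  define F where "F s z = \<Phi> (fst z) (snd z) / norm (fst z - snd z) powr (DIM('a) + s * p)" for s and z :: "'a \<times> 'a"
  have Fm: "F s \<in> borel_measurable (borel \<Otimes>\<^sub>M borel)" for s unfolding F_def \<Phi>_def by measurable
  have AE1: "AE z in lebesgue \<Otimes>\<^sub>M lebesgue. w (fst z) = u (fst z)" "AE z in lebesgue \<Otimes>\<^sub>M lebesgue. w (snd z) = u (snd z)"
    using AE_pair_fst[OF sigma_finite_lebesgue sigma_finite_lebesgue w(2)] AE_pair_snd[OF sigma_finite_lebesgue sigma_finite_lebesgue w(2)] .
  have inner: "(LINT (x, y)|(lebesgue \<Otimes>\<^sub>M lebesgue). \<bar>w x - w y\<bar> powr (p - 2) * (w x - w y) * (v x - v y) / norm (x - y) powr (DIM('a) + s * p))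
    = (LINT z|(lborel \<Otimes>\<^sub>M lborel). F s z)" for s
  proof -
    have v: "v \<in> borel_measurable lebesgue" by (rule measurable_completion) simp
    have m: "(\<lambda>z. norm (fst z - snd z :: 'a)) \<in> borel_measurable (lebesgue \<Otimes>\<^sub>M lebesgue)"
      by (rule LINT_lebesgue_pair(2)) measurable
    have mv: "(\<lambda>z. v (fst z)) \<in> borel_measurable (lebesgue \<Otimes>\<^sub>M lebesgue)" "(\<lambda>z. v (snd z)) \<in> borel_measurable (lebesgue \<Otimes>\<^sub>M lebesgue)"
      using measurable_compose[OF measurable_fst v] measurable_compose[OF measurable_snd v] .
    have mw: "(\<lambda>z. w (fst z)) \<in> borel_measurable (lebesgue \<Otimes>\<^sub>M lebesgue)" "(\<lambda>z. w (snd z)) \<in> borel_measurable (lebesgue \<Otimes>\<^sub>M lebesgue)"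
      using measurable_compose[OF measurable_fst w(1)] measurable_compose[OF measurable_snd w(1)] .
    note [measurable] = m mv mw
    have "(LINT (x, y)|(lebesgue \<Otimes>\<^sub>M lebesgue). \<bar>w x - w y\<bar> powr (p - 2) * (w x - w y) * (v x - v y) / norm (x - y) powr (DIM('a) + s * p))
      = (LINT z|(lebesgue \<Otimes>\<^sub>M lebesgue). F s z)"
    proof (rule integral_cong_AE)
      show "(\<lambda>(x, y). \<bar>w x - w y\<bar> powr (p - 2) * (w x - w y) * (v x - v y) / norm (x - y) powr (DIM('a) + s * p)) \<in> borel_measurable (lebesgue \<Otimes>\<^sub>M lebesgue)"
        unfolding split_beta by measurable
      show "AE z in lebesgue \<Otimes>\<^sub>M lebesgue. (case z of (x, y) \<Rightarrow> \<bar>w x - w y\<bar> powr (p - 2) * (w x - w y) * (v x - v y) / norm (x - y) powr (DIM('a) + s * p)) = F s z"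
        using AE1 by eventually_elim (simp add: split_beta F_def \<Phi>_def)
    qed (rule LINT_lebesgue_pair(2)[OF Fm])
    then show ?thesis using LINT_lebesgue_pair(1)[OF Fm] by simp
  qed
  define G where "G s = (LINT z|(lborel \<Otimes>\<^sub>M lborel). F s z)" for s
  have Gm: "G \<in> borel_measurable borel"
    unfolding G_def
  proof (rule sigma_finite_measure.borel_measurable_lebesgue_integral)
    show "sigma_finite_measure (lborel \<Otimes>\<^sub>M lborel :: ('a \<times> 'a) measure)" by (rule lborel_pair.sigma_finite_measure_axioms)
    have "(\<lambda>(s, z). F s z) \<in> borel_measurable (borel \<Otimes>\<^sub>M (borel \<Otimes>\<^sub>M borel))"
      unfolding F_def \<Phi>_def by measurable
    moreover have "sets (borel \<Otimes>\<^sub>M (lborel \<Otimes>\<^sub>M lborel)) = sets (borel \<Otimes>\<^sub>M (borel \<Otimes>\<^sub>M borel) :: (real \<times> 'a \<times> 'a) measure)"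
      by (intro sets_pair_measure_cong sets_lborel refl)
    ultimately show "(\<lambda>(s, z). F s z) \<in> borel_measurable (borel \<Otimes>\<^sub>M (lborel \<Otimes>\<^sub>M lborel))"
      using measurable_cong_sets by blast
  qed
  have "(LINT x:\<Omega>|lebesgue. norm (Du x) powr (p - 2) * (Du x \<bullet> Dv x)) = (LINT x|lebesgue. local_term x)"
    unfolding set_lebesgue_integral_def
  proof (rule Bochner_Integration.integral_cong[OF refl])
    fix x
    show "indicator \<Omega> x *\<^sub>R (norm (Du x) powr (p - 2) * (Du x \<bullet> Dv x)) = local_term x"
    proof (cases "x \<in> S")
      case True
      then have "x \<in> \<Omega>" using S_subset(2) \<Omega> by blast
      then show ?thesis by (simp add: local_term_def)
    qed (use v_outside(2)[of x] in \<open>simp add: local_term_def del: mem_cball\<close>)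
  qed
  also have "\<dots> = (LINT x|lborel. local_term x)" by (rule integral_completion) simp
  finally have local: "(LINT x:\<Omega>|lebesgue. norm (Du x) powr (p - 2) * (Du x \<bullet> Dv x)) = (LINT x|lborel. local_term x)" .
  have "weak_form \<mu> p \<Omega> w Du v Dv = (LINT s:{0<..<1}|\<mu>. normalization DIM('a) p s * G s) + measure \<mu> {1} * (LINT x|lborel. local_term x)"
    unfolding weak_form_def local inner G_def ..
  also have "(LINT s:{0<..<1}|\<mu>. normalization DIM('a) p s * G s) = (LINT s|weighted_exponents \<mu> DIM('a) p. G s)"
    by (rule integral_weighted_exponents[OF \<mu> N p Gm, symmetric])
  finally have "weak_form \<mu> p \<Omega> w Du v Dv
    = (LINT s|weighted_exponents \<mu> DIM('a) p. G s) + measure \<mu> {1} * (LINT x|lborel. local_term x)" .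
  moreover have "F s = (\<lambda>(x, y). \<Phi> x y / norm (x - y) powr (DIM('a) + s * p))" for s
    by (simp add: F_def fun_eq_iff)
  ultimately show ?thesis by (simp only: G_def)
qed

lemma log_double_integral_eq:
  fixes \<mu> :: "real measure" and w :: "'a \<Rightarrow> real"
  assumes \<mu>: "sets \<mu> = sets (restrict_space borel {0..1})" "finite_measure \<mu>"
    and w: "AE x in lebesgue. w x = u x"
  shows "(\<integral>\<^sup>+s\<in>{0<..<1}. ennreal (normalization DIM('a) p s) *
           (\<integral>\<^sup>+x\<in>ball x0 r. (\<integral>\<^sup>+y\<in>ball x0 r.
              ennreal (\<bar>ln ((w x + d) / (w y + d))\<bar> powr p / norm (x - y) powr (DIM('a) + s * p)) \<partial>lebesgue) \<partial>lebesgue) \<partial>\<mu>)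
    = (\<integral>\<^sup>+s. \<integral>\<^sup>+x. \<integral>\<^sup>+y. ennreal (log_part x y / norm (x - y) powr (DIM('a) + s * p)) \<partial>lborel \<partial>lborel \<partial>weighted_exponents \<mu> DIM('a) p)"
proof -
  have N: "0 < real DIM('a)" by simp
  define G where "G s = (\<integral>\<^sup>+x. \<integral>\<^sup>+y. ennreal (log_part x y / norm (x - y) powr (DIM('a) + s * p)) \<partial>lborel \<partial>lborel)" for s
  have Gm: "G \<in> borel_measurable borel" unfolding G_def log_part_def by measurable
  have inner: "(\<integral>\<^sup>+x\<in>ball x0 r. (\<integral>\<^sup>+y\<in>ball x0 r.
      ennreal (\<bar>ln ((w x + d) / (w y + d))\<bar> powr p / norm (x - y) powr (DIM('a) + s * p)) \<partial>lebesgue) \<partial>lebesgue) = G s" for s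
  proof -
    have "(\<integral>\<^sup>+x\<in>ball x0 r. (\<integral>\<^sup>+y\<in>ball x0 r.
      ennreal (\<bar>ln ((w x + d) / (w y + d))\<bar> powr p / norm (x - y) powr (DIM('a) + s * p)) \<partial>lebesgue) \<partial>lebesgue)
      = (\<integral>\<^sup>+x. \<integral>\<^sup>+y. ennreal (log_part x y / norm (x - y) powr (DIM('a) + s * p)) \<partial>lborel \<partial>lebesgue)"
    proof (intro nn_integral_cong_AE, use w in eventually_elim)
      case (elim x)
      have "(\<integral>\<^sup>+y\<in>ball x0 r. ennreal (\<bar>ln ((w x + d) / (w y + d))\<bar> powr p / norm (x - y) powr (DIM('a) + s * p)) \<partial>lebesgue)
        = (\<integral>\<^sup>+y\<in>ball x0 r. ennreal (\<bar>ln ((u x + d) / (u y + d))\<bar> powr p / norm (x - y) powr (DIM('a) + s * p)) \<partial>lebesgue)"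
        by (intro nn_integral_cong_AE, use w in eventually_elim) (simp add: elim)
      then show ?case
        by (cases "x \<in> ball x0 r") (auto simp: log_part_def nn_integral_completion indicator_def simp del: mem_ball intro!: nn_integral_cong)
    qed
    then show ?thesis by (simp add: G_def nn_integral_completion)
  qed
  show ?thesis unfolding inner using nn_integral_weighted_exponents[OF \<mu> N p Gm] by (simp add: G_def)
qed

text \<open>For t \<ge> 0 the derivative of ln (t + d) is at most 1/d, so the chain rule
  applies.\<close>

lemma weak_gradient_log:
  "has_weak_gradient (\<lambda>x. ln (u x + d)) (\<lambda>x. inverse (u x + d) *\<^sub>R Du x) (ball x0 R)"
proof (rule has_weak_gradient_compose[where F = "\<lambda>t. ln (t + d)" and F' = "\<lambda>t. inverse (t + d)" and M = "inverse d"])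
  show "AE x in lborel. x \<in> ball x0 R \<longrightarrow> 0 \<le> u x" using u_nonneg by simp
  fix t :: real assume t: "0 \<le> t"
  show "((\<lambda>t. ln (t + d)) has_real_derivative inverse (t + d)) (at t)"
    using t d by (auto intro!: derivative_eq_intros simp: inverse_eq_divide)
  show "\<bar>inverse (t + d)\<bar> \<le> inverse d" using t d by (auto intro!: le_imp_inverse_le)
qed (use weak_gradient in auto)

end

section \<open>Choice of representatives and of the constant\<close>

lemma set_borel_measurable_open:
  fixes f :: "'a::euclidean_space \<Rightarrow> 'b::euclidean_space"
  assumes "f \<in> borel_measurable lebesgue" "open X"
  shows "set_borel_measurable lebesgue X f"
proof -
  have [measurable]: "X \<in> sets lebesgue" using assms(2) by simp
  note [measurable] = assms(1)
  show ?thesis unfolding set_borel_measurable_def by measurable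
qed

lemma Lp_Borel_representative_finite:
  fixes f f' :: "'a::euclidean_space \<Rightarrow> 'b::euclidean_space"
  assumes f: "f \<in> Lp q K" and f': "f' \<in> borel_measurable borel" and eq: "AE x in lebesgue. x \<in> K \<longrightarrow> f x = f' x"
    and K: "compact K"
  shows "(\<integral>\<^sup>+x\<in>K. ennreal (norm (f' x) powr q) \<partial>lborel) < \<infinity>"
proof -
  have [measurable]: "K \<in> sets borel" using K by (rule borel_compact)
  note [measurable] = f'
  have "(\<integral>\<^sup>+x\<in>K. ennreal (norm (f' x) powr q) \<partial>lborel) = (\<integral>\<^sup>+x\<in>K. ennreal (norm (f' x) powr q) \<partial>lebesgue)"
    by (simp add: nn_integral_completion)
  also have "\<dots> = (\<integral>\<^sup>+x\<in>K. ennreal (norm (f x) powr q) \<partial>lebesgue)"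
    by (intro nn_integral_cong_AE, use eq in eventually_elim) (auto simp: indicator_def)
  also have "\<dots> < \<infinity>" using f by (simp add: Lp_def)
  finally show ?thesis .
qed

theorem lemma1p5:
  fixes p :: real and \<mu> :: "real measure"
  assumes "1 < p"
    and "sets \<mu> = sets (restrict_space borel {0..1})"
    and "finite_measure \<mu>"
    and "0 < emeasure \<mu> {0<..<1}"
    and "emeasure \<mu> {0} = 0"
    and "0 < measure \<mu> {1}"
  shows "\<exists>C>0. \<forall>(\<Omega> :: 'a::euclidean_space set) u x\<^sub>0 R r d.
    open \<Omega> \<and> connected \<Omega> \<and> \<Omega> \<noteq> {} \<and> bounded \<Omega> \<and>
    weak_supersolution \<mu> p \<Omega> u \<and>
    0 < R \<and> ball x\<^sub>0 R \<subseteq> \<Omega> \<and> (AE x in lebesgue. x \<in> ball x\<^sub>0 R \<longrightarrow> 0 \<le> u x) \<and>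
    0 < r \<and> ball x\<^sub>0 r \<subseteq> ball x\<^sub>0 (R / 2) \<and> 0 < d \<longrightarrow>
    (\<exists>G. has_weak_gradient (\<lambda>x. ln (u x + d)) G (ball x\<^sub>0 r) \<and>
      ennreal (measure \<mu> {1}) * (\<integral>\<^sup>+x\<in>ball x\<^sub>0 r. ennreal (norm (G x) powr p) \<partial>lebesgue)
      + (\<integral>\<^sup>+s\<in>{0<..<1}. ennreal (normalization DIM('a) p s) *
           (\<integral>\<^sup>+x\<in>ball x\<^sub>0 r. (\<integral>\<^sup>+y\<in>ball x\<^sub>0 r.
              ennreal (\<bar>ln ((u x + d) / (u y + d))\<bar> powr p
                / norm (x - y) powr (DIM('a) + s * p)) \<partial>lebesgue) \<partial>lebesgue) \<partial>\<mu>)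
      \<le> ennreal (C * r ^ DIM('a)) *
          (ennreal (d powr (1 - p) * R powr (- p))
             * ennpowr (Tail \<mu> p (\<lambda>x. max (- u x) 0) x\<^sub>0 R) (p - 1)
           + (SUP s\<in>support \<mu>. ennreal (r powr (- s * p))))
        + ennreal (C * measure \<mu> {1} * r powr (DIM('a) - p)))"
proof -
  note p = assms(1) and \<mu> = assms(2,3)
  define N where "N = DIM('a)"
  have N: "0 < real N" by (simp add: N_def)
  define \<kappa> where "\<kappa> = weighted_exponents \<mu> N p"
  note \<kappa> = sets_weighted_exponents[OF \<mu> N p, folded \<kappa>_def] finite_measure_weighted_exponents[OF \<mu> N p, folded \<kappa>_def]
    AE_weighted_exponents[OF \<mu> N p, folded \<kappa>_def]
  obtain A where A: "0 < A" "(\<integral>\<^sup>+s. ennreal (1 / s + 1 / (1 - s)) \<partial>\<kappa>) \<le> ennreal A"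
    using weighted_exponents_bound[OF \<mu> N p] by (auto simp: \<kappa>_def)
  define \<alpha> where "\<alpha> = measure \<mu> {1}"
  have \<alpha>: "0 \<le> \<alpha>" by (simp add: \<alpha>_def)
  define c0 where "c0 = (p - 1) / 2 * (5 / 9) powr p"
  have c0: "0 < c0" using p by (simp add: c0_def)
  define c1 where "c1 = 2 powr (p - 1)"
  have c1: "0 < c1" by (simp add: c1_def)
  \<comment> \<open>The volume of the cutoff ball with r^N scaled out.\<close>
  define V where "V = unit_ball_vol N * (3 / 2) ^ N"
  have V: "0 < V" using N by (simp add: V_def)
  define sphere where "sphere = N * unit_ball_vol N"
  have sphere: "0 < sphere" using N by (simp add: sphere_def)
  define K1 where "K1 = 2 * V * sphere * ((4 / 3) powr p + 2 powr p) * A"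
  define K2 where "K2 = 2 * V * 4 powr (N + p)"
  define K3 where "K3 = (4 / 3) powr p * V"
  have K: "0 < K1" "0 < K2" "0 < K3" using V sphere A(1) by (auto simp: K1_def K2_def K3_def add_pos_pos)
  \<comment> \<open>Everything here is fixed before \<open>u\<close>, the radii and
    \<open>d\<close>. \<open>K1\<close> belongs to the kernel integrals, \<open>K2\<close> to the
    tail, \<open>K3\<close> to the gradient of the cutoff; \<open>c1\<close> is the constant of the
    pointwise inequalities, and \<open>c0\<close> the factor of the logarithmic terms to be divided
    out.\<close>
  define C where "C = c1 / c0 * (K1 + K2 + K3)"
  have C: "0 < C" using c0 c1 K by (simp add: C_def)
  have CK: "c1 * K1 \<le> c0 * C" "c1 * K2 \<le> c0 * C" "c1 * K3 \<le> c0 * C"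
    using c0 c1 K by (simp_all add: C_def)
  show ?thesis
  proof (intro exI[of _ C] conjI C allI impI, elim conjE)
    fix \<Omega> :: "'a set" and u :: "'a \<Rightarrow> real" and x0 :: 'a and R r d :: real
    assume \<Omega>: "open \<Omega>" and sup: "weak_supersolution \<mu> p \<Omega> u" and R: "0 < R" "ball x0 R \<subseteq> \<Omega>"
      and nonneg: "AE x in lebesgue. x \<in> ball x0 R \<longrightarrow> 0 \<le> u x"
      and r: "0 < r" "ball x0 r \<subseteq> ball x0 (R / 2)" and d: "0 < d"
    have rR: "r \<le> R / 2" using r ball_subset_ball_iff[of x0 r x0 "R / 2"] by simp
    have uT: "u \<in> tail_space \<mu> p" and uW: "u \<in> W1p_loc p \<Omega>"
      using sup by (auto simp: weak_supersolution_def)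
    have uL: "u \<in> Lp_loc (p - 1) UNIV" using uT by (simp add: tail_space_def)
    have um: "u \<in> borel_measurable lebesgue"
      using Lp_loc_measurable[OF uL open_UNIV] by (simp add: set_borel_measurable_def)
    obtain u1 where u1: "u1 \<in> borel_measurable borel" "AE x in lebesgue. x \<in> UNIV \<longrightarrow> u x = u1 x"
      using Borel_representative[OF Lp_loc_measurable[OF uL open_UNIV]] .
    \<comment> \<open>The hypothesis gives nonnegativity almost everywhere only; truncation inside
      the ball makes it hold at every point, as the locale demands, and changes the function on a
      null set.\<close>
    define w where "w x = (if x \<in> ball x0 R then max 0 (u1 x) else u1 x)" for x
    have wm: "w \<in> borel_measurable borel"
    proof -
      have [measurable]: "ball x0 R \<in> sets borel" by simp
      show ?thesis unfolding w_def using u1(1) by measurable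
    qed
    have uw: "AE x in lebesgue. u x = w x"
      using u1(2) nonneg by eventually_elim (auto simp: w_def)
    obtain g where g: "has_weak_gradient u g \<Omega>" "g \<in> Lp_loc p \<Omega>" using uW by (auto simp: W1p_loc_def)
    obtain Du where Du: "Du \<in> borel_measurable borel" "AE x in lebesgue. x \<in> \<Omega> \<longrightarrow> g x = Du x"
      using Borel_representative[OF Lp_loc_measurable[OF g(2) \<Omega>]] .
    have wu: "has_weak_gradient u Du \<Omega>"
      using Du(2) by (intro has_weak_gradient_cong_AE[OF g(1) \<Omega>] set_borel_measurable_open[OF um \<Omega>] set_borel_measurable_open[OF measurable_completion \<Omega>]) (use Du in auto)
    have ww: "has_weak_gradient w Du \<Omega>"
      by (intro has_weak_gradient_cong_AE[OF wu \<Omega>] set_borel_measurable_open[OF measurable_completion \<Omega>])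
        (use uw wm Du in \<open>auto elim: eventually_mono\<close>)
    interpret log_estimate p R r d x0 w Du
    proof
      show "has_weak_gradient w Du (ball x0 R)" using ww R(2) by (rule has_weak_gradient_subset)
      show "0 \<le> w x" if "x \<in> ball x0 R" for x using that by (simp add: w_def)
      show "(\<integral>\<^sup>+x\<in>K. ennreal (norm (Du x) powr p) \<partial>lborel) < \<infinity>" if "compact K" "K \<subseteq> ball x0 R" for K
      proof (rule Lp_Borel_representative_finite[where f = g])
        show "g \<in> Lp p K" using g(2) that R(2) by (auto simp: Lp_loc_def)
        show "AE x in lebesgue. x \<in> K \<longrightarrow> g x = Du x" using Du(2) by eventually_elim (use that R(2) in auto)
      qed (use Du that in auto)
      show "(\<integral>\<^sup>+x\<in>K. ennreal (\<bar>w x\<bar> powr (p - 1)) \<partial>lborel) < \<infinity>" if "compact K" for K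
      proof -
        have "AE x in lebesgue. x \<in> K \<longrightarrow> u x = w x" using uw by eventually_elim simp
        moreover have "u \<in> Lp (p - 1) K" using uL that by (simp add: Lp_loc_def)
        ultimately show ?thesis using Lp_Borel_representative_finite[of u "p - 1" K w] wm that by simp
      qed
    qed (use p r rR d wm Du in auto)
    \<comment> \<open>The supersolution is tested here, with the original \<open>u\<close>; the weak
      gradient \<open>Du\<close> is the same for both versions.\<close>
    have "0 \<le> weak_form \<mu> p \<Omega> u Du v Dv"
    proof -
      have "compactly_inside (ball x0 (7 * R / 8)) \<Omega>"
      proof -
        have "cball x0 (7 * R / 8) \<subseteq> ball x0 R" using R by auto
        then show ?thesis using R by (auto simp: compactly_inside_def)
      qed
      then show ?thesis
        using sup v_W1p_0 wu weak_gradient_v v_bounds(1) unfolding weak_supersolution_def by blast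
    qed
    also have "weak_form \<mu> p \<Omega> u Du v Dv = (LINT s|\<kappa>. LINT (x, y)|(lborel \<Otimes>\<^sub>M lborel). \<Phi> x y / norm (x - y) powr (DIM('a) + s * p))
      + \<alpha> * (LINT x|lborel. local_term x)"
      unfolding \<kappa>_def \<alpha>_def N_def by (rule weak_form_eq[OF \<mu> um uw R(2)])
    finally have ineq: "0 \<le> \<dots>" .
    define TL where "TL = (\<integral>\<^sup>+s. (\<integral>\<^sup>+y\<in>- ball x0 R. ennreal (max (- w y) 0 powr (p - 1) / norm (y - x0) powr (DIM('a) + s * p)) \<partial>lborel) \<partial>\<kappa>)"
    define B where "B = (SUP s\<in>support \<mu>. ennreal (r powr (- s * p)))"
    define I1 where "I1 = (\<integral>\<^sup>+x\<in>ball x0 r. ennreal ((norm (Du x) / (w x + d)) powr p) \<partial>lborel)"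
    define I2 where "I2 = (\<integral>\<^sup>+s. \<integral>\<^sup>+x. \<integral>\<^sup>+y. ennreal (log_part x y / norm (x - y) powr (DIM('a) + s * p)) \<partial>lborel \<partial>lborel \<partial>\<kappa>)"
    have tail: "(\<integral>\<^sup>+s. (\<integral>\<^sup>+y\<in>- ball x0 R. ennreal (\<bar>w y\<bar> powr (p - 1) / norm (y - x0) powr (DIM('a) + s * p)) \<partial>lborel) \<partial>\<kappa>) < \<infinity>"
      (is "?T < _")
    proof -
      have "Tail \<mu> p u x0 R < \<infinity>" using uT R(1) by (simp add: tail_space_def)
      then have "ennpowr (Tail \<mu> p u x0 R) (p - 1) < \<infinity>" by (auto simp: ennpowr_def)
      then have "ennreal (R powr p) * ?T < \<infinity>"
        unfolding Tail_powr[OF \<mu> p R(1) wm uw] \<kappa>_def N_def .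
      then show ?thesis using R(1) by (auto simp: ennreal_mult_less_top)
    qed
    have AEB: "AE s in \<kappa>. ennreal (r powr (- s * p)) \<le> B"
      using \<kappa>(4) by eventually_elim (auto simp: B_def intro: SUP_upper)
    have vol_eq: "vol = V * r ^ N" by (simp add: vol_def V_def N_def power_mult_distrib power_divide)
    have sph_eq: "sph = sphere" by (simp add: sph_def sphere_def N_def)
    have est: "ennreal c0 * (ennreal \<alpha> * I1 + I2) \<le> ennreal c1 * (ennreal (K1 * r ^ N) * B
        + ennreal (K2 * r ^ N * d powr (1 - p)) * TL + ennreal (\<alpha> * (4 / (3 * r)) powr p * (V * r ^ N)))"
    proof -
      have e: "2 * vol * sph * ((4 / 3) powr p + 2 powr p) * A = K1 * r ^ N"
        "2 * vol * 4 powr (DIM('a) + p) * d powr (1 - p) = K2 * r ^ N * d powr (1 - p)"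
        by (simp_all add: vol_eq sph_eq K1_def K2_def N_def)
      show ?thesis
        using weighted_log_estimate[OF \<kappa>(1,2,3) less_imp_le[OF A(1)] A(2) AEB tail \<alpha> ineq]
        unfolding c0_def[symmetric] c1_def[symmetric] e
        unfolding vol_eq I1_def I2_def TL_def .
    qed
    \<comment> \<open>The cutoff gradient is of order 1/r on a ball of volume proportional to r^N,
      whence r^(N - p).\<close>
    have loc: "ennreal c1 * ennreal (\<alpha> * (4 / (3 * r)) powr p * (V * r ^ N)) \<le> ennreal c0 * ennreal (C * \<alpha> * r powr (DIM('a) - p))"
    proof -
      have "(4 / (3 * r)) powr p * r ^ N = (4 / 3) powr p * r powr (DIM('a) - p)"
        using r(1) by (simp add: powr_divide powr_mult powr_diff powr_realpow N_def)
      then have "c1 * (\<alpha> * (4 / (3 * r)) powr p * (V * r ^ N)) = (c1 * K3) * (\<alpha> * r powr (DIM('a) - p))"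
        by (simp add: K3_def mult_ac)
      also have "\<dots> \<le> (c0 * C) * (\<alpha> * r powr (DIM('a) - p))"
        using CK(3) \<alpha> by (intro mult_right_mono) auto
      also have "\<dots> = c0 * (C * \<alpha> * r powr (DIM('a) - p))" by (simp add: mult.assoc)
      finally have "ennreal (c1 * (\<alpha> * (4 / (3 * r)) powr p * (V * r ^ N))) \<le> ennreal (c0 * (C * \<alpha> * r powr (DIM('a) - p)))"
        by (rule ennreal_leI)
      moreover have "0 \<le> \<alpha> * (4 / (3 * r)) powr p * (V * r ^ N)" "0 \<le> C * \<alpha> * r powr (DIM('a) - p)"
        using \<alpha> V C r(1) by simp_all
      ultimately show ?thesis using c0 c1 by (simp only: ennreal_mult less_imp_le)
    qed
    have sup_part: "ennreal c1 * (ennreal (K1 * r ^ N) * B) \<le> ennreal c0 * (ennreal (C * r ^ N) * B)"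
    proof -
      have "ennreal (c1 * K1 * r ^ N) * B \<le> ennreal (c0 * C * r ^ N) * B"
        using CK(1) r(1) by (intro mult_right_mono ennreal_leI) auto
      then show ?thesis using c0 c1 C K r(1) by (simp add: ennreal_mult mult.assoc)
    qed
    have tail_part: "ennreal c1 * (ennreal (K2 * r ^ N * d powr (1 - p)) * TL) \<le> ennreal c0 * (ennreal (C * r ^ N) * (ennreal (d powr (1 - p)) * TL))"
    proof -
      have "ennreal (c1 * K2 * r ^ N) * (ennreal (d powr (1 - p)) * TL) \<le> ennreal (c0 * C * r ^ N) * (ennreal (d powr (1 - p)) * TL)"
        using CK(2) r(1) by (intro mult_right_mono ennreal_leI) auto
      then show ?thesis using c0 c1 C K r(1) by (simp add: ennreal_mult mult.assoc)
    qed
    have "ennreal c0 * (ennreal \<alpha> * I1 + I2)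
      \<le> ennreal c0 * (ennreal (C * r ^ N) * (ennreal (d powr (1 - p)) * TL + B) + ennreal (C * \<alpha> * r powr (DIM('a) - p)))"
      using order_trans[OF est] add_mono[OF add_mono[OF tail_part sup_part] loc]
      by (simp add: distrib_left add_ac)
    \<comment> \<open>As \<open>c0\<close> is positive and finite, it can be cancelled between
      extended integrals.\<close>
    then have main: "ennreal \<alpha> * I1 + I2 \<le> ennreal (C * r ^ N) * (ennreal (d powr (1 - p)) * TL + B) + ennreal (C * \<alpha> * r powr (DIM('a) - p))"
      using c0 by (simp add: ennreal_mult_le_mult_iff)
    have TLeq: "ennreal (d powr (1 - p)) * TL = ennreal (d powr (1 - p) * R powr (- p)) * ennpowr (Tail \<mu> p (\<lambda>x. max (- u x) 0) x0 R) (p - 1)"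
    proof -
      have "ennpowr (Tail \<mu> p (\<lambda>x. max (- u x) 0) x0 R) (p - 1) = ennreal (R powr p) * TL"
      proof -
        have "AE x in lebesgue. max (- u x) 0 = max (- w x) 0" using uw by eventually_elim simp
        moreover have "(\<lambda>x. max (- w x) 0) \<in> borel_measurable borel" using wm by measurable
        ultimately show ?thesis
          using Tail_powr[OF \<mu> p R(1), of "\<lambda>x. max (- w x) 0" "\<lambda>x. max (- u x) 0" x0] by (simp add: TL_def \<kappa>_def N_def)
      qed
      moreover have "ennreal (d powr (1 - p) * R powr (- p)) * ennreal (R powr p) = ennreal (d powr (1 - p))"
        using R(1) by (simp add: powr_minus flip: ennreal_mult)
      ultimately show ?thesis by (simp add: mult.assoc[symmetric])
    qed
    \<comment> \<open>The witness Du / (w + d) of the chain rule: its p-th power is exactly the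
      integrand of \<open>I1\<close>.\<close>
    let ?G = "\<lambda>x. inverse (w x + d) *\<^sub>R Du x"
    have Br: "ball x0 r \<subseteq> ball x0 R" using r rR by auto
    have G: "has_weak_gradient (\<lambda>x. ln (u x + d)) ?G (ball x0 r)"
    proof (rule has_weak_gradient_cong_AE[OF has_weak_gradient_subset[OF weak_gradient_log Br] open_ball])
      show "set_borel_measurable lebesgue (ball x0 r) (\<lambda>x. ln (u x + d))"
        by (intro set_borel_measurable_open open_ball) (use um in measurable)
      show "set_borel_measurable lebesgue (ball x0 r) ?G"
        by (intro set_borel_measurable_open open_ball measurable_completion) (use wm Du in measurable)
      show "AE x in lebesgue. x \<in> ball x0 r \<longrightarrow> ln (w x + d) = ln (u x + d)"
        using uw by eventually_elim simp
    qed simp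
    have I1eq: "(\<integral>\<^sup>+x\<in>ball x0 r. ennreal (norm (?G x) powr p) \<partial>lebesgue) = I1"
    proof -
      have "(\<integral>\<^sup>+x\<in>ball x0 r. ennreal (norm (?G x) powr p) \<partial>lebesgue) = (\<integral>\<^sup>+x\<in>ball x0 r. ennreal ((norm (Du x) / (w x + d)) powr p) \<partial>lebesgue)"
      proof (rule nn_integral_cong)
        fix x
        show "ennreal (norm (?G x) powr p) * indicator (ball x0 r) x = ennreal ((norm (Du x) / (w x + d)) powr p) * indicator (ball x0 r) x"
        proof (cases "x \<in> ball x0 r")
          case True
          then have "0 < w x + d" using Br u_add_d[of x] d by fastforce
          then show ?thesis by (simp add: divide_inverse mult.commute)
        qed (simp del: mem_ball)
      qed
      then show ?thesis using wm Du by (simp add: I1_def nn_integral_completion)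
    qed
    show "\<exists>G. has_weak_gradient (\<lambda>x. ln (u x + d)) G (ball x0 r) \<and>
      ennreal (measure \<mu> {1}) * (\<integral>\<^sup>+x\<in>ball x0 r. ennreal (norm (G x) powr p) \<partial>lebesgue)
      + (\<integral>\<^sup>+s\<in>{0<..<1}. ennreal (normalization DIM('a) p s) *
           (\<integral>\<^sup>+x\<in>ball x0 r. (\<integral>\<^sup>+y\<in>ball x0 r.
              ennreal (\<bar>ln ((u x + d) / (u y + d))\<bar> powr p
                / norm (x - y) powr (DIM('a) + s * p)) \<partial>lebesgue) \<partial>lebesgue) \<partial>\<mu>)
      \<le> ennreal (C * r ^ DIM('a)) *
          (ennreal (d powr (1 - p) * R powr (- p))
             * ennpowr (Tail \<mu> p (\<lambda>x. max (- u x) 0) x0 R) (p - 1)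
           + (SUP s\<in>support \<mu>. ennreal (r powr (- s * p))))
        + ennreal (C * measure \<mu> {1} * r powr (DIM('a) - p))"
      using main unfolding log_double_integral_eq[OF \<mu> uw] TLeq
      by (intro exI[of _ ?G] conjI G) (simp only: I1eq I2_def B_def \<alpha>_def \<kappa>_def N_def)
  qed
qed

end
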